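(* Fix $T\in\mathbb{N}$ and $m\in\mathbb{N}$. Let $h\in C^3(\mathbb{T}\times\mathbb{T})$ and $\kappa,K>0$. There exists a constant $\Delta_0>0$, depending only on $\|h\|_{C^3},\kappa,K$ and having property (E) (see context), such that the following holds whenever $0<\Delta<\Delta_0$. Let $F:\mathbb{T}\to\mathbb{T}$ be $C^3$ with $|F'(x)|\geq c$ for all $x\in\mathbb{T}$, for some constant $c>0$. Let $\bar\rho_t$, $t=0,\dots,T$, be a solution of $\bar\rho_{t+1}=(F_{\bar\rho_t})_*\bar\rho_t$ consisting of $C^2$ probability densities with $\bar\rho_t\ge\kappa$ and $\|\bar\rho_t\|_{C^2}\le K$ for all $t$. Let $x_i(0)$, $i\ge1$, be i.i.d. with common distribution $\bar\rho_0$, let $$x_i(t+1)=F\Big(x_i(t)+\frac{\Delta}{N}\sum_{j=1}^N h(x_i(t),x_j(t))\Big),\quad i=1,\dots,N,$$ $\mu_N(t)=\frac1N\sum_{j=1}^N\delta_{x_j(t)}$ and $\eta^N_t=\sqrt N(\mu_N(t)-\bar\rho_t)$. Let $\eta_0$ be the centered Gaussian field with $\langle\varphi,\eta_0\rangle\sim\mathcal{N}(0,\langle\varphi^2,\bar\rho_0\rangle-\langle\varphi,\bar\rho_0\rangle^2)$ for $\varphi\in C^\infty(\mathbb{T})$, and let $\eta=(\eta_t)_{0\le t\le T}$ be the solution with initial datum $\eta_0$ of $$\eta_{t+1}=(F_{\bar\rho_t})_*\eta_t-\Delta F_*\Big(\big((\phi_{\bar\rho_t})_*(\bar\rho_t\cdot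 h*\eta_t)\big)'\Big).$$ Then, for any test functions $\varphi_1,\dots,\varphi_m\in C^2(\mathbb{T})$ and any $\Psi\in C_b^3(\mathbb{R}^m)$, $$\Big|\mathbb{E}\Psi\big(\langle\varphi_1,\eta^N_t\rangle,\dots,\langle\varphi_m,\eta^N_t\rangle\big)-\mathbb{E}\Psi\big(\langle\varphi_1,\eta_t\rangle,\dots,\langle\varphi_m,\eta_t\rangle\big)\Big|\le\frac{Ce^{Ct}}{\sqrt N},\quad t=0,\dots,T,$$ where the constant $C>0$ depends on $\Delta,m,\|\Psi\|_{C_b^3},\|F\|_{C^2},\|h\|_{C^2}$ and $\|\varphi_i\|_{C^2}$ ($1\le i\le m$); in particular it does not depend on $N$.
   Context: $\mathbb{T}=\mathbb{R}/\mathbb{Z}$; $h$ is real-valued and sums $x+(\text{real number})$ with $x\in\mathbb{T}$ are modulo $1$. For a Borel probability measure $\mu$ on $\mathbb{T}$, $\phi_\mu(x):=x+\Delta\int h(x,y)\,d\mu(y)$, $F_\mu:=F\circ\phi_\mu$. $G_*$ denotes push-forward (for distributions, $\langle\varphi,G_*\eta\rangle=\langle\varphi\circ G,\eta\rangle$). The same symbol denotes an absolutely continuous measure and its density. $\langle\cdot,\cdot\rangle$ denotes integration/duality pairing, $(h*\eta)(x):=\langle h(x,\cdot),\eta\rangle$. $\mathcal{N}(0,a)$ is the centered Gaussian law on $\mathbb{R}$ with variance $a$. $C_b^3(\mathbb{R}^m)$ is the space of $C^3$ functions bounded together with all derivatives up to order $3$. $H^\alpha(\mathbb{T})$ has norm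 $\|f\|_{H^\alpha}^2=\sum_{k\in\mathbb{Z}}(1+k^2)^\alpha|\langle f,e_k\rangle|^2$, $e_k(x)=e^{2\pi i kx}$. The field $\eta_0$ is the limit in distribution of $\eta_0^N$ and is a random element of $H^{-\alpha}(\mathbb{T})$ for every $\alpha>1/2$, as is each $\eta_t$, so the pairings with $C^2$ functions make sense. The equation for $\eta_t$ is understood in its weak form (for $0\le t\le T-1$ and all test functions $\varphi$): $$\langle\varphi,\eta_{t+1}\rangle=\langle\varphi\circ F_{\bar\rho_t},\eta_t\rangle+\Delta\big\langle(\varphi\circ F)'(\phi_{\bar\rho_t})\cdot (h*\eta_t),\bar\rho_t\big\rangle .$$ Property (E) of a constant $\Delta_0=\Delta_0(\|h\|_{C^3},\kappa,K)>0$: there is $C'>0$ depending only on $\|h\|_{C^3},\kappa,K$ such that, whenever $0<\Delta<\Delta_0$, for every continuous $F:\mathbb{T}\to\mathbb{T}$, every solution $\bar\rho_0,\dots,\bar\rho_T$ of $\bar\rho_{t+1}=(F_{\bar\rho_t})_*\bar\rho_t$ by $C^2$ densities with $\bar\rho_t\ge\kappa$, $\|\bar\rho_t\|_{C^2}\le K$, every $N\ge1$ and every law on $\mathbb{T}^N$ of the initial data $(x_1(0),\dots,x_N(0))$ of the particle system $x_i(t+1)=F\big(x_i(t)+\frac{\Delta}{N}\sum_{j=1}^N h(x_i(t),x_j(t))\big)$, $i=1,\dots,N$, with $\rho_{N,t}$ the law of $(x_1(t),\dots,x_N(t))$, one has $\frac1N H(\rho_{N,t}|\bar\rho_t^{\otimes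 N})\le e^{C't}\big(\frac1N H(\rho_{N,0}|\bar\rho_0^{\otimes N})+\frac1N\big)$ for $t=0,\dots,T$, where $H(\mu|\nu)=\int\log\frac{d\mu}{d\nu}\,d\mu$ if $\mu\ll\nu$ and $+\infty$ otherwise. *)

theory Defs
  imports "HOL-Probability.Probability"
begin

section \<open>The torus\<close>

quotient_type torus = real / "\<lambda>x y. x - y \<in> \<int>"
  morphisms rep_torus proj
proof (rule equivpI)
  show "reflp (\<lambda>x y::real. x - y \<in> \<int>)"
    by (simp add: reflp_def)
  show "symp (\<lambda>x y::real. x - y \<in> \<int>)"
  proof (rule sympI)
    fix x y :: real
    assume "x - y \<in> \<int>"
    from Ints_minus[OF this] show "y - x \<in> \<int>" by simp
  qed
  show "transp (\<lambda>x y::real. x - y \<in> \<int>)"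
  proof (rule transpI)
    fix x y z :: real
    assume "x - y \<in> \<int>" "y - z \<in> \<int>"
    from Ints_add[OF this] show "x - z \<in> \<int>" by simp
  qed
qed

instantiation torus :: topological_space
begin

definition open_torus :: "torus set \<Rightarrow> bool"
  where "open_torus U \<longleftrightarrow> open (proj -` U)"

instance
  by standard (auto simp: open_torus_def vimage_Union)

end

lift_definition torus_add :: "torus \<Rightarrow> real \<Rightarrow> torus" is "(+)"
  by simp

definition leb :: "torus measure"
  where "leb = distr (restrict_space lborel {0..<1}) borel proj"

definition dens :: "(torus \<Rightarrow> real) \<Rightarrow> torus measure"
  where "dens \<rho> = density leb (\<lambda>x. ennreal (\<rho> x))"

section \<open>Differentiability classes and norms\<close>

text \<open>Functions on the torus are differentiated through their 1-periodic lifts; the value of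
  \<^term>\<open>torus_deriv f x\<close> does not depend on the representative of \<^term>\<open>x\<close>.\<close>

definition Ck_real :: "nat \<Rightarrow> (real \<Rightarrow> real) \<Rightarrow> bool"
  where "Ck_real k g \<longleftrightarrow>
    (\<forall>j<k. \<forall>x. ((deriv ^^ j) g) differentiable (at x)) \<and> continuous_on UNIV ((deriv ^^ k) g)"

definition Ck_torus :: "nat \<Rightarrow> (torus \<Rightarrow> real) \<Rightarrow> bool"
  where "Ck_torus k f \<longleftrightarrow> Ck_real k (\<lambda>s. f (proj s))"

definition smooth_torus :: "(torus \<Rightarrow> real) \<Rightarrow> bool"
  where "smooth_torus f \<longleftrightarrow> (\<forall>k. Ck_torus k f)"

definition torus_deriv :: "(torus \<Rightarrow> real) \<Rightarrow> torus \<Rightarrow> real"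
  where "torus_deriv f x = deriv (\<lambda>s. f (proj s)) (rep_torus x)"

definition Ck_norm_torus :: "nat \<Rightarrow> (torus \<Rightarrow> real) \<Rightarrow> real"
  where "Ck_norm_torus k f = Sup {\<bar>(deriv ^^ j) (\<lambda>s. f (proj s)) x\<bar> | j x. j \<le> k}"

text \<open>Self-maps of the torus are differentiated through a continuous lift to the real line, which is
  unique up to an additive integer.  Since the values of the map are only defined modulo 1, its
  norm consists of the derivatives of orders 1 to \<^term>\<open>k\<close>.\<close>

definition is_lift :: "(torus \<Rightarrow> torus) \<Rightarrow> (real \<Rightarrow> real) \<Rightarrow> bool"
  where "is_lift F G \<longleftrightarrow> continuous_on UNIV G \<and> (\<forall>s. F (proj s) = proj (G s))"

definition Ck_map :: "nat \<Rightarrow> (torus \<Rightarrow> torus) \<Rightarrow> bool"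
  where "Ck_map k F \<longleftrightarrow> (\<exists>G. is_lift F G \<and> Ck_real k G)"

definition map_deriv :: "(torus \<Rightarrow> torus) \<Rightarrow> torus \<Rightarrow> real"
  where "map_deriv F x = deriv (SOME G. is_lift F G) (rep_torus x)"

definition Ck_norm_map :: "nat \<Rightarrow> (torus \<Rightarrow> torus) \<Rightarrow> real"
  where "Ck_norm_map k F =
    Sup {\<bar>(deriv ^^ j) (SOME G. is_lift F G) x\<bar> | j x. 1 \<le> j \<and> j \<le> k}"

text \<open>A function on \<open>\<real>\<^sup>n\<close>, with \<^term>\<open>n\<close> a natural number, is a function on
  \<^typ>\<open>nat \<Rightarrow> real\<close> that depends only on the coordinates below \<^term>\<open>n\<close>.  For such functions
  continuity in the product topology is continuity on \<open>\<real>\<^sup>n\<close>.\<close>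

definition partial_deriv :: "nat \<Rightarrow> ((nat \<Rightarrow> real) \<Rightarrow> real) \<Rightarrow> (nat \<Rightarrow> real) \<Rightarrow> real"
  where "partial_deriv i f x = deriv (\<lambda>s. f (x(i := s))) (x i)"

primrec partial_derivs :: "nat list \<Rightarrow> ((nat \<Rightarrow> real) \<Rightarrow> real) \<Rightarrow> (nat \<Rightarrow> real) \<Rightarrow> real"
  where
    "partial_derivs [] f = f"
  | "partial_derivs (i # js) f = partial_deriv i (partial_derivs js f)"

definition Ck_euclid :: "nat \<Rightarrow> nat \<Rightarrow> ((nat \<Rightarrow> real) \<Rightarrow> real) \<Rightarrow> bool"
  where "Ck_euclid n k f \<longleftrightarrow>
    (\<forall>x y. (\<forall>i<n. x i = y i) \<longrightarrow> f x = f y) \<and>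
    (\<forall>js i x. set js \<subseteq> {..<n} \<longrightarrow> length js < k \<longrightarrow> i < n \<longrightarrow>
       (\<lambda>s. partial_derivs js f (x(i := s))) differentiable (at (x i))) \<and>
    (\<forall>js. set js \<subseteq> {..<n} \<longrightarrow> length js \<le> k \<longrightarrow> continuous_on UNIV (partial_derivs js f))"

definition Cb_euclid :: "nat \<Rightarrow> nat \<Rightarrow> ((nat \<Rightarrow> real) \<Rightarrow> real) \<Rightarrow> bool"
  where "Cb_euclid n k f \<longleftrightarrow> Ck_euclid n k f \<and>
    (\<forall>js. set js \<subseteq> {..<n} \<longrightarrow> length js \<le> k \<longrightarrow> bounded (range (partial_derivs js f)))"

definition Ck_norm_euclid :: "nat \<Rightarrow> nat \<Rightarrow> ((nat \<Rightarrow> real) \<Rightarrow> real) \<Rightarrow> real"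
  where "Ck_norm_euclid n k f =
    Sup {\<bar>partial_derivs js f x\<bar> | js x. set js \<subseteq> {..<n} \<and> length js \<le> k}"

definition lift2 :: "(torus \<Rightarrow> torus \<Rightarrow> real) \<Rightarrow> (nat \<Rightarrow> real) \<Rightarrow> real"
  where "lift2 h v = h (proj (v 0)) (proj (v 1))"

definition Ck_torus2 :: "nat \<Rightarrow> (torus \<Rightarrow> torus \<Rightarrow> real) \<Rightarrow> bool"
  where "Ck_torus2 k h \<longleftrightarrow> Ck_euclid 2 k (lift2 h)"

definition Ck_norm_torus2 :: "nat \<Rightarrow> (torus \<Rightarrow> torus \<Rightarrow> real) \<Rightarrow> real"
  where "Ck_norm_torus2 k h = Ck_norm_euclid 2 k (lift2 h)"

section \<open>The particle system and the mean-field equation\<close>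

definition phi :: "real \<Rightarrow> (torus \<Rightarrow> torus \<Rightarrow> real) \<Rightarrow> torus measure \<Rightarrow> torus \<Rightarrow> torus"
  where "phi \<Delta> h \<mu> x = torus_add x (\<Delta> * (\<integral>y. h x y \<partial>\<mu>))"

definition F_mu :: "real \<Rightarrow> (torus \<Rightarrow> torus \<Rightarrow> real) \<Rightarrow> (torus \<Rightarrow> torus) \<Rightarrow> torus measure \<Rightarrow> torus \<Rightarrow> torus"
  where "F_mu \<Delta> h F \<mu> = F \<circ> phi \<Delta> h \<mu>"

definition mean_field_solution ::
  "real \<Rightarrow> (torus \<Rightarrow> torus \<Rightarrow> real) \<Rightarrow> (torus \<Rightarrow> torus) \<Rightarrow> real \<Rightarrow> real \<Rightarrow> nat \<Rightarrow> (nat \<Rightarrow> torus \<Rightarrow> real) \<Rightarrow> bool"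
  where "mean_field_solution \<Delta> h F \<kappa> K T \<rho> \<longleftrightarrow>
    (\<forall>t\<le>T. Ck_torus 2 (\<rho> t) \<and> prob_space (dens (\<rho> t)) \<and> (\<forall>x. \<kappa> \<le> \<rho> t x) \<and>
       Ck_norm_torus 2 (\<rho> t) \<le> K) \<and>
    (\<forall>t<T. dens (\<rho> (Suc t)) = distr (dens (\<rho> t)) borel (F_mu \<Delta> h F (dens (\<rho> t))))"

text \<open>The \<^term>\<open>N\<close> particles are numbered from 0 to \<^term>\<open>N - 1\<close>.\<close>

definition particle_step ::
  "real \<Rightarrow> (torus \<Rightarrow> torus \<Rightarrow> real) \<Rightarrow> (torus \<Rightarrow> torus) \<Rightarrow> nat \<Rightarrow> (nat \<Rightarrow> torus) \<Rightarrow> (nat \<Rightarrow> torus)"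
  where "particle_step \<Delta> h F N x =
    (\<lambda>i\<in>{..<N}. F (torus_add (x i) (\<Delta> / real N * (\<Sum>j<N. h (x i) (x j)))))"

definition particles ::
  "real \<Rightarrow> (torus \<Rightarrow> torus \<Rightarrow> real) \<Rightarrow> (torus \<Rightarrow> torus) \<Rightarrow> nat \<Rightarrow> (nat \<Rightarrow> torus) \<Rightarrow> nat \<Rightarrow> (nat \<Rightarrow> torus)"
  where "particles \<Delta> h F N x t = (particle_step \<Delta> h F N ^^ t) x"

definition empirical :: "nat \<Rightarrow> (nat \<Rightarrow> torus) \<Rightarrow> torus measure"
  where "empirical N x = distr (uniform_count_measure {..<N}) borel x"

text \<open>\<open>\<langle>\<phi>, \<eta>\<rangle>\<close> for the signed measure \<open>\<eta> = \<surd>N (\<mu>\<^sub>N - \<rho>)\<close>, \<open>\<mu>\<^sub>N\<close> the empirical measure of \<open>x\<close>.\<close>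

definition fluctuation :: "nat \<Rightarrow> (nat \<Rightarrow> torus) \<Rightarrow> (torus \<Rightarrow> real) \<Rightarrow> (torus \<Rightarrow> real) \<Rightarrow> real"
  where "fluctuation N x \<rho> \<phi> = sqrt (real N) * ((\<integral>y. \<phi> y \<partial>empirical N x) - (\<integral>y. \<phi> y \<partial>dens \<rho>))"

section \<open>Relative entropy and property (E)\<close>

text \<open>\<open>H(\<mu>|\<nu>)\<close> with values in the extended reals.  The negative part of \<open>log (d\<mu>/d\<nu>)\<close> is always
  \<open>\<mu>\<close>-integrable for probability measures, so the difference below is never \<open>\<infinity> - \<infinity>\<close>.
  (\<^const>\<open>KL_divergence\<close> would be 0 where the entropy is infinite.)\<close>

definition rel_entropy :: "'a measure \<Rightarrow> 'a measure \<Rightarrow> ereal"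
  where "rel_entropy \<mu> \<nu> =
    (if absolutely_continuous \<nu> \<mu>
     then enn2ereal (\<integral>\<^sup>+x. ennreal (ln (enn2real (RN_deriv \<nu> \<mu> x))) \<partial>\<mu>)
        - enn2ereal (\<integral>\<^sup>+x. ennreal (- ln (enn2real (RN_deriv \<nu> \<mu> x))) \<partial>\<mu>)
     else \<infinity>)"

text \<open>\<open>H0\<close> is the value of \<open>\<parallel>h\<parallel>\<close> in \<open>C\<^sup>3\<close>: the constant \<open>C'\<close> is chosen before \<open>h\<close>, so it depends on
  \<open>h\<close> only through this norm.\<close>

definition property_E :: "real \<Rightarrow> real \<Rightarrow> real \<Rightarrow> real \<Rightarrow> bool"
  where "property_E H0 \<kappa> K \<Delta>0 \<longleftrightarrow>
    (\<exists>C'>0. \<forall>h \<Delta> F T \<rho> N (L :: (nat \<Rightarrow> torus) measure).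
       Ck_torus2 3 h \<longrightarrow> Ck_norm_torus2 3 h = H0 \<longrightarrow> 0 < \<Delta> \<longrightarrow> \<Delta> < \<Delta>0 \<longrightarrow>
       continuous_on UNIV F \<longrightarrow> mean_field_solution \<Delta> h F \<kappa> K T \<rho> \<longrightarrow> N \<ge> 1 \<longrightarrow>
       prob_space L \<longrightarrow> sets L = sets (PiM {..<N} (\<lambda>_. borel)) \<longrightarrow>
       (\<forall>t\<le>T.
          ereal (1 / real N) *
            rel_entropy (distr L (PiM {..<N} (\<lambda>_. borel)) (\<lambda>x. particles \<Delta> h F N x t))
                        (PiM {..<N} (\<lambda>_. dens (\<rho> t)))
          \<le> ereal (exp (C' * real t)) *
             (ereal (1 / real N) * rel_entropy L (PiM {..<N} (\<lambda>_. dens (\<rho> 0))) + ereal (1 / real N))))"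

section \<open>Random distributions\<close>

text \<open>A distribution is a functional on functions of which only the values on smooth functions
  matter.\<close>

definition distribution :: "((torus \<Rightarrow> real) \<Rightarrow> real) \<Rightarrow> bool"
  where "distribution u \<longleftrightarrow>
    (\<forall>f g a b. smooth_torus f \<longrightarrow> smooth_torus g \<longrightarrow> u (\<lambda>x. a * f x + b * g x) = a * u f + b * u g) \<and>
    (\<exists>n B. \<forall>f. smooth_torus f \<longrightarrow> \<bar>u f\<bar> \<le> B * Ck_norm_torus n f)"

text \<open>\<open>\<langle>u, e\<^sub>k\<rangle>\<close> with \<open>e\<^sub>k(x) = exp(2\<pi>ikx)\<close>, by real and imaginary part.\<close>

definition fourier :: "((torus \<Rightarrow> real) \<Rightarrow> real) \<Rightarrow> int \<Rightarrow> complex"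
  where "fourier u k = Complex (u (\<lambda>x. cos (2 * pi * of_int k * rep_torus x)))
                               (u (\<lambda>x. sin (2 * pi * of_int k * rep_torus x)))"

definition Sobolev :: "real \<Rightarrow> ((torus \<Rightarrow> real) \<Rightarrow> real) set"
  where "Sobolev s = {u. distribution u \<and>
    (\<lambda>k::int. (1 + (real_of_int k)\<^sup>2) powr s * (cmod (fourier u k))\<^sup>2) summable_on UNIV}"

definition Sobolev_norm :: "real \<Rightarrow> ((torus \<Rightarrow> real) \<Rightarrow> real) \<Rightarrow> real"
  where "Sobolev_norm s u =
    sqrt (\<Sum>\<^sub>\<infinity>k::int\<in>UNIV. (1 + (real_of_int k)\<^sup>2) powr s * (cmod (fourier u k))\<^sup>2)"

definition Sobolev_open :: "real \<Rightarrow> ((torus \<Rightarrow> real) \<Rightarrow> real) set \<Rightarrow> bool"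
  where "Sobolev_open s U \<longleftrightarrow> U \<subseteq> Sobolev s \<and>
    (\<forall>u\<in>U. \<exists>r>0. \<forall>v\<in>Sobolev s. Sobolev_norm s (\<lambda>f. v f - u f) < r \<longrightarrow> v \<in> U)"

definition Sobolev_random_element :: "real \<Rightarrow> 'b measure \<Rightarrow> ('b \<Rightarrow> (torus \<Rightarrow> real) \<Rightarrow> real) \<Rightarrow> bool"
  where "Sobolev_random_element s Q X \<longleftrightarrow>
    (\<forall>\<omega>\<in>space Q. X \<omega> \<in> Sobolev s) \<and> (\<forall>U. Sobolev_open s U \<longrightarrow> X -` U \<inter> space Q \<in> sets Q)"

text \<open>Duality pairing of a function and a distribution, extending \<open>u f\<close> from smooth \<open>f\<close> to
  the functions in \<open>H\<^sup>\<alpha>\<close> if \<open>u\<close> lies in the Sobolev space of order \<open>-\<alpha>\<close>; the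
  conjugate occurs because \<open>f = (\<Sum>k. \<langle>f, e\<^bsub>-k\<^esub>\<rangle> e\<^sub>k)\<close>.\<close>

definition dual_pair :: "(torus \<Rightarrow> real) \<Rightarrow> ((torus \<Rightarrow> real) \<Rightarrow> real) \<Rightarrow> real"
  where "dual_pair f u =
    Re (\<Sum>\<^sub>\<infinity>k::int\<in>UNIV. cnj (fourier (\<lambda>g. \<integral>x. g x * f x \<partial>leb) k) * fourier u k)"

text \<open>The law \<open>N(0,a)\<close>; degenerate for \<open>a = 0\<close>.\<close>

definition centered_normal :: "real \<Rightarrow> real measure"
  where "centered_normal a =
    (if a = 0 then return borel 0 else density lborel (\<lambda>x. ennreal (normal_density 0 (sqrt a) x)))"

text \<open>By linearity of \<open>\<phi> \<mapsto> \<langle>\<phi>, X\<rangle>\<close>, prescribing the one-dimensional laws below makes the field jointly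
  Gaussian and fixes its covariance.\<close>

definition gaussian_field :: "(torus \<Rightarrow> real) \<Rightarrow> 'b measure \<Rightarrow> ('b \<Rightarrow> (torus \<Rightarrow> real) \<Rightarrow> real) \<Rightarrow> bool"
  where "gaussian_field \<rho> Q X \<longleftrightarrow> (\<forall>\<phi>. smooth_torus \<phi> \<longrightarrow>
    distr Q borel (\<lambda>\<omega>. dual_pair \<phi> (X \<omega>)) =
      centered_normal ((\<integral>x. (\<phi> x)\<^sup>2 \<partial>dens \<rho>) - (\<integral>x. \<phi> x \<partial>dens \<rho>)\<^sup>2))"

text \<open>The weak form of the limit equation from \<open>\<eta>\<^sub>t = u\<close> to \<open>\<eta>\<^bsub>t+1\<^esub> = u'\<close>.\<close>

definition fluctuation_equation ::
  "real \<Rightarrow> (torus \<Rightarrow> torus \<Rightarrow> real) \<Rightarrow> (torus \<Rightarrow> torus) \<Rightarrow> (torus \<Rightarrow> real) \<Rightarrow>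
     ((torus \<Rightarrow> real) \<Rightarrow> real) \<Rightarrow> ((torus \<Rightarrow> real) \<Rightarrow> real) \<Rightarrow> bool"
  where "fluctuation_equation \<Delta> h F \<rho> u u' \<longleftrightarrow> (\<forall>\<phi>. smooth_torus \<phi> \<longrightarrow>
    dual_pair \<phi> u' = dual_pair (\<phi> \<circ> F_mu \<Delta> h F (dens \<rho>)) u +
      \<Delta> * (\<integral>x. torus_deriv (\<phi> \<circ> F) (phi \<Delta> h (dens \<rho>) x) * dual_pair (h x) u \<partial>dens \<rho>))"

definition fluctuation_solution ::
  "real \<Rightarrow> (torus \<Rightarrow> torus \<Rightarrow> real) \<Rightarrow> (torus \<Rightarrow> torus) \<Rightarrow> nat \<Rightarrow> (nat \<Rightarrow> torus \<Rightarrow> real) \<Rightarrow>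
     'b measure \<Rightarrow> (nat \<Rightarrow> 'b \<Rightarrow> (torus \<Rightarrow> real) \<Rightarrow> real) \<Rightarrow> bool"
  where "fluctuation_solution \<Delta> h F T \<rho> Q \<eta> \<longleftrightarrow>
    (\<forall>t\<le>T. \<forall>\<alpha>>1/2. Sobolev_random_element (- \<alpha>) Q (\<eta> t)) \<and>
    (AE \<omega> in Q. \<forall>t<T. fluctuation_equation \<Delta> h F (\<rho> t) (\<eta> t \<omega>) (\<eta> (Suc t) \<omega>))"

end

theory Submission
  imports Defs
begin

text \<open>
  Entropy. Write one step of the particles as \<open>F \<circ> T\<close> and one step of the product measure as \<open>F \<circ> S\<close>, where
  \<open>S\<close> moves every coordinate by the mean-field displacement. For small \<open>\<Delta>\<close> the map \<open>S\<^sup>-\<^sup>1 \<circ> T\<close> is a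
  perturbation of the identity, and the logarithm of the density that it creates has, up to a bounded
  error, only terms quadratic in the centred empirical measure: the linear ones sum to a kernel of
  mean zero. Its exponential moments are bounded, and the Donsker-Varadhan formula converts them into
  the entropy increment.

  Fluctuations. The pairing of \<open>\<phi>\<close> with \<open>\<eta>\<^sup>N\<close> at time \<open>t + 1\<close> equals that of the adjoint step
  \<open>back_step \<phi>\<close> at time \<open>t\<close> up to \<open>\<surd>N\<close> times the square of the Kantorovich distance of empirical measure
  and density, which grows by at most a constant factor per step and has second moment \<open>O(1/N)\<close> at
  time 0. The limit equation gives the same identity without error. This reduces the theorem to
  \<open>t = 0\<close>, where the summands are independent and Lindeberg's replacement argument applies.
\<close>

text \<open>The Donsker-Varadhan formula only asks for an upper bound on integrals after the
  substitution, so \<open>exp G\<close> may be a lower bound for the density that the map creates.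
  This allows a substitution inequality for Lipschitz data with lower bounds on the diagonal
  Jacobian entries. Off-diagonal entries are of order \<open>1 / N\<close>; eliminating one variable
  changes the remaining entries by order \<open>1 / N^2\<close>, so after \<open>N\<close> rounds
  each diagonal entry has lost order \<open>1 / N\<close> and the logarithm of their product order
  one. The quadratic terms involve all pairs of particles. Cutting the second argument of a
  Lipschitz kernel into \<open>N\<close> tail arcs turns them into products of two ordinary
  averages, whose squares have exponential moments by a Gaussian mixture and Hoeffding's lemma. The
  same arcs bound the initial Kantorovich distance. For the fluctuations the obstacle is regularity:
  the limit equation and the Gaussian law are given on smooth functions, and
  \<open>back_step\<close> does not stay there. Both are extended to C^{1,1} by convolution with
  trigonometric kernels that do not increase the C^{1,1} constant.\<close>

lemmas bochner_cong = Bochner_Integration.integral_cong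

section \<open>The torus\<close>

notation torus_add (infixl "\<oplus>" 65)

lemma proj_eq_iff: "proj a = proj b \<longleftrightarrow> a - b \<in> \<int>"
  using Quotient3_rel[OF Quotient3_torus] by (metis torus.abs_eq_iff)

lemma torus_add_proj [simp]: "proj a \<oplus> t = proj (a + t)"
  by (rule torus_add.abs_eq)

text \<open>The quotient supplies some representative \<open>rep_torus x\<close>; its fractional
  part is the representative in \<open>[0,1)\<close>, and this choice is Borel measurable.\<close>

definition crep :: "torus \<Rightarrow> real"
  where "crep x = frac (rep_torus x)"

lemma proj_rep [simp]: "proj (rep_torus x) = x"
  by (meson Quotient3_abs_rep Quotient3_torus)

lemma proj_frac [simp]: "proj (frac a) = proj a"
  by (simp add: proj_eq_iff frac_def)

lemma proj_crep [simp]: "proj (crep x) = x"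
  by (simp add: crep_def)

lemma crep_ge_0 [simp]: "0 \<le> crep x" and crep_lt_1 [simp]: "crep x < 1"
  by (simp_all add: crep_def frac_lt_1)

lemma frac_cong: "a - b \<in> \<int> \<Longrightarrow> frac a = frac (b::real)"
proof -
  assume "a - b \<in> \<int>"
  then obtain k where "a = b + of_int k" by (metis Ints_cases add.commute diff_add_cancel)
  then show "frac a = frac b" by (simp add: frac_def)
qed

lemma crep_proj [simp]: "crep (proj s) = frac s"
  unfolding crep_def by (rule frac_cong) (simp flip: proj_eq_iff)

lemma torus_induct: "(\<And>s. P (proj s)) \<Longrightarrow> P x"
  by (metis proj_crep)

lemma torus_add_add: "x \<oplus> s \<oplus> t = x \<oplus> (s + t)"
  by (rule torus_induct[of _ x]) (simp add: add.assoc)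

lemma torus_add_0 [simp]: "x \<oplus> 0 = x"
  by (rule torus_induct[of _ x]) simp

lemma torus_add_Ints: "k \<in> \<int> \<Longrightarrow> x \<oplus> k = x"
  by (rule torus_induct[of _ x]) (simp add: proj_eq_iff)

lemma torus_add_cancel [simp]: "x \<oplus> t \<oplus> - t = x" "x \<oplus> - t \<oplus> t = x"
  by (simp_all add: torus_add_add)

lemma torus_add_connect: "\<exists>t. 0 \<le> t \<and> t < 1 \<and> y = x \<oplus> t"
proof (rule exI[of _ "frac (crep y - crep x)"])
  have "x \<oplus> frac (crep y - crep x) = proj (crep x + frac (crep y - crep x))" by (metis proj_crep torus_add_proj)
  also have "... = proj (crep y)" unfolding proj_eq_iff by (simp add: frac_def)
  also have "... = y" by simp
  finally show "0 \<le> frac (crep y - crep x) \<and> frac (crep y - crep x) < 1 \<and> y = x \<oplus> frac (crep y - crep x)"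
    by (simp add: frac_lt_1)
qed

lemma continuous_proj: "continuous_on UNIV proj"
  by (simp add: continuous_on_open_vimage open_torus_def)

lemma measurable_proj [measurable]: "proj \<in> borel_measurable borel"
  by (rule borel_measurable_continuous_onI[OF continuous_proj])

text \<open>At an integer \<open>frac\<close> drops to its minimum 0, so it is lower semicontinuous.
  In the quotient topology this makes \<open>crep\<close> Borel, although it is not
  continuous.\<close>

lemma open_frac_gt: "open {s::real. a < frac s}"
proof (cases "a < 0")
  case True
  then have "{s::real. a < frac s} = UNIV" using frac_ge_0 less_le_trans by blast
  then show ?thesis by simp
next
  case False
  have "{s::real. a < frac s} = (\<Union>k::int. {of_int k + a<..<of_int k + 1})"
  proof (intro equalityI subsetI)
    fix s :: real assume "s \<in> {s. a < frac s}"
    then have "s \<in> {of_int \<lfloor>s\<rfloor> + a<..<of_int \<lfloor>s\<rfloor> + 1}" by (simp add: frac_def)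
    then show "s \<in> (\<Union>k::int. {of_int k + a<..<of_int k + 1})" by blast
  next
    fix s :: real assume "s \<in> (\<Union>k::int. {of_int k + a<..<of_int k + 1})"
    then obtain k :: int where k: "of_int k + a < s" "s < of_int k + 1" by auto
    then have "\<lfloor>s\<rfloor> = k" using False by (intro floor_unique) linarith+
    then show "s \<in> {s. a < frac s}" using k by (simp add: frac_def)
  qed
  then show ?thesis by auto
qed

lemma measurable_crep [measurable]: "crep \<in> borel_measurable borel"
  unfolding borel_measurable_iff_greater
proof
  fix a
  have "open {x. a < crep x}" using open_frac_gt[of a] by (simp add: open_torus_def vimage_def)
  then show "{w \<in> space borel. a < crep w} \<in> sets borel" by simp
qed

lemma measurable_torus_add [measurable]:
  assumes [measurable]: "f \<in> measurable M borel" "g \<in> borel_measurable M"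
  shows "(\<lambda>x. f x \<oplus> g x) \<in> measurable M borel"
proof -
  have "(\<lambda>x. f x \<oplus> g x) = (\<lambda>x. proj (crep (f x) + g x))" by (metis proj_crep torus_add_proj)
  then show ?thesis by simp
qed

text \<open>As \<open>crep\<close> is a Borel section of \<open>proj\<close>, measurability may be
  checked on the periodic lift.\<close>

lemma measurable_torusI:
  assumes "(\<lambda>s. f (proj s)) \<in> measurable borel M"
  shows "f \<in> measurable borel M"
proof -
  have "f = (\<lambda>s. f (proj s)) \<circ> crep" by auto
  then show ?thesis using measurable_comp[OF measurable_crep assms] by simp
qed

lemma sets_leb [simp, measurable_cong]: "sets leb = sets borel"
  and space_leb [simp]: "space leb = UNIV"
  by (simp_all add: leb_def)

lemma measurable_proj_restrict [measurable]: "proj \<in> measurable (restrict_space lborel {0..<1}) borel"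
  by (simp add: measurable_restrict_space1)

lemma nn_integral_leb:
  assumes [measurable]: "f \<in> borel_measurable borel"
  shows "(\<integral>\<^sup>+x. f x \<partial>leb) = (\<integral>\<^sup>+s. f (proj s) * indicator {0..<1} s \<partial>lborel)"
  unfolding leb_def by (subst nn_integral_distr) (auto simp: nn_integral_restrict_space)

interpretation leb: prob_space leb
proof
  have "emeasure leb (space leb) = (\<integral>\<^sup>+x. 1 \<partial>leb)" by simp
  also have "... = (\<integral>\<^sup>+s. indicator {0..<1::real} s \<partial>lborel)" by (subst nn_integral_leb) auto
  also have "... = 1" by simp
  finally show "emeasure leb (space leb) = 1" .
qed

text \<open>With \<open>n\<close> the floor of \<open>a\<close>, the window is cut at
  \<open>n + 1\<close> and its right piece moved back by one, which completes the period
  \<open>[n, n + 1)\<close>.\<close>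

lemma nn_integral_periodic_shift:
  fixes f :: "real \<Rightarrow> ennreal"
  assumes [measurable]: "f \<in> borel_measurable borel" and per: "\<And>s. f (s + 1) = f s"
  shows "(\<integral>\<^sup>+s. f s * indicator {a..<a+1} s \<partial>lborel) = (\<integral>\<^sup>+s. f s * indicator {0..<1} s \<partial>lborel)"
proof -
  have per': "f (s + of_int k) = f s" for s k
  proof (induct k rule: int_induct[of _ 0])
    case (step1 i) then show ?case using per[of "s + of_int i"] by (simp add: add.assoc)
  next
    case (step2 i) then show ?case using per[of "s + of_int i - 1"] by (simp add: algebra_simps)
  qed simp
  have shift: "(\<integral>\<^sup>+s. f s * indicator {u..<v} s \<partial>lborel) =
      (\<integral>\<^sup>+s. f s * indicator {u + of_int k..<v + of_int k} s \<partial>lborel)" for u v k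
  proof -
    have "(\<integral>\<^sup>+s. f s * indicator {u + of_int k..<v + of_int k} s \<partial>lborel) =
      (\<integral>\<^sup>+s. f (of_int k + s) * indicator {u + of_int k..<v + of_int k} (of_int k + s) \<partial>lborel)"
      by (subst lborel_distr_plus[symmetric, of "of_int k"], subst nn_integral_distr) auto
    also have "... = (\<integral>\<^sup>+s. f s * indicator {u..<v} s \<partial>lborel)"
      by (intro nn_integral_cong) (auto simp: indicator_def per' add.commute[of "of_int k"])
    finally show ?thesis by simp
  qed
  define n where "n = \<lfloor>a\<rfloor>"
  have n: "of_int n \<le> a" "a < of_int n + 1" unfolding n_def by linarith+
  have "(\<integral>\<^sup>+s. f s * indicator {a..<a+1} s \<partial>lborel) =
    (\<integral>\<^sup>+s. f s * indicator {a..<of_int n + 1} s + f s * indicator {of_int n + 1..<a + 1} s \<partial>lborel)"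
    using n by (intro nn_integral_cong) (auto simp: indicator_def)
  also have "... = (\<integral>\<^sup>+s. f s * indicator {a..<of_int n + 1} s \<partial>lborel) +
     (\<integral>\<^sup>+s. f s * indicator {of_int n + 1..<a + 1} s \<partial>lborel)" by (rule nn_integral_add) auto
  also have "(\<integral>\<^sup>+s. f s * indicator {of_int n + 1..<a + 1} s \<partial>lborel) =
     (\<integral>\<^sup>+s. f s * indicator {of_int n..<a} s \<partial>lborel)" using shift[of "of_int n" a 1] by simp
  also have "(\<integral>\<^sup>+s. f s * indicator {a..<of_int n + 1} s \<partial>lborel) + ... =
     (\<integral>\<^sup>+s. f s * indicator {a..<of_int n + 1} s + f s * indicator {of_int n..<a} s \<partial>lborel)"
    by (rule nn_integral_add[symmetric]) auto
  also have "... = (\<integral>\<^sup>+s. f s * indicator {of_int n..<of_int n + 1} s \<partial>lborel)"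
    using n by (intro nn_integral_cong) (auto simp: indicator_def)
  also have "... = (\<integral>\<^sup>+s. f s * indicator {0..<1} s \<partial>lborel)" using shift[of 0 1 n] by (simp add: add.commute)
  finally show ?thesis .
qed

lemma nn_integral_leb_shift:
  assumes [measurable]: "f \<in> borel_measurable borel"
  shows "(\<integral>\<^sup>+x. f (x \<oplus> t) \<partial>leb) = (\<integral>\<^sup>+x. f x \<partial>leb)"
proof -
  have "(\<integral>\<^sup>+x. f (x \<oplus> t) \<partial>leb) = (\<integral>\<^sup>+s. f (proj (t + s)) * indicator {0..<1} s \<partial>lborel)"
    by (subst nn_integral_leb) (auto simp: add.commute)
  also have "... = (\<integral>\<^sup>+s. f (proj (t + s)) * indicator {t..<t+1} (t + s) \<partial>lborel)"
    by (intro nn_integral_cong) (auto simp: indicator_def)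
  also have "... = (\<integral>\<^sup>+s. f (proj s) * indicator {t..<t+1} s \<partial>lborel)"
    by (subst (2) lborel_distr_plus[symmetric, of t], subst nn_integral_distr) auto
  also have "... = (\<integral>\<^sup>+s. f (proj s) * indicator {0..<1} s \<partial>lborel)"
    by (rule nn_integral_periodic_shift) (auto intro!: arg_cong[of _ _ f] simp: proj_eq_iff)
  finally show ?thesis by (simp add: nn_integral_leb)
qed

lemma distr_leb_shift: "distr leb borel (\<lambda>x. x \<oplus> t) = leb"
proof (rule measure_eqI)
  fix A assume "A \<in> sets (distr leb borel (\<lambda>x. x \<oplus> t))"
  then have [measurable]: "A \<in> sets borel" by simp
  have "emeasure (distr leb borel (\<lambda>x. x \<oplus> t)) A = (\<integral>\<^sup>+x. indicator A (x \<oplus> t) \<partial>leb)"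
    by (subst nn_integral_indicator[symmetric], simp, subst nn_integral_distr) auto
  also have "... = emeasure leb A" by (subst nn_integral_leb_shift) auto
  finally show "emeasure (distr leb borel (\<lambda>x. x \<oplus> t)) A = emeasure leb A" .
qed simp

lemma integral_leb_shift:
  fixes f :: "torus \<Rightarrow> 'b::{banach, second_countable_topology}"
  assumes [measurable]: "f \<in> borel_measurable borel"
  shows "(LINT x|leb. f (x \<oplus> t)) = (LINT x|leb. f x)"
  by (subst (2) distr_leb_shift[symmetric, of t], subst integral_distr) auto

section \<open>Lipschitz functions and functions with Lipschitz derivative\<close>

text \<open>Displacements range over all reals, so this is exactly the Lipschitz bound of the
  periodic lift; no metric on the torus is introduced.\<close>

definition lip :: "real \<Rightarrow> (torus \<Rightarrow> real) \<Rightarrow> bool"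
  where "lip L f \<longleftrightarrow> (\<forall>x t. \<bar>f (x \<oplus> t) - f x\<bar> \<le> L * abs t)"

text \<open>The class C^{1,1}, written as a uniform first-order expansion. In this form it passes
  through averages, products and compositions by plain estimates, without interchanging a derivative
  and an integral.\<close>

definition qd :: "real \<Rightarrow> (torus \<Rightarrow> real) \<Rightarrow> (torus \<Rightarrow> real) \<Rightarrow> bool"
  where "qd L f f' \<longleftrightarrow> (\<forall>x t. \<bar>f (x \<oplus> t) - f x - t * f' x\<bar> \<le> L * t^2)"

lemma lipD: "lip L f \<Longrightarrow> \<bar>f (x \<oplus> t) - f x\<bar> \<le> L * abs t"
  by (simp add: lip_def)

lemma qdD: "qd L f f' \<Longrightarrow> \<bar>f (x \<oplus> t) - f x - t * f' x\<bar> \<le> L * t^2"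
  by (simp add: qd_def)

lemma lip_nonneg: "lip L f \<Longrightarrow> 0 \<le> L"
  using order_trans[OF abs_ge_zero lipD[of L f undefined 1]] by simp

lemma qd_nonneg: "qd L f f' \<Longrightarrow> 0 \<le> L"
  using order_trans[OF abs_ge_zero qdD[of L f f' undefined 1]] by simp

lemma lip_mono: "lip L f \<Longrightarrow> L \<le> L' \<Longrightarrow> lip L' f"
  unfolding lip_def by (meson abs_ge_zero mult_right_mono order_trans)

lemma qd_mono: "qd L f f' \<Longrightarrow> L \<le> L' \<Longrightarrow> qd L' f f'"
  unfolding qd_def by (meson zero_le_power2 mult_right_mono order_trans)

lemma lip_isCont: assumes "lip L f" shows "isCont (\<lambda>s. f (proj s)) s"
proof -
  have "((\<lambda>u. f (proj u) - f (proj s)) \<longlongrightarrow> 0) (at s)"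
  proof (rule tendsto_rabs_zero_cancel, rule tendsto_sandwich[of "\<lambda>_. 0"])
    have "\<bar>f (proj u) - f (proj s)\<bar> \<le> L * \<bar>u - s\<bar>" for u using lipD[OF assms, of "proj s" "u - s"] by simp
    then show "\<forall>\<^sub>F u in at s. \<bar>f (proj u) - f (proj s)\<bar> \<le> L * \<bar>u - s\<bar>" by simp
    have "((\<lambda>u. L * \<bar>u - s\<bar>) \<longlongrightarrow> L * \<bar>s - s\<bar>) (at s)" by (intro tendsto_intros)
    then show "((\<lambda>u. L * \<bar>u - s\<bar>) \<longlongrightarrow> 0) (at s)" by simp
  qed auto
  then show ?thesis unfolding isCont_def using Lim_null by blast
qed

lemma lip_measurable: "lip L f \<Longrightarrow> f \<in> borel_measurable borel"
  by (rule measurable_torusI, rule borel_measurable_continuous_onI,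
      rule continuous_at_imp_continuous_on) (simp add: lip_isCont)

lemma lip_oscillation: "lip L f \<Longrightarrow> \<bar>f y - f x\<bar> \<le> L"
proof -
  assume L: "lip L f"
  obtain t where t: "0 \<le> t" "t < 1" "y = x \<oplus> t" using torus_add_connect by blast
  have "\<bar>f y - f x\<bar> \<le> L * abs t" using lipD[OF L] t(3) by blast
  also have "... \<le> L * 1" using t lip_nonneg[OF L] by (intro mult_left_mono) auto
  finally show ?thesis by simp
qed

text \<open>The expansions from \<open>x\<close> to \<open>x \<oplus> t\<close> and back are added:
  the increments of \<open>f\<close> cancel and \<open>t * (f' (x \<oplus> t) - f' x)\<close>
  remains.\<close>

lemma qd_deriv_lip: assumes "qd L f f'" shows "lip (2 * L) f'"
  unfolding lip_def
proof (intro allI)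
  fix x t
  have 1: "\<bar>f (x \<oplus> t) - f x - t * f' x\<bar> \<le> L * t^2" by (rule qdD[OF assms])
  have 2: "\<bar>f x - f (x \<oplus> t) + t * f' (x \<oplus> t)\<bar> \<le> L * t^2" using qdD[OF assms, of "x \<oplus> t" "- t"] by simp
  have "abs t * \<bar>f' (x \<oplus> t) - f' x\<bar> = \<bar>(f x - f (x \<oplus> t) + t * f' (x \<oplus> t)) + (f (x \<oplus> t) - f x - t * f' x)\<bar>"
    by (simp add: abs_mult[symmetric] algebra_simps)
  also have "... \<le> 2 * L * t^2" using 1 2 by linarith
  also have "... = abs t * (2 * L * abs t)" by (simp add: power2_eq_square abs_mult[symmetric])
  finally show "\<bar>f' (x \<oplus> t) - f' x\<bar> \<le> 2 * L * abs t" by (cases "t = 0") auto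
qed

lemma qd_DERIV: assumes "qd L f f'"
  shows "((\<lambda>s. f (proj s)) has_real_derivative f' (proj s)) (at s)"
  unfolding DERIV_def
proof (rule LIM_zero_cancel, rule tendsto_rabs_zero_cancel, rule tendsto_sandwich[of "\<lambda>_. 0"])
  show "\<forall>\<^sub>F h in at 0. \<bar>(f (proj (s + h)) - f (proj s)) / h - f' (proj s)\<bar> \<le> L * abs h" unfolding eventually_at_filter
  proof (intro always_eventually allI impI)
    fix h :: real assume h: "h \<noteq> 0"
    have "(f (proj (s + h)) - f (proj s)) / h - f' (proj s) = (f (proj s \<oplus> h) - f (proj s) - h * f' (proj s)) / h"
      using h by (simp add: field_simps)
    then have "\<bar>(f (proj (s + h)) - f (proj s)) / h - f' (proj s)\<bar> = \<bar>f (proj s \<oplus> h) - f (proj s) - h * f' (proj s)\<bar> / abs h"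
      by (simp only: abs_divide)
    also have "... \<le> L * h^2 / abs h" by (intro divide_right_mono qdD[OF assms]) simp
    also have "... = L * abs h" using h by (simp add: power2_eq_square abs_if)
    finally show "\<bar>(f (proj (s + h)) - f (proj s)) / h - f' (proj s)\<bar> \<le> L * abs h" .
  qed
  have "((\<lambda>h. L * abs h) \<longlongrightarrow> L * \<bar>0\<bar>) (at 0)" by (intro tendsto_intros)
  then show "((\<lambda>h. L * abs h) \<longlongrightarrow> 0) (at 0)" by simp
qed auto

lemma qd_torus_deriv: assumes "qd L f f'" shows "torus_deriv f = f'"
  using DERIV_imp_deriv[OF qd_DERIV[OF assms]] by (auto simp: torus_deriv_def)

lemma second_difference_le: assumes "qd L f f'"
  shows "\<bar>f (x \<oplus> t) + f (x \<oplus> - t) - 2 * f x\<bar> \<le> 2 * L * t^2"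
  using qdD[OF assms, of x t] qdD[OF assms, of x "- t"] by (simp add: abs_le_iff)

text \<open>Integration by parts on the circle. By translation invariance the integral of
  \<open>f (x \<oplus> t) - f x\<close> vanishes, so \<open>t\<close> times the mean of
  \<open>f'\<close> is at most \<open>L * t^2\<close>; then \<open>t\<close> tends to 0.\<close>

lemma lip_integral_shift_0: assumes qd: "qd L f f'" and lp: "lip L' f"
  shows "(LINT x|leb. f' x) = 0"
proof -
  have [measurable]: "f \<in> borel_measurable borel" "f' \<in> borel_measurable borel"
    using lip_measurable[OF lp] lip_measurable[OF qd_deriv_lip[OF qd]] by auto
  have bdd: "integrable leb g" if "lip M g" for g M
  proof (rule leb.integrable_const_bound[of _ "\<bar>g undefined\<bar> + M"])
    show "AE x in leb. norm (g x) \<le> \<bar>g undefined\<bar> + M"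
    proof (intro AE_I2)
      fix x show "norm (g x) \<le> \<bar>g undefined\<bar> + M" using lip_oscillation[OF that, of x undefined] by simp
    qed
    show "g \<in> borel_measurable leb" using lip_measurable[OF that] by simp
  qed
  have int: "integrable leb f" "integrable leb f'" using bdd lp qd_deriv_lip[OF qd] by auto
  have ints: "integrable leb (\<lambda>x. f (x \<oplus> t))" for t
    using int(1) by (subst (asm) distr_leb_shift[symmetric, of t], subst (asm) integrable_distr_eq) auto
  have key: "\<bar>LINT x|leb. f' x\<bar> \<le> L * t" if t: "t > 0" for t
  proof -
    have "(LINT x|leb. f (x \<oplus> t) - f x - t * f' x) = - t * (LINT x|leb. f' x)"
      using int ints by (simp add: integral_leb_shift)
    moreover have "\<bar>LINT x|leb. f (x \<oplus> t) - f x - t * f' x\<bar> \<le> (LINT x|leb. L * t^2)"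
      using int ints qdD[OF qd, of _ t] by (intro order_trans[OF integral_abs_bound] integral_mono) auto
    ultimately have "t * \<bar>LINT x|leb. f' x\<bar> \<le> t * (L * t)"
      using t leb.prob_space by (simp add: abs_mult power2_eq_square mult_ac)
    then show ?thesis using t by simp
  qed
  have "((\<lambda>t. L * t) \<longlongrightarrow> L * 0) (at_right 0)" by (intro tendsto_intros)
  then have "\<bar>LINT x|leb. f' x\<bar> \<le> L * 0" by (rule tendsto_lowerbound)
       (auto intro!: eventually_mono[OF eventually_at_right_less[of 0]] key)
  then show ?thesis by simp
qed

section \<open>The variational formula for the relative entropy\<close>

lemma nn_integral_le_of_truncations:
  fixes g :: "'a \<Rightarrow> real"
  assumes [measurable]: "g \<in> borel_measurable M"
    and le: "\<And>n::nat. (\<integral>\<^sup>+x. ennreal (min (real n) (g x)) \<partial>M) \<le> c"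
  shows "(\<integral>\<^sup>+x. ennreal (g x) \<partial>M) \<le> c"
proof -
  have lim: "(\<lambda>n. ennreal (min (real n) (g x))) \<longlonglongrightarrow> ennreal (g x)" for x
  proof (rule tendsto_eventually, rule eventually_sequentiallyI[of "nat \<lceil>g x\<rceil>"])
    fix n assume "nat \<lceil>g x\<rceil> \<le> n"
    then have "g x \<le> real n" by linarith
    then show "ennreal (min (real n) (g x)) = ennreal (g x)" by simp
  qed
  have inc: "incseq (\<lambda>n x. ennreal (min (real n) (g x)))" by (auto simp: incseq_def le_fun_def intro!: ennreal_leI)
  have "(SUP n. ennreal (min (real n) (g x))) = ennreal (g x)" for x
    by (rule LIMSEQ_unique[OF LIMSEQ_SUP lim]) (use inc in \<open>auto simp: incseq_def le_fun_def\<close>)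
  then have "(\<integral>\<^sup>+x. ennreal (g x) \<partial>M) = (\<integral>\<^sup>+x. (SUP n. ennreal (min (real n) (g x))) \<partial>M)" by simp
  also have "... = (SUP n. \<integral>\<^sup>+x. ennreal (min (real n) (g x)) \<partial>M)"
    by (rule nn_integral_monotone_convergence_SUP[OF inc]) simp
  also have "... \<le> c" by (intro SUP_least le)
  finally show ?thesis .
qed

locale ac_pair = \<mu>: prob_space \<mu> + \<nu>: prob_space \<nu> for \<mu> \<nu> :: "'a measure" +
  assumes sets_eq: "sets \<mu> = sets \<nu>" and ac: "absolutely_continuous \<nu> \<mu>"
begin

definition D :: "'a \<Rightarrow> real" where "D x = enn2real (RN_deriv \<nu> \<mu> x)"

lemma D_measurable [measurable]: "D \<in> borel_measurable \<nu>"
  unfolding D_def by measurable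

lemma D_nonneg [simp]: "0 \<le> D x"
  by (simp add: D_def)

lemma measurable_mu [measurable_dest]: "f \<in> borel_measurable \<nu> \<Longrightarrow> f \<in> borel_measurable \<mu>"
  by (simp add: sets_eq cong: measurable_cong_sets)

lemma mu_eq: "\<mu> = density \<nu> (\<lambda>x. ennreal (D x))"
proof -
  have "AE x in \<nu>. RN_deriv \<nu> \<mu> x \<noteq> \<infinity>"
    by (rule \<nu>.RN_deriv_finite) (use ac sets_eq \<mu>.sigma_finite_measure_axioms in auto)
  then have "AE x in \<nu>. RN_deriv \<nu> \<mu> x = ennreal (D x)" by eventually_elim (simp add: D_def ennreal_enn2real_if)
  then have "density \<nu> (RN_deriv \<nu> \<mu>) = density \<nu> (\<lambda>x. ennreal (D x))" by (intro density_cong) auto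
  then show ?thesis using \<nu>.density_RN_deriv[OF ac sets_eq] by simp
qed

lemma AE_D_pos: "AE x in \<mu>. 0 < D x"
proof (subst mu_eq, subst AE_density)
  show "AE x in \<nu>. 0 < ennreal (D x) \<longrightarrow> 0 < D x" by (auto simp: ennreal_less_zero_iff)
qed auto

lemma integral_D: "integrable \<nu> D" "(LINT x|\<nu>. D x) = 1"
proof -
  have "emeasure \<mu> (space \<mu>) = (\<integral>\<^sup>+x. ennreal (D x) \<partial>\<nu>)"
    by (subst (1) mu_eq) (simp add: emeasure_density sets_eq_imp_space_eq[OF sets_eq] cong: nn_integral_cong)
  then have *: "(\<integral>\<^sup>+x. ennreal (D x) \<partial>\<nu>) = ennreal 1" using \<mu>.emeasure_space_1 by simp
  show "integrable \<nu> D" using * by (intro integrableI_nonneg) auto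
  show "(LINT x|\<nu>. D x) = 1" using * by (intro integral_eq_nn_integral[THEN trans]) auto
qed

lemma nn_integral_mu: "f \<in> borel_measurable \<nu> \<Longrightarrow> (\<integral>\<^sup>+x. f x \<partial>\<mu>) = (\<integral>\<^sup>+x. ennreal (D x) * f x \<partial>\<nu>)"
  by (subst mu_eq) (simp add: nn_integral_density)

text \<open>Pointwise \<open>- r * ln r \<le> 1\<close>, integrated against \<nu>. The negative part
  is finite whatever the entropy is, so the difference defining \<open>rel_entropy\<close> is never
  indeterminate.\<close>

lemma neg_part: "(\<integral>\<^sup>+x. ennreal (- ln (D x)) \<partial>\<mu>) \<le> 1"
proof -
  have "ennreal (D x) * ennreal (- ln (D x)) \<le> 1" for x
  proof (cases "0 < D x")
    case True
    have "ln (1 / D x) \<le> 1 / D x - 1" using True by (intro ln_le_minus_one) simp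
    then have "D x * (- ln (D x)) \<le> D x * (1 / D x - 1)" using True by (intro mult_left_mono) (auto simp: ln_div)
    also have "... \<le> 1" using True by (simp add: right_diff_distrib)
    finally have "D x * (- ln (D x)) \<le> 1" .
    then have "ennreal (D x * (- ln (D x))) \<le> ennreal 1" by (rule ennreal_leI)
    then show ?thesis using True by (subst (asm) ennreal_mult') auto
  qed (use D_nonneg[of x] in \<open>simp add: not_less\<close>)
  then have "(\<integral>\<^sup>+x. ennreal (D x) * ennreal (- ln (D x)) \<partial>\<nu>) \<le> (\<integral>\<^sup>+x. 1 \<partial>\<nu>)" by (intro nn_integral_mono) auto
  then show ?thesis using \<nu>.emeasure_space_1 by (subst nn_integral_mu) auto
qed

lemma rel_entropy_eq:
  "rel_entropy \<mu> \<nu> = enn2ereal (\<integral>\<^sup>+x. ennreal (ln (D x)) \<partial>\<mu>) - enn2ereal (\<integral>\<^sup>+x. ennreal (- ln (D x)) \<partial>\<mu>)"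
  using ac by (simp add: rel_entropy_def D_def)

lemma neg_part_ennreal: obtains b where "0 \<le> b" "b \<le> 1" "(\<integral>\<^sup>+x. ennreal (- ln (D x)) \<partial>\<mu>) = ennreal b"
proof -
  have "(\<integral>\<^sup>+x. ennreal (- ln (D x)) \<partial>\<mu>) \<noteq> \<top>" using neg_part by (auto simp: top_unique)
  then obtain b where b: "0 \<le> b" "(\<integral>\<^sup>+x. ennreal (- ln (D x)) \<partial>\<mu>) = ennreal b"
    by (metis ennreal_cases infinity_ennreal_def)
  have "b \<le> 1" using neg_part b by (simp add: ennreal_le_1)
  with b show ?thesis using that by blast
qed

lemma rel_entropy_finite:
  assumes "(\<integral>\<^sup>+x. ennreal (ln (D x)) \<partial>\<mu>) \<noteq> \<infinity>"
  shows "integrable \<mu> (\<lambda>x. ln (D x))" "rel_entropy \<mu> \<nu> = ereal (LINT x|\<mu>. ln (D x))"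
proof -
  obtain b where b: "0 \<le> b" "(\<integral>\<^sup>+x. ennreal (- ln (D x)) \<partial>\<mu>) = ennreal b" using neg_part_ennreal by metis
  obtain a where a: "0 \<le> a" "(\<integral>\<^sup>+x. ennreal (ln (D x)) \<partial>\<mu>) = ennreal a"
    using assms by (metis ennreal_cases infinity_ennreal_def)
  have [measurable]: "(\<lambda>x. ln (D x)) \<in> borel_measurable \<mu>" by (rule measurable_mu) measurable
  show int: "integrable \<mu> (\<lambda>x. ln (D x))" unfolding real_integrable_def using a b by auto
  show "rel_entropy \<mu> \<nu> = ereal (LINT x|\<mu>. ln (D x))"
    using a b by (simp add: rel_entropy_eq real_lebesgue_integral_def[OF int])
qed

lemma rel_entropy_infinite:
  assumes "(\<integral>\<^sup>+x. ennreal (ln (D x)) \<partial>\<mu>) = \<infinity>"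
  shows "rel_entropy \<mu> \<nu> = \<infinity>"
  using assms neg_part_ennreal by (metis rel_entropy_eq PInfty_neq_ereal(1) enn2ereal_ennreal enn2ereal_top ereal_minus(6) infinity_ennreal_def minus_ereal_def uminus_ereal.simps(1) plus_ereal.simps(2))

end

lemma exp_bounded_integrable:
  assumes "prob_space M" "f \<in> borel_measurable M" "\<And>x. \<bar>f x\<bar> \<le> B"
  shows "integrable M (\<lambda>x. exp (f x :: real))" "integrable M f" "0 < (LINT x|M. exp (f x))"
proof -
  interpret prob_space M by fact
  note [measurable] = assms(2)
  show int: "integrable M (\<lambda>x. exp (f x))"
    using assms(3) by (intro integrable_const_bound[of _ "exp B"]) (auto simp: abs_le_iff)
  show "integrable M f" using assms(3) by (intro integrable_const_bound[of _ B]) auto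
  have "(LINT x|M. exp (- B)) \<le> (LINT x|M. exp (f x))"
  proof (intro integral_mono int)
    fix x show "exp (- B) \<le> exp (f x)" using assms(3)[of x] by (simp add: abs_le_iff)
  qed auto
  then have "exp (- B) \<le> (LINT x|M. exp (f x))" by (simp add: prob_space)
  then show "0 < (LINT x|M. exp (f x))" using exp_gt_zero[of "- B"] by linarith
qed

text \<open>Convexity enters as \<open>ln y \<le> y - 1\<close> at
  \<open>y = exp (f x) / (D x * Z)\<close>; the \<mu>-mean of the right-hand side is at most
  0.\<close>

theorem donsker_varadhan_le:
  fixes f :: "'a \<Rightarrow> real"
  assumes "prob_space \<mu>" "prob_space \<nu>" and sets: "sets \<mu> = sets \<nu>"
    and f[measurable]: "f \<in> borel_measurable \<nu>" and bdd: "\<And>x. \<bar>f x\<bar> \<le> B"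
    and H: "rel_entropy \<mu> \<nu> \<le> ereal c"
  shows "(LINT x|\<mu>. f x) \<le> c + ln (LINT x|\<nu>. exp (f x))"
proof -
  have "absolutely_continuous \<nu> \<mu>" using H unfolding rel_entropy_def by (auto split: if_splits)
  then interpret ac_pair \<mu> \<nu> using assms by (simp add: ac_pair_def ac_pair_axioms_def)
  note [measurable] = measurable_mu[OF f]
  have [measurable]: "D \<in> borel_measurable \<mu>" by (rule measurable_mu) measurable
  have "(\<integral>\<^sup>+x. ennreal (ln (D x)) \<partial>\<mu>) \<noteq> \<infinity>" using rel_entropy_infinite H by auto
  from rel_entropy_finite[OF this] H
  have int: "integrable \<mu> (\<lambda>x. ln (D x))" and le: "(LINT x|\<mu>. ln (D x)) \<le> c" by auto
  define Z where "Z = (LINT x|\<nu>. exp (f x))"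
  have fint: "integrable \<mu> f" and eint: "integrable \<nu> (\<lambda>x. exp (f x))" and Z: "0 < Z"
    using exp_bounded_integrable[OF assms(1) measurable_mu[OF f] bdd]
      exp_bounded_integrable[OF assms(2) f bdd] by (auto simp: Z_def)
  \<comment> \<open>Division by zero gives 0: the product is \<open>exp (f x)\<close> where the
    density is positive and 0 elsewhere, so in general only an inequality holds.\<close>
  have D_le: "D x * (exp (f x) / D x) \<le> exp (f x)" for x by simp
  have intD: "integrable \<nu> (\<lambda>x. D x * (exp (f x) / D x))"
    by (rule Bochner_Integration.integrable_bound[OF eint]) auto
  have intq: "integrable \<mu> (\<lambda>x. exp (f x) / D x)" by (subst mu_eq, subst integrable_density) (use intD in auto)
  have "(LINT x|\<mu>. exp (f x) / D x) = (LINT x|\<nu>. D x * (exp (f x) / D x))"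
    by (subst mu_eq, subst integral_density) auto
  also have "... \<le> Z" unfolding Z_def by (intro integral_mono intD eint) (rule D_le)
  finally have q: "(LINT x|\<mu>. exp (f x) / D x) \<le> Z" .
  have intqZ: "integrable \<mu> (\<lambda>x. (exp (f x) / D x) / Z - 1)"
    using intq by (intro Bochner_Integration.integrable_diff integrable_divide) auto
  have "(LINT x|\<mu>. f x - ln (D x) - ln Z) \<le> (LINT x|\<mu>. (exp (f x) / D x) / Z - 1)"
  proof (intro integral_mono_AE)
    show "AE x in \<mu>. f x - ln (D x) - ln Z \<le> (exp (f x) / D x) / Z - 1" using AE_D_pos
    proof eventually_elim
      case (elim x)
      have "ln ((exp (f x) / D x) / Z) \<le> (exp (f x) / D x) / Z - 1" using elim Z by (intro ln_le_minus_one) simp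
      then show ?case using elim Z by (simp add: ln_div ln_mult)
    qed
  qed (use fint int intqZ in auto)
  also have "... = (LINT x|\<mu>. exp (f x) / D x / Z) - (LINT x|\<mu>. 1)"
    by (intro Bochner_Integration.integral_diff integrable_divide) (use intq in auto)
  also have "... = (LINT x|\<mu>. exp (f x) / D x) / Z - 1"
    unfolding Bochner_Integration.integral_divide_zero by (simp add: \<mu>.prob_space)
  also have "... \<le> 0" using q Z by simp
  finally show ?thesis using fint int le by (simp add: \<mu>.prob_space Z_def)
qed

text \<open>Tested with \<open>n\<close> times the indicator of a \<nu>-null set: the exponential
  integral stays 1, so \<open>n\<close> times the \<mu>-measure of the set is at most
  \<open>c\<close> for every \<open>n\<close>.\<close>

lemma absolutely_continuous_of_exp_bound:
  assumes "prob_space \<mu>" "prob_space \<nu>" and sets: "sets \<mu> = sets \<nu>"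
    and le: "\<And>f B. f \<in> borel_measurable \<nu> \<Longrightarrow> (\<And>x. \<bar>f x\<bar> \<le> B) \<Longrightarrow>
      (LINT x|\<mu>. f x) \<le> (c::real) + ln (LINT x|\<nu>. exp (f x))"
  shows "absolutely_continuous \<nu> \<mu>"
  unfolding absolutely_continuous_def
proof
  interpret \<mu>: prob_space \<mu> by fact
  interpret \<nu>: prob_space \<nu> by fact
  fix A assume A: "A \<in> null_sets \<nu>"
  then have [measurable]: "A \<in> sets \<nu>" "A \<in> sets \<mu>" using sets by auto
  have n: "real n * measure \<mu> A \<le> c" for n :: nat
  proof -
    have "AE x in \<nu>. exp (real n * indicator A x) = 1" using AE_not_in[OF A] by eventually_elim simp
    then have "(LINT x|\<nu>. exp (real n * indicator A x)) = (LINT x|\<nu>. 1)" by (intro integral_cong_AE) measurable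
    moreover have "(LINT x|\<mu>. real n * indicator A x) = real n * measure \<mu> A" by simp
    ultimately show ?thesis
      using le[of "\<lambda>x. real n * indicator A x" "real n"] by (simp add: \<nu>.prob_space abs_mult split: split_indicator)
  qed
  have "measure \<mu> A = 0"
  proof (rule ccontr)
    assume "measure \<mu> A \<noteq> 0"
    then have "0 < measure \<mu> A" by (simp add: zero_less_measure_iff)
    then obtain n :: nat where "c < real n * measure \<mu> A" using reals_Archimedean3 by blast
    with n[of n] show False by simp
  qed
  then show "A \<in> null_sets \<mu>" by (simp add: null_sets_def \<mu>.emeasure_eq_measure)
qed

text \<open>The optimal test function is the logarithm of the density. Its truncations
  \<open>F n\<close> are admissible and cost at most \<open>ln (1 + exp (- n))\<close>; they first
  show that \<open>ln D\<close> is integrable, and the bound follows in the limit.\<close>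

theorem donsker_varadhan_ge:
  assumes "prob_space \<mu>" "prob_space \<nu>" and sets: "sets \<mu> = sets \<nu>"
    and le: "\<And>f B. f \<in> borel_measurable \<nu> \<Longrightarrow> (\<And>x. \<bar>f x\<bar> \<le> B) \<Longrightarrow>
      (LINT x|\<mu>. f x) \<le> (c::real) + ln (LINT x|\<nu>. exp (f x))"
  shows "rel_entropy \<mu> \<nu> \<le> ereal c"
proof -
  have "absolutely_continuous \<nu> \<mu>" by (rule absolutely_continuous_of_exp_bound[OF assms(1-3)]) (rule le)
  then interpret ac_pair \<mu> \<nu> using assms(1-3) by (simp add: ac_pair_def ac_pair_axioms_def)
  have [measurable]: "D \<in> borel_measurable \<mu>" by (rule measurable_mu) measurable
  \<comment> \<open>Where the density vanishes, \<open>- n\<close> is the truncation of minus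
    infinity; this keeps \<open>exp (F n x)\<close> below \<open>D x + exp (- n)\<close>.\<close>
  define F where "F n x = (if D x = 0 then - real n else max (- real n) (min (real n) (ln (D x))))" for n x
  have F[measurable]: "F n \<in> borel_measurable \<nu>" for n unfolding F_def by measurable
  note [measurable] = measurable_mu[OF F]
  have Fb: "\<bar>F n x\<bar> \<le> real n" for n x unfolding F_def by auto
  have Fint: "integrable \<mu> (F n)" for n using exp_bounded_integrable[OF assms(1) measurable_mu[OF F] Fb] by auto
  have Fle: "(LINT x|\<mu>. F n x) \<le> c + exp (- real n)" for n
  proof -
    note E = exp_bounded_integrable[OF assms(2) F Fb, of n]
    have "exp (F n x) \<le> D x + exp (- real n)" for x
    proof (cases "D x = 0")
      case False
      then have D: "0 < D x" using D_nonneg[of x] by linarith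
      show ?thesis
      proof (cases "- real n \<le> ln (D x)")
        case True
        then have "F n x \<le> ln (D x)" using False by (simp add: F_def)
        then have "exp (F n x) \<le> exp (ln (D x))" by simp
        also have "... = D x" using D by simp
        finally show ?thesis using exp_gt_zero[of "- real n"] by linarith
      next
        case f2: False
        then show ?thesis using False D by (simp add: F_def)
      qed
    qed (simp add: F_def)
    then have "(LINT x|\<nu>. exp (F n x)) \<le> (LINT x|\<nu>. D x + exp (- real n))"
      using E integral_D by (intro integral_mono) auto
    also have "... = 1 + exp (- real n)" using integral_D by (simp add: \<nu>.prob_space)
    finally have "ln (LINT x|\<nu>. exp (F n x)) \<le> ln (1 + exp (- real n))"
      using E(3) by (subst ln_le_cancel_iff) (auto intro: add_pos_pos)
    also have "... \<le> exp (- real n)" by (rule ln_add_one_self_le_self) simp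
    finally show ?thesis using le[OF F Fb, of n] by linarith
  qed
  obtain b where b: "0 \<le> b" "b \<le> 1" "(\<integral>\<^sup>+x. ennreal (- ln (D x)) \<partial>\<mu>) = ennreal b" by (rule neg_part_ennreal)
  have negint: "integrable \<mu> (\<lambda>x. max 0 (- ln (D x)))" "(LINT x|\<mu>. max 0 (- ln (D x))) = b"
  proof -
    have *: "(\<integral>\<^sup>+x. ennreal (max 0 (- ln (D x))) \<partial>\<mu>) = ennreal b"
      unfolding b(3)[symmetric] by (intro nn_integral_cong) (auto simp: max_def ennreal_neg)
    show "integrable \<mu> (\<lambda>x. max 0 (- ln (D x)))" using * by (intro integrableI_nonneg) auto
    show "(LINT x|\<mu>. max 0 (- ln (D x))) = b" using * b by (subst integral_eq_nn_integral) auto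
  qed
  have "(\<integral>\<^sup>+x. ennreal (ln (D x)) \<partial>\<mu>) \<le> ennreal (c + 2)"
  proof (rule nn_integral_le_of_truncations)
    fix n
    have int: "integrable \<mu> (\<lambda>x. F n x + max 0 (- ln (D x)))" using Fint negint by auto
    have pos: "AE x in \<mu>. max 0 (min (real n) (ln (D x))) \<le> F n x + max 0 (- ln (D x))"
      using AE_D_pos by eventually_elim (auto simp: F_def)
    have "(\<integral>\<^sup>+x. ennreal (min (real n) (ln (D x))) \<partial>\<mu>) \<le> (\<integral>\<^sup>+x. ennreal (F n x + max 0 (- ln (D x))) \<partial>\<mu>)"
      by (intro nn_integral_mono_AE, use pos in eventually_elim) (auto intro!: ennreal_leI)
    also have "... = ennreal (LINT x|\<mu>. F n x + max 0 (- ln (D x)))"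
      by (rule nn_integral_eq_integral[OF int], use pos in eventually_elim) auto
    also have "... \<le> ennreal (c + 2)"
    proof (rule ennreal_leI)
      \<comment> \<open>The slack 2 consists of \<open>exp (- n) \<le> 1\<close> and of the negative
        part \<open>b \<le> 1\<close>.\<close>
      have "exp (- real n) \<le> 1" by simp
      then show "(LINT x|\<mu>. F n x + max 0 (- ln (D x))) \<le> c + 2"
        using Fint[of n] negint Fle[of n] b(2) by (simp, linarith)
    qed
    finally show "(\<integral>\<^sup>+x. ennreal (min (real n) (ln (D x))) \<partial>\<mu>) \<le> ennreal (c + 2)" .
  qed measurable
  then have "(\<integral>\<^sup>+x. ennreal (ln (D x)) \<partial>\<mu>) \<noteq> \<infinity>" by (auto simp: top_unique)
  note fin = rel_entropy_finite[OF this]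
  have "(\<lambda>n. LINT x|\<mu>. F n x) \<longlonglongrightarrow> (LINT x|\<mu>. ln (D x))"
  proof (rule integral_dominated_convergence[where w = "\<lambda>x. \<bar>ln (D x)\<bar>"])
    show "AE x in \<mu>. (\<lambda>n. F n x) \<longlonglongrightarrow> ln (D x)" using AE_D_pos
    proof eventually_elim
      case (elim x)
      show ?case
      proof (rule tendsto_eventually, rule eventually_sequentiallyI[of "nat \<lceil>\<bar>ln (D x)\<bar>\<rceil>"])
        fix n assume "nat \<lceil>\<bar>ln (D x)\<bar>\<rceil> \<le> n"
        then have "\<bar>ln (D x)\<bar> \<le> real n" by linarith
        then show "F n x = ln (D x)" using elim by (auto simp: F_def)
      qed
    qed
    show "AE x in \<mu>. norm (F n x) \<le> \<bar>ln (D x)\<bar>" for n using AE_D_pos by eventually_elim (auto simp: F_def)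
  qed (use fin in auto)
  moreover have "(\<lambda>n. c + exp (- real n)) \<longlonglongrightarrow> c + 0"
    by (intro tendsto_intros filterlim_compose[OF exp_at_bot] filterlim_compose[OF filterlim_uminus_at_bot_at_top] filterlim_real_sequentially)
  ultimately have "(LINT x|\<mu>. ln (D x)) \<le> c + 0" using Fle by (intro LIMSEQ_le) auto
  then show ?thesis using fin by simp
qed

lemma rel_entropy_nonneg:
  assumes "prob_space \<mu>" "prob_space \<nu>" "sets \<mu> = sets \<nu>"
  shows "0 \<le> rel_entropy \<mu> \<nu>"
proof (cases "rel_entropy \<mu> \<nu> = \<infinity>")
  case False
  have *: "0 \<le> c" if "rel_entropy \<mu> \<nu> \<le> ereal c" for c
    using donsker_varadhan_le[OF assms, of "\<lambda>_. 0" 0 c] that prob_space.prob_space[OF assms(2)] by simp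
  show ?thesis using False *[of "real_of_ereal (rel_entropy \<mu> \<nu>)"] *[of "- 1"] by (cases "rel_entropy \<mu> \<nu>") auto
qed simp

text \<open>The change of variables \<open>\<Psi>\<close> is controlled through the density proxy \<open>exp G\<close>; the
  exponential moment of \<open>- G\<close> only has to be finite for one small exponent \<open>r\<close>.\<close>

theorem rel_entropy_push_le:
  fixes G :: "'a \<Rightarrow> real"
  assumes P: "prob_space \<mu>" "prob_space \<nu>" and sets: "sets \<mu> = sets \<nu>"
    and \<Psi>[measurable]: "\<Psi> \<in> measurable \<nu> \<nu>" and R[measurable]: "R \<in> measurable \<nu> N"
    and G[measurable]: "G \<in> borel_measurable \<nu>" and Gb: "\<And>x. \<bar>G x\<bar> \<le> B"
    and r: "0 < r"
    and push: "\<And>f B. f \<in> borel_measurable \<nu> \<Longrightarrow> (\<And>x. \<bar>f x\<bar> \<le> B) \<Longrightarrow>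
      (LINT x|\<nu>. exp (f (\<Psi> x) + G x)) \<le> (LINT x|\<nu>. exp (f x))"
    and mom: "(LINT x|\<nu>. exp (- r * G x)) \<le> exp C"
  shows "rel_entropy (distr \<mu> N (R \<circ> \<Psi>)) (distr \<nu> N R) \<le> ereal (1 + 1 / r) * rel_entropy \<mu> \<nu> + ereal (C / r)"
proof (cases "rel_entropy \<mu> \<nu> = \<infinity>")
  case True
  moreover have "0 < 1 + 1 / r" using r by (simp add: add_pos_pos)
  ultimately show ?thesis by simp
next
  case False
  then obtain h where h: "rel_entropy \<mu> \<nu> = ereal h"
    using rel_entropy_nonneg[OF P sets] by (cases "rel_entropy \<mu> \<nu>") auto
  interpret \<mu>: prob_space \<mu> by fact
  interpret \<nu>: prob_space \<nu> by fact
  have mm[measurable_dest]: "f \<in> measurable \<nu> M \<Longrightarrow> f \<in> measurable \<mu> M" for f :: "'a \<Rightarrow> 'c" and M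
    by (simp add: sets cong: measurable_cong_sets)
  have [measurable]: "\<Psi> \<in> measurable \<mu> \<nu>" "G \<in> borel_measurable \<mu>"
    using \<Psi> G by (simp_all add: sets cong: measurable_cong_sets)
  have "rel_entropy (distr \<mu> N (R \<circ> \<Psi>)) (distr \<nu> N R) \<le> ereal ((1 + 1 / r) * h + C / r)"
  proof (rule donsker_varadhan_ge)
    show "prob_space (distr \<mu> N (R \<circ> \<Psi>))" by (rule \<mu>.prob_space_distr) measurable
    show "prob_space (distr \<nu> N R)" by (rule \<nu>.prob_space_distr) measurable
    show "sets (distr \<mu> N (R \<circ> \<Psi>)) = sets (distr \<nu> N R)" by simp
    fix f :: "'b \<Rightarrow> real" and B' assume f: "f \<in> borel_measurable (distr \<nu> N R)" and fb: "\<And>x. \<bar>f x\<bar> \<le> B'"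
    have [measurable]: "f \<in> borel_measurable N" using f by simp
    define g where "g x = f (R x)" for x
    have [measurable]: "g \<in> borel_measurable \<nu>" unfolding g_def by measurable
    have gb: "\<bar>g x\<bar> \<le> B'" for x using fb by (simp add: g_def)
    have b1: "\<bar>g (\<Psi> x) + G x\<bar> \<le> B' + B" for x using gb[of "\<Psi> x"] Gb[of x] by linarith
    have b2: "\<bar>- r * G x\<bar> \<le> r * B" for x using Gb[of x] r by (simp add: abs_mult)
    \<comment> \<open>The variational formula is used twice with the same entropy \<open>h\<close>:
      here for the transported test function, below for \<open>- r * G\<close>, which removes the
      mean of \<open>G\<close> at the price of the factor \<open>1 / r\<close>.\<close>
    have "(LINT x|\<mu>. g (\<Psi> x) + G x) \<le> h + ln (LINT x|\<nu>. exp (g (\<Psi> x) + G x))"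
      by (rule donsker_varadhan_le[OF P sets _ b1]) (auto simp: h)
    also have "ln (LINT x|\<nu>. exp (g (\<Psi> x) + G x)) \<le> ln (LINT x|\<nu>. exp (g x))"
      using push[of g, OF _ gb] exp_bounded_integrable(3)[OF P(2) _ b1] exp_bounded_integrable(3)[OF P(2) _ gb]
      by (subst ln_le_cancel_iff) auto
    finally have 1: "(LINT x|\<mu>. g (\<Psi> x) + G x) \<le> h + ln (LINT x|\<nu>. exp (g x))" by simp
    have "(LINT x|\<mu>. - r * G x) \<le> h + ln (LINT x|\<nu>. exp (- r * G x))"
      by (rule donsker_varadhan_le[OF P sets _ b2]) (auto simp: h)
    also have "ln (LINT x|\<nu>. exp (- r * G x)) \<le> ln (exp C)"
      using mom exp_bounded_integrable(3)[OF P(2) _ b2] by (subst ln_le_cancel_iff) auto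
    finally have "- r * (LINT x|\<mu>. G x) \<le> h + C" by simp
    then have 2: "- (LINT x|\<mu>. G x) \<le> (h + C) / r" using r by (simp add: field_simps)
    have int: "integrable \<mu> (\<lambda>x. g (\<Psi> x))" "integrable \<mu> G"
      by (rule exp_bounded_integrable(2)[OF P(1) _ gb], measurable)
         (rule exp_bounded_integrable(2)[OF P(1) _ Gb], measurable)
    have "(LINT x|distr \<mu> N (R \<circ> \<Psi>). f x) = (LINT x|\<mu>. g (\<Psi> x))" by (subst integral_distr) (auto simp: g_def)
    also have "... \<le> ((1 + 1 / r) * h + C / r) + ln (LINT x|\<nu>. exp (g x))"
      using 1 2 int by (simp add: algebra_simps add_divide_distrib)
    also have "(LINT x|\<nu>. exp (g x)) = (LINT x|distr \<nu> N R. exp (f x))" by (subst integral_distr) (auto simp: g_def)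
    finally show "(LINT x|distr \<mu> N (R \<circ> \<Psi>). f x) \<le> ((1 + 1 / r) * h + C / r) + ln (LINT x|distr \<nu> N R. exp (f x))" .
  qed
  then show ?thesis by (simp add: h)
qed

section \<open>A substitution inequality for perturbations of the identity\<close>

text \<open>The difference of the distribution functions is nondecreasing and right-continuous,
  hence belongs to a measure \<open>K\<close>. Then \<open>N\<close> is the sum of \<open>M\<close>
  and \<open>K\<close> on intervals, and by Dynkin's theorem on all Borel sets.\<close>

lemma emeasure_le_of_intervals:
  fixes M N :: "real measure"
  assumes M: "finite_borel_measure M" and N: "finite_borel_measure N"
    and le: "\<And>a b. a < b \<Longrightarrow> emeasure M {a<..b} \<le> emeasure N {a<..b}"
    and A: "A \<in> sets borel"
  shows "emeasure M A \<le> emeasure N A"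
proof -
  interpret M: finite_borel_measure M by fact
  interpret N: finite_borel_measure N by fact
  define F where "F x = cdf N x - cdf M x" for x
  have diff: "F b - F a = measure N {a<..b} - measure M {a<..b}" if "a < b" for a b
    using M.cdf_diff_eq[OF that] N.cdf_diff_eq[OF that] by (simp add: F_def)
  have mle: "measure M {a<..b} \<le> measure N {a<..b}" if "a < b" for a b
    using le[OF that] by (simp add: M.emeasure_eq_measure N.emeasure_eq_measure)
  have mono: "F a \<le> F b" if "a \<le> b" for a b using diff[of a b] mle[of a b] that by (cases "a = b") auto
  define K where "K = interval_measure F"
  have cont: "continuous (at_right a) F" for a
    unfolding F_def by (intro continuous_diff M.cdf_is_right_cont N.cdf_is_right_cont)
  have sets_K [simp, measurable_cong]: "sets K = sets borel" and space_K [simp]: "space K = UNIV"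
    by (simp_all add: K_def)
  have K: "emeasure K {a<..b} = ennreal (F b - F a)" if "a \<le> b" for a b
    unfolding K_def by (rule emeasure_interval_measure_Ioc[OF that mono cont])
  have eqI: "emeasure N {a<..b} = emeasure M {a<..b} + emeasure K {a<..b}" for a b
  proof (cases "a < b")
    case True
    then have "emeasure M {a<..b} + emeasure K {a<..b} = ennreal (measure M {a<..b} + (F b - F a))"
      using mono[of a b] by (simp add: K M.emeasure_eq_measure)
    then show ?thesis using diff[OF True] by (simp add: N.emeasure_eq_measure)
  qed simp
  \<comment> \<open>Complements in the Dynkin induction need additivity on the whole line, obtained
    by exhausting it with intervals.\<close>
  have eqU: "emeasure N UNIV = emeasure M UNIV + emeasure K UNIV"
  proof -
    have U: "(\<Union>n. {- real n<..real n}) = UNIV"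
    proof (intro equalityI subsetI UNIV_I)
      fix x :: real
      obtain n :: nat where "abs x < real n" using reals_Archimedean2 by blast
      then have "x \<in> {- real n<..real n}" by (auto simp: abs_less_iff)
      then show "x \<in> (\<Union>n. {- real n<..real n})" by blast
    qed
    have inc: "incseq (\<lambda>n. {- real n<..real n})" by (auto simp: incseq_def)
    have lim: "(\<lambda>n. emeasure L {- real n<..real n}) \<longlonglongrightarrow> emeasure L UNIV" if "sets L = sets borel" for L
      using Lim_emeasure_incseq[of "\<lambda>n. {- real n<..real n}" L] inc U that by (auto simp: image_subset_iff)
    have "(\<lambda>n. emeasure N {- real n<..real n}) \<longlonglongrightarrow> emeasure M UNIV + emeasure K UNIV"
      unfolding eqI by (intro tendsto_add lim) (auto simp: M.M_is_borel)
    moreover have "(\<lambda>n. emeasure N {- real n<..real n}) \<longlonglongrightarrow> emeasure N UNIV" by (intro lim) (auto simp: N.M_is_borel)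
    ultimately show ?thesis by (rule LIMSEQ_unique[symmetric])
  qed
  have sb: "sets borel = sigma_sets UNIV (range (\<lambda>(a, b). {a <.. b::real}))"
    unfolding borel_sigma_sets_Ioc by (rule sets_measure_of) auto
  have IS: "Int_stable (range (\<lambda>(a, b). {a<..b::real}))"
  proof (rule Int_stableI)
    fix a b :: "real set" assume "a \<in> range (\<lambda>(a, b). {a<..b})" "b \<in> range (\<lambda>(a, b). {a<..b})"
    then obtain u v u' v' where "a = {u<..v}" "b = {u'<..v'}" by auto
    then have "a \<inter> b = (\<lambda>(a, b). {a<..b}) (max u u', min v v')" by auto
    then show "a \<inter> b \<in> range (\<lambda>(a, b). {a<..b})" by blast
  qed
  have sub: "range (\<lambda>(a, b). {a<..b::real}) \<subseteq> Pow UNIV" by simp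
  have "A \<in> sigma_sets UNIV (range (\<lambda>(a, b). {a<..b}))" using A sb by simp
  with IS sub have "emeasure N A = emeasure M A + emeasure K A"
  proof (induct rule: sigma_sets_induct_disjoint)
    case (compl B)
    then have B: "B \<in> sets borel" by (simp add: sb)
    have *: "emeasure L (UNIV - B) + emeasure L B = emeasure L UNIV"
      if "sets L = sets borel" for L using plus_emeasure[of "UNIV - B" L B] B that by auto
    have "emeasure N (UNIV - B) + emeasure N B = (emeasure M (UNIV - B) + emeasure K (UNIV - B)) + emeasure N B"
      using *[of M] *[of N] *[of K] compl(2) eqU
      by (simp add: M.M_is_borel N.M_is_borel) (metis add.assoc add.commute)
    moreover have "emeasure N B \<noteq> \<top>" using N.emeasure_finite by auto
    ultimately show ?case by (metis ennreal_add_diff_cancel_right infinity_ennreal_def)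
  next
    case (union B)
    then have B: "range B \<subseteq> sets borel" by (auto simp: sb)
    have *: "emeasure L (\<Union>i. B i) = (\<Sum>i. emeasure L (B i))" if "sets L = sets borel" for L
      using suminf_emeasure[of B L] B union(1) that by auto
    show ?case using union(3) by (simp add: * M.M_is_borel N.M_is_borel suminf_add)
  qed (auto simp: eqI)
  then show ?thesis by simp
qed

text \<open>Over \<open>n + 1\<close> equal pieces the increments of \<open>A\<close> telescope,
  while the local errors add up to \<open>c * (v - u)^2 / (n + 1)\<close>, which tends to 0.\<close>

lemma partition_bound:
  fixes A :: "real \<Rightarrow> real" and jj :: "real \<Rightarrow> real"
  assumes [measurable]: "jj \<in> borel_measurable borel"
    and c: "0 \<le> c" and mono: "\<And>x y. x \<le> y \<Longrightarrow> A x \<le> A y"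
    and loc: "\<And>x t. 0 \<le> t \<Longrightarrow> (\<integral>\<^sup>+u. ennreal (jj u) * indicator {x..<x + t} u \<partial>lborel) \<le> ennreal (A (x + t) - A x + c * t^2)"
    and uv: "u \<le> v"
  shows "(\<integral>\<^sup>+x. ennreal (jj x) * indicator {u..<v} x \<partial>lborel) \<le> ennreal (A v - A u)"
proof -
  have step: "(\<integral>\<^sup>+x. ennreal (jj x) * indicator {u..<u + real k * t} x \<partial>lborel)
      \<le> ennreal (A (u + real k * t) - A u + real k * (c * t^2))" if t: "0 \<le> t" for k t
  proof (induct k)
    case (Suc k)
    let ?m = "u + real k * t"
    have "(\<integral>\<^sup>+x. ennreal (jj x) * indicator {u..<u + real (Suc k) * t} x \<partial>lborel) =
      (\<integral>\<^sup>+x. ennreal (jj x) * indicator {u..<?m} x + ennreal (jj x) * indicator {?m..<?m + t} x \<partial>lborel)"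
    proof (intro nn_integral_cong)
      fix x :: real
      have ind: "indicator {a..<c} x = (indicator {a..<b} x + indicator {b..<c} x :: ennreal)"
        if "a \<le> b" "b \<le> c" for a b c :: real using that by (auto simp: indicator_def)
      have "indicator {u..<?m + t} x = (indicator {u..<?m} x + indicator {?m..<?m + t} x :: ennreal)"
        using t by (intro ind) auto
      moreover have "u + real (Suc k) * t = ?m + t" by (simp add: algebra_simps)
      ultimately show "ennreal (jj x) * indicator {u..<u + real (Suc k) * t} x =
        ennreal (jj x) * indicator {u..<?m} x + ennreal (jj x) * indicator {?m..<?m + t} x"
        by (simp only: distrib_left)
    qed
    also have "... = (\<integral>\<^sup>+x. ennreal (jj x) * indicator {u..<?m} x \<partial>lborel) +
        (\<integral>\<^sup>+x. ennreal (jj x) * indicator {?m..<?m + t} x \<partial>lborel)" by (rule nn_integral_add) auto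
    also have "... \<le> ennreal (A ?m - A u + real k * (c * t^2)) + ennreal (A (?m + t) - A ?m + c * t^2)"
      by (intro add_mono Suc loc t)
    also have "... = ennreal (A (?m + t) - A u + real (Suc k) * (c * t^2))"
    proof -
      have "0 \<le> A ?m - A u + real k * (c * t^2)" "0 \<le> A (?m + t) - A ?m + c * t^2"
        using mono[of u ?m] mono[of ?m "?m + t"] t c by (auto intro!: add_nonneg_nonneg)
      then show ?thesis by (subst ennreal_plus[symmetric]) (auto simp: algebra_simps)
    qed
    finally show ?case by (simp add: algebra_simps)
  qed simp
  have "(\<integral>\<^sup>+x. ennreal (jj x) * indicator {u..<v} x \<partial>lborel) \<le> ennreal (A v - A u + c * (v - u)^2 / real (Suc n))" for n
    using step[of "(v - u) / real (Suc n)" "Suc n"] uv by (simp del: of_nat_Suc add: power2_eq_square)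
  moreover have "(\<lambda>n. ennreal (A v - A u + c * (v - u)^2 / real (Suc n))) \<longlonglongrightarrow> ennreal (A v - A u + 0)"
    by (intro tendsto_intros tendsto_divide_0[OF tendsto_const] filterlim_compose[OF filterlim_at_top_imp_at_infinity[OF filterlim_real_sequentially] filterlim_Suc])
  ultimately show ?thesis by (intro LIMSEQ_le_const[of _ "ennreal (A v - A u)"]) auto
qed

text \<open>The lift \<open>A u = u + d (proj u)\<close> is strictly increasing because
  \<open>s < 1\<close>, and \<open>A (u + 1) = A u + 1\<close>. So the push-forward of the weight
  over one period can be compared with Lebesgue measure on the period starting at
  \<open>A 0\<close>, interval by interval, from lower bounds on the increments of
  \<open>A\<close>.\<close>

lemma circle_substitution_le:
  assumes d: "lip s d" and s: "s < 1" and j: "lip L j"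
    and incr: "\<And>x t. 0 \<le> t \<Longrightarrow> j x * t - L * t^2 \<le> t + d (x \<oplus> t) - d x"
    and g[measurable]: "g \<in> borel_measurable borel"
  shows "(\<integral>\<^sup>+x. g (x \<oplus> d x) * ennreal (j x) \<partial>leb) \<le> (\<integral>\<^sup>+x. g x \<partial>leb)"
proof -
  note [measurable] = lip_measurable[OF d] lip_measurable[OF j]
  have L: "0 \<le> L" by (rule lip_nonneg[OF j])
  define A where "A u = u + d (proj u)" for u
  define jj where "jj u = j (proj u)" for u
  have [measurable]: "jj \<in> borel_measurable borel" "A \<in> borel_measurable borel" unfolding jj_def A_def by measurable
  have A1: "A (u + 1) = A u + 1" for u
  proof -
    have "proj (u + 1) = proj u" by (simp add: proj_eq_iff)
    then show ?thesis by (simp add: A_def)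
  qed
  have strict: "A x < A y" if "x < y" for x y
  proof -
    have "\<bar>d (proj y) - d (proj x)\<bar> \<le> s * \<bar>y - x\<bar>" using lipD[OF d, of "proj x" "y - x"] by simp
    also have "... < \<bar>y - x\<bar>" using that s by simp
    finally show ?thesis using that by (simp add: A_def)
  qed
  have mono: "A x \<le> A y" if "x \<le> y" for x y using strict[of x y] that by (cases "x = y") auto
  have contA: "isCont A u" for u unfolding A_def by (intro continuous_intros lip_isCont[OF d])
  have loc: "(\<integral>\<^sup>+u. ennreal (jj u) * indicator {x..<x + t} u \<partial>lborel) \<le> ennreal (A (x + t) - A x + 2 * L * t^2)"
    if t: "0 \<le> t" for x t
  proof -
    \<comment> \<open>\<open>ennreal\<close> cuts off negative values of the weight, hence the
      positive part; the case \<open>jj x < 0\<close> is covered by the monotonicity of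
      \<open>A\<close>.\<close>
    have "jj u \<le> max 0 (jj x) + L * t" if u: "u \<in> {x..<x + t}" for u
    proof -
      have "\<bar>jj u - jj x\<bar> \<le> L * \<bar>u - x\<bar>" using lipD[OF j, of "proj x" "u - x"] by (simp add: jj_def)
      also have "... \<le> L * t" using u L by (intro mult_left_mono) auto
      finally show ?thesis by linarith
    qed
    then have "(\<integral>\<^sup>+u. ennreal (jj u) * indicator {x..<x + t} u \<partial>lborel)
        \<le> (\<integral>\<^sup>+u. ennreal (max 0 (jj x) + L * t) * indicator {x..<x + t} u \<partial>lborel)"
      by (intro nn_integral_mono) (auto simp: indicator_def intro!: ennreal_leI)
    also have "... = ennreal (max 0 (jj x) + L * t) * ennreal t" using t by (subst nn_integral_cmult_indicator) auto
    also have "... = ennreal ((max 0 (jj x) + L * t) * t)" using t L by (subst ennreal_mult[symmetric]) auto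
    also have "... \<le> ennreal (A (x + t) - A x + 2 * L * t^2)"
    proof (rule ennreal_leI)
      have "jj x * t - L * t^2 \<le> A (x + t) - A x" using incr[OF t, of "proj x"] by (simp add: A_def jj_def)
      moreover have "0 \<le> A (x + t) - A x" using mono[of x "x + t"] t by simp
      moreover have "0 \<le> L * t^2" using L by simp
      ultimately have "max 0 (jj x) * t \<le> A (x + t) - A x + L * t^2" by (cases "0 \<le> jj x") (auto simp: max_def)
      then show "(max 0 (jj x) + L * t) * t \<le> A (x + t) - A x + 2 * L * t^2"
        by (simp add: algebra_simps power2_eq_square)
    qed
    finally show ?thesis .
  qed
  have bound: "(\<integral>\<^sup>+x. ennreal (jj x) * indicator {u..<v} x \<partial>lborel) \<le> ennreal (A v - A u)" if "u \<le> v" for u v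
    by (rule partition_bound[where c = "2 * L", OF _ _ mono loc that]) (use L in auto)
  define M where "M = distr (density lborel (\<lambda>u. ennreal (jj u) * indicator {0..<1} u)) borel A"
  define N where "N = density lborel (indicator {A 0..<A 0 + 1} :: real \<Rightarrow> ennreal)"
  have [simp, measurable_cong]: "sets M = sets borel" "sets N = sets borel" by (simp_all add: M_def N_def)
  have Meq: "(\<integral>\<^sup>+y. f y \<partial>M) = (\<integral>\<^sup>+u. f (A u) * (ennreal (jj u) * indicator {0..<1} u) \<partial>lborel)"
    if [measurable]: "f \<in> borel_measurable borel" for f
    unfolding M_def by (simp add: nn_integral_distr nn_integral_density mult.commute)
  have Neq: "(\<integral>\<^sup>+y. f y \<partial>N) = (\<integral>\<^sup>+y. f y * indicator {A 0..<A 0 + 1} y \<partial>lborel)"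
    if [measurable]: "f \<in> borel_measurable borel" for f
    unfolding N_def by (simp add: nn_integral_density mult.commute)
  have Mem: "emeasure M X = (\<integral>\<^sup>+u. indicator X (A u) * (ennreal (jj u) * indicator {0..<1} u) \<partial>lborel)"
    if "X \<in> sets borel" for X using Meq[of "indicator X"] that by simp
  have Nem: "emeasure N X = (\<integral>\<^sup>+y. indicator X y * indicator {A 0..<A 0 + 1} y \<partial>lborel)"
    if "X \<in> sets borel" for X using Neq[of "indicator X"] that by simp
  have A01: "A 1 = A 0 + 1" using A1[of 0] by simp
  have "M \<le> N"
  proof (rule le_measure[THEN iffD2], simp, intro ballI)
    fix X assume "X \<in> sets M"
    then have X: "X \<in> sets borel" by simp
    show "emeasure M X \<le> emeasure N X"
    proof (rule emeasure_le_of_intervals[OF _ _ _ X])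
      have "emeasure M UNIV \<le> (\<integral>\<^sup>+u. ennreal (jj u) * indicator {0..<1} u \<partial>lborel)" by (subst Mem) auto
      also have "... \<le> ennreal (A 1 - A 0)" by (rule bound) simp
      also have "... < \<infinity>" by simp
      finally have "emeasure M (space M) < \<infinity>" using sets_eq_imp_space_eq[of M borel] by simp
      then show "finite_borel_measure M"
        by (intro finite_borel_measure.intro finite_measureI) (auto simp: finite_borel_measure_axioms_def)
      have "emeasure N UNIV = emeasure lborel {A 0..<A 0 + 1}" by (subst Nem) auto
      then have "emeasure N (space N) < \<infinity>" by (simp add: N_def)
      then show "finite_borel_measure N"
        by (intro finite_borel_measure.intro finite_measureI) (auto simp: finite_borel_measure_axioms_def)
      fix a b :: real assume "a < b"
      define a' b' where "a' = max a (A 0)" and "b' = min b (A 1)"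
      show "emeasure M {a<..b} \<le> emeasure N {a<..b}"
      proof (cases "a' \<le> b'")
        case True
        \<comment> \<open>After clipping to the range of \<open>A\<close> over the period, both
          endpoints of the interval are values of \<open>A\<close>.\<close>
        have "\<exists>u\<ge>0. u \<le> 1 \<and> A u = y" if "A 0 \<le> y" "y \<le> A 1" for y by (rule IVT) (use that contA in auto)
        moreover have "A 0 \<le> a'" "a' \<le> A 1" "A 0 \<le> b'" "b' \<le> A 1" using True by (auto simp: a'_def b'_def)
        ultimately obtain u v where u: "0 \<le> u" "u \<le> 1" "A u = a'" and v: "0 \<le> v" "v \<le> 1" "A v = b'" by metis
        have uv: "u \<le> v" using True u v strict[of v u] by force
        have "emeasure M {a<..b} = (\<integral>\<^sup>+x. indicator {a<..b} (A x) * (ennreal (jj x) * indicator {0..<1} x) \<partial>lborel)"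
          by (subst Mem) auto
        also have "... \<le> (\<integral>\<^sup>+x. ennreal (jj x) * indicator {u..<v} x \<partial>lborel)"
        proof (rule nn_integral_mono_AE)
          show "AE x in lborel. indicator {a<..b} (A x) * (ennreal (jj x) * indicator {0..<1} x) \<le> ennreal (jj x) * indicator {u..<v} x"
            \<comment> \<open>The interval in the image contains \<open>A v\<close> while the one in
              the domain excludes \<open>v\<close>; a single point has measure 0.\<close>
            using AE_lborel_singleton[of v]
          proof eventually_elim
            case (elim x)
            have "x \<in> {u..<v}" if "a < A x" "A x \<le> b" "0 \<le> x" "x < 1"
            proof -
              have "a' \<le> A x" using that mono[of 0 x] by (simp add: a'_def)
              then have "u \<le> x" using strict[of x u] u by force
              moreover have "A x \<le> b'" using that mono[of x 1] by (simp add: b'_def)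
              then have "x \<le> v" using strict[of v x] v by force
              ultimately show ?thesis using elim by auto
            qed
            then show ?case by (auto simp: indicator_def)
          qed
        qed
        also have "... \<le> ennreal (b' - a')" using bound[OF uv] u v by simp
        also have "... = emeasure lborel {a'<..<b'}" using True by simp
        also have "... = (\<integral>\<^sup>+y. indicator {a'<..<b'} y \<partial>lborel)" by (rule nn_integral_indicator[symmetric]) simp
        also have "... \<le> (\<integral>\<^sup>+y. indicator {a<..b} y * indicator {A 0..<A 0 + 1} y \<partial>lborel)"
          by (intro nn_integral_mono) (auto simp: indicator_def a'_def b'_def A01)
        also have "... = emeasure N {a<..b}" by (subst Nem) auto
        finally show ?thesis .
      next
        case False
        have "emeasure M {a<..b} = (\<integral>\<^sup>+x. indicator {a<..b} (A x) * (ennreal (jj x) * indicator {0..<1} x) \<partial>lborel)"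
          by (subst Mem) auto
        also have "... = (\<integral>\<^sup>+x. 0 \<partial>(lborel :: real measure))"
        proof (intro nn_integral_cong)
          fix x
          have "\<not> (a < A x \<and> A x \<le> b \<and> 0 \<le> x \<and> x < 1)"
            using False mono[of 0 x] mono[of x 1] by (auto simp: a'_def b'_def)
          then show "indicator {a<..b} (A x) * (ennreal (jj x) * indicator {0..<1} x) = 0"
            by (auto simp: indicator_def)
        qed
        finally show ?thesis by simp
      qed
    qed
  qed
  have "(\<integral>\<^sup>+x. g (x \<oplus> d x) * ennreal (j x) \<partial>leb) = (\<integral>\<^sup>+y. g (proj y) \<partial>M)"
    by (subst nn_integral_leb, measurable, subst Meq) (auto simp: A_def jj_def mult.assoc)
  also have "... \<le> (\<integral>\<^sup>+y. g (proj y) \<partial>N)" by (rule nn_integral_mono_measure) (use \<open>M \<le> N\<close> in auto)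
  also have "... = (\<integral>\<^sup>+y. g (proj y) * indicator {0..<1} y \<partial>lborel)"
    by (subst Neq, measurable, rule nn_integral_periodic_shift) (auto intro!: arg_cong[of _ _ g] simp: proj_eq_iff)
  also have "... = (\<integral>\<^sup>+x. g x \<partial>leb)" by (simp add: nn_integral_leb)
  finally show ?thesis .
qed

section \<open>Inverting a small perturbation of the identity\<close>

definition inv_shift :: "(torus \<Rightarrow> real) \<Rightarrow> torus \<Rightarrow> real"
  where "inv_shift d y = (THE r. r + d (y \<oplus> r) = 0)"

text \<open>The equation says that \<open>y \<oplus> r\<close> is the point which
  \<open>x \<mapsto> x \<oplus> d x\<close> sends to \<open>y\<close>. The distance of two solutions
  would be at most \<open>s\<close> times itself.\<close>

lemma inv_shift_unique:
  assumes d: "lip s d" and s: "s < 1" and "r + d (y \<oplus> r) = 0"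
  shows "inv_shift d y = r"
  unfolding inv_shift_def
proof (rule the_equality)
  fix r' assume r': "r' + d (y \<oplus> r') = 0"
  have "\<bar>d (y \<oplus> r') - d (y \<oplus> r)\<bar> \<le> s * \<bar>r' - r\<bar>" using lipD[OF d, of "y \<oplus> r" "r' - r"] by (simp add: torus_add_add)
  moreover have "d (y \<oplus> r') - d (y \<oplus> r) = - (r' - r)" using r' assms(3) by simp
  ultimately have "\<bar>r' - r\<bar> \<le> s * \<bar>r' - r\<bar>" by simp
  moreover have "s * \<bar>r' - r\<bar> < \<bar>r' - r\<bar>" if "r' \<noteq> r" using s that by simp
  ultimately show "r' = r" by (rule_tac ccontr) auto
qed fact

text \<open>As \<open>d\<close> oscillates by at most \<open>s\<close>, it is bounded by
  \<open>B\<close>, and \<open>r + d (y \<oplus> r)\<close> changes sign on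
  \<open>[- B, B]\<close>.\<close>

lemma inv_shift_eq:
  assumes d: "lip s d" and s: "s < 1"
  shows "inv_shift d y + d (y \<oplus> inv_shift d y) = 0"
proof -
  define B where "B = \<bar>d y\<bar> + s"
  have B: "\<bar>d (y \<oplus> r)\<bar> \<le> B" for r using lip_oscillation[OF d, of "y \<oplus> r" y] by (simp add: B_def)
  have "B \<ge> 0" using B[of 0] by linarith
  have "\<exists>r\<ge>- B. r \<le> B \<and> r + d (y \<oplus> r) = 0"
  proof (rule IVT)
    show "- B + d (y \<oplus> - B) \<le> 0" "0 \<le> B + d (y \<oplus> B)" using B[of B] B[of "- B"] by linarith+
    have "isCont (\<lambda>r. r + d (proj (crep y + r))) x" for x
      by (intro continuous_intros continuous_within_compose3[OF lip_isCont[OF d]])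
    moreover have "proj (crep y + r) = y \<oplus> r" for r by (metis proj_crep torus_add_proj)
    ultimately show "\<forall>x. - B \<le> x \<and> x \<le> B \<longrightarrow> isCont (\<lambda>r. r + d (y \<oplus> r)) x" by simp
  qed (use \<open>B \<ge> 0\<close> in simp)
  then obtain r where "r + d (y \<oplus> r) = 0" by blast
  with inv_shift_unique[OF d s this] show ?thesis by simp
qed

lemma inv_shift_shift: "lip s d \<Longrightarrow> s < 1 \<Longrightarrow> inv_shift d (x \<oplus> d x) = - d x"
  by (rule inv_shift_unique) auto

text \<open>\<open>r + d (y \<oplus> r)\<close> is strictly increasing in \<open>r\<close>. Sublevel
  sets of the implicitly defined inverse thus become explicit, which is how its measurability in
  further variables is obtained.\<close>

lemma inv_shift_less_iff:
  assumes d: "lip s d" and s: "s < 1"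
  shows "inv_shift d y < c \<longleftrightarrow> 0 < c + d (y \<oplus> c)"
proof -
  let ?r = "inv_shift d y"
  have le: "\<bar>d (y \<oplus> c) - d (y \<oplus> ?r)\<bar> \<le> s * \<bar>c - ?r\<bar>"
    using lipD[OF d, of "y \<oplus> ?r" "c - ?r"] by (simp add: torus_add_add)
  have r: "?r + d (y \<oplus> ?r) = 0" by (rule inv_shift_eq[OF d s])
  show ?thesis
  proof (cases "c = ?r")
    case False
    then have "s * \<bar>c - ?r\<bar> < \<bar>c - ?r\<bar>" using s by simp
    then show ?thesis using le r by linarith
  qed (use r in simp)
qed

text \<open>The displacement \<open>\<tau>\<close> of the preimage is tied to \<open>t\<close> by an
  equation for the forward map, so expansions of \<open>d\<close> can be inverted.\<close>

lemma inv_shift_increment: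
  assumes d: "lip s d" and s: "s < 1"
  defines "X \<equiv> \<lambda>y. y \<oplus> inv_shift d y"
  obtains \<tau> where "\<tau> = t + inv_shift d (y \<oplus> t) - inv_shift d y" "X (y \<oplus> t) = X y \<oplus> \<tau>"
    "\<tau> + d (X y \<oplus> \<tau>) - d (X y) = t"
proof
  let ?\<tau> = "t + inv_shift d (y \<oplus> t) - inv_shift d y"
  show X: "X (y \<oplus> t) = X y \<oplus> ?\<tau>" by (simp add: X_def torus_add_add)
  show "?\<tau> + d (X y \<oplus> ?\<tau>) - d (X y) = t"
    using inv_shift_eq[OF d s, of y] inv_shift_eq[OF d s, of "y \<oplus> t"] unfolding X[symmetric] by (simp add: X_def)
qed simp

section \<open>Gaussian elimination for maps of product spaces\<close>

abbreviation iid :: "nat \<Rightarrow> 'a measure \<Rightarrow> (nat \<Rightarrow> 'a) measure"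
  where "iid n M \<equiv> PiM {..<n} (\<lambda>_. M)"

abbreviation torus_pow :: "nat \<Rightarrow> (nat \<Rightarrow> torus) measure"
  where "torus_pow n \<equiv> iid n borel"

lemma sets_PiM_leb [measurable_cong]: "sets (PiM I (\<lambda>_. leb)) = sets (PiM I (\<lambda>_. borel))"
  by (intro sets_PiM_cong) auto

lemma measurable_upd_last [measurable]:
  "(\<lambda>x. x(n := y)) \<in> measurable (torus_pow n) (torus_pow (Suc n))"
  by (rule measurable_fun_upd[of _ "{..<n}"]) auto

lemma measurable_upd_point [measurable]:
  assumes "x \<in> space (torus_pow n)"
  shows "(\<lambda>y. x(n := y)) \<in> measurable borel (torus_pow (Suc n))"
  by (rule measurable_fun_upd[of _ "{..<n}"]) (use assms in auto)

lemma measurable_torus_pow_restrict: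
  assumes "\<And>i. i < n \<Longrightarrow> f i \<in> measurable M borel"
  shows "(\<lambda>x. \<lambda>i\<in>{..<n}. f i x) \<in> measurable M (torus_pow n)"
  using assms by (intro measurable_restrict) auto

text \<open>A Jacobian matrix without derivatives. For the map with components
  \<open>x i \<oplus> d i x\<close>, \<open>s\<close> bounds the diagonal and \<open>b\<close> the
  off-diagonal entries of the derivative of \<open>d\<close>; \<open>j i\<close> is a lower bound
  for the diagonal entry of the whole map, Lipschitz with constant \<open>L\<close> and valid up to
  the quadratic slack \<open>L * t^2\<close>.\<close>

definition near_id ::
  "nat \<Rightarrow> real \<Rightarrow> real \<Rightarrow> real \<Rightarrow> (nat \<Rightarrow> (nat \<Rightarrow> torus) \<Rightarrow> real) \<Rightarrow> (nat \<Rightarrow> (nat \<Rightarrow> torus) \<Rightarrow> real) \<Rightarrow> bool"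
  where "near_id n s b L d j \<longleftrightarrow> (\<forall>i<n.
    d i \<in> borel_measurable (torus_pow n) \<and> j i \<in> borel_measurable (torus_pow n) \<and>
    (\<forall>x t. \<bar>d i (x(i := x i \<oplus> t)) - d i x\<bar> \<le> s * abs t) \<and>
    (\<forall>x t. 0 \<le> t \<longrightarrow> j i x * t - L * t^2 \<le> t + d i (x(i := x i \<oplus> t)) - d i x) \<and>
    (\<forall>k<n. \<forall>x t. k \<noteq> i \<longrightarrow> \<bar>d i (x(k := x k \<oplus> t)) - d i x\<bar> \<le> b * abs t) \<and>
    (\<forall>k<n. \<forall>x t. \<bar>j i (x(k := x k \<oplus> t)) - j i x\<bar> \<le> L * abs t))"

lemma near_idD:
  assumes "near_id n s b L d j" "i < n"
  shows "d i \<in> borel_measurable (torus_pow n)" "j i \<in> borel_measurable (torus_pow n)"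
    "\<And>x t. \<bar>d i (x(i := x i \<oplus> t)) - d i x\<bar> \<le> s * abs t"
    "\<And>x t. 0 \<le> t \<Longrightarrow> j i x * t - L * t^2 \<le> t + d i (x(i := x i \<oplus> t)) - d i x"
    "\<And>k x t. k < n \<Longrightarrow> k \<noteq> i \<Longrightarrow> \<bar>d i (x(k := x k \<oplus> t)) - d i x\<bar> \<le> b * abs t"
    "\<And>k x t. k < n \<Longrightarrow> \<bar>j i (x(k := x k \<oplus> t)) - j i x\<bar> \<le> L * abs t"
  using assms unfolding near_id_def by blast+

text \<open>Solving \<open>y = z n \<oplus> d n z\<close> for the last coordinate.\<close>

definition elim_last :: "nat \<Rightarrow> ((nat \<Rightarrow> torus) \<Rightarrow> real) \<Rightarrow> (nat \<Rightarrow> torus) \<Rightarrow> (nat \<Rightarrow> torus)"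
  where "elim_last n dn z = z(n := z n \<oplus> inv_shift (\<lambda>u. dn (z(n := u))) (z n))"

context
  fixes n s b L d j
  assumes N: "near_id (Suc n) s b L d j" and s: "s \<le> 1 / 2" and b: "0 \<le> b"
begin

lemma slice_lip: "lip s (\<lambda>u. d n (z(n := u)))"
  unfolding lip_def using near_idD(3)[OF N, of n "z(n := _)"] by simp

lemma slice_j_lip: "lip L (\<lambda>u. j n (z(n := u)))"
  unfolding lip_def using near_idD(6)[OF N, of n n "z(n := _)"] by simp

lemma L_nonneg: "0 \<le> L" by (rule lip_nonneg[OF slice_j_lip])

lemma elim_last_inverse: "elim_last n (d n) (z(n := z n \<oplus> d n z)) = z"
  using inv_shift_shift[OF slice_lip[of z], of "z n"] s by (simp add: elim_last_def)

lemma elim_last_measurable [measurable]: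
  "elim_last n (d n) \<in> measurable (torus_pow (Suc n)) (torus_pow (Suc n))"
proof -
  have dn[measurable]: "d n \<in> borel_measurable (torus_pow (Suc n))" using near_idD(1)[OF N] by simp
  have upd[measurable]: "(\<lambda>z. z(n := z n \<oplus> c)) \<in> measurable (torus_pow (Suc n)) (torus_pow (Suc n))" for c
    by (rule measurable_fun_upd[of _ "{..<Suc n}"]) (auto intro!: measurable_torus_add)
  have "(\<lambda>z. inv_shift (\<lambda>u. d n (z(n := u))) (z n)) \<in> borel_measurable (torus_pow (Suc n))"
    unfolding borel_measurable_iff_less
  proof
    fix c
    have "{z \<in> space (torus_pow (Suc n)). inv_shift (\<lambda>u. d n (z(n := u))) (z n) < c} =
      {z \<in> space (torus_pow (Suc n)). 0 < c + d n (z(n := z n \<oplus> c))}"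
      using inv_shift_less_iff[OF slice_lip, where c = c] s by auto
    also have "... \<in> sets (torus_pow (Suc n))" by measurable
    finally show "{z \<in> space (torus_pow (Suc n)). inv_shift (\<lambda>u. d n (z(n := u))) (z n) < c} \<in> sets (torus_pow (Suc n))" .
  qed
  then show ?thesis unfolding elim_last_def
    by (intro measurable_fun_upd[of _ "{..<Suc n}"]) (auto intro!: measurable_torus_add)
qed

text \<open>Moving coordinate \<open>k\<close> by \<open>t\<close> perturbs the last equation by at
  most \<open>b * abs t\<close>; the contraction factor \<open>s \<le> 1 / 2\<close> at most doubles
  this in its solution.\<close>

lemma elim_last_shift:
  assumes "k < n"
  obtains \<tau> where "abs \<tau> \<le> 2 * b * abs t"
    "elim_last n (d n) (z(k := z k \<oplus> t)) =
      (let w = (elim_last n (d n) z)(k := elim_last n (d n) z k \<oplus> t) in w(n := w n \<oplus> \<tau>))"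
proof
  let ?D = "\<lambda>u. d n (z(n := u))" and ?D' = "\<lambda>u. d n ((z(k := z k \<oplus> t))(n := u))"
  let ?e = "inv_shift ?D (z n)" and ?e' = "inv_shift ?D' (z n)"
  have e: "?e + ?D (z n \<oplus> ?e) = 0" by (rule inv_shift_eq[OF slice_lip]) (use s in simp)
  have e': "?e' + ?D' (z n \<oplus> ?e') = 0" by (rule inv_shift_eq[OF slice_lip]) (use s in simp)
  have DD: "\<bar>?D' u - ?D u\<bar> \<le> b * abs t" for u
    using near_idD(5)[OF N, of n k "z(n := u)" t] assms by (simp add: fun_upd_twist)
  have "\<bar>?D (z n \<oplus> ?e') - ?D (z n \<oplus> ?e)\<bar> \<le> s * \<bar>?e' - ?e\<bar>"
    using lipD[OF slice_lip, of z "z n \<oplus> ?e" "?e' - ?e"] by (simp add: torus_add_add)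
  also have "... \<le> 1 / 2 * \<bar>?e' - ?e\<bar>" using s by (intro mult_right_mono) auto
  finally have "\<bar>?D (z n \<oplus> ?e') - ?D (z n \<oplus> ?e)\<bar> \<le> 1 / 2 * \<bar>?e' - ?e\<bar>" .
  moreover have "\<bar>v - u\<bar> \<le> 2 * B" if "u + p = 0" "v + q = 0" "\<bar>q - r\<bar> \<le> B" "\<bar>r - p\<bar> \<le> 1 / 2 * \<bar>v - u\<bar>"
    for u v p q r B :: real
  proof -
    have "v - u = (r - q) + (p - r)" using that by linarith
    then have "\<bar>v - u\<bar> \<le> \<bar>r - q\<bar> + \<bar>p - r\<bar>" using abs_triangle_ineq by metis
    then show ?thesis using that(3,4) abs_minus_commute[of q r] abs_minus_commute[of r p] by simp
  qed
  ultimately show "\<bar>?e' - ?e\<bar> \<le> 2 * b * abs t" using e e' DD[of "z n \<oplus> ?e'"] unfolding mult.assoc by blast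
  show "elim_last n (d n) (z(k := z k \<oplus> t)) =
      (let w = (elim_last n (d n) z)(k := elim_last n (d n) z k \<oplus> t) in w(n := w n \<oplus> (?e' - ?e)))"
    using assms by (simp add: elim_last_def Let_def torus_add_add fun_upd_twist)
qed

text \<open>A Schur complement. The last coordinate reacts to coordinate \<open>k\<close> with slope
  at most \<open>2 * b\<close> and acts on coordinate \<open>i\<close> with slope at most
  \<open>b\<close>, so every slope changes by at most \<open>2 * b^2\<close>; subtracting \<gamma>
  keeps \<open>j\<close> a lower bound.\<close>

lemma near_id_elim:
  assumes s': "s + 2 * b^2 \<le> s'" and b': "b + 2 * b^2 \<le> b'" and \<gamma>: "2 * b^2 \<le> \<gamma>"
  shows "near_id n s' b' (L * (1 + 2 * b))
    (\<lambda>i x. d i (elim_last n (d n) (x(n := y)))) (\<lambda>i x. j i (elim_last n (d n) (x(n := y))) - \<gamma>)"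
  unfolding near_id_def
proof (intro allI impI conjI)
  let ?X = "elim_last n (d n)"
  fix i assume i: "i < n"
  then have i': "i < Suc n" "i \<noteq> n" by auto
  note [measurable] = near_idD(1,2)[OF N i'(1)]
  show "(\<lambda>x. d i (?X (x(n := y)))) \<in> borel_measurable (torus_pow n)"
    "(\<lambda>x. j i (?X (x(n := y))) - \<gamma>) \<in> borel_measurable (torus_pow n)" by measurable
  have shift: "\<exists>\<tau> W. W = (?X (x(n := y)))(k := ?X (x(n := y)) k \<oplus> t) \<and> \<bar>\<tau>\<bar> \<le> 2 * b * abs t \<and>
    ?X ((x(k := x k \<oplus> t))(n := y)) = W(n := W n \<oplus> \<tau>)" if k: "k < n" for k x t
  proof -
    obtain \<tau> where "abs \<tau> \<le> 2 * b * abs t"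
      "?X ((x(n := y))(k := (x(n := y)) k \<oplus> t)) =
      (let w = (?X (x(n := y)))(k := ?X (x(n := y)) k \<oplus> t) in w(n := w n \<oplus> \<tau>))" by (rule elim_last_shift[OF k])
    moreover have "(x(n := y))(k := (x(n := y)) k \<oplus> t) = (x(k := x k \<oplus> t))(n := y)"
      using k by (auto simp: fun_upd_twist)
    ultimately show ?thesis by (auto simp: Let_def)
  qed
  have last: "\<bar>d i (W(n := W n \<oplus> \<tau>)) - d i W\<bar> \<le> 2 * b^2 * abs t" if "abs \<tau> \<le> 2 * b * abs t" for W \<tau> t
  proof -
    have "\<bar>d i (W(n := W n \<oplus> \<tau>)) - d i W\<bar> \<le> b * abs \<tau>" using near_idD(5)[OF N i'(1), of n] i by simp
    also have "... \<le> b * (2 * b * abs t)" using that b by (intro mult_left_mono) auto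
    finally show ?thesis by (simp add: power2_eq_square)
  qed
  {
    fix x t
    obtain \<tau> W where W: "W = (?X (x(n := y)))(i := ?X (x(n := y)) i \<oplus> t)" "abs \<tau> \<le> 2 * b * abs t"
      "?X ((x(i := x i \<oplus> t))(n := y)) = W(n := W n \<oplus> \<tau>)" using shift[OF i] by blast
    note l = last[OF W(2), of W]
    have "\<bar>d i W - d i (?X (x(n := y)))\<bar> \<le> s * abs t" unfolding W(1) by (rule near_idD(3)[OF N i'(1)])
    with l have "\<bar>d i (?X ((x(i := x i \<oplus> t))(n := y))) - d i (?X (x(n := y)))\<bar> \<le> (s + 2 * b^2) * abs t"
      unfolding W(3) by (simp add: distrib_right abs_le_iff)
    also have "... \<le> s' * abs t" using s' by (intro mult_right_mono) auto
    finally show "\<bar>d i (?X ((x(i := x i \<oplus> t))(n := y))) - d i (?X (x(n := y)))\<bar> \<le> s' * abs t" .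
    assume t: "0 \<le> t"
    have "j i (?X (x(n := y))) * t - L * t^2 \<le> t + d i W - d i (?X (x(n := y)))"
      unfolding W(1) by (rule near_idD(4)[OF N i'(1) t])
    moreover have "2 * b^2 * t \<le> \<gamma> * t" using \<gamma> t by (intro mult_right_mono)
    moreover have "L * t^2 \<le> L * (1 + 2 * b) * t^2" using b L_nonneg by (intro mult_right_mono) (auto simp: mult_le_cancel_left1)
    ultimately show "(j i (?X (x(n := y))) - \<gamma>) * t - L * (1 + 2 * b) * t^2 \<le>
        t + d i (?X ((x(i := x i \<oplus> t))(n := y))) - d i (?X (x(n := y)))"
      using l t unfolding W(3) by (simp add: left_diff_distrib abs_le_iff)
  }
  fix k x t assume k: "k < n"
  obtain \<tau> W where W: "W = (?X (x(n := y)))(k := ?X (x(n := y)) k \<oplus> t)" "abs \<tau> \<le> 2 * b * abs t"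
    "?X ((x(k := x k \<oplus> t))(n := y)) = W(n := W n \<oplus> \<tau>)" using shift[OF k] by blast
  have "\<bar>j i (W(n := W n \<oplus> \<tau>)) - j i W\<bar> \<le> L * abs \<tau>" using near_idD(6)[OF N i'(1), of n] by simp
  also have "... \<le> L * (2 * b * abs t)" using W(2) L_nonneg by (intro mult_left_mono)
  finally have "\<bar>j i (W(n := W n \<oplus> \<tau>)) - j i W\<bar> \<le> L * (2 * b * abs t)" .
  moreover have "\<bar>j i W - j i (?X (x(n := y)))\<bar> \<le> L * abs t"
    unfolding W(1) by (rule near_idD(6)[OF N i'(1)]) (use k in simp)
  ultimately show "\<bar>j i (?X ((x(k := x k \<oplus> t))(n := y))) - \<gamma> - (j i (?X (x(n := y))) - \<gamma>)\<bar> \<le> L * (1 + 2 * b) * abs t"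
    unfolding W(3) by (simp add: algebra_simps abs_le_iff)
  assume "k \<noteq> i"
  then have "\<bar>d i W - d i (?X (x(n := y)))\<bar> \<le> b * abs t"
    unfolding W(1) using k by (intro near_idD(5)[OF N i'(1)]) auto
  with last[OF W(2), of W] have "\<bar>d i (?X ((x(k := x k \<oplus> t))(n := y))) - d i (?X (x(n := y)))\<bar> \<le> (b + 2 * b^2) * abs t"
    unfolding W(3) by (simp add: distrib_right abs_le_iff)
  also have "... \<le> b' * abs t" using b' by (intro mult_right_mono) auto
  finally show "\<bar>d i (?X ((x(k := x k \<oplus> t))(n := y))) - d i (?X (x(n := y)))\<bar> \<le> b' * abs t" .
qed

end

interpretation leb_prod: product_sigma_finite "\<lambda>_. leb" by standard

text \<open>Integrating out the last variable first replaces the other components by perturbations of the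
  identity of the same kind: Gaussian elimination instead of a Jacobian determinant.\<close>

theorem near_id_substitution_le:
  assumes "near_id n s b L d j" "0 \<le> b" "2 * B^2 \<le> \<gamma>"
    and "s + real n * \<gamma> \<le> 1 / 2" "b + real n * \<gamma> \<le> B" "0 \<le> \<gamma>"
    and "g \<in> borel_measurable (torus_pow n)"
  shows "(\<integral>\<^sup>+x. g (\<lambda>i\<in>{..<n}. x i \<oplus> d i x) * (\<Prod>i<n. ennreal (j i x - real n * \<gamma>)) \<partial>iid n leb)
    \<le> (\<integral>\<^sup>+x. g x \<partial>iid n leb)" using assms
proof (induct n arbitrary: s b L d j g)
  case 0
  then show ?case by (simp add: PiM_empty nn_integral_count_space_finite)
next
  case (Suc n)
  note N = Suc.prems(1) and b = Suc.prems(2) and \<gamma> = Suc.prems(6)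
  note [measurable] = Suc.prems(7)
  have n\<gamma>: "0 \<le> real n * \<gamma>" using \<gamma> by simp
  have S: "real (Suc n) * \<gamma> = real n * \<gamma> + \<gamma>" by (simp add: distrib_right)
  have s: "s \<le> 1 / 2" using Suc.prems(4) n\<gamma> \<gamma> unfolding S by linarith
  have "b \<le> B" using Suc.prems(5) n\<gamma> \<gamma> unfolding S by linarith
  then have "b^2 \<le> B^2" using b by (intro power_mono)
  then have b\<gamma>: "2 * b^2 \<le> \<gamma>" using Suc.prems(3) by simp
  have [measurable]: "d i \<in> borel_measurable (torus_pow (Suc n))" "j i \<in> borel_measurable (torus_pow (Suc n))"
    if "i < Suc n" for i using near_idD(1,2)[OF N that] by auto
  note [measurable] = elim_last_measurable[OF N s b]
  let ?X = "elim_last n (d n)"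
  \<comment> \<open>The integrand after the last variable has been substituted: \<open>w\<close>
    carries the old coordinates below \<open>n\<close> and the new value in position
    \<open>n\<close>.\<close>
  define k where "k w = g (\<lambda>i\<in>{..<Suc n}. if i < n then w i \<oplus> d i (?X w) else w n) *
      (\<Prod>i<n. ennreal (j i (?X w) - real (Suc n) * \<gamma>))" for w
  have X_meas[measurable]: "(\<lambda>w. d i (?X w)) \<in> borel_measurable (torus_pow (Suc n))"
     "(\<lambda>w. j i (?X w)) \<in> borel_measurable (torus_pow (Suc n))" if "i < Suc n" for i
    using that by measurable
  have [measurable]: "(\<lambda>w. \<lambda>i\<in>{..<Suc n}. if i < n then w i \<oplus> d i (?X w) else w n) \<in> measurable (torus_pow (Suc n)) (torus_pow (Suc n))"
  proof (rule measurable_torus_pow_restrict)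
    fix i assume i: "i < Suc n"
    show "(\<lambda>w. if i < n then w i \<oplus> d i (?X w) else w n) \<in> measurable (torus_pow (Suc n)) borel"
      using i by (cases "i < n") auto
  qed
  have [measurable]: "(\<lambda>w. \<lambda>i\<in>{..<Suc n}. w i \<oplus> d i w) \<in> measurable (torus_pow (Suc n)) (torus_pow (Suc n))"
    by (rule measurable_torus_pow_restrict) auto
  have k_meas[measurable]: "k \<in> borel_measurable (torus_pow (Suc n))"
    unfolding k_def by (intro borel_measurable_times_ennreal borel_measurable_prod_ennreal) auto
  define f where "f z = g (\<lambda>i\<in>{..<Suc n}. z i \<oplus> d i z) * (\<Prod>i<Suc n. ennreal (j i z - real (Suc n) * \<gamma>))" for z
  have f_meas[measurable]: "f \<in> borel_measurable (torus_pow (Suc n))"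
    unfolding f_def by (intro borel_measurable_times_ennreal borel_measurable_prod_ennreal) auto
  have f_le: "f z \<le> k (z(n := z n \<oplus> d n z)) * ennreal (j n z)" for z
  proof -
    have inv: "?X (z(n := z n \<oplus> d n z)) = z" by (rule elim_last_inverse[OF N s b])
    have *: "(\<lambda>i\<in>{..<Suc n}. if i < n then (z(n := z n \<oplus> d n z)) i \<oplus> d i z else (z(n := z n \<oplus> d n z)) n) =
        (\<lambda>i\<in>{..<Suc n}. z i \<oplus> d i z)" by (auto simp: restrict_def fun_eq_iff less_Suc_eq)
    have "f z = k (z(n := z n \<oplus> d n z)) * ennreal (j n z - real (Suc n) * \<gamma>)"
      unfolding k_def f_def inv * by (simp add: mult.assoc)
    \<comment> \<open>The last factor is relaxed to \<open>j n z\<close>, the weight of the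
      one-dimensional substitution.\<close>
    also have "... \<le> k (z(n := z n \<oplus> d n z)) * ennreal (j n z)" using \<gamma> by (intro mult_left_mono ennreal_leI) auto
    finally show ?thesis .
  qed
  have ins: "{..<Suc n} = insert n {..<n}" by (rule lessThan_Suc)
  have int_ins: "(\<integral>\<^sup>+z. h z \<partial>iid (Suc n) leb) = (\<integral>\<^sup>+x. \<integral>\<^sup>+y. h (x(n := y)) \<partial>leb \<partial>iid n leb)"
    if [measurable]: "h \<in> borel_measurable (torus_pow (Suc n))" for h
    unfolding ins by (rule leb_prod.product_nn_integral_insert) (use that in \<open>auto simp flip: ins cong: measurable_cong_sets\<close>)
  have int_ins_rev: "(\<integral>\<^sup>+z. h z \<partial>iid (Suc n) leb) = (\<integral>\<^sup>+y. \<integral>\<^sup>+x. h (x(n := y)) \<partial>iid n leb \<partial>leb)"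
    if [measurable]: "h \<in> borel_measurable (torus_pow (Suc n))" for h
    unfolding ins by (rule leb_prod.product_nn_integral_insert_rev) (use that in \<open>auto simp flip: ins cong: measurable_cong_sets\<close>)
  have "(\<integral>\<^sup>+z. f z \<partial>iid (Suc n) leb) = (\<integral>\<^sup>+x. \<integral>\<^sup>+y. f (x(n := y)) \<partial>leb \<partial>iid n leb)" by (rule int_ins) simp
  also have "... \<le> (\<integral>\<^sup>+x. \<integral>\<^sup>+y. k (x(n := y)) \<partial>leb \<partial>iid n leb)"
  proof (rule nn_integral_mono)
    fix x :: "nat \<Rightarrow> torus" assume "x \<in> space (iid n leb)"
    then have x: "x \<in> space (torus_pow n)" by (simp add: space_PiM)
    note [measurable] = measurable_upd_point[OF x]
    have "(\<integral>\<^sup>+y. f (x(n := y)) \<partial>leb) \<le> (\<integral>\<^sup>+y. k (x(n := y \<oplus> d n (x(n := y)))) * ennreal (j n (x(n := y))) \<partial>leb)"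
      by (intro nn_integral_mono) (use f_le[of "x(n := _)"] in simp)
    also have "... \<le> (\<integral>\<^sup>+y. k (x(n := y)) \<partial>leb)"
    proof (rule circle_substitution_le[OF slice_lip[OF N s b] _ slice_j_lip[OF N s b]])
      fix y t :: "real" and u assume "0 \<le> t"
      then show "j n (x(n := u)) * t - L * t^2 \<le> t + d n (x(n := u \<oplus> t)) - d n (x(n := u))"
        using near_idD(4)[OF N lessI, of t "x(n := u)"] by (simp only: fun_upd_same fun_upd_upd)
    qed (use s in auto)
    finally show "(\<integral>\<^sup>+y. f (x(n := y)) \<partial>leb) \<le> (\<integral>\<^sup>+y. k (x(n := y)) \<partial>leb)" .
  qed
  also have "... = (\<integral>\<^sup>+y. \<integral>\<^sup>+x. k (x(n := y)) \<partial>iid n leb \<partial>leb)"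
    by (subst int_ins[symmetric], simp, rule int_ins_rev) simp
  also have "... \<le> (\<integral>\<^sup>+y. \<integral>\<^sup>+x. g (x(n := y)) \<partial>iid n leb \<partial>leb)"
  proof (rule nn_integral_mono)
    fix y
    define d' where "d' i x = d i (?X (x(n := y)))" for i x
    define j' where "j' i x = j i (?X (x(n := y))) - \<gamma>" for i x
    \<comment> \<open>Each round raises \<open>s\<close> and \<open>b\<close> by \<gamma> and lowers
      \<open>j\<close> by \<gamma>. The margins \<open>real n * \<gamma>\<close> in the hypotheses
      pay for the remaining rounds, during which \<open>b\<close> stays below \<open>B\<close> and
      \<open>2 * B^2 \<le> \<gamma>\<close> applies.\<close>
    have N': "near_id n (s + \<gamma>) (b + \<gamma>) (L * (1 + 2 * b)) d' j'"
      unfolding d'_def j'_def by (rule near_id_elim[OF N s b]) (use b\<gamma> in auto)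
    have "k (x(n := y)) = g ((\<lambda>i\<in>{..<n}. x i \<oplus> d' i x)(n := y)) * (\<Prod>i<n. ennreal (j' i x - real n * \<gamma>))" for x
    proof -
      have "(\<lambda>i\<in>{..<Suc n}. if i < n then (x(n := y)) i \<oplus> d i (?X (x(n := y))) else (x(n := y)) n) =
        (\<lambda>i\<in>{..<n}. x i \<oplus> d' i x)(n := y)" by (auto simp: restrict_def fun_eq_iff less_Suc_eq d'_def)
      then show ?thesis unfolding k_def by (simp add: j'_def algebra_simps)
    qed
    then have "(\<integral>\<^sup>+x. k (x(n := y)) \<partial>iid n leb) =
      (\<integral>\<^sup>+x. g ((\<lambda>i\<in>{..<n}. x i \<oplus> d' i x)(n := y)) * (\<Prod>i<n. ennreal (j' i x - real n * \<gamma>)) \<partial>iid n leb)" by simp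
    also have "... \<le> (\<integral>\<^sup>+x. g (x(n := y)) \<partial>iid n leb)"
      by (rule Suc.hyps[OF N', of "\<lambda>u. g (u(n := y))"]) (use Suc.prems \<gamma> b in \<open>auto simp: algebra_simps\<close>)
    finally show "(\<integral>\<^sup>+x. k (x(n := y)) \<partial>iid n leb) \<le> (\<integral>\<^sup>+x. g (x(n := y)) \<partial>iid n leb)" .
  qed
  also have "... = (\<integral>\<^sup>+x. g x \<partial>iid (Suc n) leb)" by (rule int_ins_rev[symmetric]) simp
  finally show ?case unfolding f_def .
qed

section \<open>Functions of class C^k\<close>

lemma real_mvt:
  fixes g g' :: "real \<Rightarrow> real"
  assumes g: "\<And>x. (g has_real_derivative g' x) (at x)"
  obtains z where "\<bar>z - x\<bar> \<le> abs t" "g (x + t) - g x = t * g' z"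
proof (cases t "0::real" rule: linorder_cases)
  case less
  then obtain z where "x + t < z" "z < x" "g x - g (x + t) = (x - (x + t)) * g' z"
    using MVT2[of "x + t" x g g'] g by auto
  then show thesis using less by (intro that[of z]) (auto simp: algebra_simps)
next
  case greater
  then obtain z where "x < z" "z < x + t" "g (x + t) - g x = (x + t - x) * g' z"
    using MVT2[of x "x + t" g g'] g by auto
  then show thesis using greater by (intro that[of z]) auto
qed (use that[of x] in simp)

lemma deriv_shift: "deriv u (x + c) = deriv (\<lambda>s. u (s + c :: real)) x"
  by (simp add: deriv_def DERIV_shift)

lemma funpow_deriv_periodic:
  fixes u :: "real \<Rightarrow> real"
  assumes "\<And>s. u (s + 1) = u s"
  shows "(deriv ^^ j) u (s + 1) = (deriv ^^ j) u s"
proof (induct j arbitrary: s)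
  case (Suc j)
  then show ?case by (simp add: deriv_shift)
qed (simp add: assms)

lemma periodic_Ints: assumes "\<And>s::real. u (s + 1) = u s" "k \<in> \<int>" shows "u (s + k) = u s"
proof -
  have "u (s + of_int i) = u s" for i
  proof (induct i rule: int_induct[of _ 0])
    case (step1 i) then show ?case using assms(1)[of "s + of_int i"] by (simp add: add.assoc)
  next
    case (step2 i) then show ?case using assms(1)[of "s + of_int i - 1"] by (simp add: algebra_simps)
  qed simp
  then show ?thesis using assms(2) by (auto elim: Ints_cases)
qed

lemma periodic_cong: assumes "\<And>s::real. u (s + 1) = u s" "proj a = proj b" shows "u a = u b"
  using periodic_Ints[where u = u, OF assms(1), of "a - b" b] assms(2) by (simp add: proj_eq_iff)

lemma periodic_bounded:
  fixes u :: "real \<Rightarrow> real"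
  assumes per: "\<And>s. u (s + 1) = u s" and cont: "continuous_on UNIV u"
  shows "\<exists>B. \<forall>s. \<bar>u s\<bar> \<le> B"
proof -
  have "compact (u ` {0..1})" by (rule compact_continuous_image[OF continuous_on_subset[OF cont]]) auto
  then obtain B where B: "\<And>s. s \<in> {0..1} \<Longrightarrow> \<bar>u s\<bar> \<le> B"
    using compact_imp_bounded bounded_iff by (metis imageI real_norm_def)
  have "\<bar>u s\<bar> \<le> B" for s
  proof -
    have "u s = u (frac s)" by (rule periodic_cong[where u = u, OF per]) simp
    then show ?thesis using B[of "frac s"] frac_lt_1[of s] by (simp add: less_imp_le)
  qed
  then show ?thesis by blast
qed

lemma Ck_real_continuous: "Ck_real k u \<Longrightarrow> j \<le> k \<Longrightarrow> continuous_on UNIV ((deriv ^^ j) u)"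
  by (cases "j = k")
     (auto simp: Ck_real_def intro!: continuous_at_imp_continuous_on differentiable_imp_continuous_within)

lemma Ck_real_DERIV:
  "Ck_real k u \<Longrightarrow> j < k \<Longrightarrow> ((deriv ^^ j) u has_real_derivative (deriv ^^ Suc j) u x) (at x)"
  unfolding Ck_real_def by (simp add: DERIV_deriv_iff_real_differentiable)

text \<open>Continuity and periodicity of finitely many derivatives make the supremum one of a
  bounded set. The index set \<open>J\<close> allows order 0 to be left out: the lift of a self-map
  need not be periodic, but its derivatives are.\<close>

lemma Ck_real_periodic_bound:
  assumes "Ck_real k u" and per: "\<And>j s. j \<in> J \<Longrightarrow> (deriv ^^ j) u (s + 1) = (deriv ^^ j) u s" and J: "J \<subseteq> {..k}"
    and j: "j \<in> J"
  shows "\<bar>(deriv ^^ j) u x\<bar> \<le> Sup {\<bar>(deriv ^^ i) u y\<bar> | i y. i \<in> J}"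
proof -
  have "\<exists>B. \<forall>s. \<bar>(deriv ^^ i) u s\<bar> \<le> B" if "i \<in> J" for i
    by (rule periodic_bounded) (use per that J Ck_real_continuous[OF assms(1)] in auto)
  then obtain B where B: "\<And>i s. i \<in> J \<Longrightarrow> \<bar>(deriv ^^ i) u s\<bar> \<le> B i" by metis
  have fin: "finite J" using J finite_subset by blast
  have "bdd_above {\<bar>(deriv ^^ i) u y\<bar> | i y. i \<in> J}"
  proof (rule bdd_aboveI[of _ "\<Sum>i\<in>J. \<bar>B i\<bar>"])
    fix z assume "z \<in> {\<bar>(deriv ^^ i) u y\<bar> | i y. i \<in> J}"
    then obtain i y where z: "z = \<bar>(deriv ^^ i) u y\<bar>" "i \<in> J" by blast
    have "z \<le> \<bar>B i\<bar>" using B[OF z(2), of y] z(1) by linarith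
    also have "... \<le> (\<Sum>i\<in>J. \<bar>B i\<bar>)" by (rule member_le_sum) (use z fin in auto)
    finally show "z \<le> (\<Sum>i\<in>J. \<bar>B i\<bar>)" .
  qed
  then show ?thesis by (intro cSup_upper) (use j in auto)
qed

lemma Ck_torus_bound:
  assumes "Ck_torus k f" "j \<le> k"
  shows "\<bar>(deriv ^^ j) (\<lambda>s. f (proj s)) x\<bar> \<le> Ck_norm_torus k f"
proof -
  have "proj (s + 1) = proj s" for s by (simp add: proj_eq_iff)
  then have per: "f (proj (s + 1)) = f (proj s)" for s by simp
  show ?thesis
    using Ck_real_periodic_bound[of k "\<lambda>s. f (proj s)" "{..k}" j x] assms funpow_deriv_periodic[of "\<lambda>s. f (proj s)", OF per]
    by (simp add: Ck_torus_def Ck_norm_torus_def)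
qed

text \<open>The working class of test functions, with a single constant for all three bounds.
  Averaging against a measure and composition with C^{1,1} maps preserve it with explicit
  constants.\<close>

definition C11 :: "real \<Rightarrow> (torus \<Rightarrow> real) \<Rightarrow> (torus \<Rightarrow> real) \<Rightarrow> bool"
  where "C11 q f f' \<longleftrightarrow> (\<forall>x. \<bar>f x\<bar> \<le> q) \<and> lip q f \<and> qd q f f'"

lemma C11D: assumes "C11 q f f'" shows "\<bar>f x\<bar> \<le> q" "lip q f" "qd q f f'" "0 \<le> q"
  using assms lip_nonneg by (auto simp: C11_def)

lemma lip_deriv_bound: assumes "lip q f" "qd L f f'" shows "\<bar>f' x\<bar> \<le> q"
proof (rule field_le_epsilon)
  fix e :: real assume e: "0 < e"
  define t where "t = e / (L + 1)"
  have L: "0 \<le> L" by (rule qd_nonneg[OF assms(2)])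
  have t: "0 < t" using e L by (simp add: t_def)
  have "L * t \<le> e" using e L by (simp add: t_def field_simps)
  have "t * \<bar>f' x\<bar> = \<bar>t * f' x\<bar>" using t by (simp add: abs_mult)
  also have "... \<le> q * t + L * t^2" using lipD[OF assms(1), of x t] qdD[OF assms(2), of x t] t by linarith
  also have "... = t * (q + L * t)" by (simp add: algebra_simps power2_eq_square)
  finally have "\<bar>f' x\<bar> \<le> q + L * t" using t by simp
  then show "\<bar>f' x\<bar> \<le> q + e" using \<open>L * t \<le> e\<close> by linarith
qed

lemma real_taylor1:
  fixes g g' :: "real \<Rightarrow> real"
  assumes g: "\<And>x. (g has_real_derivative g' x) (at x)" and g': "\<And>x y. \<bar>g' y - g' x\<bar> \<le> B * \<bar>y - x\<bar>"
  shows "\<bar>g (x + t) - g x - t * g' x\<bar> \<le> B * t^2"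
proof -
  obtain z where z: "\<bar>z - x\<bar> \<le> abs t" "g (x + t) - g x = t * g' z" by (rule real_mvt[OF g])
  have B: "0 \<le> B" using order_trans[OF abs_ge_zero g'[of 1 0]] by simp
  have "\<bar>g (x + t) - g x - t * g' x\<bar> = abs t * \<bar>g' z - g' x\<bar>"
    by (simp add: z(2) abs_mult[symmetric] right_diff_distrib)
  also have "... \<le> abs t * (B * abs t)"
    using g'[of z x] z(1) B by (intro mult_left_mono order_trans[OF g'] mult_left_mono) auto
  also have "... = B * \<bar>t\<bar>\<^sup>2" by (simp only: power2_eq_square mult.left_commute)
  finally show ?thesis unfolding power2_abs .
qed

lemma real_lip_of_deriv:
  fixes g g' :: "real \<Rightarrow> real"
  assumes g: "\<And>x. (g has_real_derivative g' x) (at x)" and g': "\<And>x. \<bar>g' x\<bar> \<le> B"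
  shows "\<bar>g y - g x\<bar> \<le> B * \<bar>y - x\<bar>"
proof -
  obtain z where z: "g (x + (y - x)) - g x = (y - x) * g' z" by (rule real_mvt[OF g])
  have "\<bar>g y - g x\<bar> = \<bar>y - x\<bar> * \<bar>g' z\<bar>" using z by (simp add: abs_mult)
  also have "... \<le> \<bar>y - x\<bar> * B" by (intro mult_left_mono g') simp
  finally show ?thesis by (simp add: mult.commute)
qed

lemma Ck_torus_C11:
  assumes f: "Ck_torus 2 f"
  shows "C11 (Ck_norm_torus 2 f) f (torus_deriv f)"
proof -
  let ?u = "\<lambda>s. f (proj s)" and ?B = "Ck_norm_torus 2 f"
  have u: "Ck_real 2 ?u" using f by (simp add: Ck_torus_def)
  have D1: "(?u has_real_derivative deriv ?u x) (at x)" for x using Ck_real_DERIV[OF u, of 0 x] by simp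
  have D2: "(deriv ?u has_real_derivative deriv (deriv ?u) x) (at x)" for x
    using Ck_real_DERIV[OF u, of 1 x] by simp
  have b0: "\<bar>?u x\<bar> \<le> ?B" and b1: "\<bar>deriv ?u x\<bar> \<le> ?B" and b2: "\<bar>deriv (deriv ?u) x\<bar> \<le> ?B" for x
    using Ck_torus_bound[OF f, of 0 x] Ck_torus_bound[OF f, of 1 x] Ck_torus_bound[OF f, of 2 x]
    by (simp_all add: numeral_2_eq_2)
  have sh: "f (x \<oplus> t) = ?u (rep_torus x + t)" for x t by (metis proj_rep torus_add_proj)
  show ?thesis unfolding C11_def lip_def qd_def torus_deriv_def
  proof (intro conjI allI)
    fix x t
    show "\<bar>f x\<bar> \<le> ?B" using b0[of "rep_torus x"] by simp
    show "\<bar>f (x \<oplus> t) - f x\<bar> \<le> ?B * abs t"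
      using real_lip_of_deriv[OF D1 b1, of "rep_torus x + t" "rep_torus x"] by (simp add: sh)
    show "\<bar>f (x \<oplus> t) - f x - t * deriv ?u (rep_torus x)\<bar> \<le> ?B * t^2"
      using real_taylor1[OF D1 real_lip_of_deriv[OF D2 b2], of "rep_torus x" t] by (simp add: sh)
  qed
qed

lemma Ck_euclid_DERIV:
  assumes "Ck_euclid n k f" "set js \<subseteq> {..<n}" "length js < k" "i < n"
  shows "((\<lambda>s. partial_derivs js f (x(i := s))) has_real_derivative partial_derivs (i # js) f (x(i := s))) (at s)"
proof -
  have "\<forall>js i x. set js \<subseteq> {..<n} \<longrightarrow> length js < k \<longrightarrow> i < n \<longrightarrow>
      (\<lambda>s. partial_derivs js f (x(i := s))) differentiable (at (x i))"
    using assms(1) unfolding Ck_euclid_def by (elim conjE)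
  from this[rule_format, OF assms(2-4), of "x(i := s)"]
  have "(\<lambda>r. partial_derivs js f ((x(i := s))(i := r))) differentiable (at ((x(i := s)) i))" .
  then show ?thesis by (simp add: partial_deriv_def DERIV_deriv_iff_real_differentiable[symmetric])
qed

lemma partial_derivs_depend:
  assumes "\<And>x y. (\<And>i. i < n \<Longrightarrow> x i = y i) \<Longrightarrow> f x = f y"
    and "set js \<subseteq> {..<n}" "\<And>i. i < n \<Longrightarrow> x i = y i"
  shows "partial_derivs js f x = partial_derivs js f y"
  using assms(2,3)
proof (induct js arbitrary: x y)
  case Nil
  then show ?case using assms(1)[of x y] by simp
next
  case (Cons i js)
  have "partial_derivs js f (x(i := s)) = partial_derivs js f (y(i := s))" for s
    using Cons by (intro Cons.hyps) auto
  then show ?case using Cons.prems by (simp add: partial_deriv_def)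
qed

text \<open>Two cases: when differentiating along the translated coordinate the base point moves
  with the shift; along another coordinate the two updates commute.\<close>

lemma partial_derivs_translate:
  fixes f :: "(nat \<Rightarrow> real) \<Rightarrow> real"
  assumes "\<And>x. f (x(i := x i + c)) = f x"
  shows "partial_derivs js f (x(i := x i + c)) = partial_derivs js f x"
proof (induct js arbitrary: x)
  case (Cons k js)
  show ?case
  proof (cases "k = i")
    case True
    have "partial_derivs js f (x(i := s + c)) = partial_derivs js f (x(i := s))" for s
      using Cons[of "x(i := s)"] unfolding fun_upd_upd fun_upd_same .
    then show ?thesis
      unfolding True partial_derivs.simps partial_deriv_def fun_upd_upd fun_upd_same deriv_shift by simp
  next
    case False
    have "x(i := x i + c, k := s) = (x(k := s))(i := (x(k := s)) i + c)" for s
      using False by (auto simp: fun_eq_iff)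
    then have "partial_derivs js f (x(i := x i + c, k := s)) = partial_derivs js f (x(k := s))" for s
      by (simp only: Cons)
    moreover have "(x(i := x i + c)) k = x k" using False by simp
    ultimately show ?thesis unfolding partial_derivs.simps partial_deriv_def by simp
  qed
qed (simp add: assms)

text \<open>Partial derivatives of \<open>h\<close> as functions on the torus itself. Evaluating at
  \<open>crep\<close> makes them measurable, and \<open>hpart_eq\<close> shows that other
  representatives give the same value. The head of the list is the derivative taken last.\<close>

definition hpart :: "(torus \<Rightarrow> torus \<Rightarrow> real) \<Rightarrow> nat list \<Rightarrow> torus \<Rightarrow> torus \<Rightarrow> real"
  where "hpart h js x z = partial_derivs js (lift2 h) (\<lambda>i. if i = 0 then crep x else crep z)"

context
  fixes h k assumes h: "Ck_torus2 k h"
begin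

lemma lift2_Ck: "Ck_euclid 2 k (lift2 h)"
  using h by (simp add: Ck_torus2_def)

lemma lift2_depend:
  assumes "set js \<subseteq> {..<2}" "x 0 = y 0" "x 1 = y 1"
  shows "partial_derivs js (lift2 h) x = partial_derivs js (lift2 h) y"
  by (rule partial_derivs_depend[of 2]) (use assms in \<open>auto simp: lift2_def less_2_cases_iff\<close>)

lemma lift2_periodic: "partial_derivs js (lift2 h) (x(i := x i + of_int c)) = partial_derivs js (lift2 h) x"
proof (rule partial_derivs_translate)
  fix x :: "nat \<Rightarrow> real"
  have "proj ((x(i := x i + of_int c)) j) = proj (x j)" for j by (simp add: proj_eq_iff)
  then show "lift2 h (x(i := x i + of_int c)) = lift2 h x" by (simp only: lift2_def)
qed

lemma lift2_reduce:
  assumes js: "set js \<subseteq> {..<2}"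
  shows "partial_derivs js (lift2 h) x = partial_derivs js (lift2 h) (\<lambda>i. if i = 0 then frac (x 0) else frac (x 1))"
proof -
  define y where "y = x(0 := x 0 + of_int (- \<lfloor>x 0\<rfloor>))"
  have "partial_derivs js (lift2 h) x = partial_derivs js (lift2 h) y" unfolding y_def lift2_periodic ..
  also have "... = partial_derivs js (lift2 h) (y(1 := y 1 + of_int (- \<lfloor>x 1\<rfloor>)))" unfolding lift2_periodic ..
  also have "... = partial_derivs js (lift2 h) (\<lambda>i. if i = 0 then frac (x 0) else frac (x 1))"
    by (rule lift2_depend[OF js]) (auto simp: y_def frac_def)
  finally show ?thesis .
qed

text \<open>Periodicity reduces each derivative to the compact unit square, and only finitely many
  lists of length at most \<open>k\<close> occur; hence the \<open>Sup\<close> in the norm is that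
  of a bounded set.\<close>

lemma lift2_bound:
  assumes js: "set js \<subseteq> {..<2}" "length js \<le> k"
  shows "\<bar>partial_derivs js (lift2 h) x\<bar> \<le> Ck_norm_torus2 k h"
proof -
  have *: "\<exists>B. \<forall>x. \<bar>partial_derivs js (lift2 h) x\<bar> \<le> B" if js: "set js \<subseteq> {..<2}" "length js \<le> k" for js
  proof -
    let ?g = "\<lambda>p::real \<times> real. (\<lambda>i::nat. if i = 0 then fst p else snd p)"
    have cont: "continuous_on UNIV (partial_derivs js (lift2 h))" using lift2_Ck js unfolding Ck_euclid_def by blast
    have "continuous_on UNIV (\<lambda>p. if i = 0 then fst p else snd p :: real)" for i :: nat
      by (cases "i = 0") (auto intro!: continuous_intros)
    then have g: "continuous_on UNIV ?g" by (intro continuous_on_coordinatewise_then_product)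
    have "continuous_on UNIV (partial_derivs js (lift2 h) \<circ> ?g)"
      by (rule continuous_on_compose[OF g continuous_on_subset[OF cont]]) simp
    then have "compact ((partial_derivs js (lift2 h) \<circ> ?g) ` ({0..1} \<times> {0..1}))"
      by (intro compact_continuous_image compact_Times) (auto intro: continuous_on_subset)
    then have "bounded ((partial_derivs js (lift2 h) \<circ> ?g) ` ({0..1} \<times> {0..1}))" by (rule compact_imp_bounded)
    then obtain B where "\<forall>v\<in>(partial_derivs js (lift2 h) \<circ> ?g) ` ({0..1} \<times> {0..1}). norm v \<le> B"
      unfolding bounded_iff by blast
    then have B: "\<bar>(partial_derivs js (lift2 h) \<circ> ?g) p\<bar> \<le> B" if "p \<in> {0..1} \<times> {0..1}" for p
      using that unfolding real_norm_def by blast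
    have "\<bar>partial_derivs js (lift2 h) x\<bar> \<le> B" for x
      using B[of "(frac (x 0), frac (x 1))"] lift2_reduce[OF js(1), of x]
      by (auto simp: frac_lt_1 less_imp_le cong: if_cong)
    then show ?thesis by blast
  qed
  define S where "S = {js. set js \<subseteq> {..<2::nat} \<and> length js \<le> k}"
  have fin: "finite S" unfolding S_def by (rule finite_lists_length_le) simp
  obtain B where B: "\<And>js x. js \<in> S \<Longrightarrow> \<bar>partial_derivs js (lift2 h) x\<bar> \<le> B js"
    using * unfolding S_def by (metis mem_Collect_eq)
  have "bdd_above {\<bar>partial_derivs js (lift2 h) x\<bar> | js x. set js \<subseteq> {..<2} \<and> length js \<le> k}"
  proof (rule bdd_aboveI[of _ "\<Sum>i\<in>S. \<bar>B i\<bar>"])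
    fix z assume "z \<in> {\<bar>partial_derivs js (lift2 h) x\<bar> | js x. set js \<subseteq> {..<2} \<and> length js \<le> k}"
    then obtain i y where z: "z = \<bar>partial_derivs i (lift2 h) y\<bar>" "i \<in> S" unfolding S_def by blast
    have "z \<le> \<bar>B i\<bar>" using B[OF z(2), of y] z(1) by linarith
    also have "... \<le> (\<Sum>i\<in>S. \<bar>B i\<bar>)" by (rule member_le_sum) (use z fin in auto)
    finally show "z \<le> (\<Sum>i\<in>S. \<bar>B i\<bar>)" .
  qed
  then show ?thesis unfolding Ck_norm_torus2_def Ck_norm_euclid_def by (intro cSup_upper) (use js in auto)
qed

lemma hpart_eq:
  assumes "set js \<subseteq> {..<2}"
  shows "hpart h js (proj a) (proj b) = partial_derivs js (lift2 h) (\<lambda>i. if i = 0 then a else b)"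
  using lift2_reduce[OF assms, of "\<lambda>i. if i = 0 then a else b"] by (simp add: hpart_def cong: if_cong)

lemma hpart_Nil: "hpart h [] = h"
  by (intro ext) (simp add: hpart_def lift2_def)

lemma hpart_bound: "set js \<subseteq> {..<2} \<Longrightarrow> length js \<le> k \<Longrightarrow> \<bar>hpart h js x z\<bar> \<le> Ck_norm_torus2 k h"
  unfolding hpart_def by (rule lift2_bound)

lemma hpart_norm_nonneg: "0 \<le> Ck_norm_torus2 k h"
  using order_trans[OF abs_ge_zero hpart_bound[of "[]" undefined undefined]] by simp

lemma hpart_fst:
  assumes "set js \<subseteq> {..<2}"
  shows "hpart h js (x \<oplus> t) z = partial_derivs js (lift2 h) ((\<lambda>i. if i = 0 then crep x else crep z)(0 := crep x + t))"
proof -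
  have "hpart h js (x \<oplus> t) z = hpart h js (proj (crep x + t)) (proj (crep z))" by (metis proj_crep torus_add_proj)
  then show ?thesis unfolding hpart_eq[OF assms] by (auto intro!: lift2_depend[OF assms])
qed

lemma hpart_snd:
  assumes "set js \<subseteq> {..<2}"
  shows "hpart h js x (z \<oplus> t) = partial_derivs js (lift2 h) ((\<lambda>i. if i = 0 then crep x else crep z)(1 := crep z + t))"
proof -
  have "hpart h js x (z \<oplus> t) = hpart h js (proj (crep x)) (proj (crep z + t))" by (metis proj_crep torus_add_proj)
  then show ?thesis unfolding hpart_eq[OF assms] by (auto intro!: lift2_depend[OF assms])
qed

lemma lift2_lip:
  assumes "set js \<subseteq> {..<2}" "length js < k" "i < 2"
  shows "\<bar>partial_derivs js (lift2 h) (x(i := s')) - partial_derivs js (lift2 h) (x(i := s))\<bar> \<le> Ck_norm_torus2 k h * \<bar>s' - s\<bar>"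
  by (rule real_lip_of_deriv[OF Ck_euclid_DERIV[OF lift2_Ck assms] lift2_bound]) (use assms in auto)

lemma hpart_lip_fst:
  assumes "set js \<subseteq> {..<2}" "length js < k"
  shows "lip (Ck_norm_torus2 k h) (\<lambda>x. hpart h js x z)"
  unfolding lip_def
proof (intro allI)
  fix x t show "\<bar>hpart h js (x \<oplus> t) z - hpart h js x z\<bar> \<le> Ck_norm_torus2 k h * abs t"
    using hpart_fst[OF assms(1), of x t z] hpart_fst[OF assms(1), of x 0 z] lift2_lip[OF assms, of 0 _ "crep x + t" "crep x"] by simp
qed

lemma hpart_lip_snd:
  assumes "set js \<subseteq> {..<2}" "length js < k"
  shows "lip (Ck_norm_torus2 k h) (hpart h js x)"
  unfolding lip_def
proof (intro allI)
  fix z t show "\<bar>hpart h js x (z \<oplus> t) - hpart h js x z\<bar> \<le> Ck_norm_torus2 k h * abs t"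
    using hpart_snd[OF assms(1), of x z t] hpart_snd[OF assms(1), of x z 0] lift2_lip[OF assms, of 1 _ "crep z + t" "crep z"] by simp
qed

lemma hpart_qd_fst:
  assumes js: "set js \<subseteq> {..<2}" "length js + 2 \<le> k"
  shows "qd (Ck_norm_torus2 k h) (\<lambda>x. hpart h js x z) (\<lambda>x. hpart h (0 # js) x z)"
  unfolding qd_def
proof (intro allI)
  fix x t
  let ?p = "\<lambda>i::nat. if i = 0 then crep x else crep z"
  have j1: "length js < k" and j0: "(0::nat) < 2" and j2: "set (0 # js) \<subseteq> {..<2}" "length (0 # js) < k" using js by auto
  show "\<bar>hpart h js (x \<oplus> t) z - hpart h js x z - t * hpart h (0 # js) x z\<bar> \<le> Ck_norm_torus2 k h * t^2"
    using real_taylor1[OF Ck_euclid_DERIV[OF lift2_Ck js(1) j1 j0, of ?p] lift2_lip[OF j2 j0, of ?p], of "crep x" t]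
      hpart_fst[OF js(1), of x t z] hpart_fst[OF js(1), of x 0 z] hpart_fst[OF j2(1), of x 0 z] by simp
qed

lemma hpart_qd_snd:
  assumes js: "set js \<subseteq> {..<2}" "length js + 2 \<le> k"
  shows "qd (Ck_norm_torus2 k h) (hpart h js x) (hpart h (1 # js) x)"
  unfolding qd_def
proof (intro allI)
  fix z t
  let ?p = "\<lambda>i::nat. if i = 0 then crep x else crep z"
  have j1: "length js < k" and j0: "(1::nat) < 2" and j2: "set (1 # js) \<subseteq> {..<2}" "length (1 # js) < k" using js by auto
  show "\<bar>hpart h js x (z \<oplus> t) - hpart h js x z - t * hpart h (1 # js) x z\<bar> \<le> Ck_norm_torus2 k h * t^2"
    using real_taylor1[OF Ck_euclid_DERIV[OF lift2_Ck js(1) j1 j0, of ?p] lift2_lip[OF j2 j0, of ?p], of "crep z" t]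
      hpart_snd[OF js(1), of x z t] hpart_snd[OF js(1), of x z 0] hpart_snd[OF j2(1), of x z 0] by simp
qed

lemma hpart_measurable [measurable (raw)]:
  assumes js: "set js \<subseteq> {..<2}" "length js \<le> k"
    and [measurable]: "f \<in> measurable M borel" "g \<in> measurable M borel"
  shows "(\<lambda>w. hpart h js (f w) (g w)) \<in> borel_measurable M"
proof -
  have cont: "continuous_on UNIV (partial_derivs js (lift2 h))" using lift2_Ck js unfolding Ck_euclid_def by blast
  have "(\<lambda>w. if i = 0 then crep (f w) else crep (g w)) \<in> borel_measurable M" for i :: nat by (cases "i = 0") auto
  then have "(\<lambda>w i::nat. if i = 0 then crep (f w) else crep (g w)) \<in> measurable M borel"
    by (rule measurable_coordinatewise_then_product)
  from measurable_compose[OF this borel_measurable_continuous_onI[OF cont]]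
  show ?thesis by (simp add: hpart_def)
qed

end

section \<open>Discretisation of integrals of Lipschitz functions\<close>

text \<open>Tail arcs \<open>[(k + 1) / n, 1)\<close>. A function with Lipschitz constant
  \<open>L\<close> is within \<open>L / n\<close> of a combination of their indicators with
  coefficients at most \<open>L / n\<close>, so the \<open>n\<close> frequencies of these arcs
  control the integrals of all Lipschitz functions at once.\<close>

definition upper :: "nat \<Rightarrow> nat \<Rightarrow> torus set"
  where "upper n k = {x. real (Suc k) / real n \<le> crep x}"

definition jump :: "nat \<Rightarrow> (torus \<Rightarrow> real) \<Rightarrow> nat \<Rightarrow> real"
  where "jump n f k = f (proj (real (Suc k) / real n)) - f (proj (real k / real n))"

lemma upper_sets [measurable]: "upper n k \<in> sets borel"
proof -
  have "{x \<in> space borel. real (Suc k) / real n \<le> crep x} \<in> sets borel" by measurable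
  then show ?thesis by (simp add: upper_def)
qed

lemma jump_le: assumes "lip L f" "0 < n" shows "\<bar>jump n f k\<bar> \<le> L / real n"
  using lipD[OF assms(1), of "proj (real k / real n)" "1 / real n"] assms(2)
  by (simp add: jump_def add_divide_distrib add.commute)

text \<open>Summation by parts on the grid: at a point of the \<open>m\<close>-th cell exactly the
  first \<open>m\<close> indicators are 1, and the jumps telescope to the value at the left grid
  point.\<close>

lemma step_approx:
  assumes f: "lip L f" and n: "0 < n"
  shows "\<bar>f x - (f (proj 0) + (\<Sum>k<n. jump n f k * indicator (upper n k) x))\<bar> \<le> L / real n"
proof -
  define m where "m = nat \<lfloor>real n * crep x\<rfloor>"
  have m: "real m \<le> real n * crep x" "real n * crep x < real m + 1"
  proof -
    have "0 \<le> real n * crep x" by simp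
    then show "real m \<le> real n * crep x" "real n * crep x < real m + 1" unfolding m_def by linarith+
  qed
  have "real n * crep x < real n * 1" using n by (intro mult_strict_left_mono) auto
  then have mn: "m < n" using m by simp
  have iff: "x \<in> upper n k \<longleftrightarrow> k < m" for k
  proof -
    have "x \<in> upper n k \<longleftrightarrow> real (Suc k) \<le> real n * crep x" using n by (simp add: upper_def field_simps)
    also have "... \<longleftrightarrow> real (Suc k) < real m + 1" using m by (auto simp: not_le[symmetric])
    finally show ?thesis by auto
  qed
  have "(\<Sum>k<n. jump n f k * indicator (upper n k) x) = (\<Sum>k<m. jump n f k)"
  proof -
    have "(\<Sum>k<n. jump n f k * indicator (upper n k) x) = (\<Sum>k\<in>{..<m}. jump n f k * indicator (upper n k) x)"
      using mn by (intro sum.mono_neutral_right) (auto simp: iff)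
    also have "... = (\<Sum>k<m. jump n f k)" by (intro sum.cong) (auto simp: iff)
    finally show ?thesis .
  qed
  also have "... = f (proj (real m / real n)) - f (proj 0)"
    unfolding jump_def using sum_lessThan_telescope[of "\<lambda>k. f (proj (real k / real n))" m] by simp
  finally have eq: "f (proj 0) + (\<Sum>k<n. jump n f k * indicator (upper n k) x) = f (proj (real m / real n))" by simp
  have "f x = f (proj (real m / real n) \<oplus> (crep x - real m / real n))" by simp
  then have "\<bar>f x - f (proj (real m / real n))\<bar> \<le> L * \<bar>crep x - real m / real n\<bar>" using lipD[OF f] by metis
  also have "... \<le> L * (1 / real n)"
  proof (intro mult_left_mono lip_nonneg[OF f])
    have "real m / real n \<le> crep x" "crep x < (real m + 1) / real n"
      using m n by (simp_all add: divide_le_eq less_divide_eq mult.commute)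
    then show "\<bar>crep x - real m / real n\<bar> \<le> 1 / real n" by (simp add: add_divide_distrib)
  qed
  finally show ?thesis unfolding eq by simp
qed

lemma lip_integrable:
  assumes "lip L f" "prob_space M" "sets M = sets borel"
  shows "integrable M f"
proof -
  interpret prob_space M by fact
  show ?thesis
  proof (rule integrable_const_bound[of _ "\<bar>f undefined\<bar> + L"])
    have "\<bar>f x\<bar> \<le> \<bar>f undefined\<bar> + L" for x using lip_oscillation[OF assms(1), of x undefined] by linarith
    then show "AE x in M. norm (f x) \<le> \<bar>f undefined\<bar> + L" by simp
    show "f \<in> borel_measurable M" using lip_measurable[OF assms(1)] assms(3) by (simp cong: measurable_cong_sets)
  qed
qed

text \<open>The value at \<open>proj 0\<close> cancels in the difference because both measures have
  mass one.\<close>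

lemma discretise:
  assumes f: "lip L f" and n: "0 < n"
    and \<mu>: "prob_space \<mu>" "sets \<mu> = sets borel" and \<nu>: "prob_space \<nu>" "sets \<nu> = sets borel"
  shows "\<bar>(LINT x|\<mu>. f x) - (LINT x|\<nu>. f x) - (\<Sum>k<n. jump n f k * (measure \<mu> (upper n k) - measure \<nu> (upper n k)))\<bar> \<le> 2 * L / real n"
proof -
  have *: "\<bar>(LINT x|M. f x) - (f (proj 0) + (\<Sum>k<n. jump n f k * measure M (upper n k)))\<bar> \<le> L / real n"
    if M: "prob_space M" and s[measurable_cong]: "sets M = sets borel" for M
  proof -
    interpret prob_space M by fact
    let ?g = "\<lambda>x. f (proj 0) + (\<Sum>k<n. jump n f k * indicator (upper n k) x)"
    have [measurable]: "upper n k \<in> sets M" for k using s by simp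
    have int: "integrable M f" by (rule lip_integrable[OF f M s])
    have ind: "integrable M (indicator (upper n k) :: torus \<Rightarrow> real)" for k
      by (rule integrable_real_indicator) (auto simp: emeasure_eq_measure)
    have intg: "integrable M ?g" using ind by (intro Bochner_Integration.integrable_add Bochner_Integration.integrable_sum integrable_mult_right) auto
    have "(LINT x|M. ?g x) = f (proj 0) + (\<Sum>k<n. jump n f k * measure M (upper n k))"
    proof -
      have "(LINT x|M. ?g x) = (LINT x|M. f (proj 0)) + (LINT x|M. (\<Sum>k<n. jump n f k * indicator (upper n k) x))"
        using ind by (intro Bochner_Integration.integral_add Bochner_Integration.integrable_sum integrable_mult_right) auto
      also have "(LINT x|M. (\<Sum>k<n. jump n f k * indicator (upper n k) x)) = (\<Sum>k<n. LINT x|M. jump n f k * indicator (upper n k) x)"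
        using ind by (intro Bochner_Integration.integral_sum integrable_mult_right) auto
      finally show ?thesis using sets_eq_imp_space_eq[OF s] prob_space by simp
    qed
    then have "(LINT x|M. f x) - (f (proj 0) + (\<Sum>k<n. jump n f k * measure M (upper n k))) = (LINT x|M. f x - ?g x)"
      using int intg by simp
    also have "\<bar>...\<bar> \<le> (LINT x|M. L / real n)"
      using step_approx[OF f n] int intg by (intro order_trans[OF integral_abs_bound] integral_mono) auto
    finally show ?thesis by (simp add: prob_space)
  qed
  show ?thesis using *[OF \<mu>] *[OF \<nu>] by (simp add: right_diff_distrib sum_subtractf abs_le_iff)
qed

section \<open>Exponential moments of squares of normalised sums\<close>

text \<open>The Hubbard-Stratonovich identity: the exponential of a square is a Gaussian mixture of
  exponentials of linear terms, which factorise over independent variables.\<close>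

lemma gaussian_linearise:
  "(\<integral>\<^sup>+u. ennreal (exp (c * u) * std_normal_density u) \<partial>lborel) = ennreal (exp (c^2 / 2))"
proof -
  have "exp (c * u) * std_normal_density u = exp (c^2 / 2) * normal_density c 1 u" for u
    by (simp add: normal_density_def mult_exp_exp power2_eq_square field_simps)
  then have "(\<integral>\<^sup>+u. ennreal (exp (c * u) * std_normal_density u) \<partial>lborel) =
    ennreal (exp (c^2 / 2)) * (\<integral>\<^sup>+u. ennreal (normal_density c 1 u) \<partial>lborel)"
    by (subst nn_integral_cmult[symmetric]) (auto simp: ennreal_mult')
  also have "(\<integral>\<^sup>+u. ennreal (normal_density c 1 u) \<partial>lborel) = ennreal 1"
    by (subst nn_integral_eq_integral) (auto simp: integrable_normal_density integral_normal_density)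
  finally show ?thesis by simp
qed

lemma gaussian_square_moment:
  "(\<integral>\<^sup>+u. ennreal (exp (u^2 / 4) * std_normal_density u) \<partial>lborel) \<le> 2"
proof -
  have "exp (u^2 / 4) * std_normal_density u = sqrt 2 * normal_density 0 (sqrt 2) u" for u
    by (simp add: normal_density_def mult_exp_exp real_sqrt_mult field_simps)
  then have "(\<integral>\<^sup>+u. ennreal (exp (u^2 / 4) * std_normal_density u) \<partial>lborel) =
    ennreal (sqrt 2) * (\<integral>\<^sup>+u. ennreal (normal_density 0 (sqrt 2) u) \<partial>lborel)"
    by (subst nn_integral_cmult[symmetric]) (auto simp: ennreal_mult')
  also have "(\<integral>\<^sup>+u. ennreal (normal_density 0 (sqrt 2) u) \<partial>lborel) = ennreal 1"
    by (subst nn_integral_eq_integral) (auto simp: integrable_normal_density integral_normal_density)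
  also have "ennreal (sqrt 2) * ennreal 1 = ennreal (sqrt 2)" by simp
  also have "... \<le> ennreal 2" by (rule ennreal_leI) (use real_sqrt_le_mono[of 2 4] in simp)
  finally show ?thesis by simp
qed

text \<open>The square is linearised by a Gaussian variable \<open>u\<close>, Fubini exchanges the
  integrals, and Hoeffding's lemma bounds each factor. The exponent becomes
  \<open>l * B^2 * u^2\<close>, and \<open>4 * l * B^2 \<le> 1\<close> keeps it below
  \<open>u^2 / 4\<close>, which the Gaussian density can integrate.\<close>

lemma square_sum_exp_moment:
  fixes g :: "'a \<Rightarrow> real"
  assumes M: "prob_space M" and g[measurable]: "g \<in> borel_measurable M"
    and gb: "\<And>x. \<bar>g x\<bar> \<le> B" and l: "0 \<le> l" "4 * l * B^2 \<le> 1" and N: "0 < N"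
  shows "(\<integral>\<^sup>+x. ennreal (exp (l * (\<Sum>i<N. g (x i) - (LINT y|M. g y))^2 / real N)) \<partial>iid N M) \<le> 2"
proof -
  interpret prob_space M by fact
  interpret P: product_sigma_finite "\<lambda>_::nat. M" by standard
  interpret PN: finite_product_sigma_finite "\<lambda>_::nat. M" "{..<N}" by standard simp
  define m where "m = (LINT y|M. g y)"
  define S where "S x = (\<Sum>i<N. g (x i) - m)" for x :: "nat \<Rightarrow> 'a"
  have [measurable]: "S \<in> borel_measurable (iid N M)" unfolding S_def by measurable
  have hoeff: "(\<integral>\<^sup>+y. ennreal (exp (c * (g y - m))) \<partial>M) \<le> ennreal (exp (c^2 * B^2 / 2))" for c
  proof -
    have pos: "(\<integral>\<^sup>+y. ennreal (exp (c * (f y - (LINT y|M. f y)))) \<partial>M) \<le> ennreal (exp (c^2 * (B - - B)^2 / 8))"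
      if [measurable]: "f \<in> borel_measurable M" and "\<And>y. \<bar>f y\<bar> \<le> B" and "0 < c" for f c
    proof -
      interpret H: interval_bounded_random_variable M f "- B" B
        by unfold_locales (use that(2) in \<open>auto simp: abs_le_iff minus_le_iff\<close>)
      show ?thesis using H.Hoeffdings_lemma_nn_integral[OF that(3)] by simp
    qed
    have e: "c^2 * (B - - B)^2 / 8 = c^2 * B^2 / 2" for c by (simp add: power2_eq_square)
    consider "c = 0" | "0 < c" | "c < 0" by linarith
    then show ?thesis
    proof cases
      case 1 then show ?thesis by (simp add: emeasure_space_1)
    next
      case 2
      then show ?thesis using pos[OF g gb 2] unfolding e m_def by simp
    next
      case 3
      have "- c * (- g y - (LINT y|M. - g y)) = c * (g y - m)" for y by (simp add: m_def algebra_simps)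
      then show ?thesis using pos[of "\<lambda>y. - g y" "- c"] gb 3 unfolding e by simp
    qed
  qed
  have mgf: "(\<integral>\<^sup>+x. ennreal (exp (c * S x)) \<partial>iid N M) \<le> ennreal (exp (real N * (c^2 * B^2 / 2)))" for c
  proof -
    have "(\<integral>\<^sup>+x. ennreal (exp (c * S x)) \<partial>iid N M) =
      (\<integral>\<^sup>+x. (\<Prod>i<N. ennreal (exp (c * (g (x i) - m)))) \<partial>iid N M)"
      by (simp add: S_def sum_distrib_left exp_sum prod_ennreal)
    also have "... = (\<Prod>i<N. \<integral>\<^sup>+y. ennreal (exp (c * (g y - m))) \<partial>M)" by (rule P.product_nn_integral_prod) auto
    also have "... \<le> (\<Prod>i<N. ennreal (exp (c^2 * B^2 / 2)))" by (intro prod_mono_ennreal hoeff)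
    also have "... = ennreal (exp (c^2 * B^2 / 2) ^ N)" by (simp add: ennreal_power)
    also have "exp (c^2 * B^2 / 2) ^ N = exp (real N * (c^2 * B^2 / 2))" by (rule exp_of_nat_mult[symmetric])
    finally show ?thesis .
  qed
  \<comment> \<open>Chosen so that \<open>(w * S x)^2 / 2\<close> is the exponent
    \<open>l * (S x)^2 / N\<close>.\<close>
  define w where "w = sqrt (2 * l / real N)"
  have w: "w^2 = 2 * l / real N" using l by (simp add: w_def)
  have "(\<integral>\<^sup>+x. ennreal (exp (l * (S x)^2 / real N)) \<partial>iid N M) =
    (\<integral>\<^sup>+x. \<integral>\<^sup>+u. ennreal (exp (w * S x * u) * std_normal_density u) \<partial>lborel \<partial>iid N M)"
  proof (rule nn_integral_cong)
    fix x
    have "(w * S x)^2 / 2 = l * (S x)^2 / real N" by (simp add: power_mult_distrib w)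
    then show "ennreal (exp (l * (S x)^2 / real N)) = (\<integral>\<^sup>+u. ennreal (exp (w * S x * u) * std_normal_density u) \<partial>lborel)"
      by (simp only: gaussian_linearise)
  qed
  also have "... = (\<integral>\<^sup>+u. \<integral>\<^sup>+x. ennreal (exp (w * S x * u) * std_normal_density u) \<partial>iid N M \<partial>lborel)"
  proof -
    interpret pair_sigma_finite "lborel :: real measure" "iid N M"
      by (intro pair_sigma_finite.intro lborel.sigma_finite_measure_axioms PN.sigma_finite_measure_axioms)
    show ?thesis by (rule Fubini') measurable
  qed
  also have "... \<le> (\<integral>\<^sup>+u. ennreal (exp (u^2 / 4) * std_normal_density u) \<partial>lborel)"
  proof (rule nn_integral_mono)
    fix u :: real
    have "(\<integral>\<^sup>+x. ennreal (exp (w * S x * u) * std_normal_density u) \<partial>iid N M) =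
      (\<integral>\<^sup>+x. ennreal (exp ((w * u) * S x)) \<partial>iid N M) * ennreal (std_normal_density u)"
      by (subst nn_integral_multc[symmetric]) (auto simp: ennreal_mult' mult_ac)
    also have "... \<le> ennreal (exp (real N * ((w * u)^2 * B^2 / 2))) * ennreal (std_normal_density u)"
      by (intro mult_right_mono mgf) auto
    also have "real N * ((w * u)^2 * B^2 / 2) = (l * B^2) * u^2" using N by (simp add: power_mult_distrib w)
    also have "ennreal (exp ((l * B^2) * u^2)) * ennreal (std_normal_density u) \<le> ennreal (exp (u^2 / 4)) * ennreal (std_normal_density u)"
    proof (intro mult_right_mono ennreal_leI)
      have "(l * B^2) * u^2 \<le> 1 / 4 * u^2" using l by (intro mult_right_mono) auto
      then show "exp ((l * B^2) * u^2) \<le> exp (u^2 / 4)" by simp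
    qed simp
    also have "... = ennreal (exp (u^2 / 4) * std_normal_density u)" by (simp add: ennreal_mult')
    finally show "(\<integral>\<^sup>+x. ennreal (exp (w * S x * u) * std_normal_density u) \<partial>iid N M) \<le> ennreal (exp (u^2 / 4) * std_normal_density u)" .
  qed
  also have "... \<le> 2" by (rule gaussian_square_moment)
  finally show ?thesis unfolding S_def m_def .
qed

section \<open>Calculus of Lipschitz bounds and first-order expansions\<close>

lemma abs_le_mult: "abs a \<le> A \<Longrightarrow> \<bar>b\<bar> \<le> B \<Longrightarrow> \<bar>a * b\<bar> \<le> A * (B::real)"
  unfolding abs_mult by (intro mult_mono) auto

lemma lip_mult:
  assumes f: "\<And>x. \<bar>f x\<bar> \<le> A" "lip p f" and g: "\<And>x. \<bar>g x\<bar> \<le> B" "lip q g"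
  shows "lip (A * q + B * p) (\<lambda>x. f x * g x)"
  unfolding lip_def
proof (intro allI)
  fix x t
  have "f (x \<oplus> t) * g (x \<oplus> t) - f x * g x = f (x \<oplus> t) * (g (x \<oplus> t) - g x) + g x * (f (x \<oplus> t) - f x)"
    by (simp add: algebra_simps)
  also have "\<bar>...\<bar> \<le> A * (q * abs t) + B * (p * abs t)"
    by (intro order_trans[OF abs_triangle_ineq] add_mono abs_le_mult f g lipD[OF f(2)] lipD[OF g(2)])
  finally show "\<bar>f (x \<oplus> t) * g (x \<oplus> t) - f x * g x\<bar> \<le> (A * q + B * p) * abs t" by (simp add: algebra_simps)
qed

lemma qd_mult:
  assumes f: "\<And>x. \<bar>f x\<bar> \<le> A" "lip p f" "qd L f f'" and g: "\<And>x. \<bar>g x\<bar> \<le> B" "lip q g" "qd M g g'"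
  shows "qd (A * M + B * L + p * q) (\<lambda>x. f x * g x) (\<lambda>x. f' x * g x + f x * g' x)"
  unfolding qd_def
proof (intro allI)
  fix x t
  have "f (x \<oplus> t) * g (x \<oplus> t) - f x * g x - t * (f' x * g x + f x * g' x) =
    f x * (g (x \<oplus> t) - g x - t * g' x) + g x * (f (x \<oplus> t) - f x - t * f' x) + (f (x \<oplus> t) - f x) * (g (x \<oplus> t) - g x)"
    by (simp add: algebra_simps)
  also have "\<bar>...\<bar> \<le> A * (M * t^2) + B * (L * t^2) + (p * abs t) * (q * abs t)"
    by (intro order_trans[OF abs_triangle_ineq] add_mono abs_le_mult f g lipD[OF f(2)] lipD[OF g(2)] qdD[OF f(3)] qdD[OF g(3)])
  also have "... = (A * M + B * L + p * q) * t^2" by (simp add: algebra_simps power2_eq_square)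
  finally show "\<bar>f (x \<oplus> t) * g (x \<oplus> t) - f x * g x - t * (f' x * g x + f x * g' x)\<bar> \<le> (A * M + B * L + p * q) * t^2" .
qed

lemma qd_compose:
  assumes f: "lip p f" "qd L f f'"
    and \<psi>: "\<And>x y. \<bar>\<psi> (f y) - \<psi> (f x) - (f y - f x) * \<psi>' (f x)\<bar> \<le> C * (f y - f x)^2"
    and \<psi>': "\<And>x. \<bar>\<psi>' (f x)\<bar> \<le> D" and C: "0 \<le> C"
  shows "qd (C * p^2 + L * D) (\<lambda>x. \<psi> (f x)) (\<lambda>x. f' x * \<psi>' (f x))"
  unfolding qd_def
proof (intro allI)
  fix x t
  have "\<psi> (f (x \<oplus> t)) - \<psi> (f x) - t * (f' x * \<psi>' (f x)) =
    (\<psi> (f (x \<oplus> t)) - \<psi> (f x) - (f (x \<oplus> t) - f x) * \<psi>' (f x)) + (f (x \<oplus> t) - f x - t * f' x) * \<psi>' (f x)"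
    by (simp add: algebra_simps)
  also have "\<bar>...\<bar> \<le> C * (f (x \<oplus> t) - f x)^2 + (L * t^2) * D"
    by (intro order_trans[OF abs_triangle_ineq] add_mono abs_le_mult \<psi> \<psi>' qdD[OF f(2)])
  also have "C * (f (x \<oplus> t) - f x)^2 \<le> C * (p * abs t)^2"
    using power_mono[OF lipD[OF f(1), of x t], of 2] C by (intro mult_left_mono) auto
  finally show "\<bar>\<psi> (f (x \<oplus> t)) - \<psi> (f x) - t * (f' x * \<psi>' (f x))\<bar> \<le> (C * p^2 + L * D) * t^2"
    by (simp add: algebra_simps power_mult_distrib)
qed

lemma inverse_taylor:
  assumes "0 < c" "c \<le> r" "c \<le> (s::real)"
  shows "\<bar>1 / s - 1 / r - (s - r) * (- 1 / r^2)\<bar> \<le> 1 / c ^ 3 * (s - r)^2"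
proof -
  have "1 / s - 1 / r - (s - r) * (- 1 / r^2) = (s - r)^2 / (r^2 * s)"
    using assms by (simp add: field_simps power2_eq_square)
  moreover have "c ^ 3 \<le> r^2 * s"
  proof -
    have "c^2 \<le> r^2" using assms by (intro power_mono) auto
    then have "c^2 * c \<le> r^2 * s" using assms by (intro mult_mono) auto
    then show ?thesis by (simp add: power2_eq_square power3_eq_cube)
  qed
  ultimately show ?thesis using assms by (simp add: frac_le zero_less_mult_iff)
qed

text \<open>The inequality \<open>ln y \<le> y - 1\<close> at \<open>s / r\<close> and at
  \<open>r / s\<close> brackets the logarithm between two bounds that differ by
  \<open>(s - r)^2 / (r * s)\<close>.\<close>

lemma ln_taylor:
  assumes "0 < c" "c \<le> r" "c \<le> (s::real)"
  shows "\<bar>ln s - ln r - (s - r) * (1 / r)\<bar> \<le> 1 / c^2 * (s - r)^2"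
proof -
  have r: "0 < r" "0 < s" using assms by auto
  have "ln (s / r) \<le> s / r - 1" "ln (r / s) \<le> r / s - 1" using r by (intro ln_le_minus_one; simp)+
  then have 1: "ln s - ln r \<le> s / r - 1" and 2: "1 - r / s \<le> ln s - ln r" using r by (simp_all add: ln_div)
  have "(s - r) * (1 / r) = s / r - 1" "(s / r - 1) - (1 - r / s) = (s - r)^2 / (r * s)"
    using r by (simp_all add: field_simps power2_eq_square)
  with 1 2 have "\<bar>ln s - ln r - (s - r) * (1 / r)\<bar> \<le> (s - r)^2 / (r * s)" by (simp add: abs_le_iff)
  also have "... \<le> (s - r)^2 / c^2"
    using assms mult_mono[of c r c s] by (intro divide_left_mono) (auto simp: power2_eq_square)
  finally show ?thesis by simp
qed

lemma lip_compose:
  assumes f: "lip p f" and \<psi>: "\<And>x y. \<bar>\<psi> (f y) - \<psi> (f x)\<bar> \<le> D * \<bar>f y - f x\<bar>" and D: "0 \<le> D"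
  shows "lip (D * p) (\<lambda>x. \<psi> (f x))"
  unfolding lip_def
proof (intro allI)
  fix x t
  have "\<bar>\<psi> (f (x \<oplus> t)) - \<psi> (f x)\<bar> \<le> D * (p * abs t)" by (intro order_trans[OF \<psi>] mult_left_mono lipD[OF f] D)
  then show "\<bar>\<psi> (f (x \<oplus> t)) - \<psi> (f x)\<bar> \<le> D * p * abs t" by (simp add: mult.assoc)
qed

lemma lip_cmult: "lip p f \<Longrightarrow> 0 \<le> c \<Longrightarrow> lip (c * p) (\<lambda>x. c * f x)"
  by (rule lip_compose) (auto simp: abs_mult right_diff_distrib[symmetric])

lemma qd_affine: assumes "qd L f f'" "0 \<le> c" shows "qd (c * L) (\<lambda>x. b + c * f x) (\<lambda>x. c * f' x)"
  unfolding qd_def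
proof (intro allI)
  fix x t
  have "b + c * f (x \<oplus> t) - (b + c * f x) - t * (c * f' x) = c * (f (x \<oplus> t) - f x - t * f' x)"
    by (simp add: algebra_simps)
  also have "\<bar>...\<bar> \<le> c * (L * t^2)" using assms(2) qdD[OF assms(1)] by (simp add: abs_mult mult_left_mono)
  finally show "\<bar>b + c * f (x \<oplus> t) - (b + c * f x) - t * (c * f' x)\<bar> \<le> c * L * t^2" by (simp add: mult.assoc)
qed

section \<open>Densities and averages\<close>

lemma sets_dens [simp, measurable_cong]: "sets (dens \<rho>) = sets borel" and space_dens [simp]: "space (dens \<rho>) = UNIV"
  by (simp_all add: dens_def)

lemma average_bound:
  assumes "prob_space M" "f \<in> borel_measurable M" "\<And>x. \<bar>f x\<bar> \<le> (B::real)"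
  shows "\<bar>LINT x|M. f x\<bar> \<le> B" "integrable M f"
proof -
  interpret prob_space M by fact
  show int: "integrable M f" by (rule integrable_const_bound[of _ B]) (use assms in auto)
  have "\<bar>LINT x|M. f x\<bar> \<le> (LINT x|M. B)"
    using int assms(3) by (intro order_trans[OF integral_abs_bound] integral_mono) auto
  then show "\<bar>LINT x|M. f x\<bar> \<le> B" by (simp add: prob_space)
qed

lemma lip_average:
  assumes M: "prob_space M" and f: "\<And>x. (\<lambda>z. f x z) \<in> borel_measurable M" "\<And>x z. \<bar>f x z\<bar> \<le> B"
    and lip: "\<And>z. lip L (\<lambda>x. f x z)"
  shows "lip L (\<lambda>x. LINT z|M. f x z)"
  unfolding lip_def
proof (intro allI)
  fix x t
  have "(LINT z|M. f (x \<oplus> t) z) - (LINT z|M. f x z) = (LINT z|M. f (x \<oplus> t) z - f x z)"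
    using average_bound(2)[OF M f] by simp
  also have "\<bar>...\<bar> \<le> L * abs t" by (rule average_bound(1)[OF M]) (use f lipD[OF lip] in auto)
  finally show "\<bar>(LINT z|M. f (x \<oplus> t) z) - (LINT z|M. f x z)\<bar> \<le> L * abs t" .
qed

lemma qd_average:
  assumes M: "prob_space M" and f: "\<And>x. (\<lambda>z. f x z) \<in> borel_measurable M" "\<And>x z. \<bar>f x z\<bar> \<le> B"
    and f': "\<And>x. (\<lambda>z. f' x z) \<in> borel_measurable M" "\<And>x z. \<bar>f' x z\<bar> \<le> B'"
    and qd: "\<And>z. qd L (\<lambda>x. f x z) (\<lambda>x. f' x z)"
  shows "qd L (\<lambda>x. LINT z|M. f x z) (\<lambda>x. LINT z|M. f' x z)"
  unfolding qd_def
proof (intro allI)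
  fix x t
  have "(LINT z|M. f (x \<oplus> t) z) - (LINT z|M. f x z) - t * (LINT z|M. f' x z) = (LINT z|M. f (x \<oplus> t) z - f x z - t * f' x z)"
    using average_bound(2)[OF M f] average_bound(2)[OF M f'] by simp
  also have "\<bar>...\<bar> \<le> L * t^2" by (rule average_bound(1)[OF M]) (use f f' qdD[OF qd] in auto)
  finally show "\<bar>(LINT z|M. f (x \<oplus> t) z) - (LINT z|M. f x z) - t * (LINT z|M. f' x z)\<bar> \<le> L * t^2" .
qed

lemma nn_integral_PiM_density:
  assumes \<rho>[measurable]: "\<rho> \<in> borel_measurable borel" and P: "prob_space (dens \<rho>)"
    and f: "f \<in> borel_measurable (torus_pow N)"
  shows "(\<integral>\<^sup>+x. f x \<partial>iid N (dens \<rho>)) = (\<integral>\<^sup>+x. (\<Prod>i<N. ennreal (\<rho> (x i))) * f x \<partial>iid N leb)"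
proof -
  interpret d: prob_space "dens \<rho>" by fact
  interpret D: product_sigma_finite "\<lambda>_::nat. dens \<rho>" by standard
  have [measurable]: "(\<lambda>x. \<Prod>i<N. ennreal (\<rho> (x i))) \<in> borel_measurable (iid N leb)"
    by (intro borel_measurable_prod_ennreal) auto
  have "density (iid N leb) (\<lambda>x. \<Prod>i<N. ennreal (\<rho> (x i))) = iid N (dens \<rho>)"
  proof (rule D.PiM_eqI)
    show "sets (density (iid N leb) (\<lambda>x. \<Prod>i<N. ennreal (\<rho> (x i)))) = sets (iid N (dens \<rho>))"
      by (simp, intro sets_PiM_cong) auto
    fix A assume "\<And>i. i \<in> {..<N} \<Longrightarrow> A i \<in> sets (dens \<rho>)"
    then have [measurable]: "A i \<in> sets borel" if "i < N" for i using that by simp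
    have PA: "Pi\<^sub>E {..<N} A \<in> sets (iid N leb)" by (intro sets_PiM_I_finite) auto
    have "emeasure (density (iid N leb) (\<lambda>x. \<Prod>i<N. ennreal (\<rho> (x i)))) (Pi\<^sub>E {..<N} A) =
      (\<integral>\<^sup>+x. (\<Prod>i<N. ennreal (\<rho> (x i))) * indicator (Pi\<^sub>E {..<N} A) x \<partial>iid N leb)"
      by (rule emeasure_density[OF _ PA]) measurable
    also have "... = (\<integral>\<^sup>+x. (\<Prod>i<N. ennreal (\<rho> (x i)) * indicator (A i) (x i)) \<partial>iid N leb)"
    proof (intro nn_integral_cong)
      fix x assume "x \<in> space (iid N leb)"
      then have "indicator (Pi\<^sub>E {..<N} A) x = (\<Prod>i<N. indicator (A i) (x i) :: ennreal)"
        by (auto simp: indicator_def space_PiM PiE_def Pi_def prod_eq_1_iff split: if_splits intro!: prod_zero[symmetric])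
      then show "(\<Prod>i<N. ennreal (\<rho> (x i))) * indicator (Pi\<^sub>E {..<N} A) x = (\<Prod>i<N. ennreal (\<rho> (x i)) * indicator (A i) (x i))"
        by (simp add: prod.distrib)
    qed
    also have "... = (\<Prod>i<N. \<integral>\<^sup>+y. ennreal (\<rho> y) * indicator (A i) y \<partial>leb)"
      by (rule leb_prod.product_nn_integral_prod) auto
    also have "... = (\<Prod>i<N. emeasure (dens \<rho>) (A i))"
      unfolding dens_def by (intro prod.cong refl, subst emeasure_density) auto
    finally show "emeasure (density (iid N leb) (\<lambda>x. \<Prod>i<N. ennreal (\<rho> (x i)))) (Pi\<^sub>E {..<N} A) =
      (\<Prod>i<N. emeasure (dens \<rho>) (A i))" .
  qed simp
  then have "(\<integral>\<^sup>+x. f x \<partial>iid N (dens \<rho>)) = (\<integral>\<^sup>+x. f x \<partial>density (iid N leb) (\<lambda>x. \<Prod>i<N. ennreal (\<rho> (x i))))" by simp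
  also have "... = (\<integral>\<^sup>+x. (\<Prod>i<N. ennreal (\<rho> (x i))) * f x \<partial>iid N leb)"
    by (rule nn_integral_density) (use f in \<open>auto cong: measurable_cong_sets\<close>)
  finally show ?thesis .
qed

section \<open>One step of the particle system\<close>

text \<open>The factor 64 gives \<open>dt * H \<le> 1 / 64\<close>. This keeps the derivative
  \<open>a\<close> of the displacement map close to 1, makes that map invertible, leaves room for
  the losses \<open>8 * (dt * H)^2\<close> of the elimination, and keeps the relative change of the
  Jacobian below 1/2, where the logarithm can be expanded.\<close>

locale mean_field_step =
  fixes h :: "torus \<Rightarrow> torus \<Rightarrow> real" and H dt \<kappa> K :: real and \<rho> :: "torus \<Rightarrow> real"
  assumes h: "Ck_torus2 3 h" and H: "H = Ck_norm_torus2 3 h"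
    and dt: "0 < dt" "dt < 1 / (64 * (1 + H))"
    and \<kappa>: "0 < \<kappa>"
    and \<rho>: "Ck_torus 2 \<rho>" "prob_space (dens \<rho>)" "\<And>x. \<kappa> \<le> \<rho> x" "Ck_norm_torus 2 \<rho> \<le> K"
begin

lemma H_nonneg: "0 \<le> H" unfolding H by (rule hpart_norm_nonneg[OF h])

lemma dtH: "0 \<le> dt * H" "dt * H \<le> 1 / 64" "dt \<le> 1"
proof -
  have *: "dt * (64 * (1 + H)) \<le> 1" using dt H_nonneg by (simp add: less_divide_eq)
  show "0 \<le> dt * H" using dt H_nonneg by simp
  then show "dt * H \<le> 1 / 64" "dt \<le> 1" using * dt by (simp_all add: algebra_simps)
qed

abbreviation "h1 \<equiv> hpart h [0]"
abbreviation "h11 \<equiv> hpart h [0, 0]"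
abbreviation "\<mu> \<equiv> dens \<rho>"

lemma h_bounds: "\<bar>h x z\<bar> \<le> H" "\<bar>h1 x z\<bar> \<le> H" "\<bar>h11 x z\<bar> \<le> H"
  using hpart_bound[OF h, of "[]" x z] hpart_bound[OF h, of "[0]" x z] hpart_bound[OF h, of "[0, 0]" x z]
  by (simp_all add: hpart_Nil[OF h] H)

lemma h_measurable [measurable (raw)]:
  assumes "f \<in> measurable M borel" "g \<in> measurable M borel"
  shows "(\<lambda>w. h (f w) (g w)) \<in> borel_measurable M" "(\<lambda>w. h1 (f w) (g w)) \<in> borel_measurable M"
    "(\<lambda>w. h11 (f w) (g w)) \<in> borel_measurable M"
  using hpart_measurable[OF h, of "[]" f M g] hpart_measurable[OF h, of "[0]" f M g] hpart_measurable[OF h, of "[0, 0]" f M g] assms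
  by (simp_all add: hpart_Nil[OF h])

lemma h_lip: "lip H (\<lambda>x. h x z)" "lip H (\<lambda>z. h x z)" "lip H (\<lambda>x. h1 x z)" "lip H (\<lambda>z. h1 x z)" "lip H (\<lambda>x. h11 x z)"
  using hpart_lip_fst[OF h, of "[]" z] hpart_lip_snd[OF h, of "[]" x] hpart_lip_fst[OF h, of "[0]" z]
    hpart_lip_snd[OF h, of "[0]" x] hpart_lip_fst[OF h, of "[0, 0]" z] by (simp_all add: hpart_Nil[OF h] H)

lemma h_qd: "qd H (\<lambda>x. h x z) (\<lambda>x. h1 x z)" "qd H (\<lambda>x. h1 x z) (\<lambda>x. h11 x z)"
  using hpart_qd_fst[OF h, of "[]" z] hpart_qd_fst[OF h, of "[0]" z] by (simp_all add: hpart_Nil[OF h] H)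

sublocale \<mu>: prob_space \<mu> by (rule \<rho>(2))

definition s where "s x = (LINT z|\<mu>. h x z)"
definition s1 where "s1 x = (LINT z|\<mu>. h1 x z)"
definition s2 where "s2 x = (LINT z|\<mu>. h11 x z)"
text \<open>The derivative of the displacement map \<open>S\<close> introduced below.\<close>

definition a where "a x = 1 + dt * s1 x"
definition a' where "a' x = dt * s2 x"
definition ia where "ia x = 1 / a x"
definition ia' where "ia' x = a' x * (- 1 / (a x)^2)"
definition \<rho>' where "\<rho>' = torus_deriv \<rho>"
text \<open>At \<open>x\<close>, the density at the point \<open>S x\<close> of the push-forward of
  \<open>\<mu>\<close> under \<open>S\<close>.\<close>

definition w where "w x = \<rho> x * ia x"
definition w' where "w' x = \<rho>' x * ia x + \<rho> x * ia' x"
definition l where "l x = ln (w x)"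
definition l' where "l' x = w' x * (1 / w x)"
text \<open>The derivative of \<open>l \<circ> S_inv\<close> at the point
  \<open>S x\<close>.\<close>

definition u where "u x = l' x * ia x"

lemma s_props: "\<bar>s x\<bar> \<le> H" "\<bar>s1 x\<bar> \<le> H" "\<bar>s2 x\<bar> \<le> H" "lip H s" "lip H s1" "lip H s2" "qd H s s1" "qd H s1 s2"
proof -
  note m = h_measurable[of "\<lambda>_. _" \<mu> "\<lambda>z. z", simplified]
  show "\<bar>s x\<bar> \<le> H" "\<bar>s1 x\<bar> \<le> H" "\<bar>s2 x\<bar> \<le> H"
    unfolding s_def s1_def s2_def by (rule average_bound[OF \<rho>(2)]; (rule h_bounds)?; measurable)+
  show "lip H s" "lip H s1" "lip H s2"
    unfolding s_def s1_def s2_def by (rule lip_average[OF \<rho>(2)]; (rule h_bounds h_lip)?; measurable)+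
  show "qd H s s1" "qd H s1 s2"
    unfolding s_def s1_def s2_def by (rule qd_average[OF \<rho>(2)]; (rule h_bounds h_qd)?; measurable)+
qed

lemma a_props: "63 / 64 \<le> a x" "a x \<le> 65 / 64" "lip 1 a" "qd 1 a a'"
proof -
  have "\<bar>dt * s1 x\<bar> \<le> dt * H" using s_props(2)[of x] dt by (simp add: abs_mult)
  then show "63 / 64 \<le> a x" "a x \<le> 65 / 64" using dtH unfolding a_def by (simp_all add: abs_le_iff)
  have "lip (dt * H) a" using lip_cmult[OF s_props(5), of dt] dt unfolding a_def lip_def by simp
  then show "lip 1 a" by (rule lip_mono) (use dtH in simp)
  have "qd (dt * H) a a'" unfolding a_def a'_def by (rule qd_affine[OF s_props(8)]) (use dt in simp)
  then show "qd 1 a a'" by (rule qd_mono) (use dtH in simp)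
qed

lemma a_pos: "1 / 2 \<le> a x" "0 < a x" "a x \<le> 2" using a_props(1,2)[of x] by linarith+

lemma ia_props: "0 < ia x" "1 / 2 \<le> ia x" "ia x \<le> 2" "\<bar>ia x\<bar> \<le> 2" "lip 4 ia" "qd 12 ia ia'"
proof -
  show 1: "0 < ia x" "1 / 2 \<le> ia x" "ia x \<le> 2" using a_pos[of x] by (simp_all add: ia_def divide_le_eq le_divide_eq)
  then show "\<bar>ia x\<bar> \<le> 2" by simp
  have inv: "\<bar>1 / a y - 1 / a x\<bar> \<le> 4 * \<bar>a y - a x\<bar>" for x y
  proof -
    have "1 / a y - 1 / a x = (a x - a y) / (a x * a y)" using a_pos[of x] a_pos[of y] by (simp add: field_simps)
    moreover have m: "1 / 4 \<le> a x * a y" using mult_mono[of "1/2" "a x" "1/2" "a y"] a_pos[of x] a_pos[of y] by simp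
    ultimately have "\<bar>1 / a y - 1 / a x\<bar> = \<bar>a y - a x\<bar> / (a x * a y)" by (simp add: abs_divide abs_minus_commute)
    also have "... \<le> \<bar>a y - a x\<bar> / (1 / 4)" using m by (intro divide_left_mono) auto
    finally show ?thesis by simp
  qed
  show "lip 4 ia" using lip_compose[OF a_props(3), of "\<lambda>r. 1 / r" 4, OF inv] by (simp add: ia_def[abs_def])
  have "qd (8 * 1^2 + 1 * 4) (\<lambda>x. 1 / a x) (\<lambda>x. a' x * (- 1 / (a x)^2))"
  proof (rule qd_compose[OF a_props(3,4), where \<psi> = "\<lambda>r. 1 / r" and \<psi>' = "\<lambda>r. - 1 / r^2"])
    show "\<bar>1 / a y - 1 / a x - (a y - a x) * (- 1 / (a x)^2)\<bar> \<le> 8 * (a y - a x)^2" for x y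
      using inverse_taylor[of "1/2" "a x" "a y"] a_pos by (simp add: power3_eq_cube)
    show "\<bar>- 1 / (a x)^2\<bar> \<le> 4" for x
      using power_mono[OF a_pos(1)[of x], of 2] by (simp add: divide_le_eq power2_eq_square)
  qed simp
  then show "qd 12 ia ia'" by (simp add: ia_def[abs_def] ia'_def[abs_def])
qed

lemma \<rho>_props: "\<bar>\<rho> x\<bar> \<le> K" "lip K \<rho>" "qd K \<rho> \<rho>'" "0 < K" "\<bar>\<rho>' x\<bar> \<le> K" "\<rho> \<in> borel_measurable borel" "0 < \<rho> x"
proof -
  note C = C11D[OF Ck_torus_C11[OF \<rho>(1)]]
  show "\<bar>\<rho> x\<bar> \<le> K" for x using C(1)[of x] \<rho>(4) by linarith
  then show "0 < K" using \<rho>(3)[of undefined] \<kappa> by (meson abs_ge_self less_le_trans)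
  show L: "lip K \<rho>" by (rule lip_mono[OF C(2) \<rho>(4)])
  show Q: "qd K \<rho> \<rho>'" unfolding \<rho>'_def by (rule qd_mono[OF C(3) \<rho>(4)])
  show "\<bar>\<rho>' x\<bar> \<le> K" by (rule lip_deriv_bound[OF L Q])
  show "\<rho> \<in> borel_measurable borel" by (rule lip_measurable[OF L])
  show "0 < \<rho> x" using \<rho>(3)[of x] \<kappa> by linarith
qed

lemma w_props: "\<kappa> / 2 \<le> w x" "0 < w x" "\<bar>w x\<bar> \<le> 2 * K" "lip (6 * K) w" "qd (18 * K) w w'" "\<bar>w' x\<bar> \<le> 6 * K"
proof -
  have "\<kappa> * (1 / 2) \<le> \<rho> x * ia x" using \<rho>(3) ia_props(2) \<kappa> \<rho>_props(7)[of x] by (intro mult_mono) auto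
  then show "\<kappa> / 2 \<le> w x" by (simp add: w_def)
  then show "0 < w x" using \<kappa> by linarith
  show "\<bar>w x\<bar> \<le> 2 * K" unfolding w_def using abs_le_mult[OF \<rho>_props(1) ia_props(4), of x x] by simp
  have "lip (K * 4 + 2 * K) w" unfolding w_def by (rule lip_mult[OF \<rho>_props(1,2) ia_props(4,5)])
  then show L: "lip (6 * K) w" by simp
  have "qd (K * 12 + 2 * K + K * 4) w w'" unfolding w_def w'_def by (rule qd_mult[OF \<rho>_props(1,2,3) ia_props(4,5,6)])
  then show Q: "qd (18 * K) w w'" by simp
  show "\<bar>w' x\<bar> \<le> 6 * K" by (rule lip_deriv_bound[OF L Q])
qed

text \<open>\<open>C1\<close> and \<open>Cl\<close> come from the chain rule for \<open>ln\<close>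
  on values at least \<open>\<kappa> / 2\<close>, applied to \<open>w\<close> with Lipschitz
  constant \<open>6 * K\<close> and expansion constant \<open>18 * K\<close>.\<close>

definition C1 where "C1 = 12 * K / \<kappa>"
definition Cl where "Cl = 144 * K^2 / \<kappa>^2 + 36 * K / \<kappa>"

lemma C_nonneg: "0 \<le> C1" "0 \<le> Cl" using \<kappa> \<rho>_props(4) by (auto simp: C1_def Cl_def)

lemma l_props: "lip C1 l" "qd Cl l l'" "\<bar>l' x\<bar> \<le> C1" "\<bar>u x\<bar> \<le> 2 * C1"
proof -
  have iw: "\<bar>1 / w x\<bar> \<le> 2 / \<kappa>" for x using w_props(1,2)[of x] \<kappa> by (simp add: divide_le_eq le_divide_eq field_simps)
  have Q: "qd (1 / (\<kappa> / 2)^2 * (6 * K)^2 + 18 * K * (2 / \<kappa>)) (\<lambda>x. ln (w x)) (\<lambda>x. w' x * (1 / w x))"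
    by (rule qd_compose[OF w_props(4,5), where \<psi> = ln and \<psi>' = "\<lambda>r. 1 / r"])
       (use ln_taylor[of "\<kappa> / 2"] w_props(1) \<kappa> iw in auto)
  then show "qd Cl l l'" by (simp add: l_def[abs_def] l'_def[abs_def] Cl_def power_divide power_mult_distrib)
  show l': "\<bar>l' x\<bar> \<le> C1" for x using abs_le_mult[OF w_props(6)[of x] iw[of x]] by (simp add: l'_def C1_def)
  have lnl: "\<bar>ln (w y) - ln (w x)\<bar> \<le> 2 / \<kappa> * \<bar>w y - w x\<bar>" for x y
  proof -
    have *: "ln p - ln q \<le> 2 / \<kappa> * \<bar>p - q\<bar>" if "0 < p" "\<kappa> / 2 \<le> q" for p q
    proof -
      have q: "0 < q" using that \<kappa> by linarith
      have "ln p - ln q = ln (p / q)" using that q by (simp add: ln_div)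
      also have "... \<le> p / q - 1" using that q by (intro ln_le_minus_one) simp
      also have "... = (p - q) / q" using q by (simp add: diff_divide_distrib)
      also have "... \<le> \<bar>p - q\<bar> / q" using q by (intro divide_right_mono) auto
      also have "... \<le> \<bar>p - q\<bar> / (\<kappa> / 2)" using that \<kappa> q by (intro divide_left_mono) auto
      finally show ?thesis by (simp add: mult.commute)
    qed
    show ?thesis using *[of "w y" "w x"] *[of "w x" "w y"] w_props(1,2)[of x] w_props(1,2)[of y]
      by (simp add: abs_le_iff abs_minus_commute)
  qed
  have "lip (2 / \<kappa> * (6 * K)) l"
    unfolding l_def[abs_def] by (rule lip_compose[OF w_props(4), where \<psi> = ln, OF lnl]) (use \<kappa> in simp)
  then show "lip C1 l" by (simp add: C1_def)
  show "\<bar>u x\<bar> \<le> 2 * C1" using abs_le_mult[OF l'[of x] ia_props(4)[of x]] by (simp add: u_def)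
qed

text \<open>Linear response of the log-density at \<open>x\<close> to a change of the drift by
  \<open>h x z\<close>: the first term comes from displacing the point, the second from the change
  of the Jacobian.\<close>

definition \<Phi> where "\<Phi> x z = u x * h x z + h1 x z * ia x"
definition C\<Phi> where "C\<Phi> = (2 * C1 + 2) * H"

lemma \<Phi>_lip: "lip C\<Phi> (\<Phi> x)"
  unfolding lip_def
proof (intro allI)
  fix z t
  have "\<Phi> x (z \<oplus> t) - \<Phi> x z = u x * (h x (z \<oplus> t) - h x z) + ia x * (h1 x (z \<oplus> t) - h1 x z)"
    by (simp add: \<Phi>_def algebra_simps)
  also have "\<bar>...\<bar> \<le> (2 * C1) * (H * abs t) + 2 * (H * abs t)"
    by (intro order_trans[OF abs_triangle_ineq] add_mono abs_le_mult l_props(4) ia_props(4) lipD[OF h_lip(2)] lipD[OF h_lip(4)])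
  finally show "\<bar>\<Phi> x (z \<oplus> t) - \<Phi> x z\<bar> \<le> C\<Phi> * abs t" by (simp add: C\<Phi>_def algebra_simps)
qed

lemma measurable_coeffs [measurable]: "a \<in> borel_measurable borel" "ia \<in> borel_measurable borel" "w \<in> borel_measurable borel"
  "l \<in> borel_measurable borel" "u \<in> borel_measurable borel" "\<rho> \<in> borel_measurable borel" "s \<in> borel_measurable borel"
proof -
  show [measurable]: "a \<in> borel_measurable borel" "ia \<in> borel_measurable borel" "w \<in> borel_measurable borel"
    "l \<in> borel_measurable borel" "\<rho> \<in> borel_measurable borel" "s \<in> borel_measurable borel"
    using lip_measurable a_props ia_props w_props l_props \<rho>_props s_props by blast+
  have [measurable]: "l' \<in> borel_measurable borel" by (rule lip_measurable[OF qd_deriv_lip[OF l_props(2)]])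
  show "u \<in> borel_measurable borel" unfolding u_def by measurable
qed

lemma \<Phi>_measurable [measurable (raw)]:
  assumes [measurable]: "f \<in> measurable M borel" "g \<in> measurable M borel"
  shows "(\<lambda>x. \<Phi> (f x) (g x)) \<in> borel_measurable M"
  unfolding \<Phi>_def by measurable

lemma \<Phi>_bound: "\<bar>\<Phi> x z\<bar> \<le> C\<Phi>"
proof -
  have "\<bar>\<Phi> x z\<bar> \<le> (2 * C1) * H + H * 2"
    unfolding \<Phi>_def by (intro order_trans[OF abs_triangle_ineq] add_mono abs_le_mult l_props(4) ia_props(4) h_bounds)
  then show ?thesis by (simp add: C\<Phi>_def algebra_simps)
qed

text \<open>The first-order kernel is a divergence with respect to \<open>\<mu>\<close>: this cancellation is what keeps
  the entropy production of order one instead of order \<open>N\<close>.\<close>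

lemma \<Phi>_mean_zero: "(LINT x|\<mu>. \<Phi> x z) = 0"
proof -
  have "(LINT x|\<mu>. \<Phi> x z) = (LINT x|leb. \<rho> x * \<Phi> x z)"
    unfolding dens_def by (subst integral_density) (auto intro!: AE_I2 less_imp_le \<rho>_props)
  also have "... = (LINT x|leb. w' x * h x z + w x * h1 x z)"
  proof (intro bochner_cong refl)
    fix x
    \<comment> \<open>Since \<open>w = \<rho> * ia\<close> and \<open>u = w' / w * ia\<close>. Hence
      \<open>\<rho> x * \<Phi> x z\<close> is the derivative in \<open>x\<close> of
      \<open>w x * h x z\<close>, and its integral over the circle vanishes.\<close>
    have "\<rho> x * u x = w' x"
      using w_props(2)[of x] \<rho>_props(7)[of x] ia_props(1)[of x] by (simp add: u_def l'_def w_def)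
    then show "\<rho> x * \<Phi> x z = w' x * h x z + w x * h1 x z"
      unfolding \<Phi>_def distrib_left by (simp add: mult.assoc[symmetric]) (simp add: w_def mult_ac)
  qed
  also have "... = 0"
    by (rule lip_integral_shift_0[OF qd_mult[OF w_props(3-5) h_bounds(1) h_lip(1) h_qd(1)] lip_mult[OF w_props(3,4) h_bounds(1) h_lip(1)]])
  finally show ?thesis .
qed

definition \<sigma> where "\<sigma> = inv_shift (\<lambda>x. dt * s x)"
definition S where "S x = x \<oplus> dt * s x"
definition S_inv where "S_inv y = y \<oplus> \<sigma> y"

lemma dts_lip: "lip (1 / 64) (\<lambda>x. dt * s x)"
  by (rule lip_mono[OF lip_cmult[OF s_props(4)]]) (use dt dtH in auto)

lemma S_inv_S [simp]: "S_inv (S x) = x"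
  using inv_shift_shift[OF dts_lip, of x] by (simp add: S_inv_def S_def \<sigma>_def)

lemma S_S_inv [simp]: "S (S_inv y) = y"
  using inv_shift_eq[OF dts_lip, of y] unfolding S_inv_def S_def \<sigma>_def by (simp add: torus_add_add)

text \<open>\<open>S_inv\<close> has derivative \<open>ia (S_inv y)\<close>. The remainder of
  \<open>dt * s\<close> along \<open>\<tau>\<close> is at most \<open>\<tau>^2 / 64\<close>, hence
  at most \<open>t^2 / 16\<close>, and multiplying by \<open>ia \<le> 2\<close> keeps it below
  \<open>t^2\<close>.\<close>

lemma S_inv_shift:
  obtains \<tau> where "\<tau> = t + \<sigma> (y \<oplus> t) - \<sigma> y" "S_inv (y \<oplus> t) = S_inv y \<oplus> \<tau>" "abs \<tau> \<le> 2 * abs t"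
    "\<bar>\<tau> - t * ia (S_inv y)\<bar> \<le> t^2" "\<bar>\<sigma> (y \<oplus> t) - \<sigma> y\<bar> \<le> 1 / 32 * abs t"
proof -
  let ?x = "S_inv y"
  obtain \<tau> where \<tau>: "\<tau> = t + \<sigma> (y \<oplus> t) - \<sigma> y" "S_inv (y \<oplus> t) = S_inv y \<oplus> \<tau>"
    "\<tau> + dt * s (?x \<oplus> \<tau>) - dt * s ?x = t"
    using inv_shift_increment[OF dts_lip, of t y] unfolding \<sigma>_def S_inv_def by auto
  have e: "\<bar>dt * s (?x \<oplus> \<tau>) - dt * s ?x\<bar> \<le> 1 / 64 * abs \<tau>" by (rule lipD[OF dts_lip])
  then have 1: "abs \<tau> \<le> 2 * abs t" using \<tau>(3) by linarith
  have 2: "\<bar>\<sigma> (y \<oplus> t) - \<sigma> y\<bar> \<le> 1 / 32 * abs t" using \<tau>(1,3) e 1 by linarith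
  have "\<bar>s (?x \<oplus> \<tau>) - s ?x - \<tau> * s1 ?x\<bar> \<le> H * \<tau>^2" by (rule qdD[OF s_props(7)])
  then have "dt * \<bar>s (?x \<oplus> \<tau>) - s ?x - \<tau> * s1 ?x\<bar> \<le> dt * (H * \<tau>^2)" using dt by (intro mult_left_mono) auto
  also have "... \<le> 1 / 64 * \<tau>^2" using dtH mult_right_mono[of "dt * H" "1 / 64" "\<tau>^2"] by (simp add: mult.assoc)
  also have "\<tau>^2 \<le> (2 * abs t)^2" using power_mono[OF 1, of 2] by simp
  finally have 3: "dt * \<bar>s (?x \<oplus> \<tau>) - s ?x - \<tau> * s1 ?x\<bar> \<le> 1 / 16 * t^2" by (simp add: power_mult_distrib)
  have "\<tau> * a ?x - t = - (dt * (s (?x \<oplus> \<tau>) - s ?x - \<tau> * s1 ?x))"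
    using \<tau>(3) unfolding a_def by (simp add: algebra_simps)
  then have "\<bar>\<tau> * a ?x - t\<bar> = dt * \<bar>s (?x \<oplus> \<tau>) - s ?x - \<tau> * s1 ?x\<bar>" using dt by (simp add: abs_mult)
  with 3 have 4: "\<bar>\<tau> * a ?x - t\<bar> \<le> 1 / 16 * t^2" by simp
  have "\<tau> - t * ia ?x = (\<tau> * a ?x - t) * ia ?x" using a_pos(2)[of ?x] by (simp add: ia_def field_simps)
  then have "\<bar>\<tau> - t * ia ?x\<bar> \<le> (1 / 16 * t^2) * 2" using abs_le_mult[OF 4 ia_props(4)] by simp
  also have "... \<le> t^2" by simp
  finally show thesis using that \<tau> 1 2 by blast
qed

lemma \<sigma>_measurable [measurable]: "\<sigma> \<in> borel_measurable borel"
proof (rule lip_measurable)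
  show "lip (1 / 32) \<sigma>" unfolding lip_def using S_inv_shift by blast
qed

lemma S_inv_measurable [measurable]: "S_inv \<in> borel_measurable borel"
  unfolding S_inv_def by measurable

text \<open>A product map, so the off-diagonal constant is 0. The 8 is the Lipschitz constant 4 of
  \<open>ia\<close> times the factor 2 by which \<open>S_inv\<close> may stretch.\<close>

lemma near_id_S_inv: "near_id n (1 / 32) 0 8 (\<lambda>i x. \<sigma> (x i)) (\<lambda>i x. ia (S_inv (x i)))"
  unfolding near_id_def
proof (intro allI impI conjI)
  fix i assume i: "i < n"
  show "(\<lambda>x. \<sigma> (x i)) \<in> borel_measurable (torus_pow n)" "(\<lambda>x. ia (S_inv (x i))) \<in> borel_measurable (torus_pow n)"
  proof -
    have [measurable]: "(\<lambda>x. x i) \<in> measurable (torus_pow n) borel"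
      using i by (intro measurable_component_singleton) auto
    show "(\<lambda>x. \<sigma> (x i)) \<in> borel_measurable (torus_pow n)" by measurable
    show "(\<lambda>x. ia (S_inv (x i))) \<in> borel_measurable (torus_pow n)" by measurable
  qed
  fix x :: "nat \<Rightarrow> torus" and t :: real
  obtain \<tau> where \<tau>: "\<tau> = t + \<sigma> (x i \<oplus> t) - \<sigma> (x i)" "S_inv (x i \<oplus> t) = S_inv (x i) \<oplus> \<tau>" "abs \<tau> \<le> 2 * abs t"
    "\<bar>\<tau> - t * ia (S_inv (x i))\<bar> \<le> t^2" "\<bar>\<sigma> (x i \<oplus> t) - \<sigma> (x i)\<bar> \<le> 1 / 32 * abs t"
    by (rule S_inv_shift)
  show "\<bar>\<sigma> ((x(i := x i \<oplus> t)) i) - \<sigma> (x i)\<bar> \<le> 1 / 32 * abs t" using \<tau>(5) by simp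
  have "0 \<le> t^2" by simp
  then show "ia (S_inv (x i)) * t - 8 * t^2 \<le> t + \<sigma> ((x(i := x i \<oplus> t)) i) - \<sigma> (x i)"
    using \<tau>(1,4) by (simp add: mult.commute abs_le_iff)
  fix k
  show "\<bar>\<sigma> ((x(k := x k \<oplus> t)) i) - \<sigma> (x i)\<bar> \<le> 0 * abs t" if "k \<noteq> i" using that by simp
  show "\<bar>ia (S_inv ((x(k := x k \<oplus> t)) i)) - ia (S_inv (x i))\<bar> \<le> 8 * abs t"
  proof (cases "k = i")
    case True
    have "\<bar>ia (S_inv (x i) \<oplus> \<tau>) - ia (S_inv (x i))\<bar> \<le> 4 * abs \<tau>" by (rule lipD[OF ia_props(5)])
    then show ?thesis using True \<tau>(2,3) by simp
  qed simp
qed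

end

section \<open>Empirical measures\<close>

lemma integral_empirical:
  fixes f :: "torus \<Rightarrow> real"
  assumes N: "0 < N" and f: "f \<in> borel_measurable borel"
  shows "(LINT y|empirical N x. f y) = (\<Sum>k<N. f (x k)) / real N"
  unfolding empirical_def
  by (subst integral_distr) (use f N in \<open>auto simp: uniform_count_measure_def lebesgue_integral_point_measure_finite sum_divide_distrib\<close>)

lemma empirical_prob: "0 < N \<Longrightarrow> prob_space (empirical N x)" and sets_empirical [simp, measurable_cong]: "sets (empirical N x) = sets borel"
  by (auto simp: empirical_def intro!: prob_space.prob_space_distr prob_space_uniform_count_measure)

lemma measure_empirical:
  assumes "0 < N" "A \<in> sets borel"
  shows "measure (empirical N x) A = (\<Sum>k<N. indicator A (x k)) / real N"
proof -
  interpret prob_space "empirical N x" by (rule empirical_prob[OF assms(1)])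
  have "space (empirical N x) = UNIV" using sets_eq_imp_space_eq[OF sets_empirical] by simp
  then have "measure (empirical N x) A = (LINT y|empirical N x. indicator A y)" by simp
  then show ?thesis using integral_empirical[OF assms(1), of "indicator A"] assms(2) by simp
qed

text \<open>Jensen's inequality, from the tangent of \<open>exp\<close> at the mean.\<close>

lemma exp_average_le:
  assumes N: "0 < N"
  shows "exp ((\<Sum>k<N. p k) / real N) \<le> (\<Sum>k<N. exp (p k)) / real N"
proof -
  define m where "m = (\<Sum>k<N. p k) / real N"
  have "exp m * (1 + (p k - m)) \<le> exp (p k)" for k
    using mult_left_mono[OF exp_ge_add_one_self[of "p k - m"], of "exp m"] by (simp add: mult_exp_exp)
  then have "(\<Sum>k<N. exp m * (1 + (p k - m))) \<le> (\<Sum>k<N. exp (p k))" by (intro sum_mono)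
  also have "(\<Sum>k<N. exp m * (1 + (p k - m))) = exp m * real N"
    using N by (simp add: sum_distrib_left[symmetric] sum.distrib sum_subtractf m_def)
  finally show ?thesis using N by (simp add: m_def le_divide_eq)
qed

section \<open>The density created by one particle step\<close>

context mean_field_step
begin

definition dd where "dd N i x = dt / real N * (\<Sum>k<N. h (x i) (x k))"
text \<open>A lower bound for the diagonal Jacobian entry. The correction \<open>dt * H / N\<close>
  pays for the self-interaction \<open>k = i\<close>, where the second argument of \<open>h\<close>
  moves as well.\<close>

definition JJ where "JJ N i x = 1 + dt / real N * (\<Sum>k<N. h1 (x i) (x k)) - dt * H / real N"
text \<open>Twice the square of \<open>2 * dt * H / N\<close>, a bound on the off-diagonal entries
  that survives all \<open>N\<close> elimination rounds.\<close>

definition \<gamma> where "\<gamma> N = 8 * (dt * H)^2 / (real N)^2"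
definition J where "J N i x = JJ N i x - real N * \<gamma> N"
definition Tm where "Tm N i x = x i \<oplus> dd N i x"
definition Psi where "Psi N x = (\<lambda>i\<in>{..<N}. S_inv (Tm N i x))"
text \<open>The logarithm of the product density times the Jacobian bounds, relative to its value
  before the step: \<open>w\<close> at the preimages and \<open>J\<close> enter the numerator,
  \<open>\<rho> = w * a\<close> the denominator.\<close>

definition G where "G N x = (\<Sum>i<N. l (S_inv (Tm N i x)) - l (x i) + ln (J N i x) - ln (a (x i)))"

lemma measurable_coord: "i < N \<Longrightarrow> (\<lambda>x. x i) \<in> measurable (torus_pow N) borel"
  by (intro measurable_component_singleton) auto

lemma dd_measurable [measurable]: "i < N \<Longrightarrow> dd N i \<in> borel_measurable (torus_pow N)"
  and JJ_measurable [measurable]: "i < N \<Longrightarrow> JJ N i \<in> borel_measurable (torus_pow N)"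
  supply [measurable] = measurable_coord unfolding dd_def JJ_def by measurable

lemma J_measurable [measurable]: "i < N \<Longrightarrow> J N i \<in> borel_measurable (torus_pow N)"
  and Tm_measurable [measurable]: "i < N \<Longrightarrow> Tm N i \<in> measurable (torus_pow N) borel"
  supply [measurable] = measurable_coord unfolding J_def Tm_def by measurable

lemma Psi_measurable [measurable]: "Psi N \<in> measurable (torus_pow N) (torus_pow N)"
  unfolding Psi_def by (rule measurable_torus_pow_restrict) measurable

lemma G_measurable [measurable]: "G N \<in> borel_measurable (torus_pow N)"
  supply [measurable] = measurable_coord unfolding G_def by measurable

text \<open>Moving particle \<open>m\<close> changes one summand through the second argument, and
  all \<open>N\<close> summands through the first argument when \<open>i = m\<close>.\<close>

lemma sum_h_perturb:
  assumes g: "\<And>z. lip H (\<lambda>x. g x z)" "\<And>x. lip H (g x)" and m: "m < N"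
  shows "\<bar>(\<Sum>k<N. g ((x(m := x m \<oplus> t)) i) ((x(m := x m \<oplus> t)) k)) - (\<Sum>k<N. g (x i) (x k))\<bar>
    \<le> (if i = m then real N * (H * abs t) else 0) + H * abs t"
proof -
  let ?y = "x(m := x m \<oplus> t)"
  have "\<bar>g (?y i) (?y k) - g (x i) (x k)\<bar> \<le> (if i = m then H * abs t else 0) + (if k = m then H * abs t else 0)" for k
  proof -
    have "\<bar>g (?y i) (?y k) - g (x i) (?y k)\<bar> \<le> (if i = m then H * abs t else 0)" using lipD[OF g(1)] by simp
    moreover have "\<bar>g (x i) (?y k) - g (x i) (x k)\<bar> \<le> (if k = m then H * abs t else 0)" using lipD[OF g(2)] by simp
    ultimately show ?thesis by linarith
  qed
  then have "\<bar>\<Sum>k<N. g (?y i) (?y k) - g (x i) (x k)\<bar> \<le> (\<Sum>k<N. (if i = m then H * abs t else 0) + (if k = m then H * abs t else 0))"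
    by (intro order_trans[OF sum_abs] sum_mono)
  also have "... = (if i = m then real N * (H * abs t) else 0) + H * abs t" using m by (simp add: sum.distrib)
  finally show ?thesis by (simp add: sum_subtractf)
qed

text \<open>\<open>b\<close> stands for \<open>i = m\<close> in \<open>sum_h_perturb\<close>:
  diagonal slopes are of order \<open>dt * H\<close>, off-diagonal ones smaller by the factor
  \<open>1 / N\<close>.\<close>

lemma scaled_le:
  assumes "0 < N" "abs D \<le> (if b then real N * (H * abs t) else 0) + H * abs t"
  shows "\<bar>dt / real N * D\<bar> \<le> 2 * (dt * H) * abs t" "\<not> b \<Longrightarrow> \<bar>dt / real N * D\<bar> \<le> dt * H / real N * abs t"
proof -
  have N1: "1 \<le> real N" using assms(1) by simp
  have "H * abs t \<le> real N * (H * abs t)" using mult_right_mono[OF N1, of "H * abs t"] H_nonneg by simp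
  then have "abs D \<le> real N * (2 * (H * abs t))" using assms(2) H_nonneg by (auto split: if_splits)
  then have "dt / real N * abs D \<le> dt / real N * (real N * (2 * (H * abs t)))" using dt by (intro mult_left_mono) auto
  then show "\<bar>dt / real N * D\<bar> \<le> 2 * (dt * H) * abs t" using dt assms(1) by (simp add: abs_mult mult_ac)
  assume "\<not> b"
  then have "dt / real N * abs D \<le> dt / real N * (H * abs t)" using dt assms(2) by (intro mult_left_mono) auto
  then show "\<bar>dt / real N * D\<bar> \<le> dt * H / real N * abs t" using dt by (simp add: abs_mult mult_ac)
qed

lemma near_id_particles:
  assumes N: "0 < N"
  shows "near_id N (2 * (dt * H)) (dt * H / real N) (2 * (dt * H)) (dd N) (JJ N)"
  unfolding near_id_def
proof (intro allI impI conjI)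
  fix i assume i: "i < N"
  show "dd N i \<in> borel_measurable (torus_pow N)" "JJ N i \<in> borel_measurable (torus_pow N)" using i by measurable
  fix x :: "nat \<Rightarrow> torus" and t :: real
  have dd: "dd N i (x(m := x m \<oplus> t)) - dd N i x = dt / real N * ((\<Sum>k<N. h ((x(m := x m \<oplus> t)) i) ((x(m := x m \<oplus> t)) k)) - (\<Sum>k<N. h (x i) (x k)))" for m
    unfolding dd_def by (simp add: right_diff_distrib)
  have JJ: "JJ N i (x(m := x m \<oplus> t)) - JJ N i x = dt / real N * ((\<Sum>k<N. h1 ((x(m := x m \<oplus> t)) i) ((x(m := x m \<oplus> t)) k)) - (\<Sum>k<N. h1 (x i) (x k)))" for m
    unfolding JJ_def by (simp add: right_diff_distrib)
  show "\<bar>dd N i (x(i := x i \<oplus> t)) - dd N i x\<bar> \<le> 2 * (dt * H) * abs t"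
    unfolding dd by (rule scaled_le(1)[OF N sum_h_perturb[OF h_lip(1,2) i]])
  fix k assume k: "k < N"
  show "\<bar>dd N i (x(k := x k \<oplus> t)) - dd N i x\<bar> \<le> dt * H / real N * abs t" if "k \<noteq> i"
    unfolding dd by (rule scaled_le(2)[OF N sum_h_perturb[OF h_lip(1,2) k]]) (use that in simp)
  show "\<bar>JJ N i (x(k := x k \<oplus> t)) - JJ N i x\<bar> \<le> 2 * (dt * H) * abs t"
    unfolding JJ by (rule scaled_le(1)[OF N sum_h_perturb[OF h_lip(3,4) k]])
next
  fix i x and t :: real assume i: "i < N" and t: "0 \<le> t"
  define y where "y = x(i := x i \<oplus> t)"
  have yi: "y i = x i \<oplus> t" and yk: "y k = (if k = i then x k \<oplus> t else x k)" for k by (simp_all add: y_def)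
  have "t * h1 (x i) (x k) - H * t^2 - (if k = i then H * t else 0) \<le> h (y i) (y k) - h (x i) (x k)" for k
  proof -
    have "\<bar>h (y i) (y k) - h (y i) (x k)\<bar> \<le> (if k = i then H * t else 0)"
      using lipD[OF h_lip(2), of "y i" "x k" t] t by (cases "k = i") (auto simp: yk)
    moreover have "\<bar>h (y i) (x k) - h (x i) (x k) - t * h1 (x i) (x k)\<bar> \<le> H * t^2"
      using qdD[OF h_qd(1), of "x i" t "x k"] by (simp add: yi)
    ultimately show ?thesis unfolding abs_le_iff by linarith
  qed
  then have "(\<Sum>k<N. t * h1 (x i) (x k) - H * t^2 - (if k = i then H * t else 0)) \<le> (\<Sum>k<N. h (y i) (y k) - h (x i) (x k))"
    by (intro sum_mono)
  then have "t * (\<Sum>k<N. h1 (x i) (x k)) - real N * (H * t^2) - H * t \<le> (\<Sum>k<N. h (y i) (y k)) - (\<Sum>k<N. h (x i) (x k))"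
    using i by (simp add: sum_subtractf sum_distrib_left)
  then have "dt / real N * (t * (\<Sum>k<N. h1 (x i) (x k)) - real N * (H * t^2) - H * t) \<le> dt / real N * ((\<Sum>k<N. h (y i) (y k)) - (\<Sum>k<N. h (x i) (x k)))"
    using dt by (intro mult_left_mono) auto
  also have "... = dd N i y - dd N i x" unfolding dd_def by (simp add: right_diff_distrib)
  also have "dt / real N * (t * (\<Sum>k<N. h1 (x i) (x k)) - real N * (H * t^2) - H * t) = (JJ N i x - 1) * t - dt * H * t^2"
    using N unfolding JJ_def by (simp add: field_simps)
  finally have "JJ N i x * t - 2 * (dt * H) * t^2 \<le> t + dd N i y - dd N i x"
    using mult_nonneg_nonneg[OF dtH(1), of "t^2"] by (simp add: algebra_simps)
  then show "JJ N i x * t - 2 * (dt * H) * t^2 \<le> t + dd N i (x(i := x i \<oplus> t)) - dd N i x" unfolding y_def .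
qed

text \<open>Collects the two corrections of order \<open>1 / N\<close> in \<open>J\<close>: the
  self-interaction and the total elimination loss \<open>real N * \<gamma> N\<close>.\<close>

definition c0 where "c0 = dt * H + 8 * (dt * H)^2"

lemma c0: "0 \<le> c0" "c0 \<le> 1 / 32"
proof -
  show "0 \<le> c0" using dtH unfolding c0_def by simp
  have "(dt * H)^2 \<le> (1 / 64)^2" using dtH by (intro power_mono) auto
  then have "(dt * H)^2 \<le> 1 / 4096" by (simp add: power2_eq_square)
  then show "c0 \<le> 1 / 32" unfolding c0_def using dtH(2) by linarith
qed

lemma J_eq: assumes N: "0 < N" shows "J N i x = 1 + dt * ((\<Sum>k<N. h1 (x i) (x k)) / real N) - c0 / real N"
proof -
  have "real N * \<gamma> N = 8 * (dt * H)^2 / real N" using N by (simp add: \<gamma>_def power2_eq_square)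
  then show ?thesis by (simp add: J_def JJ_def c0_def add_divide_distrib)
qed

lemma average_h1: assumes N: "0 < N" shows "\<bar>(\<Sum>k<N. h1 (x i) (x k)) / real N\<bar> \<le> H"
proof -
  have "\<bar>\<Sum>k<N. h1 (x i) (x k)\<bar> \<le> (\<Sum>k<N. H)" by (intro order_trans[OF sum_abs] sum_mono h_bounds)
  then show ?thesis using N by (simp add: divide_le_eq mult.commute abs_divide)
qed

lemma c0_N: assumes N: "0 < N" shows "0 \<le> c0 / real N" "c0 / real N \<le> 1 / 32"
proof -
  show "0 \<le> c0 / real N" using c0 by simp
  have "c0 / real N \<le> c0 / 1" using N c0 by (intro divide_left_mono) auto
  then show "c0 / real N \<le> 1 / 32" using c0(2) unfolding div_by_1 by (rule order_trans)
qed

lemma J_bounds: assumes N: "0 < N" shows "1 / 2 \<le> J N i x" "J N i x \<le> 2"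
proof -
  have "\<bar>dt * ((\<Sum>k<N. h1 (x i) (x k)) / real N)\<bar> \<le> dt * H"
    by (rule abs_le_mult[OF _ average_h1[OF N]]) (use dt in simp)
  then have "\<bar>dt * ((\<Sum>k<N. h1 (x i) (x k)) / real N)\<bar> \<le> 1 / 64" using dtH(2) by (rule order_trans)
  moreover have "1 / 2 \<le> 1 + p - q \<and> 1 + p - q \<le> 2" if "abs p \<le> 1 / 64" "0 \<le> q" "q \<le> 1 / 32" for p q :: real
    using that by (auto simp: abs_le_iff)
  ultimately show "1 / 2 \<le> J N i x" "J N i x \<le> 2" unfolding J_eq[OF N] using c0_N[OF N] by blast+
qed

lemma exp_G: assumes N: "0 < N"
  shows "(\<Prod>i<N. \<rho> (x i)) * exp (G N x) = (\<Prod>i<N. w (S_inv (Tm N i x)) * J N i x)"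
proof -
  have "\<rho> (x i) * exp (l (S_inv (Tm N i x)) - l (x i) + ln (J N i x) - ln (a (x i))) = w (S_inv (Tm N i x)) * J N i x" for i
  proof -
    have "\<rho> (x i) = w (x i) * a (x i)" using a_pos(2)[of "x i"] by (simp add: w_def ia_def)
    moreover have "0 < J N i x" using J_bounds(1)[OF N, of i x] by linarith
    ultimately show ?thesis using w_props(2)[of "x i"] w_props(2)[of "S_inv (Tm N i x)"] a_pos(2)[of "x i"]
      by (simp add: exp_diff exp_add l_def)
  qed
  then show ?thesis unfolding G_def by (simp add: exp_sum prod.distrib[symmetric])
qed

text \<open>\<open>Psi\<close> is a composition, so the substitution inequality is used twice: for
  the particle displacement with weights \<open>J\<close>, then for the coordinatewise inverse
  \<open>S_inv\<close> with weights \<open>ia\<close>, whose product with \<rho> is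
  \<open>w\<close>.\<close>

lemma push_nn:
  assumes N: "0 < N" and f[measurable]: "f \<in> borel_measurable (torus_pow N)"
  shows "(\<integral>\<^sup>+x. ennreal (exp (f (Psi N x) + G N x)) \<partial>iid N \<mu>) \<le> (\<integral>\<^sup>+x. ennreal (exp (f x)) \<partial>iid N \<mu>)"
proof -
  define SI where "SI y = (\<lambda>i\<in>{..<N}. y i \<oplus> \<sigma> (y i))" for y
  have [measurable]: "SI \<in> measurable (torus_pow N) (torus_pow N)"
    supply [measurable] = measurable_coord unfolding SI_def by (rule measurable_torus_pow_restrict) measurable
  define g where "g y = ennreal (exp (f (SI y))) * (\<Prod>i<N. ennreal (w (S_inv (y i))))" for y
  have [measurable]: "g \<in> borel_measurable (torus_pow N)"
    supply [measurable] = measurable_coord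
    unfolding g_def by (intro borel_measurable_times_ennreal borel_measurable_prod_ennreal) measurable
  define g2 where "g2 y = ennreal (exp (f y)) * (\<Prod>i<N. ennreal (\<rho> (y i)))" for y
  have [measurable]: "g2 \<in> borel_measurable (torus_pow N)"
    supply [measurable] = measurable_coord
    unfolding g2_def by (intro borel_measurable_times_ennreal borel_measurable_prod_ennreal) measurable
  have "(\<integral>\<^sup>+x. ennreal (exp (f (Psi N x) + G N x)) \<partial>iid N \<mu>) =
    (\<integral>\<^sup>+x. (\<Prod>i<N. ennreal (\<rho> (x i))) * ennreal (exp (f (Psi N x) + G N x)) \<partial>iid N leb)"
    by (rule nn_integral_PiM_density[OF \<rho>_props(6) \<rho>(2)]) measurable
  also have "... = (\<integral>\<^sup>+x. g (\<lambda>i\<in>{..<N}. x i \<oplus> dd N i x) * (\<Prod>i<N. ennreal (JJ N i x - real N * \<gamma> N)) \<partial>iid N leb)"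
  proof (rule nn_integral_cong)
    fix x
    have 1: "SI (\<lambda>i\<in>{..<N}. x i \<oplus> dd N i x) = Psi N x"
      by (auto simp: SI_def Psi_def Tm_def S_inv_def restrict_def fun_eq_iff)
    have Jp: "0 \<le> J N i x" for i using J_bounds(1)[OF N, of i x] by linarith
    have wp: "0 \<le> w y" for y using w_props(2)[of y] by linarith
    have \<rho>p: "0 \<le> \<rho> y" for y using \<rho>_props(7)[of y] by linarith
    have "(\<Prod>i<N. ennreal (\<rho> (x i))) * ennreal (exp (f (Psi N x) + G N x)) =
      ennreal (exp (f (Psi N x)) * ((\<Prod>i<N. \<rho> (x i)) * exp (G N x)))"
      by (simp add: prod_ennreal \<rho>p exp_add ennreal_mult' prod_nonneg mult_ac)
    also have "... = ennreal (exp (f (Psi N x))) * (\<Prod>i<N. ennreal (w (S_inv (Tm N i x)) * J N i x))"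
      unfolding exp_G[OF N] by (subst prod_ennreal) (auto simp: ennreal_mult' wp Jp)
    also have "... = g (\<lambda>i\<in>{..<N}. x i \<oplus> dd N i x) * (\<Prod>i<N. ennreal (J N i x))"
      unfolding g_def 1 by (simp add: Tm_def prod.distrib ennreal_mult' wp mult.assoc)
    finally show "(\<Prod>i<N. ennreal (\<rho> (x i))) * ennreal (exp (f (Psi N x) + G N x)) =
      g (\<lambda>i\<in>{..<N}. x i \<oplus> dd N i x) * (\<Prod>i<N. ennreal (JJ N i x - real N * \<gamma> N))" by (simp add: J_def)
  qed
  also have "... \<le> (\<integral>\<^sup>+y. g y \<partial>iid N leb)"
  proof (rule near_id_substitution_le[OF near_id_particles[OF N]])
    let ?c = "dt * H"
    have N\<gamma>: "real N * \<gamma> N = 8 * ?c\<^sup>2 / real N" using N by (simp add: \<gamma>_def power2_eq_square)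
    have c2: "8 * ?c\<^sup>2 \<le> ?c" using dtH mult_left_mono[of "8 * ?c" 1 ?c] by (simp add: power2_eq_square)
    show "0 \<le> \<gamma> N" by (simp add: \<gamma>_def)
    show "0 \<le> ?c / real N" using dtH by simp
    \<comment> \<open>The threshold \<open>B\<close> is twice the initial off-diagonal bound; the
      second half absorbs the growth during the elimination.\<close>
    show "2 * (2 * ?c / real N)^2 \<le> \<gamma> N" by (simp add: \<gamma>_def power_divide power_mult_distrib)
    have "8 * ?c\<^sup>2 / real N \<le> 8 * ?c\<^sup>2 / 1" using N by (intro divide_left_mono) auto
    then show "2 * ?c + real N * \<gamma> N \<le> 1 / 2" unfolding N\<gamma> using c2 dtH by linarith
    have "8 * ?c\<^sup>2 / real N \<le> ?c / real N" using c2 by (intro divide_right_mono) auto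
    moreover have "2 * ?c / real N = ?c / real N + ?c / real N" by (simp add: add_divide_distrib[symmetric])
    ultimately show "?c / real N + real N * \<gamma> N \<le> 2 * ?c / real N" unfolding N\<gamma> by (simp only: add_left_mono)
  qed measurable
  also have "... = (\<integral>\<^sup>+y. g2 (\<lambda>i\<in>{..<N}. y i \<oplus> \<sigma> (y i)) * (\<Prod>i<N. ennreal (ia (S_inv (y i)) - real N * 0)) \<partial>iid N leb)"
  proof (rule nn_integral_cong)
    fix y
    have "ennreal (w z) = ennreal (\<rho> z) * ennreal (ia z)" for z
      unfolding w_def using ia_props(1)[of z] \<rho>_props(7)[of z] by (simp add: ennreal_mult less_imp_le)
    then show "g y = g2 (\<lambda>i\<in>{..<N}. y i \<oplus> \<sigma> (y i)) * (\<Prod>i<N. ennreal (ia (S_inv (y i)) - real N * 0))"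
      unfolding g_def g2_def SI_def by (simp add: prod.distrib mult.assoc S_inv_def)
  qed
  \<comment> \<open>A diagonal map needs no elimination, so the loss and the threshold are both
    0.\<close>
  also have "... \<le> (\<integral>\<^sup>+x. g2 x \<partial>iid N leb)" by (rule near_id_substitution_le[OF near_id_S_inv, where B = 0]) (auto)
  also have "... = (\<integral>\<^sup>+x. ennreal (exp (f x)) \<partial>iid N \<mu>)"
    unfolding g2_def by (subst nn_integral_PiM_density[OF \<rho>_props(6) \<rho>(2)]) (auto simp: mult.commute)
  finally show ?thesis .
qed

section \<open>A quadratic lower bound for the log-density\<close>

definition Dk where "Dk N k x = (\<Sum>i<N. indicator (upper N k) (x i)) / real N - measure \<mu> (upper N k)"
text \<open>The increment of \<open>\<Phi> y\<close> over one grid cell in its second argument. The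
  factor \<open>N\<close> makes it of order one, so that \<open>Ek\<close> is the average of a
  bounded function.\<close>

definition ek where "ek N k y = real N * jump N (\<Phi> y) k"
definition Ek where "Ek N k x = (\<Sum>i<N. ek N k (x i)) / real N"
text \<open>A sum of \<open>2 * N\<close> squares of centred averages. Under the product measure
  each has mean of order \<open>1 / N\<close>, so the sum is of order one.\<close>

definition QQ where "QQ N x = (\<Sum>k<N. (Dk N k x)^2 + (Ek N k x)^2)"
definition Cc where "Cc = C1 + 4 * Cl + 16"
definition Ca where "Ca = 2 * C\<Phi> + Cc * (8 * H^2) + 2"
definition Cb where "Cb = 1 / 2 + Cc * (2 * H^2)"

lemma Cc_nonneg: "0 \<le> Cc" using C_nonneg by (simp add: Cc_def)

lemma C\<Phi>_nonneg: "0 \<le> C\<Phi>" using C_nonneg H_nonneg by (simp add: C\<Phi>_def)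

lemma disc_emp:
  assumes N: "0 < N" and f: "lip L f"
  shows "\<bar>(\<Sum>k<N. f (x k)) / real N - (LINT z|\<mu>. f z) - (\<Sum>k<N. jump N f k * Dk N k x)\<bar> \<le> 2 * L / real N"
  using discretise[OF f N empirical_prob[OF N, of x] sets_empirical \<rho>(2) sets_dens]
  by (simp add: integral_empirical[OF N lip_measurable[OF f]] measure_empirical[OF N] Dk_def)

text \<open>Cauchy-Schwarz over \<open>N\<close> jumps of size at most \<open>L / N\<close> yields
  \<open>L^2 * QQ / N\<close>; the discretisation error \<open>2 * L / N\<close> is squared
  separately. Both appear doubled through \<open>(p + q)^2 \<le> 2 * p^2 + 2 * q^2\<close>.\<close>

lemma disc_sq:
  assumes N: "0 < N" and f: "lip L f"
  shows "((\<Sum>k<N. f (x k)) / real N - (LINT z|\<mu>. f z))^2 \<le> (8 * L^2 + 2 * L^2 * QQ N x) / real N"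
proof -
  have L: "0 \<le> L" by (rule lip_nonneg[OF f])
  let ?v = "(\<Sum>k<N. f (x k)) / real N - (LINT z|\<mu>. f z)" and ?q = "\<Sum>k<N. jump N f k * Dk N k x"
  have "?q\<^sup>2 \<le> (\<Sum>k<N. (jump N f k * Dk N k x)^2) * real N"
    using sum_squared_le_sum_of_squares[of "\<lambda>k. jump N f k * Dk N k x" "{..<N}"] by simp
  also have "(\<Sum>k<N. (jump N f k * Dk N k x)^2) \<le> (\<Sum>k<N. (L / real N)^2 * (Dk N k x)^2)"
    unfolding power_mult_distrib using power_mono[OF jump_le[OF f N], of _ 2]
    by (intro sum_mono mult_right_mono) auto
  also have "... \<le> (L / real N)^2 * QQ N x"
    unfolding QQ_def sum_distrib_left[symmetric] by (intro mult_left_mono sum_mono) auto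
  finally have "?q\<^sup>2 \<le> (L / real N)^2 * QQ N x * real N" using N by (simp add: mult_right_mono)
  also have "... = L^2 * QQ N x / real N" using N by (simp add: power2_eq_square field_simps)
  finally have q: "?q\<^sup>2 \<le> L^2 * QQ N x / real N" .
  have "(?v - ?q)^2 \<le> (2 * L / real N)^2" using power_mono[OF disc_emp[OF N f, of x], of 2] by simp
  also have "(2 * L / real N)^2 = 4 * L^2 / (real N * real N)" by (simp add: power2_eq_square)
  also have "... \<le> 4 * L^2 / real N" using N by (intro divide_left_mono) (auto simp: mult_le_cancel_left1)
  finally have e: "(?v - ?q)^2 \<le> 4 * L^2 / real N" .
  have "?v\<^sup>2 \<le> 2 * (?v - ?q)^2 + 2 * ?q\<^sup>2"
    using zero_le_power2[of "?v - 2 * ?q"] by (simp add: power2_eq_square algebra_simps)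
  with e q have "?v\<^sup>2 \<le> 2 * (4 * L^2 / real N) + 2 * (L^2 * QQ N x / real N)" by linarith
  then show ?thesis by (simp add: add_divide_distrib)
qed

definition del where "del N i x = dt * ((\<Sum>k<N. h (x i) (x k)) / real N - s (x i))"
definition del' where "del' N i x = dt * ((\<Sum>k<N. h1 (x i) (x k)) / real N - s1 (x i))"

lemma Tm_eq: "Tm N i x = S (x i) \<oplus> del N i x"
  by (simp add: Tm_def S_def dd_def del_def torus_add_add algebra_simps)

lemma del_sq:
  assumes N: "0 < N"
  shows "(del N i x)^2 \<le> (8 * H^2 + 2 * H^2 * QQ N x) / real N" "(del' N i x)^2 \<le> (8 * H^2 + 2 * H^2 * QQ N x) / real N"
proof -
  have D: "(dt * v)^2 \<le> v^2" for v
  proof -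
    have "dt^2 \<le> 1" using dt dtH by (simp add: power_le_one)
    then show ?thesis by (simp add: power_mult_distrib mult_left_le_one_le)
  qed
  show "(del N i x)^2 \<le> (8 * H^2 + 2 * H^2 * QQ N x) / real N"
    unfolding del_def s_def by (rule order_trans[OF D disc_sq[OF N h_lip(2)]])
  show "(del' N i x)^2 \<le> (8 * H^2 + 2 * H^2 * QQ N x) / real N"
    unfolding del'_def s1_def by (rule order_trans[OF D disc_sq[OF N h_lip(4)]])
qed

text \<open>The particle reaches the mean-field image displaced by \<open>del\<close>. Expanding
  \<open>S_inv\<close> there costs \<open>C1 * del^2\<close>, and expanding \<open>l\<close> along a
  displacement of size at most \<open>2 * abs del\<close> costs
  \<open>4 * Cl * del^2\<close>.\<close>

lemma l_increment:
  "u (x i) * del N i x - (C1 + 4 * Cl) * (del N i x)^2 \<le> l (S_inv (Tm N i x)) - l (x i)"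
proof -
  let ?d = "del N i x"
  obtain \<tau> where \<tau>: "S_inv (S (x i) \<oplus> ?d) = S_inv (S (x i)) \<oplus> \<tau>" "abs \<tau> \<le> 2 * abs ?d"
    "\<bar>\<tau> - ?d * ia (S_inv (S (x i)))\<bar> \<le> ?d\<^sup>2"
    using S_inv_shift[of ?d "S (x i)"] by metis
  have \<tau>2: "\<tau>^2 \<le> 4 * ?d\<^sup>2" using power_mono[OF \<tau>(2), of 2] by (simp add: power_mult_distrib)
  have "\<bar>l (x i \<oplus> \<tau>) - l (x i) - \<tau> * l' (x i)\<bar> \<le> Cl * \<tau>^2" by (rule qdD[OF l_props(2)])
  moreover have "Cl * \<tau>^2 \<le> Cl * (4 * ?d\<^sup>2)" using \<tau>2 C_nonneg by (intro mult_left_mono)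
  moreover have "\<bar>(\<tau> - ?d * ia (x i)) * l' (x i)\<bar> \<le> ?d\<^sup>2 * C1" using \<tau>(3) by (intro abs_le_mult l_props(3)) simp
  moreover have "\<tau> * l' (x i) = (\<tau> - ?d * ia (x i)) * l' (x i) + u (x i) * ?d" by (simp add: u_def algebra_simps)
  ultimately have "u (x i) * ?d - (?d\<^sup>2 * C1 + Cl * (4 * ?d\<^sup>2)) \<le> l (x i \<oplus> \<tau>) - l (x i)"
    unfolding abs_le_iff by linarith
  then show ?thesis unfolding Tm_eq \<tau>(1) by (simp add: algebra_simps)
qed

text \<open>With \<open>J = a * (1 + v)\<close> and \<open>v = (del' - c0 / N) * ia\<close>, the
  bound \<open>v - 2 * v^2 \<le> ln (1 + v)\<close> applies; all contributions of
  \<open>c0 / N\<close> together fit into \<open>2 / N\<close>.\<close>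

lemma ln_J_increment:
  assumes N: "0 < N"
  shows "ia (x i) * del' N i x - 16 * (del' N i x)^2 - 2 / real N \<le> ln (J N i x) - ln (a (x i))"
proof -
  let ?d = "del' N i x"
  define c where "c = c0 / real N"
  have c: "0 \<le> c" "c \<le> 1 / 32" using c0_N[OF N] by (simp_all only: c_def)
  define v where "v = (?d - c) * ia (x i)"
  have "J N i x = a (x i) + (?d - c)" unfolding J_eq[OF N] del'_def a_def c_def by (simp add: algebra_simps)
  then have J: "J N i x = a (x i) * (1 + v)"
  proof -
    have "a (x i) * ia (x i) = 1" using a_pos(2)[of "x i"] by (simp add: ia_def)
    then have "a (x i) * v = ?d - c" unfolding v_def by (metis mult.assoc mult.commute mult.right_neutral)
    with \<open>J N i x = a (x i) + (?d - c)\<close> show ?thesis by (simp add: distrib_left)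
  qed
  have d: "abs ?d \<le> 1 / 32"
  proof -
    have "\<bar>(\<Sum>k<N. h1 (x i) (x k)) / real N - s1 (x i)\<bar> \<le> 2 * H"
      using average_h1[OF N, of x i] s_props(2)[of "x i"] by linarith
    then have "dt * \<bar>(\<Sum>k<N. h1 (x i) (x k)) / real N - s1 (x i)\<bar> \<le> dt * (2 * H)" using dt by (intro mult_left_mono) auto
    then have "abs ?d \<le> dt * (2 * H)" unfolding del'_def using dt by (simp add: abs_mult)
    then show ?thesis using dtH by linarith
  qed
  have dc: "\<bar>?d - c\<bar> \<le> 1 / 16" using d c by linarith
  have v: "abs v \<le> 1 / 2" using abs_le_mult[OF dc ia_props(4)[of "x i"]] unfolding v_def by linarith
  have ln: "v - 2 * v^2 \<le> ln (1 + v)" using abs_ln_one_plus_x_minus_x_bound[OF v] by (simp add: abs_le_iff)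
  have "v^2 = (?d - c)^2 * (ia (x i))^2" by (simp add: v_def power_mult_distrib)
  also have "... \<le> (?d - c)^2 * 4" using power_mono[OF ia_props(4)[of "x i"], of 2] by (intro mult_left_mono) auto
  also have "(?d - c)^2 \<le> 2 * ?d\<^sup>2 + 2 * c^2"
    using zero_le_power2[of "?d + c"] by (simp add: power2_eq_square algebra_simps)
  finally have v2: "v^2 \<le> 8 * ?d\<^sup>2 + 8 * c^2" by simp
  have "c * c \<le> 1 / 32 * c" using c by (intro mult_right_mono) auto
  then have c2: "16 * c^2 \<le> c / 2" by (simp add: power2_eq_square)
  have "c * ia (x i) \<le> c * 2" using c ia_props(3) by (intro mult_left_mono) auto
  then have "?d * ia (x i) - 2 * c \<le> v" unfolding v_def by (simp add: algebra_simps)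
  with ln v2 c2 have "?d * ia (x i) - 2 * c - (16 * ?d\<^sup>2 + c / 2) \<le> ln (1 + v)" by linarith
  moreover have "3 * c \<le> 2 / real N"
  proof -
    have "3 * c = (3 * c0) / real N" by (simp add: c_def)
    also have "... \<le> 2 / real N" using c0 by (intro divide_right_mono) auto
    finally show ?thesis .
  qed
  moreover have "ln (J N i x) = ln (a (x i)) + ln (1 + v)"
    unfolding J using v a_pos(2)[of "x i"] by (subst ln_mult) (auto simp: abs_le_iff)
  moreover have "2 * c + (16 * ?d\<^sup>2 + c / 2) \<le> 16 * ?d\<^sup>2 + 3 * c" using c by linarith
  ultimately show ?thesis by (simp add: mult.commute)
qed

text \<open>The linear terms form the double sum of \<Phi> over pairs of particles. Discretising the
  second argument decouples the pair: the sum over \<open>i\<close> turns the jumps into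
  \<open>Ek\<close>, leaving the sum of the products \<open>Ek * Dk\<close>, at most half of
  \<open>QQ\<close>.\<close>

lemma first_order:
  assumes N: "0 < N"
  shows "- (\<Sum>i<N. u (x i) * del N i x + ia (x i) * del' N i x) \<le> 2 * C\<Phi> + 1 / 2 * QQ N x"
proof -
  let ?r = "\<lambda>i. (\<Sum>k<N. \<Phi> (x i) (x k)) / real N - (LINT z|\<mu>. \<Phi> (x i) z)"
  have eq: "u (x i) * del N i x + ia (x i) * del' N i x = dt * ?r i" for i
  proof -
    have "(LINT z|\<mu>. \<Phi> (x i) z) = u (x i) * s (x i) + s1 (x i) * ia (x i)" unfolding \<Phi>_def s_def s1_def
      using average_bound(2)[OF \<rho>(2), of "h (x i)" H] average_bound(2)[OF \<rho>(2), of "h1 (x i)" H] h_bounds by simp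
    moreover have "(\<Sum>k<N. \<Phi> (x i) (x k)) = u (x i) * (\<Sum>k<N. h (x i) (x k)) + (\<Sum>k<N. h1 (x i) (x k)) * ia (x i)"
      unfolding \<Phi>_def by (simp add: sum.distrib sum_distrib_left sum_distrib_right)
    ultimately show ?thesis unfolding del_def del'_def by (simp add: algebra_simps add_divide_distrib)
  qed
  have "\<bar>?r i - (\<Sum>k<N. jump N (\<Phi> (x i)) k * Dk N k x)\<bar> \<le> 2 * C\<Phi> / real N" for i by (rule disc_emp[OF N \<Phi>_lip])
  then have "\<bar>\<Sum>i<N. ?r i - (\<Sum>k<N. jump N (\<Phi> (x i)) k * Dk N k x)\<bar> \<le> (\<Sum>i<N. 2 * C\<Phi> / real N)"
    by (intro order_trans[OF sum_abs] sum_mono)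
  then have "\<bar>(\<Sum>i<N. ?r i) - (\<Sum>i<N. \<Sum>k<N. jump N (\<Phi> (x i)) k * Dk N k x)\<bar> \<le> 2 * C\<Phi>"
    using N by (simp add: sum_subtractf)
  moreover have "(\<Sum>i<N. \<Sum>k<N. jump N (\<Phi> (x i)) k * Dk N k x) = (\<Sum>k<N. Ek N k x * Dk N k x)"
    by (subst sum.swap) (use N in \<open>simp add: Ek_def ek_def sum_distrib_left[symmetric] sum_distrib_right[symmetric]\<close>)
  moreover have "\<bar>\<Sum>k<N. Ek N k x * Dk N k x\<bar> \<le> (\<Sum>k<N. 1 / 2 * ((Dk N k x)^2 + (Ek N k x)^2))"
  proof (intro order_trans[OF sum_abs] sum_mono)
    fix k
    show "\<bar>Ek N k x * Dk N k x\<bar> \<le> 1 / 2 * ((Dk N k x)^2 + (Ek N k x)^2)"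
      using zero_le_power2[of "\<bar>Ek N k x\<bar> - \<bar>Dk N k x\<bar>"] by (simp add: power2_diff abs_mult algebra_simps)
  qed
  then have "\<bar>\<Sum>k<N. Ek N k x * Dk N k x\<bar> \<le> 1 / 2 * QQ N x" by (simp add: QQ_def sum_distrib_left)
  ultimately have b: "\<bar>\<Sum>i<N. ?r i\<bar> \<le> 2 * C\<Phi> + 1 / 2 * QQ N x" by linarith
  have "(\<Sum>i<N. u (x i) * del N i x + ia (x i) * del' N i x) = dt * (\<Sum>i<N. ?r i)"
    unfolding eq by (rule sum_distrib_left[symmetric])
  moreover have "\<bar>dt * (\<Sum>i<N. ?r i)\<bar> \<le> \<bar>\<Sum>i<N. ?r i\<bar>" using dt dtH by (simp add: abs_mult mult_left_le_one_le)
  ultimately show ?thesis using b by linarith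
qed

text \<open>Each of the \<open>N\<close> particles carries a quadratic error of order
  \<open>(1 + QQ) / N\<close>, so their sum stays of order \<open>1 + QQ\<close>.\<close>

lemma G_lower:
  assumes N: "0 < N"
  shows "- G N x \<le> Ca + Cb * QQ N x"
proof -
  let ?q = "(8 * H^2 + 2 * H^2 * QQ N x) / real N"
  have "u (x i) * del N i x + ia (x i) * del' N i x - Cc * ?q - 2 / real N
      \<le> l (S_inv (Tm N i x)) - l (x i) + ln (J N i x) - ln (a (x i))" for i
  proof -
    have "(C1 + 4 * Cl) * (del N i x)^2 \<le> (C1 + 4 * Cl) * ?q"
      using del_sq(1)[OF N] C_nonneg by (intro mult_left_mono) auto
    moreover have "16 * (del' N i x)^2 \<le> 16 * ?q" using del_sq(2)[OF N] by (intro mult_left_mono) auto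
    moreover have "Cc * ?q = (C1 + 4 * Cl) * ?q + 16 * ?q" by (simp only: Cc_def distrib_right)
    ultimately show ?thesis using l_increment[of x i N] ln_J_increment[OF N, of x i] by linarith
  qed
  then have "(\<Sum>i<N. u (x i) * del N i x + ia (x i) * del' N i x - Cc * ?q - 2 / real N) \<le> G N x"
    unfolding G_def by (intro sum_mono)
  moreover have "(\<Sum>i<N. u (x i) * del N i x + ia (x i) * del' N i x - Cc * ?q - 2 / real N) =
     (\<Sum>i<N. u (x i) * del N i x + ia (x i) * del' N i x) - Cc * (8 * H^2 + 2 * H^2 * QQ N x) - 2"
    using N by (simp add: sum_subtractf)
  ultimately show ?thesis using first_order[OF N, of x] by (simp add: Ca_def Cb_def algebra_simps)
qed

text \<open>A crude bound growing with \<open>N\<close>; it supplies the boundedness that the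
  variational formula and its integrals require.\<close>

lemma G_bound: assumes N: "0 < N" shows "\<bar>G N x\<bar> \<le> real N * (C1 + 2)"
proof -
  have "\<bar>l (S_inv (Tm N i x)) - l (x i) + ln (J N i x) - ln (a (x i))\<bar> \<le> C1 + 2" for i
  proof -
    have "\<bar>l (S_inv (Tm N i x)) - l (x i)\<bar> \<le> C1" by (rule lip_oscillation[OF l_props(1)])
    moreover have "\<bar>ln r\<bar> \<le> 1" if "1 / 2 \<le> r" "r \<le> 2" for r :: real
    proof -
      have "ln r \<le> r - 1" using that by (intro ln_le_minus_one) auto
      moreover have "ln (1 / r) \<le> 1 / r - 1" using that by (intro ln_le_minus_one) auto
      moreover have "1 / r \<le> 2" using that by (simp add: divide_le_eq)
      ultimately show ?thesis using that by (simp add: ln_div abs_le_iff)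
    qed
    ultimately show ?thesis using J_bounds[OF N, of i x] a_pos[of "x i"] by (smt (verit))
  qed
  then have "\<bar>G N x\<bar> \<le> (\<Sum>i<N. C1 + 2)" unfolding G_def by (intro order_trans[OF sum_abs] sum_mono)
  then show ?thesis by simp
qed

text \<open>Makes \<open>4 * (2 * rr * Cb) * (1 + C\<Phi>)^2\<close> equal to 1, the largest
  exponent that \<open>square_sum_exp_moment\<close> allows for functions bounded by
  \<open>1 + C\<Phi>\<close>. The inner factor 2 is spent on separating \<open>Dk\<close> from
  \<open>Ek\<close>.\<close>

definition rr where "rr = 1 / (8 * Cb * (1 + C\<Phi>)^2)"

lemma Cb_pos: "1 / 2 \<le> Cb" using Cc_nonneg by (simp add: Cb_def)

lemma rr_pos: "0 < rr" using Cb_pos C\<Phi>_nonneg by (simp add: rr_def zero_less_mult_iff)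

lemma rr_small: "4 * (2 * rr * Cb) * (1 + C\<Phi>)^2 \<le> 1"
  using Cb_pos C\<Phi>_nonneg by (simp add: rr_def)

text \<open>The exponent \<open>rr * Cb * QQ\<close> is an average over \<open>k\<close> of terms
  scaled by \<open>N\<close>. Jensen moves the exponential inside,
  \<open>2 * p * q \<le> p^2 + q^2\<close> separates the two kinds of squares, and each moment is at
  most 2. What remains is \<open>2 * exp (rr * Ca)\<close>, and
  \<open>2 \<le> exp 1\<close>.\<close>

lemma moment_nn:
  assumes N: "0 < N"
  shows "(\<integral>\<^sup>+x. ennreal (exp (- rr * G N x)) \<partial>iid N \<mu>) \<le> ennreal (exp (rr * Ca + 1))"
proof -
  interpret P: prob_space "iid N \<mu>" by (intro prob_space_PiM \<rho>(2))
  let ?M = "iid N \<mu>" and ?c = "2 * rr * Cb"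
  have c: "0 \<le> ?c" using rr_pos Cb_pos by simp
  have sets_M [measurable_cong]: "sets ?M = sets (torus_pow N)" by (intro sets_PiM_cong) auto
  have ek_meas[measurable]: "ek N k \<in> borel_measurable borel" for k unfolding ek_def jump_def by measurable
  have ek_b: "\<bar>ek N k y\<bar> \<le> 1 + C\<Phi>" for k y
    using jump_le[OF \<Phi>_lip N, of y k] N C\<Phi>_nonneg by (simp add: ek_def abs_mult le_divide_eq mult.commute)
  \<comment> \<open>Here the cancellation \<open>\<Phi>_mean_zero\<close> enters: \<open>ek\<close>
    is centred, so \<open>Ek\<close> is a normalised sum covered by the moment bound.\<close>
  have ek_0: "(LINT y|\<mu>. ek N k y) = 0" for k
  proof -
    have "integrable \<mu> (\<lambda>y. \<Phi> y z)" for z by (rule average_bound(2)[OF \<rho>(2) _ \<Phi>_bound]) measurable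
    then show ?thesis unfolding ek_def jump_def by (simp add: \<Phi>_mean_zero)
  qed
  have ind_b: "\<bar>indicator (upper N k) y\<bar> \<le> 1 + C\<Phi>" for k y using C\<Phi>_nonneg by (simp add: indicator_def)
  have small: "4 * ?c * (1 + C\<Phi>)^2 \<le> 1" using rr_small by simp
  have mD: "(\<integral>\<^sup>+x. ennreal (exp (?c * (real N * (Dk N k x)^2))) \<partial>?M) \<le> 2" for k
  proof -
    have "?c * (real N * (Dk N k x)^2) = ?c * (\<Sum>i<N. indicator (upper N k) (x i) - (LINT y|\<mu>. indicator (upper N k) y))^2 / real N" for x
    proof -
      have "(\<Sum>i<N. indicator (upper N k) (x i) - (LINT y|\<mu>. indicator (upper N k) y)) = real N * Dk N k x"
        using N by (simp add: Dk_def sum_subtractf right_diff_distrib)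
      then show ?thesis using N by (simp add: power_mult_distrib power2_eq_square)
    qed
    moreover have "indicator (upper N k) \<in> borel_measurable \<mu>" by simp
    ultimately show ?thesis
      using square_sum_exp_moment[where g = "indicator (upper N k)", OF \<rho>(2) _ ind_b c small N] by simp
  qed
  have mE: "(\<integral>\<^sup>+x. ennreal (exp (?c * (real N * (Ek N k x)^2))) \<partial>?M) \<le> 2" for k
  proof -
    have "?c * (real N * (Ek N k x)^2) = ?c * (\<Sum>i<N. ek N k (x i) - (LINT y|\<mu>. ek N k y))^2 / real N" for x
      using N unfolding ek_0 by (simp add: Ek_def power_divide power2_eq_square)
    moreover have "ek N k \<in> borel_measurable \<mu>" by measurable
    ultimately show ?thesis using square_sum_exp_moment[where g = "ek N k", OF \<rho>(2) _ ek_b c small N] by simp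
  qed
  have Dk_meas[measurable]: "Dk N k \<in> borel_measurable (torus_pow N)" "Ek N k \<in> borel_measurable (torus_pow N)" for k
    supply [measurable] = measurable_coord unfolding Dk_def Ek_def by measurable
  let ?d = "\<lambda>k x. exp (?c * (real N * (Dk N k x)^2))" and ?e = "\<lambda>k x. exp (?c * (real N * (Ek N k x)^2))"
  let ?u = "\<lambda>k x. rr * Cb * (real N * (Dk N k x)^2)" and ?v = "\<lambda>k x. rr * Cb * (real N * (Ek N k x)^2)"
  let ?K = "ennreal (exp (rr * Ca) / (2 * real N))"
  have le: "exp (- rr * G N x) \<le> exp (rr * Ca) * ((\<Sum>k<N. ?d k x + ?e k x) / (2 * real N))" for x
  proof -
    have "rr * (- G N x) \<le> rr * (Ca + Cb * QQ N x)" using G_lower[OF N] rr_pos by (intro mult_left_mono) auto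
    then have "- rr * G N x \<le> rr * Ca + rr * Cb * QQ N x" by (simp add: algebra_simps)
    also have "rr * Cb * QQ N x = (\<Sum>k<N. ?u k x + ?v k x) / real N"
      unfolding QQ_def sum_distrib_left sum_divide_distrib
      by (intro sum.cong refl) (use N in \<open>simp add: field_simps\<close>)
    finally have "exp (- rr * G N x) \<le> exp (rr * Ca) * exp ((\<Sum>k<N. ?u k x + ?v k x) / real N)"
      by (simp add: mult_exp_exp)
    also have "... \<le> exp (rr * Ca) * ((\<Sum>k<N. exp (?u k x + ?v k x)) / real N)"
      by (intro mult_left_mono exp_average_le[OF N]) simp
    also have "... \<le> exp (rr * Ca) * ((\<Sum>k<N. (?d k x + ?e k x) / 2) / real N)"
    proof (intro mult_left_mono divide_right_mono sum_mono)
      fix k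
      have am: "exp (p + q) \<le> (exp (2 * p) + exp (2 * q)) / 2" for p q :: real
        using zero_le_power2[of "exp p - exp q"] by (simp add: power2_diff exp_add exp_double)
      show "exp (?u k x + ?v k x) \<le>
        (?d k x + ?e k x) / 2"
        using am[of "?u k x" "?v k x"] by (simp add: mult.assoc)
    qed auto
    also have "... = exp (rr * Ca) * ((\<Sum>k<N. ?d k x + ?e k x) / (2 * real N))"
      by (simp add: sum_divide_distrib[symmetric])
    finally show ?thesis .
  qed
  have "(\<integral>\<^sup>+x. ennreal (exp (- rr * G N x)) \<partial>?M) \<le>
    (\<integral>\<^sup>+x. ?K * (\<Sum>k<N. ennreal (?d k x) + ennreal (?e k x)) \<partial>?M)"
  proof (rule nn_integral_mono)
    fix x
    have "ennreal (exp (- rr * G N x)) \<le> ennreal (exp (rr * Ca) / (2 * real N) * (\<Sum>k<N. ?d k x + ?e k x))"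
      by (rule ennreal_leI) (use le[of x] in \<open>simp\<close>)
    also have "... = ?K * (\<Sum>k<N. ennreal (?d k x) + ennreal (?e k x))"
      by (subst ennreal_mult') (auto simp: sum_ennreal[symmetric] simp del: sum_ennreal)
    finally show "ennreal (exp (- rr * G N x)) \<le> ?K * (\<Sum>k<N. ennreal (?d k x) + ennreal (?e k x))" .
  qed
  also have "... = ?K * (\<Sum>k<N. (\<integral>\<^sup>+x. ennreal (?d k x) \<partial>?M) + (\<integral>\<^sup>+x. ennreal (?e k x) \<partial>?M))"
    by (simp add: nn_integral_cmult nn_integral_sum nn_integral_add)
  also have "... \<le> ?K * (\<Sum>k<N. 2 + 2)"
    by (intro mult_left_mono sum_mono add_mono mD mE) auto
  also have "... = ?K * ennreal (real N * 4)"
    by (simp add: ennreal_mult ennreal_of_nat_eq_real_of_nat)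
  also have "... = ennreal (2 * exp (rr * Ca))" using N by (subst ennreal_mult[symmetric]) (auto simp: mult.commute)
  also have "... \<le> ennreal (exp (rr * Ca + 1))"
    using exp_ge_add_one_self[of 1] by (intro ennreal_leI) (simp add: exp_add mult.commute)
  finally show ?thesis .
qed

theorem entropy_step:
  assumes N: "0 < N" and L: "prob_space L" "sets L = sets (torus_pow N)"
    and F: "F \<in> borel_measurable borel"
  shows "rel_entropy (distr L (torus_pow N) (particle_step dt h F N)) (iid N (distr \<mu> borel (F_mu dt h F \<mu>)))
    \<le> ereal (1 + 1 / rr) * rel_entropy L (iid N \<mu>) + ereal (Ca + 1 / rr)"
proof -
  let ?M = "iid N \<mu>"
  interpret P: prob_space ?M by (intro prob_space_PiM \<rho>(2))
  have sets_M [measurable_cong]: "sets ?M = sets (torus_pow N)" by (intro sets_PiM_cong) auto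
  note [measurable] = F
  have Fmu: "F_mu dt h F \<mu> = (\<lambda>x. F (S x))" by (auto simp: F_mu_def phi_def S_def s_def)
  have [measurable]: "S \<in> borel_measurable borel" unfolding S_def by measurable
  define R where "R = compose {..<N} (\<lambda>x. F (S x))"
  have [measurable]: "R \<in> measurable (torus_pow N) (torus_pow N)"
    supply [measurable] = measurable_coord
    unfolding R_def compose_def by (rule measurable_torus_pow_restrict) measurable
  have step: "particle_step dt h F N = R \<circ> Psi N"
    by (auto simp: particle_step_def R_def compose_def Psi_def Tm_def dd_def fun_eq_iff)
  have prod: "iid N (distr \<mu> borel (F_mu dt h F \<mu>)) = distr ?M (torus_pow N) R"
  proof -
    \<comment> \<open>The product rule is applied with target \<open>leb\<close>, a probability
      measure on the Borel sets; as a target only its measurable sets matter.\<close>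
    have "distr ?M (iid N leb) (compose {..<N} (\<lambda>x. F (S x))) = PiM {..<N} (\<lambda>i. distr \<mu> leb (\<lambda>x. F (S x)))"
      by (rule distr_PiM_finite_prob_space') (auto intro: \<rho>(2) leb.prob_space_axioms)
    moreover have "distr \<mu> leb (\<lambda>x. F (S x)) = distr \<mu> borel (\<lambda>x. F (S x))" by (rule distr_cong) auto
    moreover have "distr ?M (iid N leb) R = distr ?M (torus_pow N) R"
      by (rule distr_cong) (auto intro!: sets_PiM_cong)
    ultimately show ?thesis by (simp add: Fmu R_def)
  qed
  have "rel_entropy (distr L (torus_pow N) (R \<circ> Psi N)) (distr ?M (torus_pow N) R)
    \<le> ereal (1 + 1 / rr) * rel_entropy L ?M + ereal ((rr * Ca + 1) / rr)"
  proof (rule rel_entropy_push_le[OF L(1) P.prob_space_axioms _ _ _ _ G_bound[OF N] rr_pos])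
    show "sets L = sets ?M" by (simp add: L(2) sets_M)
    fix f :: "(nat \<Rightarrow> torus) \<Rightarrow> real" and B assume f: "f \<in> borel_measurable ?M" and fb: "\<And>x. \<bar>f x\<bar> \<le> B"
    have f': "f \<in> borel_measurable (torus_pow N)" using f by (simp cong: measurable_cong_sets)
    note [measurable] = f f'
    have b2: "\<bar>f (Psi N x) + G N x\<bar> \<le> B + real N * (C1 + 2)" for x
      using fb[of "Psi N x"] G_bound[OF N, of x] by linarith
    have i1: "integrable ?M (\<lambda>x. exp (f (Psi N x) + G N x))"
      by (rule exp_bounded_integrable(1)[OF P.prob_space_axioms _ b2]) measurable
    have i2: "integrable ?M (\<lambda>x. exp (f x))" by (rule exp_bounded_integrable(1)[OF P.prob_space_axioms f fb])
    show "(LINT x|?M. exp (f (Psi N x) + G N x)) \<le> (LINT x|?M. exp (f x))"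
      using push_nn[OF N f'] i1 i2 by (simp add: nn_integral_eq_integral)
  next
    have b: "\<bar>- rr * G N x\<bar> \<le> rr * (real N * (C1 + 2))" for x
      using G_bound[OF N, of x] rr_pos by (simp add: abs_mult)
    have "integrable ?M (\<lambda>x. exp (- rr * G N x))"
      by (rule exp_bounded_integrable(1)[OF P.prob_space_axioms _ b]) measurable
    then show "(LINT x|?M. exp (- rr * G N x)) \<le> exp (rr * Ca + 1)"
      using moment_nn[OF N] by (simp add: nn_integral_eq_integral)
  qed measurable
  also have "(rr * Ca + 1) / rr = Ca + 1 / rr" using rr_pos by (simp add: add_divide_distrib)
  finally show ?thesis unfolding step prod .
qed

end

section \<open>The entropy estimate\<close>

lemma particle_step_measurable:
  assumes h: "Ck_torus2 3 h" and F [measurable]: "F \<in> borel_measurable borel"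
  shows "particle_step dt h F N \<in> measurable (torus_pow N) (torus_pow N)"
  unfolding particle_step_def
proof (rule measurable_torus_pow_restrict)
  fix i assume i: "i < N"
  have [measurable]: "(\<lambda>x. x j) \<in> measurable (torus_pow N) borel" if "j < N" for j
    using that by (intro measurable_component_singleton) auto
  have [measurable]: "(\<lambda>x. h (x i) (x j)) \<in> borel_measurable (torus_pow N)" if "j < N" for j
    using hpart_measurable[OF h, of "[]" "\<lambda>x. x i" "torus_pow N" "\<lambda>x. x j"] i that by (simp add: hpart_Nil[OF h])
  have "(\<lambda>x. dt / real N * (\<Sum>j<N. h (x i) (x j))) \<in> borel_measurable (torus_pow N)" by measurable
  then show "(\<lambda>x. F (x i \<oplus> dt / real N * (\<Sum>j<N. h (x i) (x j)))) \<in> measurable (torus_pow N) borel"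
    using i by measurable
qed

lemma particles_Suc: "particles dt h F N x (Suc t) = particle_step dt h F N (particles dt h F N x t)"
  by (simp add: particles_def)

lemma particles_0: "particles dt h F N x 0 = x"
  by (simp add: particles_def)

lemma particles_measurable:
  assumes h: "Ck_torus2 3 h" and F: "F \<in> borel_measurable borel"
  shows "(\<lambda>x. particles dt h F N x t) \<in> measurable (torus_pow N) (torus_pow N)"
proof (induct t)
  case (Suc t)
  show ?case unfolding particles_Suc by (rule measurable_compose[OF Suc particle_step_measurable[OF h F]])
qed (simp add: particles_0)

lemma mean_field_stepI:
  assumes "Ck_torus2 3 h" "0 < dt" "dt < 1 / (64 * (1 + \<bar>Ck_norm_torus2 3 h\<bar>))" "0 < \<kappa>"
    "mean_field_solution dt h F \<kappa> K T \<rho>" "t \<le> T"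
  shows "mean_field_step h (Ck_norm_torus2 3 h) dt \<kappa> K (\<rho> t)"
  using assms hpart_norm_nonneg[OF assms(1)] unfolding mean_field_step_def mean_field_solution_def by auto

text \<open>One step maps an entropy \<open>e\<close> to at most \<open>A * e + A'\<close>;
  iterating this affine recursion gives the exponential factor.\<close>

theorem property_E_holds:
  assumes \<kappa>: "0 < \<kappa>"
  shows "property_E H0 \<kappa> K (1 / (64 * (1 + abs H0)))"
proof -
  \<comment> \<open>\<open>rr\<close> and \<open>Ca\<close> are functions of the three numbers
    \<open>H0\<close>, \<kappa>, \<open>K\<close> alone, so they may be fixed before
    \<open>h\<close>, the step size and the densities.\<close>
  define r where "r = mean_field_step.rr H0 \<kappa> K"
  define A where "A = 1 + 1 / r"
  define A' where "A' = mean_field_step.Ca H0 \<kappa> K + 1 / r"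
  \<comment> \<open>Absolute values, because the signs of \<open>A\<close> and \<open>A'\<close>
    become available only from a solution; \<open>C'\<close> is \<open>ln B\<close>, so that
    \<open>exp (C' * t) = B ^ t\<close>.\<close>
  define B where "B = 2 + abs A + abs A'"
  have B: "2 \<le> B" by (simp add: B_def)
  have expB: "exp (ln B * real t) = B ^ t" for t using B by (simp add: exp_of_nat2_mult)
  show ?thesis unfolding property_E_def
  proof (intro exI[of _ "ln B"] conjI allI impI)
    show "0 < ln B" using B by simp
    fix h dt F T \<rho> N and L :: "(nat \<Rightarrow> torus) measure" and t
    assume h: "Ck_torus2 3 h" and H0: "Ck_norm_torus2 3 h = H0" and dt: "0 < dt" "dt < 1 / (64 * (1 + abs H0))"
      and F: "continuous_on UNIV F" and sol: "mean_field_solution dt h F \<kappa> K T \<rho>" and N: "1 \<le> N"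
      and L: "prob_space L" "sets L = sets (torus_pow N)" and t: "t \<le> T"
    have Fm: "F \<in> borel_measurable borel" by (rule borel_measurable_continuous_onI[OF F])
    have N0: "0 < N" using N by simp
    define Lt where "Lt t = distr L (torus_pow N) (\<lambda>x. particles dt h F N x t)" for t
    define \<nu> where "\<nu> t = iid N (dens (\<rho> t))" for t
    have pm[measurable]: "(\<lambda>x. particles dt h F N x t) \<in> measurable L (torus_pow N)" for t
      using particles_measurable[OF h Fm] L(2) by (simp cong: measurable_cong_sets)
    have Lt_prob: "prob_space (Lt t)" for t
      unfolding Lt_def by (rule prob_space.prob_space_distr[OF L(1)]) measurable
    have Lt_Suc: "Lt (Suc t) = distr (Lt t) (torus_pow N) (particle_step dt h F N)" for t
      unfolding Lt_def particles_Suc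
      by (subst distr_distr[OF particle_step_measurable[OF h Fm] pm]) (simp add: comp_def)
    have L0: "Lt 0 = L"
    proof -
      have "Lt 0 = distr L L (\<lambda>x. x)" unfolding Lt_def particles_0 by (rule distr_cong) (auto simp: L(2))
      then show ?thesis by simp
    qed
    have step: "rel_entropy (Lt (Suc t)) (\<nu> (Suc t)) \<le> ereal A * rel_entropy (Lt t) (\<nu> t) + ereal A'"
      and pos: "0 < r" "0 \<le> A'" if "t < T" for t
    proof -
      interpret mean_field_step h H0 dt \<kappa> K "\<rho> t" using mean_field_stepI[OF h _ _ \<kappa> sol, of t] that dt H0 by simp
      show "0 < r" using rr_pos by (simp add: r_def)
      then show "0 \<le> A'" using C\<Phi>_nonneg Cc_nonneg by (simp add: A'_def Ca_def)
      have "dens (\<rho> (Suc t)) = distr (dens (\<rho> t)) borel (F_mu dt h F (dens (\<rho> t)))"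
        using sol that by (simp add: mean_field_solution_def)
      then show "rel_entropy (Lt (Suc t)) (\<nu> (Suc t)) \<le> ereal A * rel_entropy (Lt t) (\<nu> t) + ereal A'"
        using entropy_step[OF N0 Lt_prob _ Fm, of t] unfolding Lt_Suc \<nu>_def A_def A'_def r_def by (simp add: Lt_def)
    qed
    show "ereal (1 / real N) * rel_entropy (distr L (torus_pow N) (\<lambda>x. particles dt h F N x t)) (iid N (dens (\<rho> t)))
      \<le> ereal (exp (ln B * real t)) * (ereal (1 / real N) * rel_entropy L (iid N (dens (\<rho> 0))) + ereal (1 / real N))"
    proof (cases "rel_entropy L (\<nu> 0) = \<infinity>")
      case True
      then show ?thesis using N0 by (simp add: \<nu>_def)
    next
      case False
      have P0: "prob_space (\<nu> 0)"
        unfolding \<nu>_def by (rule prob_space_PiM) (use sol in \<open>auto simp: mean_field_solution_def\<close>)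
      have "sets L = sets (\<nu> 0)" unfolding L(2) \<nu>_def by (intro sets_PiM_cong) auto
      from rel_entropy_nonneg[OF L(1) P0 this] False
      obtain e0 where e0: "rel_entropy L (\<nu> 0) = ereal e0" "0 \<le> e0" by (cases "rel_entropy L (\<nu> 0)") auto
      \<comment> \<open>Adding 1 to the entropy absorbs the constant \<open>A'\<close>: the quantity
        \<open>e + 1\<close> grows at most by the factor \<open>B\<close>, and dividing by
        \<open>N\<close> gives the summand \<open>1 / N\<close> of the claim.\<close>
      have "rel_entropy (Lt t) (\<nu> t) \<le> ereal (B ^ t * (e0 + 1) - 1)" using t
      proof (induct t)
        case 0
        then show ?case by (simp add: L0 e0)
      next
        case (Suc t)
        then have tT: "t < T" by simp
        note p = pos[OF tT]
        have A: "1 \<le> A" using p by (simp add: A_def)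
        let ?X = "B ^ t * (e0 + 1)"
        have X: "1 \<le> ?X" using mult_mono[of 1 "B ^ t" 1 "e0 + 1"] B e0 by (simp add: one_le_power)
        have "rel_entropy (Lt (Suc t)) (\<nu> (Suc t)) \<le> ereal A * rel_entropy (Lt t) (\<nu> t) + ereal A'" by (rule step[OF tT])
        also have "... \<le> ereal A * ereal (?X - 1) + ereal A'"
          using Suc A by (intro add_right_mono ereal_mult_left_mono) auto
        also have "... \<le> ereal (B ^ Suc t * (e0 + 1) - 1)"
        proof -
          have "A' * 1 \<le> A' * ?X" using p X by (intro mult_left_mono)
          moreover have "(A + A') * ?X \<le> B * ?X" using X A p by (intro mult_right_mono) (auto simp: B_def)
          ultimately have "A * (?X - 1) + A' \<le> B * ?X - 1" using A by (simp add: algebra_simps)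
          then show ?thesis by (simp add: mult.assoc)
        qed
        finally show ?case .
      qed
      then have "ereal (1 / real N) * rel_entropy (Lt t) (\<nu> t) \<le> ereal (1 / real N) * ereal (B ^ t * (e0 + 1) - 1)"
        by (intro ereal_mult_left_mono) auto
      also have "... \<le> ereal (B ^ t) * (ereal (1 / real N) * ereal e0 + ereal (1 / real N))"
        using N0 by (simp add: field_simps)
      finally show ?thesis using e0 by (simp add: expB Lt_def \<nu>_def)
    qed
  qed
qed

section \<open>Linearisation of the dynamics around the mean-field flow\<close>

lemma Ck_euclid_mono: "Ck_euclid n k f \<Longrightarrow> j \<le> k \<Longrightarrow> Ck_euclid n j f"
  unfolding Ck_euclid_def by (meson order_trans less_le_trans)

text \<open>C^{1,1} self-maps, described by the real displacement of the image; no lift has to be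
  chosen.\<close>

definition c11_map :: "real \<Rightarrow> (torus \<Rightarrow> torus) \<Rightarrow> (torus \<Rightarrow> real) \<Rightarrow> bool"
  where "c11_map c X X' \<longleftrightarrow> 0 \<le> c \<and> (\<forall>x t. \<exists>r. X (x \<oplus> t) = X x \<oplus> r \<and> \<bar>r\<bar> \<le> c * abs t \<and> \<bar>r - t * X' x\<bar> \<le> c * t^2)"

lemma lip_comp_map:
  assumes X: "c11_map c X X'" and g: "lip L g"
  shows "lip (L * c) (\<lambda>x. g (X x))"
  unfolding lip_def
proof (intro allI)
  fix x t
  obtain r where r: "X (x \<oplus> t) = X x \<oplus> r" "abs r \<le> c * abs t" using X unfolding c11_map_def by blast
  have "\<bar>g (X x \<oplus> r) - g (X x)\<bar> \<le> L * abs r" by (rule lipD[OF g])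
  also have "... \<le> L * (c * abs t)" using r lip_nonneg[OF g] by (intro mult_left_mono)
  finally show "\<bar>g (X (x \<oplus> t)) - g (X x)\<bar> \<le> L * c * abs t" by (simp add: r mult.assoc)
qed

lemma C11_deriv_bound: "C11 q f f' \<Longrightarrow> \<bar>f' x\<bar> \<le> q"
  using lip_deriv_bound C11D by blast

lemma C11_measurable: "C11 q f f' \<Longrightarrow> f \<in> borel_measurable borel" "C11 q f f' \<Longrightarrow> f' \<in> borel_measurable borel"
  using lip_measurable C11D(2) qd_deriv_lip[OF C11D(3)] by blast+

lemma C11_mono: "C11 q f f' \<Longrightarrow> q \<le> p \<Longrightarrow> C11 p f f'"
  unfolding C11_def by (meson lip_mono qd_mono order_trans)

lemma C11_comp_map:
  assumes X: "c11_map c X X'" and \<phi>: "C11 q \<phi> \<phi>'"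
  shows "C11 (q * (1 + c + c^2)) (\<lambda>x. \<phi> (X x)) (\<lambda>x. X' x * \<phi>' (X x))"
proof -
  note C = C11D[OF \<phi>]
  have c: "0 \<le> c" using X by (simp add: c11_map_def)
  have le: "q \<le> q * (1 + c + c^2)" "q * c \<le> q * (1 + c + c^2)"
    using C(4) c by (simp_all add: mult_le_cancel_left1 mult_left_mono)
  have "qd (q * (1 + c + c^2)) (\<lambda>x. \<phi> (X x)) (\<lambda>x. X' x * \<phi>' (X x))" unfolding qd_def
  proof (intro allI)
    fix x t
    obtain r where r: "X (x \<oplus> t) = X x \<oplus> r" "abs r \<le> c * abs t" "\<bar>r - t * X' x\<bar> \<le> c * t^2"
      using X unfolding c11_map_def by blast
    have "\<phi> (X (x \<oplus> t)) - \<phi> (X x) - t * (X' x * \<phi>' (X x)) =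
      (\<phi> (X x \<oplus> r) - \<phi> (X x) - r * \<phi>' (X x)) + (r - t * X' x) * \<phi>' (X x)" by (simp add: r algebra_simps)
    also have "\<bar>...\<bar> \<le> q * r^2 + (c * t^2) * q"
      by (intro order_trans[OF abs_triangle_ineq] add_mono abs_le_mult qdD[OF C(3)] r C11_deriv_bound[OF \<phi>])
    also have "q * r^2 \<le> q * (c^2 * t^2)"
      using power_mono[OF r(2), of 2] C(4) by (intro mult_left_mono) (auto simp: power_mult_distrib)
    finally have "\<bar>\<phi> (X (x \<oplus> t)) - \<phi> (X x) - t * (X' x * \<phi>' (X x))\<bar> \<le> q * (c + c^2) * t^2"
      by (simp add: algebra_simps)
    also have "... \<le> q * (1 + c + c^2) * t^2" using C(4) by (intro mult_right_mono mult_left_mono) auto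
    finally show "\<bar>\<phi> (X (x \<oplus> t)) - \<phi> (X x) - t * (X' x * \<phi>' (X x))\<bar> \<le> q * (1 + c + c^2) * t^2" .
  qed
  then show ?thesis unfolding C11_def using le C(1) lip_mono[OF lip_comp_map[OF X C(2)]] order_trans by blast
qed

lemma continuous_integer_valued_const:
  fixes g :: "real \<Rightarrow> real"
  assumes "continuous_on UNIV g" "\<And>x. g x \<in> \<int>"
  shows "\<exists>c. \<forall>x. g x = c"
proof -
  have "g constant_on UNIV"
  proof (rule continuous_discrete_range_constant[OF connected_UNIV assms(1)])
    fix x :: real
    have "1 \<le> norm (g y - g x)" if "g y \<noteq> g x" for y
    proof -
      have "g y - g x \<in> \<int>" using assms(2) by simp
      then obtain k where "g y - g x = of_int k" by (auto elim: Ints_cases)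
      then show ?thesis using that by (auto simp: abs_if)
    qed
    then show "\<exists>e>0. \<forall>y. y \<in> UNIV \<and> g y \<noteq> g x \<longrightarrow> e \<le> norm (g y - g x)" by (intro exI[of _ 1]) auto
  qed
  then show ?thesis by (auto simp: constant_on_def)
qed

text \<open>The norm refers to the lift picked by \<open>SOME\<close>. Two lifts differ by a
  constant, so this one is as smooth as the given one; and \<open>G (x + 1) - G x\<close> is a
  constant integer, so its derivatives are periodic and bounded.\<close>

lemma Ck_map_c11:
  assumes F: "Ck_map 3 F"
  shows "c11_map (Ck_norm_map 2 F) F (map_deriv F)"
proof -
  obtain G1 where G1: "is_lift F G1" "Ck_real 3 G1" using F by (auto simp: Ck_map_def)
  define G where "G = (SOME G. is_lift F G)"
  have G: "is_lift F G" unfolding G_def by (rule someI[of "is_lift F", OF G1(1)])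
  have "\<exists>c. \<forall>x. G x - G1 x = c"
  proof (rule continuous_integer_valued_const)
    show "continuous_on UNIV (\<lambda>x. G x - G1 x)" using G G1 by (auto simp: is_lift_def intro!: continuous_intros)
    have "proj (G x) = proj (G1 x)" for x using G G1 unfolding is_lift_def by metis
    then show "G x - G1 x \<in> \<int>" for x by (simp add: proj_eq_iff)
  qed
  then obtain c where c: "G x = G1 x + c" for x by (metis add.commute diff_add_cancel)
  have D1: "(G has_real_derivative deriv G x) (at x)" and D2: "(deriv G has_real_derivative deriv (deriv G) x) (at x)"
    and cont2: "continuous_on UNIV (deriv (deriv G))" for x
  proof -
    have a: "(G1 has_real_derivative deriv G1 x) (at x)" for x using Ck_real_DERIV[OF G1(2), of 0 x] by simp
    have "(G has_real_derivative deriv G1 x) (at x)" for x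
    proof -
      have "G = (\<lambda>x. G1 x + c)" using c by auto
      then show ?thesis using DERIV_add[OF a DERIV_const] by simp
    qed
    then have e: "deriv G = deriv G1" by (auto intro: DERIV_imp_deriv)
    show "(G has_real_derivative deriv G x) (at x)" unfolding e using \<open>\<And>x. (G has_real_derivative deriv G1 x) (at x)\<close> .
    show "(deriv G has_real_derivative deriv (deriv G) x) (at x)"
      unfolding e using Ck_real_DERIV[OF G1(2), of 1 x] by simp
    show "continuous_on UNIV (deriv (deriv G))"
      unfolding e using Ck_real_continuous[OF G1(2), of 2] by (simp add: numeral_2_eq_2)
  qed
  have C2: "Ck_real 2 G" unfolding Ck_real_def
  proof (intro conjI allI impI)
    fix j :: nat and x assume "j < 2"
    then have "j = 0 \<or> j = 1" by auto
    then show "(deriv ^^ j) G differentiable at x" using D1[of x] D2[of x] by (auto simp: real_differentiable_def)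
  qed (use cont2 in \<open>simp add: numeral_2_eq_2\<close>)
  have "\<exists>d. \<forall>x. G (x + 1) - G x = d"
  proof (rule continuous_integer_valued_const)
    have cG: "continuous_on UNIV G" using G by (simp add: is_lift_def)
    show "continuous_on UNIV (\<lambda>x. G (x + 1) - G x)" by (intro continuous_intros continuous_on_compose2[OF cG]) auto
    have "proj (x + 1) = proj x" for x by (simp add: proj_eq_iff)
    then have "proj (G (x + 1)) = proj (G x)" for x using G unfolding is_lift_def by metis
    then show "G (x + 1) - G x \<in> \<int>" for x by (simp add: proj_eq_iff)
  qed
  then obtain d where d: "G (x + 1) = G x + d" for x by (metis add.commute diff_add_cancel)
  have per1: "deriv G (x + 1) = deriv G x" for x
  proof -
    have "((\<lambda>s. G (s + 1)) has_real_derivative deriv G x) (at x)"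
    proof -
      have "(\<lambda>s. G (s + 1)) = (\<lambda>s. G s + d)" using d by auto
      then show ?thesis using DERIV_add[OF D1 DERIV_const] by simp
    qed
    then show ?thesis unfolding deriv_shift by (rule DERIV_imp_deriv)
  qed
  have per: "(deriv ^^ j) G (x + 1) = (deriv ^^ j) G x" if "j \<in> {1..2}" for j x
  proof -
    obtain i where "j = Suc i" by (cases j) (use \<open>j \<in> {1..2}\<close> in auto)
    then show ?thesis using funpow_deriv_periodic[of "deriv G" i x, OF per1] by (simp only: funpow_Suc_right comp_def)
  qed
  have bd: "\<bar>(deriv ^^ j) G x\<bar> \<le> Ck_norm_map 2 F" if "j \<in> {1..2}" for j x
    using Ck_real_periodic_bound[of 2 G "{1..2}" j x, OF C2 per] that by (auto simp: Ck_norm_map_def G_def)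
  have b1: "\<bar>deriv G x\<bar> \<le> Ck_norm_map 2 F" and b2: "\<bar>deriv (deriv G) x\<bar> \<le> Ck_norm_map 2 F" for x
    using bd[of 1 x] bd[of 2 x] by (simp_all add: numeral_2_eq_2)
  show ?thesis unfolding c11_map_def
  proof (intro conjI allI)
    show "0 \<le> Ck_norm_map 2 F" using order_trans[OF abs_ge_zero b1] .
    fix x t
    let ?r = "G (rep_torus x + t) - G (rep_torus x)"
    have "F (proj (rep_torus x + t)) = proj (G (rep_torus x + t))" "F (proj (rep_torus x)) = proj (G (rep_torus x))"
      using G unfolding is_lift_def by blast+
    moreover have "x \<oplus> t = proj (rep_torus x + t)" by (metis proj_rep torus_add_proj)
    ultimately have "F (x \<oplus> t) = F x \<oplus> ?r" by simp
    moreover have "abs ?r \<le> Ck_norm_map 2 F * abs t"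
      using real_lip_of_deriv[OF D1 b1, of "rep_torus x + t" "rep_torus x"] by simp
    moreover have "\<bar>?r - t * map_deriv F x\<bar> \<le> Ck_norm_map 2 F * t^2"
      using real_taylor1[OF D1 real_lip_of_deriv[OF D2 b2], of "rep_torus x" t] by (simp add: map_deriv_def G_def)
    ultimately show "\<exists>r. F (x \<oplus> t) = F x \<oplus> r \<and> \<bar>r\<bar> \<le> Ck_norm_map 2 F * abs t \<and> \<bar>r - t * map_deriv F x\<bar> \<le> Ck_norm_map 2 F * t^2"
      by blast
  qed
qed

lemma Ck_map_measurable: assumes "Ck_map k F" shows "F \<in> borel_measurable borel"
proof -
  obtain G where G: "continuous_on UNIV G" "\<And>s. F (proj s) = proj (G s)"
    using assms by (auto simp: Ck_map_def is_lift_def)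
  have [measurable]: "G \<in> borel_measurable borel" by (rule borel_measurable_continuous_onI[OF G(1)])
  show ?thesis by (rule measurable_torusI) (simp add: G(2))
qed

text \<open>\<open>dual_lip w \<mu> \<nu>\<close>: the Kantorovich distance of \<open>\<mu>\<close> and \<open>\<nu>\<close> is at most \<open>w\<close>.\<close>

definition dual_lip :: "real \<Rightarrow> torus measure \<Rightarrow> torus measure \<Rightarrow> bool"
  where "dual_lip w \<mu> \<nu> \<longleftrightarrow> (\<forall>L g. lip L g \<longrightarrow> \<bar>(LINT x|\<mu>. g x) - (LINT x|\<nu>. g x)\<bar> \<le> L * w)"

lemma C11_lin:
  assumes f: "C11 q f f'" and g: "C11 p g g'"
  shows "C11 (q + abs a * p) (\<lambda>x. f x + a * g x) (\<lambda>x. f' x + a * g' x)"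
proof -
  note F = C11D[OF f] and G = C11D[OF g]
  have *: "\<bar>x + a * y\<bar> \<le> (q + abs a * p) * r" if "abs x \<le> q * r" "abs y \<le> p * r" for x y r
  proof -
    have "\<bar>x + a * y\<bar> \<le> q * r + abs a * (p * r)"
      by (intro order_trans[OF abs_triangle_ineq] add_mono that abs_le_mult order_refl)
    then show ?thesis by (simp add: algebra_simps)
  qed
  show ?thesis unfolding C11_def lip_def qd_def
  proof (intro conjI allI)
    fix x t
    show "\<bar>f x + a * g x\<bar> \<le> q + abs a * p" using *[of "f x" 1 "g x"] F(1)[of x] G(1)[of x] by simp
    have "f (x \<oplus> t) + a * g (x \<oplus> t) - (f x + a * g x) = (f (x \<oplus> t) - f x) + a * (g (x \<oplus> t) - g x)" by (simp add: algebra_simps)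
    then show "\<bar>f (x \<oplus> t) + a * g (x \<oplus> t) - (f x + a * g x)\<bar> \<le> (q + abs a * p) * abs t"
      using *[OF lipD[OF F(2)] lipD[OF G(2)]] by metis
    have "f (x \<oplus> t) + a * g (x \<oplus> t) - (f x + a * g x) - t * (f' x + a * g' x) =
      (f (x \<oplus> t) - f x - t * f' x) + a * (g (x \<oplus> t) - g x - t * g' x)" by (simp add: algebra_simps)
    then show "\<bar>f (x \<oplus> t) + a * g (x \<oplus> t) - (f x + a * g x) - t * (f' x + a * g' x)\<bar> \<le> (q + abs a * p) * t^2"
      using *[OF qdD[OF F(3)] qdD[OF G(3)]] by metis
  qed
qed

lemma C11_average:
  assumes M: "prob_space M" and g: "g \<in> borel_measurable M" and gB: "\<And>x. \<bar>g x\<bar> \<le> B"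
    and h: "\<And>x. C11 b (h x) (h' x)" and hm: "\<And>z. (\<lambda>x. h x z) \<in> borel_measurable M" "\<And>z. (\<lambda>x. h' x z) \<in> borel_measurable M"
  shows "C11 (B * b) (\<lambda>z. LINT x|M. g x * h x z) (\<lambda>z. LINT x|M. g x * h' x z)"
proof -
  note H = C11D[OF h]
  have gh: "\<bar>g x * h x z\<bar> \<le> B * b" "\<bar>g x * h' x z\<bar> \<le> B * b" for x z
    by (intro abs_le_mult gB H(1) C11_deriv_bound[OF h])+
  have scale: "\<bar>g x * e\<bar> \<le> B * b * r" if "abs e \<le> b * r" for x e r
    using abs_le_mult[OF gB[of x] that] by (simp add: mult.assoc)
  note m = borel_measurable_times[OF g hm(1)] borel_measurable_times[OF g hm(2)]
  show ?thesis unfolding C11_def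
  proof (intro conjI allI)
    show "\<bar>LINT x|M. g x * h x z\<bar> \<le> B * b" for z by (rule average_bound(1)[OF M m(1) gh(1)])
    show "lip (B * b) (\<lambda>z. LINT x|M. g x * h x z)"
    proof (rule lip_average[OF M m(1) gh(1)])
      show "lip (B * b) (\<lambda>z. g x * h x z)" for x
        unfolding lip_def right_diff_distrib[symmetric] using scale lipD[OF H(2)] by blast
    qed
    show "qd (B * b) (\<lambda>z. LINT x|M. g x * h x z) (\<lambda>z. LINT x|M. g x * h' x z)"
    proof (rule qd_average[OF M m(1) gh(1) m(2) gh(2)])
      show "qd (B * b) (\<lambda>z. g x * h x z) (\<lambda>z. g x * h' x z)" for x unfolding qd_def
      proof (intro allI)
        fix z t
        have "g x * h x (z \<oplus> t) - g x * h x z - t * (g x * h' x z) = g x * (h x (z \<oplus> t) - h x z - t * h' x z)"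
          by (simp add: algebra_simps)
        also have "\<bar>...\<bar> \<le> B * b * t^2" by (rule scale[OF qdD[OF H(3)]])
        finally show "\<bar>g x * h x (z \<oplus> t) - g x * h x z - t * (g x * h' x z)\<bar> \<le> B * b * t^2" .
      qed
    qed
  qed
qed

text \<open>In the weak equation the term \<open>h * \<eta>\<close> is integrated against \<rho>.
  Exchanging this integral with the pairing writes the whole right-hand side as one function paired
  with \<eta>.\<close>

definition back_step ::
  "real \<Rightarrow> (torus \<Rightarrow> torus \<Rightarrow> real) \<Rightarrow> (torus \<Rightarrow> torus) \<Rightarrow> (torus \<Rightarrow> real) \<Rightarrow> (torus \<Rightarrow> real) \<Rightarrow> torus \<Rightarrow> real"
  where "back_step dt h F \<rho> \<phi> z = \<phi> (F_mu dt h F (dens \<rho>) z) +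
    dt * (LINT x|dens \<rho>. torus_deriv (\<phi> \<circ> F) (phi dt h (dens \<rho>) x) * h x z)"

lemma bounded_integral_swap:
  fixes k :: "'a \<Rightarrow> 'b \<Rightarrow> real"
  assumes M: "prob_space M" and N: "prob_space N"
    and k: "(\<lambda>(x, z). k x z) \<in> borel_measurable (M \<Otimes>\<^sub>M N)" and b: "\<And>x z. \<bar>k x z\<bar> \<le> B"
  shows "(LINT z|N. LINT x|M. k x z) = (LINT x|M. LINT z|N. k x z)"
proof -
  interpret M: prob_space M by fact
  interpret N: prob_space N by fact
  interpret pair_sigma_finite M N ..
  interpret PP: prob_space "M \<Otimes>\<^sub>M N" by (intro prob_space_pair M N)
  show ?thesis by (rule Fubini_integral, rule PP.integrable_const_bound[of _ B]) (use k b in auto)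
qed

text \<open>The most recent step is undone first, with the density at time \<open>t\<close>.\<close>

primrec pull_back ::
  "real \<Rightarrow> (torus \<Rightarrow> torus \<Rightarrow> real) \<Rightarrow> (torus \<Rightarrow> torus) \<Rightarrow> (nat \<Rightarrow> torus \<Rightarrow> real) \<Rightarrow> nat \<Rightarrow> (torus \<Rightarrow> real) \<Rightarrow> torus \<Rightarrow> real"
  where
    "pull_back dt h F \<rho> 0 = (\<lambda>\<phi>. \<phi>)"
  | "pull_back dt h F \<rho> (Suc t) = (\<lambda>\<phi>. pull_back dt h F \<rho> t (back_step dt h F (\<rho> t) \<phi>))"

locale interaction =
  fixes h :: "torus \<Rightarrow> torus \<Rightarrow> real" and F :: "torus \<Rightarrow> torus" and dt b f :: real
  assumes h: "Ck_torus2 3 h" and b_def: "b = Ck_norm_torus2 2 h" and F: "Ck_map 3 F" and f_def: "f = Ck_norm_map 2 F"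
    and dt: "0 < dt"
begin

lemma h2: "Ck_torus2 2 h"
  using Ck_euclid_mono[of 2 3 "lift2 h" 2] h by (simp add: Ck_torus2_def)

abbreviation "h1 \<equiv> hpart h [0]"
abbreviation "hz \<equiv> hpart h [1]"

lemma b_nonneg: "0 \<le> b" unfolding b_def by (rule hpart_norm_nonneg[OF h2])

lemma h_bounds: "\<bar>h x z\<bar> \<le> b" "\<bar>h1 x z\<bar> \<le> b" "\<bar>hz x z\<bar> \<le> b"
  using hpart_bound[OF h2, of "[]" x z] hpart_bound[OF h2, of "[0]" x z] hpart_bound[OF h2, of "[1]" x z]
  by (simp_all add: hpart_Nil[OF h] b_def)

lemma h_measurable [measurable (raw)]:
  assumes "p \<in> measurable M borel" "q \<in> measurable M borel"
  shows "(\<lambda>w. h (p w) (q w)) \<in> borel_measurable M" "(\<lambda>w. h1 (p w) (q w)) \<in> borel_measurable M"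
    "(\<lambda>w. hz (p w) (q w)) \<in> borel_measurable M"
  using hpart_measurable[OF h2, of "[]" p M q] hpart_measurable[OF h2, of "[0]" p M q] hpart_measurable[OF h2, of "[1]" p M q] assms
  by (simp_all add: hpart_Nil[OF h])

lemma h_lip: "lip b (\<lambda>x. h x z)" "lip b (\<lambda>z. h x z)" "lip b (\<lambda>x. hz x z)"
  using hpart_lip_fst[OF h2, of "[]" z] hpart_lip_snd[OF h2, of "[]" x] hpart_lip_fst[OF h2, of "[1]" z]
  by (simp_all add: hpart_Nil[OF h] b_def)

lemma h_qd: "qd b (\<lambda>x. h x z) (\<lambda>x. h1 x z)" "qd b (\<lambda>z. h x z) (\<lambda>z. hz x z)"
  using hpart_qd_fst[OF h2, of "[]" z] hpart_qd_snd[OF h2, of "[]" x] by (simp_all add: hpart_Nil[OF h] b_def)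

lemma h_C11: "C11 b (h x) (hz x)"
  unfolding C11_def using h_bounds h_lip h_qd by blast

text \<open>\<open>hz\<close> is Lipschitz in the first argument, so the increment in
  \<open>x\<close> has Lipschitz constant of order \<open>t\<close> in \<open>z\<close>. This makes
  the Lipschitz constant of the drift difference \<open>dl\<close> proportional to the Kantorovich
  distance.\<close>

lemma h_mixed: "lip (b * abs t) (\<lambda>z. h (x \<oplus> t) z - h x z)"
  unfolding lip_def
proof (intro allI)
  fix z r
  have D: "((\<lambda>s. h (x \<oplus> t) (proj s) - h x (proj s)) has_real_derivative (hz (x \<oplus> t) (proj s) - hz x (proj s))) (at s)" for s
    by (intro derivative_intros qd_DERIV[OF h_qd(2)])
  have "\<bar>hz (x \<oplus> t) (proj s) - hz x (proj s)\<bar> \<le> b * abs t" for s by (rule lipD[OF h_lip(3)])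
  from real_lip_of_deriv[OF D this, of "rep_torus z + r" "rep_torus z"]
  have *: "\<bar>(h (x \<oplus> t) (proj (rep_torus z + r)) - h x (proj (rep_torus z + r))) - (h (x \<oplus> t) z - h x z)\<bar> \<le> b * abs t * abs r"
    by simp
  have e: "proj (rep_torus z + r) = z \<oplus> r" by (metis proj_rep torus_add_proj)
  show "\<bar>(h (x \<oplus> t) (z \<oplus> r) - h x (z \<oplus> r)) - (h (x \<oplus> t) z - h x z)\<bar> \<le> b * abs t * abs r" using * unfolding e .
qed

lemma F_measurable [measurable]: "F \<in> borel_measurable borel"
  by (rule Ck_map_measurable[OF F])

lemma F_c11: "c11_map f F (map_deriv F)"
  unfolding f_def by (rule Ck_map_c11[OF F])

lemma f_nonneg: "0 \<le> f" using F_c11 by (simp add: c11_map_def)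

lemma phi_c11:
  assumes M: "prob_space M" and s: "sets M = sets borel"
  shows "c11_map (1 + dt * b) (phi dt h M) (\<lambda>x. 1 + dt * (LINT z|M. h1 x z))"
  unfolding c11_map_def
proof (intro conjI allI)
  note [measurable_cong] = s
  show "0 \<le> 1 + dt * b" using dt b_nonneg by simp
  fix x t
  define S where "S x = (LINT z|M. h x z)" for x
  have L: "lip b S" unfolding S_def by (rule lip_average[OF M _ h_bounds(1) h_lip(1)]) measurable
  have Q: "qd b S (\<lambda>x. LINT z|M. h1 x z)"
    unfolding S_def by (rule qd_average[OF M _ h_bounds(1) _ h_bounds(2) h_qd(1)]) measurable
  let ?r = "t + dt * (S (x \<oplus> t) - S x)"
  have "phi dt h M (x \<oplus> t) = phi dt h M x \<oplus> ?r" by (simp add: phi_def S_def torus_add_add algebra_simps)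
  moreover have "\<bar>dt * (S (x \<oplus> t) - S x)\<bar> \<le> dt * (b * abs t)" using dt by (intro abs_le_mult lipD[OF L]) simp
  with abs_triangle_ineq[of t "dt * (S (x \<oplus> t) - S x)"] have "abs ?r \<le> abs t + dt * (b * abs t)" by linarith
  then have "abs ?r \<le> (1 + dt * b) * abs t" by (simp add: distrib_right mult.assoc)
  moreover have "\<bar>?r - t * (1 + dt * (LINT z|M. h1 x z))\<bar> \<le> (1 + dt * b) * t^2"
  proof -
    have "?r - t * (1 + dt * (LINT z|M. h1 x z)) = dt * (S (x \<oplus> t) - S x - t * (LINT z|M. h1 x z))"
      by (simp add: algebra_simps)
    also have "\<bar>...\<bar> \<le> dt * (b * t^2)" using dt by (intro abs_le_mult qdD[OF Q]) simp
    also have "... \<le> (1 + dt * b) * t^2" by (simp add: distrib_right mult.assoc)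
    finally show ?thesis .
  qed
  ultimately show "\<exists>r. phi dt h M (x \<oplus> t) = phi dt h M x \<oplus> r \<and> \<bar>r\<bar> \<le> (1 + dt * b) * abs t \<and>
      \<bar>r - t * (1 + dt * (LINT z|M. h1 x z))\<bar> \<le> (1 + dt * b) * t^2" by blast
qed

lemma phi_measurable [measurable]:
  assumes "prob_space M" and s[measurable_cong]: "sets M = sets borel"
  shows "phi dt h M \<in> borel_measurable borel"
proof -
  have "(\<lambda>x. LINT z|M. h x z) \<in> borel_measurable borel"
    by (rule lip_measurable[OF lip_average[OF assms(1) _ h_bounds(1) h_lip(1)]]) measurable
  then show ?thesis unfolding phi_def by measurable
qed

lemma F_mu_measurable: "prob_space M \<Longrightarrow> sets M = sets borel \<Longrightarrow> F_mu dt h F M \<in> borel_measurable borel"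
  unfolding F_mu_def comp_def by measurable

definition fh where "fh = 1 + f + f^2"
definition ph where "ph = 1 + (1 + dt * b) + (1 + dt * b)^2"
text \<open>One constant for three purposes: growth of the C^{1,1} constant under
  \<open>back_step\<close>, growth of the Kantorovich distance in one step, and the coefficient of
  the quadratic error. The summand 1 makes its powers nondecreasing.\<close>

definition A where "A = 1 + fh * (ph + dt * b) + f * (1 + 2 * dt * b) + fh * (dt * b) * (3 + 3 * dt * b)"

lemma const_nonneg: "0 \<le> dt * b" "1 \<le> fh" "1 \<le> ph" "0 \<le> A" "1 \<le> A"
    "fh * (ph + dt * b) \<le> A" "f * (1 + 2 * dt * b) \<le> A" "fh * (dt * b) * (3 + 3 * dt * b) \<le> A"
proof -
  show 1: "0 \<le> dt * b" "1 \<le> fh" "1 \<le> ph" using dt b_nonneg f_nonneg by (auto simp: fh_def ph_def)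
  have "0 \<le> fh * (ph + dt * b)" "0 \<le> f * (1 + 2 * dt * b)" "0 \<le> fh * (dt * b) * (3 + 3 * dt * b)"
    using 1 f_nonneg by auto
  then show "0 \<le> A" "1 \<le> A" "fh * (ph + dt * b) \<le> A" "f * (1 + 2 * dt * b) \<le> A" "fh * (dt * b) * (3 + 3 * dt * b) \<le> A"
    unfolding A_def by linarith+
qed

lemma C11_comp_F:
  assumes "C11 q \<phi> \<phi>'"
  shows "C11 (q * fh) (\<phi> \<circ> F) (torus_deriv (\<phi> \<circ> F))"
proof -
  have C: "C11 (q * fh) (\<phi> \<circ> F) (\<lambda>x. map_deriv F x * \<phi>' (F x))"
    using C11_comp_map[OF F_c11 assms] by (simp add: comp_def fh_def)
  then show ?thesis using qd_torus_deriv[OF C11D(3)[OF C]] by simp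
qed

lemma C11_interaction:
  assumes \<phi>: "C11 q \<phi> \<phi>'" and M: "prob_space (dens \<rho>)"
  defines "g \<equiv> \<lambda>x. torus_deriv (\<phi> \<circ> F) (phi dt h (dens \<rho>) x)"
  shows "g \<in> borel_measurable borel" "\<bar>g x\<bar> \<le> q * fh"
    "C11 (q * fh * ph) (\<phi> \<circ> F_mu dt h F (dens \<rho>)) (\<lambda>x. (1 + dt * (LINT z|dens \<rho>. h1 x z)) * g x)"
    "C11 (q * fh * b) (\<lambda>z. LINT x|dens \<rho>. g x * h x z) (\<lambda>z. LINT x|dens \<rho>. g x * hz x z)"
    "back_step dt h F \<rho> \<phi> = (\<lambda>z. (\<phi> \<circ> F_mu dt h F (dens \<rho>)) z + dt * (LINT x|dens \<rho>. g x * h x z))"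
proof -
  note \<psi> = C11_comp_F[OF \<phi>]
  show gm[measurable]: "g \<in> borel_measurable borel"
    unfolding g_def by (rule measurable_compose[OF phi_measurable[OF M sets_dens] C11_measurable(2)[OF \<psi>]])
  have gb: "\<bar>g x\<bar> \<le> q * fh" for x unfolding g_def by (rule C11_deriv_bound[OF \<psi>])
  then show "\<bar>g x\<bar> \<le> q * fh" .
  show "C11 (q * fh * ph) (\<phi> \<circ> F_mu dt h F (dens \<rho>)) (\<lambda>x. (1 + dt * (LINT z|dens \<rho>. h1 x z)) * g x)"
    using C11_comp_map[OF phi_c11[OF M sets_dens] \<psi>] by (simp add: ph_def F_mu_def comp_def g_def)
  show "C11 (q * fh * b) (\<lambda>z. LINT x|dens \<rho>. g x * h x z) (\<lambda>z. LINT x|dens \<rho>. g x * hz x z)"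
    by (rule C11_average[OF M _ gb h_C11]) measurable
  show "back_step dt h F \<rho> \<phi> = (\<lambda>z. (\<phi> \<circ> F_mu dt h F (dens \<rho>)) z + dt * (LINT x|dens \<rho>. g x * h x z))"
    by (simp add: fun_eq_iff back_step_def g_def)
qed

lemma C11_back_step:
  assumes \<phi>: "C11 q \<phi> \<phi>'" and M: "prob_space (dens \<rho>)"
  shows "\<exists>\<psi>'. C11 (A * q) (back_step dt h F \<rho> \<phi>) \<psi>'"
proof -
  note i = C11_interaction[OF \<phi> M]
  have "q * fh * ph + abs dt * (q * fh * b) \<le> A * q"
    using mult_left_mono[OF const_nonneg(6) C11D(4)[OF \<phi>]] dt by (simp add: algebra_simps)
  from C11_mono[OF C11_lin[OF i(3,4)] this] show ?thesis unfolding i(5) by blast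
qed

context
  fixes \<mu> :: "torus measure" and \<rho> :: "torus \<Rightarrow> real" and w :: real
  assumes \<mu>: "prob_space \<mu>" "sets \<mu> = sets borel" and \<nu>: "prob_space (dens \<rho>)" and w: "dual_lip w \<mu> (dens \<rho>)"
begin

definition dl where "dl x = dt * ((LINT z|\<mu>. h x z) - (LINT z|dens \<rho>. h x z))"

lemma w_nonneg: "0 \<le> w"
proof -
  have "lip 1 (\<lambda>_. 0)" by (simp add: lip_def)
  then show ?thesis using w unfolding dual_lip_def by force
qed

lemma dl_bound: "\<bar>dl x\<bar> \<le> dt * (b * w)"
  unfolding dl_def using w h_lip(2)[of x] dt unfolding dual_lip_def by (intro abs_le_mult) auto

lemma dl_lip: "lip (dt * b * w) dl"
  unfolding lip_def
proof (intro allI)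
  fix x t
  note [measurable_cong] = \<mu>(2)
  have int: "integrable \<mu> (h x)" "integrable (dens \<rho>) (h x)" for x
    by (rule average_bound(2)[OF \<mu>(1) _ h_bounds(1)], measurable)
       (rule average_bound(2)[OF \<nu> _ h_bounds(1)], measurable)
  have "\<bar>(LINT z|\<mu>. h (x \<oplus> t) z - h x z) - (LINT z|dens \<rho>. h (x \<oplus> t) z - h x z)\<bar> \<le> b * abs t * w"
    using w h_mixed[of t x] unfolding dual_lip_def by blast
  then have "\<bar>dt * ((LINT z|\<mu>. h (x \<oplus> t) z - h x z) - (LINT z|dens \<rho>. h (x \<oplus> t) z - h x z))\<bar> \<le> dt * (b * abs t * w)"
    using dt by (intro abs_le_mult) auto
  then show "\<bar>dl (x \<oplus> t) - dl x\<bar> \<le> dt * b * w * abs t" using int by (simp add: dl_def algebra_simps)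
qed

lemma phi_dl: "phi dt h \<mu> x = phi dt h (dens \<rho>) x \<oplus> dl x"
  by (simp add: phi_def dl_def torus_add_add algebra_simps)

text \<open>Two contributions: under \<mu> the two maps differ by a displacement of at most
  \<open>dt * b * w\<close>, and the mean-field map is then tested against the difference of the
  measures.\<close>

lemma dual_lip_step:
  "dual_lip (A * w) (distr \<mu> borel (F_mu dt h F \<mu>)) (distr (dens \<rho>) borel (F_mu dt h F (dens \<rho>)))"
  unfolding dual_lip_def
proof (intro allI impI)
  fix L g assume g: "lip L g"
  note [measurable_cong] = \<mu>(2)
  have [measurable]: "g \<in> borel_measurable borel" by (rule lip_measurable[OF g])
  note [measurable] = F_mu_measurable[OF \<mu>] F_mu_measurable[OF \<nu> sets_dens]
  have L: "0 \<le> L" by (rule lip_nonneg[OF g])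
  let ?p = "phi dt h (dens \<rho>)"
  have gF: "lip (L * f) (\<lambda>x. g (F x))" by (rule lip_comp_map[OF F_c11 g])
  have gFp: "lip (L * f * (1 + dt * b)) (\<lambda>x. g (F (?p x)))" by (rule lip_comp_map[OF phi_c11[OF \<nu> sets_dens] gF])
  have bd: "\<bar>k x\<bar> \<le> \<bar>k undefined\<bar> + L'" if "lip L' k" for k L' x using lip_oscillation[OF that, of x undefined] by linarith
  have m[measurable]: "(\<lambda>x. g (F (?p x \<oplus> dl x))) \<in> borel_measurable borel"
    using F_mu_measurable[OF \<mu>] measurable_compose[of "F_mu dt h F \<mu>" borel borel g]
    by (simp add: F_mu_def comp_def phi_dl)
  have i1: "integrable \<mu> (\<lambda>x. g (F (?p x \<oplus> dl x)))" by (rule average_bound(2)[OF \<mu>(1) _ bd[OF gF]]) measurable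
  have i2: "integrable \<mu> (\<lambda>x. g (F (?p x)))" by (rule lip_integrable[OF gFp \<mu>])
  have "(LINT x|distr \<mu> borel (F_mu dt h F \<mu>). g x) - (LINT x|distr (dens \<rho>) borel (F_mu dt h F (dens \<rho>)). g x)
    = (LINT x|\<mu>. g (F (?p x \<oplus> dl x))) - (LINT x|dens \<rho>. g (F (?p x)))"
  proof -
    have "(LINT x|distr \<mu> borel (F_mu dt h F \<mu>). g x) = (LINT x|\<mu>. g (F_mu dt h F \<mu> x))"
      by (rule integral_distr) measurable
    moreover have "(LINT x|distr (dens \<rho>) borel (F_mu dt h F (dens \<rho>)). g x) = (LINT x|dens \<rho>. g (F_mu dt h F (dens \<rho>) x))"
      by (rule integral_distr) measurable
    ultimately show ?thesis by (simp add: F_mu_def phi_dl)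
  qed
  also have "... = (LINT x|\<mu>. g (F (?p x \<oplus> dl x)) - g (F (?p x))) + ((LINT x|\<mu>. g (F (?p x))) - (LINT x|dens \<rho>. g (F (?p x))))"
    using i1 i2 by simp
  also have "\<bar>...\<bar> \<le> L * f * (dt * (b * w)) + L * f * (1 + dt * b) * w"
  proof (intro order_trans[OF abs_triangle_ineq] add_mono)
    show "\<bar>LINT x|\<mu>. g (F (?p x \<oplus> dl x)) - g (F (?p x))\<bar> \<le> L * f * (dt * (b * w))"
    proof (rule average_bound(1)[OF \<mu>(1)])
      fix x
      have "\<bar>g (F (?p x \<oplus> dl x)) - g (F (?p x))\<bar> \<le> L * f * \<bar>dl x\<bar>" by (rule lipD[OF gF])
      also have "... \<le> L * f * (dt * (b * w))" using L f_nonneg by (intro mult_left_mono dl_bound) auto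
      finally show "\<bar>g (F (?p x \<oplus> dl x)) - g (F (?p x))\<bar> \<le> L * f * (dt * (b * w))" .
    qed (use i1 i2 in simp)
    show "\<bar>(LINT x|\<mu>. g (F (?p x))) - (LINT x|dens \<rho>. g (F (?p x)))\<bar> \<le> L * f * (1 + dt * b) * w"
      using w gFp unfolding dual_lip_def by blast
  qed
  also have "... = L * ((f * (1 + 2 * dt * b)) * w)" by (simp add: algebra_simps)
  also have "... \<le> L * (A * w)" using L w_nonneg by (intro mult_left_mono mult_right_mono const_nonneg)
  finally show "\<bar>(LINT x|distr \<mu> borel (F_mu dt h F \<mu>). g x) - (LINT x|distr (dens \<rho>) borel (F_mu dt h F (dens \<rho>)). g x)\<bar> \<le> L * (A * w)" .
qed

text \<open>Both errors are quadratic in \<open>w\<close>. The expansion of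
  \<open>\<phi> \<circ> F\<close> around the mean-field image has remainder of order
  \<open>dl^2\<close>; and its linear term \<open>g * dl\<close> is averaged over \<mu> instead of
  the density, which costs its Lipschitz constant, itself of order \<open>w\<close>, times
  \<open>w\<close>.\<close>

lemma back_step_error:
  assumes \<phi>: "C11 q \<phi> \<phi>'"
  shows "\<bar>((LINT x|distr \<mu> borel (F_mu dt h F \<mu>). \<phi> x) - (LINT x|distr (dens \<rho>) borel (F_mu dt h F (dens \<rho>)). \<phi> x))
    - ((LINT x|\<mu>. back_step dt h F \<rho> \<phi> x) - (LINT x|dens \<rho>. back_step dt h F \<rho> \<phi> x))\<bar> \<le> q * A * w^2"
proof -
  interpret mu: prob_space \<mu> by (rule \<mu>)
  interpret nu: prob_space "dens \<rho>" by (rule \<nu>)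
  note [measurable_cong] = \<mu>(2)
  let ?\<psi> = "\<phi> \<circ> F" and ?p = "phi dt h (dens \<rho>)"
  note \<psi> = C11_comp_F[OF \<phi>]
  have q: "0 \<le> q" using C11D(4)[OF \<phi>] .
  note p = phi_c11[OF \<nu> sets_dens]
  note [measurable] = C11_measurable(1)[OF \<phi>] C11_measurable[OF \<psi>] phi_measurable[OF \<nu> sets_dens] lip_measurable[OF dl_lip]
    F_mu_measurable[OF \<mu>] F_mu_measurable[OF \<nu> sets_dens]
  define g where "g x = torus_deriv ?\<psi> (?p x)" for x
  have gb: "\<bar>g x\<bar> \<le> q * fh" for x unfolding g_def by (rule C11_deriv_bound[OF \<psi>])
  have gm[measurable]: "g \<in> borel_measurable borel" unfolding g_def by measurable
  have gL: "lip (2 * (q * fh) * (1 + dt * b)) g"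
    unfolding g_def by (rule lip_comp_map[OF p qd_deriv_lip[OF C11D(3)[OF \<psi>]]])
  have gh: "\<bar>g x * h x z\<bar> \<le> q * fh * b" for x z by (intro abs_le_mult gb h_bounds)
  define v where "v z = (LINT x|dens \<rho>. g x * h x z)" for z
  have vm[measurable]: "v \<in> borel_measurable borel" unfolding v_def by measurable
  have vb: "\<bar>v z\<bar> \<le> q * fh * b" for z unfolding v_def by (rule average_bound(1)[OF \<nu> _ gh]) measurable
  have eq: "back_step dt h F \<rho> \<phi> z = ?\<psi> (?p z) + dt * v z" for z by (simp add: back_step_def F_mu_def v_def g_def)
  have \<psi>b: "\<bar>?\<psi> x\<bar> \<le> q * fh" for x by (rule C11D(1)[OF \<psi>])
  have i\<psi>: "integrable M (\<lambda>x. ?\<psi> (k x))" if "prob_space M" "sets M = sets borel" "k \<in> borel_measurable borel" for M k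
  proof (rule average_bound(2)[OF that(1) _ \<psi>b])
    show "(\<lambda>x. ?\<psi> (k x)) \<in> borel_measurable M" using that(2,3) C11_measurable(1)[OF \<psi>]
      by (auto intro: measurable_compose cong: measurable_cong_sets)
  qed
  have iv: "integrable \<mu> v" "integrable (dens \<rho>) v" by (rule average_bound(2)[OF \<mu>(1) _ vb], measurable)
       (rule average_bound(2)[OF \<nu> _ vb], measurable)
  have ig: "integrable M (\<lambda>x. g x * dl x)" if "prob_space M" "sets M = sets borel" for M
    by (rule average_bound(2)[OF that(1) _ abs_le_mult[OF gb dl_bound]])
       (use that(2) in \<open>simp cong: measurable_cong_sets\<close>)
  have fub: "(LINT z|\<mu>. v z) = (LINT x|dens \<rho>. LINT z|\<mu>. g x * h x z)"
    unfolding v_def by (rule bounded_integral_swap[OF \<nu> \<mu>(1) _ gh]) measurable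
  have fub2: "(LINT z|dens \<rho>. v z) = (LINT x|dens \<rho>. LINT z|dens \<rho>. g x * h x z)"
    unfolding v_def by (rule bounded_integral_swap[OF \<nu> \<nu> _ gh]) measurable
  have igh: "integrable (dens \<rho>) (\<lambda>x. LINT z|M. g x * h x z)" if M: "prob_space M" and s[measurable_cong]: "sets M = sets borel" for M
  proof (rule average_bound(2)[OF \<nu>])
    interpret prob_space M by (rule M)
    show "(\<lambda>x. LINT z|M. g x * h x z) \<in> borel_measurable (dens \<rho>)" by measurable
    show "\<bar>LINT z|M. g x * h x z\<bar> \<le> q * fh * b" for x by (rule average_bound(1)[OF M _ gh]) measurable
  qed
  \<comment> \<open>By Fubini the interaction part of \<open>back_step\<close>, tested against the
    difference of the measures, is the average of \<open>g * dl\<close> over the density.\<close>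
  have "dt * (LINT z|\<mu>. v z) - dt * (LINT z|dens \<rho>. v z) = dt * (LINT x|dens \<rho>. (LINT z|\<mu>. g x * h x z) - (LINT z|dens \<rho>. g x * h x z))"
    using igh[OF \<mu>] igh[OF \<nu> sets_dens] by (simp add: fub fub2 right_diff_distrib)
  also have "... = (LINT x|dens \<rho>. g x * dl x)"
    by (subst integral_mult_right_zero[symmetric]) (simp add: dl_def algebra_simps)
  finally have v_eq: "dt * (LINT z|\<mu>. v z) - dt * (LINT z|dens \<rho>. v z) = (LINT x|dens \<rho>. g x * dl x)" .
  have i1: "integrable \<mu> (\<lambda>x. ?\<psi> (?p x \<oplus> dl x))" "integrable \<mu> (\<lambda>x. ?\<psi> (?p x))" "integrable (dens \<rho>) (\<lambda>x. ?\<psi> (?p x))"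
    by (intro i\<psi> \<mu> \<nu> sets_dens; measurable)+
  have "(LINT x|distr \<mu> borel (F_mu dt h F \<mu>). \<phi> x) = (LINT x|\<mu>. \<phi> (F_mu dt h F \<mu> x))"
    by (rule integral_distr) measurable
  then have "(LINT x|distr \<mu> borel (F_mu dt h F \<mu>). \<phi> x) = (LINT x|\<mu>. ?\<psi> (?p x \<oplus> dl x))"
    by (simp add: F_mu_def phi_dl)
  moreover have "(LINT x|distr (dens \<rho>) borel (F_mu dt h F (dens \<rho>)). \<phi> x) = (LINT x|dens \<rho>. \<phi> (F_mu dt h F (dens \<rho>) x))"
    by (rule integral_distr) measurable
  then have "(LINT x|distr (dens \<rho>) borel (F_mu dt h F (dens \<rho>)). \<phi> x) = (LINT x|dens \<rho>. ?\<psi> (?p x))"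
    by (simp add: F_mu_def)
  moreover have "(LINT x|\<mu>. back_step dt h F \<rho> \<phi> x) = (LINT x|\<mu>. ?\<psi> (?p x)) + dt * (LINT z|\<mu>. v z)"
    "(LINT x|dens \<rho>. back_step dt h F \<rho> \<phi> x) = (LINT x|dens \<rho>. ?\<psi> (?p x)) + dt * (LINT z|dens \<rho>. v z)"
    unfolding eq using i1 iv by simp_all
  moreover have "(LINT x|\<mu>. ?\<psi> (?p x \<oplus> dl x) - ?\<psi> (?p x) - dl x * g x) =
     (LINT x|\<mu>. ?\<psi> (?p x \<oplus> dl x)) - (LINT x|\<mu>. ?\<psi> (?p x)) - (LINT x|\<mu>. g x * dl x)"
    using i1 ig[OF \<mu>] by (simp add: mult.commute)
  ultimately have "((LINT x|distr \<mu> borel (F_mu dt h F \<mu>). \<phi> x) - (LINT x|distr (dens \<rho>) borel (F_mu dt h F (dens \<rho>)). \<phi> x))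
    - ((LINT x|\<mu>. back_step dt h F \<rho> \<phi> x) - (LINT x|dens \<rho>. back_step dt h F \<rho> \<phi> x)) =
    (LINT x|\<mu>. ?\<psi> (?p x \<oplus> dl x) - ?\<psi> (?p x) - dl x * g x) + ((LINT x|\<mu>. g x * dl x) - (LINT x|dens \<rho>. g x * dl x))"
    using v_eq by linarith
  also have "\<bar>...\<bar> \<le> q * fh * (dt * (b * w))^2 + (q * fh * (dt * b * w) + dt * (b * w) * (2 * (q * fh) * (1 + dt * b))) * w"
  proof (intro order_trans[OF abs_triangle_ineq] add_mono)
    show "\<bar>LINT x|\<mu>. ?\<psi> (?p x \<oplus> dl x) - ?\<psi> (?p x) - dl x * g x\<bar> \<le> q * fh * (dt * (b * w))^2"
    proof (rule average_bound(1)[OF \<mu>(1)])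
      fix x
      have "\<bar>?\<psi> (?p x \<oplus> dl x) - ?\<psi> (?p x) - dl x * g x\<bar> \<le> q * fh * (dl x)^2"
        unfolding g_def by (rule qdD[OF C11D(3)[OF \<psi>]])
      also have "... \<le> q * fh * (dt * (b * w))^2"
        using power_mono[OF dl_bound[of x], of 2] q const_nonneg by (intro mult_left_mono) auto
      finally show "\<bar>?\<psi> (?p x \<oplus> dl x) - ?\<psi> (?p x) - dl x * g x\<bar> \<le> q * fh * (dt * (b * w))^2" .
    qed measurable
    show "\<bar>(LINT x|\<mu>. g x * dl x) - (LINT x|dens \<rho>. g x * dl x)\<bar> \<le> (q * fh * (dt * b * w) + dt * (b * w) * (2 * (q * fh) * (1 + dt * b))) * w"
      using w lip_mult[OF gb gL dl_bound dl_lip] unfolding dual_lip_def by blast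
  qed
  also have "... = q * (fh * (dt * b) * (3 + 3 * dt * b)) * w^2" by (simp add: power2_eq_square algebra_simps)
  also have "... \<le> q * A * w^2" using q by (intro mult_right_mono mult_left_mono const_nonneg) auto
  finally show ?thesis .
qed

end

lemma C11_back:
  assumes "C11 q \<phi> \<phi>'" "\<And>s. s < t \<Longrightarrow> prob_space (dens (\<rho> s))"
  shows "\<exists>\<psi>'. C11 (A ^ t * q) (pull_back dt h F \<rho> t \<phi>) \<psi>'"
  using assms
proof (induct t arbitrary: q \<phi> \<phi>')
  case (Suc t)
  obtain \<psi>' where "C11 (A * q) (back_step dt h F (\<rho> t) \<phi>) \<psi>'" using C11_back_step[OF Suc.prems(1,2)] by blast
  from Suc.hyps[OF this] Suc.prems(2) show ?case by (auto simp: mult_ac)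
qed auto

context
  fixes \<mu> :: "nat \<Rightarrow> torus measure" and \<rho> :: "nat \<Rightarrow> torus \<Rightarrow> real" and T :: nat and w :: real
  assumes \<mu>: "\<And>t. t \<le> T \<Longrightarrow> prob_space (\<mu> t)" "\<And>t. t \<le> T \<Longrightarrow> sets (\<mu> t) = sets borel"
    and \<mu>_step: "\<And>t. t < T \<Longrightarrow> \<mu> (Suc t) = distr (\<mu> t) borel (F_mu dt h F (\<mu> t))"
    and \<nu>: "\<And>t. t \<le> T \<Longrightarrow> prob_space (dens (\<rho> t))"
    and \<nu>_step: "\<And>t. t < T \<Longrightarrow> dens (\<rho> (Suc t)) = distr (dens (\<rho> t)) borel (F_mu dt h F (dens (\<rho> t)))"
    and w0: "dual_lip w (\<mu> 0) (dens (\<rho> 0))"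
begin

lemma dual_lip_t: "t \<le> T \<Longrightarrow> dual_lip (A ^ t * w) (\<mu> t) (dens (\<rho> t))"
proof (induct t)
  case (Suc t)
  then have t: "t \<le> T" "t < T" "dual_lip (A ^ t * w) (\<mu> t) (dens (\<rho> t))" by auto
  then show ?case
    using dual_lip_step[OF \<mu>(1)[OF t(1)] \<mu>(2)[OF t(1)] \<nu>[OF t(1)] t(3)] \<mu>_step[of t] \<nu>_step[of t] by (simp add: mult_ac)
qed (simp add: w0)

text \<open>At each step a test function whose constant has grown by a power of \<open>A\<close>
  meets the square of a Kantorovich distance that has grown likewise; the \<open>t\<close> errors
  are all bounded by \<open>q * A ^ (2 * t) * w^2\<close>.\<close>

lemma back_error:
  assumes "t \<le> T" "C11 q \<phi> \<phi>'"
  shows "\<bar>((LINT x|\<mu> t. \<phi> x) - (LINT x|dens (\<rho> t). \<phi> x)) - ((LINT x|\<mu> 0. pull_back dt h F \<rho> t \<phi> x) - (LINT x|dens (\<rho> 0). pull_back dt h F \<rho> t \<phi> x))\<bar>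
    \<le> q * real t * (A ^ (2 * t) * w^2)" using assms
proof (induct t arbitrary: q \<phi> \<phi>')
  case (Suc t)
  note A = const_nonneg(4,5)
  have q: "0 \<le> q" using C11D(4)[OF Suc.prems(2)] .
  let ?\<psi> = "back_step dt h F (\<rho> t) \<phi>" and ?X = "A ^ (2 * t) * w^2"
  have X: "0 \<le> ?X" using A by simp
  obtain \<psi>' where \<psi>: "C11 (A * q) ?\<psi> \<psi>'" using C11_back_step[OF Suc.prems(2) \<nu>] Suc.prems(1) by (metis Suc_leD)
  have t: "t \<le> T" "t < T" using Suc.prems(1) by auto
  have 1: "\<bar>((LINT x|\<mu> (Suc t). \<phi> x) - (LINT x|dens (\<rho> (Suc t)). \<phi> x)) - ((LINT x|\<mu> t. ?\<psi> x) - (LINT x|dens (\<rho> t). ?\<psi> x))\<bar> \<le> q * A * (A ^ t * w)^2"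
    unfolding \<mu>_step[OF t(2)] \<nu>_step[OF t(2)]
    by (rule back_step_error[OF \<mu>(1,2) \<nu> dual_lip_t Suc.prems(2)]) (use t in auto)
  have 2: "\<bar>((LINT x|\<mu> t. ?\<psi> x) - (LINT x|dens (\<rho> t). ?\<psi> x)) - ((LINT x|\<mu> 0. pull_back dt h F \<rho> t ?\<psi> x) - (LINT x|dens (\<rho> 0). pull_back dt h F \<rho> t ?\<psi> x))\<bar> \<le> A * q * real t * ?X"
    by (rule Suc.hyps[OF t(1) \<psi>])
  have "q * A * (A ^ t * w)^2 = A * q * ?X" by (simp add: power_mult_distrib power_even_eq)
  with 1 2 have "\<bar>((LINT x|\<mu> (Suc t). \<phi> x) - (LINT x|dens (\<rho> (Suc t)). \<phi> x)) - ((LINT x|\<mu> 0. pull_back dt h F \<rho> t ?\<psi> x) - (LINT x|dens (\<rho> 0). pull_back dt h F \<rho> t ?\<psi> x))\<bar>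
    \<le> A * q * ?X + A * q * real t * ?X" by linarith
  also have "... = q * real (Suc t) * (A * ?X)" by (simp add: algebra_simps)
  \<comment> \<open>A second factor \<open>A \<ge> 1\<close> is inserted to reach the exponent
    \<open>2 * Suc t\<close>.\<close>
  also have "... \<le> q * real (Suc t) * (A * (A * ?X))"
    using mult_right_mono[OF A(2), of "A * ?X"] A X q by (intro mult_left_mono) auto
  also have "A * (A * ?X) = A ^ (2 * Suc t) * w^2" by (simp add: mult.assoc)
  finally show ?case unfolding pull_back.simps .
qed simp

end

end

lemma measurable_uniform_count: "x \<in> measurable (uniform_count_measure {..<N::nat}) (borel :: torus measure)"
proof -
  have "x \<in> measurable (count_space {..<N}) (borel :: torus measure)"
    unfolding measurable_count_space_eq1 space_borel by (rule funcsetI, rule UNIV_I)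
  moreover have "measurable (uniform_count_measure {..<N}) (borel :: torus measure) = measurable (count_space {..<N}) borel"
    by (rule measurable_cong_sets) (simp_all only: sets_uniform_count_measure sets_count_space)
  ultimately show ?thesis by (rule ssubst[rotated])
qed

lemma empirical_map:
  assumes G: "G \<in> borel_measurable borel" and y: "\<And>i. i < N \<Longrightarrow> y i = G (x i)"
  shows "empirical N y = distr (empirical N x) borel G"
proof -
  have "distr (uniform_count_measure {..<N}) borel y = distr (uniform_count_measure {..<N}) borel (G \<circ> x)"
    by (rule distr_cong) (use y in \<open>auto simp: space_uniform_count_measure\<close>)
  then show ?thesis unfolding empirical_def distr_distr[OF G measurable_uniform_count] .
qed

lemma borel_measurable_F_mu:
  assumes F: "F \<in> borel_measurable borel" and i: "(\<lambda>y. LINT z|\<mu>. h y z) \<in> borel_measurable borel"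
  shows "F_mu dt h F \<mu> \<in> borel_measurable borel"
proof -
  have "(\<lambda>x. x \<oplus> dt * (LINT y|\<mu>. h x y)) \<in> borel_measurable borel"
    by (rule measurable_torus_add[OF measurable_ident_sets[OF refl] borel_measurable_times[OF borel_measurable_const i]])
  then show ?thesis unfolding F_mu_def comp_def phi_def by (rule measurable_compose[OF _ F])
qed

text \<open>The interaction sum contains the self-interaction, exactly as the integral against the
  empirical measure does. The particle system is thus the mean-field dynamics started from its own
  empirical measure.\<close>

lemma empirical_particle_step:
  assumes h: "Ck_torus2 3 h" and F: "F \<in> borel_measurable borel" and N: "0 < N"
  shows "empirical N (particle_step dt h F N x) = distr (empirical N x) borel (F_mu dt h F (empirical N x))"
proof (rule empirical_map)
  have hm: "h y \<in> borel_measurable borel" for y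
    using lip_measurable[OF hpart_lip_snd[OF h, of "[]" y]] by (simp add: hpart_Nil[OF h])
  have L: "lip (Ck_norm_torus2 3 h) (\<lambda>y. h y z)" for z
    using hpart_lip_fst[OF h, of "[]" z] by (simp add: hpart_Nil[OF h])
  have B: "\<bar>h y z\<bar> \<le> Ck_norm_torus2 3 h" for y z using hpart_bound[OF h, of "[]" y z] by (simp add: hpart_Nil[OF h])
  have "(\<lambda>y. LINT z|empirical N x. h y z) \<in> borel_measurable borel"
  proof (rule lip_measurable[OF lip_average[OF empirical_prob[OF N] _ B L]])
    show "h y \<in> borel_measurable (empirical N x)" for y
      using hm[of y] unfolding measurable_cong_sets[OF sets_empirical refl] .
  qed
  then show "F_mu dt h F (empirical N x) \<in> borel_measurable borel" by (rule borel_measurable_F_mu[OF F])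
  fix i assume i: "i < N"
  have "phi dt h (empirical N x) (x i) = x i \<oplus> dt / real N * (\<Sum>j<N. h (x i) (x j))"
    unfolding phi_def integral_empirical[OF N hm] by simp
  then show "particle_step dt h F N x i = F_mu dt h F (empirical N x) (x i)"
    using i by (simp only: particle_step_def F_mu_def comp_def restrict_apply lessThan_iff if_True)
qed

section \<open>Replacing independent summands one at a time\<close>

lemma real_taylor2:
  fixes g g1 g2 g3 :: "real \<Rightarrow> real"
  assumes g: "\<And>x. (g has_real_derivative g1 x) (at x)" and g1: "\<And>x. (g1 has_real_derivative g2 x) (at x)"
    and g2: "\<And>x. (g2 has_real_derivative g3 x) (at x)" and B: "\<And>x. \<bar>g3 x\<bar> \<le> B"
  shows "\<bar>g (x + t) - g x - t * g1 x - t^2 / 2 * g2 x\<bar> \<le> B * abs t ^ 3"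
proof -
  define D where "D n s = (if n = 0 then g (x + s) else if n = 1 then g1 (x + s) else if n = 2 then g2 (x + s) else g3 (x + s))" for n :: nat and s
  have sh: "((\<lambda>s. u (x + s)) has_real_derivative u' (x + s)) (at s)" if "\<And>x. (u has_real_derivative u' x) (at x)" for u u' :: "real \<Rightarrow> real" and s
    using that[of "x + s"] by (simp add: DERIV_shift add.commute)
  have "\<exists>s. abs s \<le> abs t \<and> g (x + t) = (\<Sum>k<3. D k 0 / fact k * t ^ k) + D 3 s / fact 3 * t ^ 3"
  proof (rule Maclaurin_bi_le)
    show "D 0 = (\<lambda>s. g (x + s))" by (simp add: D_def fun_eq_iff)
    show "\<forall>k s. k < 3 \<and> \<bar>s\<bar> \<le> abs t \<longrightarrow> DERIV (D k) s :> D (Suc k) s"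
    proof (intro allI impI)
      fix k :: nat and s assume "k < 3 \<and> \<bar>s\<bar> \<le> abs t"
      then have "k = 0 \<or> k = 1 \<or> k = 2" by auto
      then show "DERIV (D k) s :> D (Suc k) s"
        using sh[OF g, of s] sh[OF g1, of s] sh[OF g2, of s] by (elim disjE) (simp_all add: D_def[abs_def])
    qed
  qed
  then obtain s where s: "g (x + t) = (\<Sum>k<3. D k 0 / fact k * t ^ k) + D 3 s / fact 3 * t ^ 3" by blast
  have "g (x + t) - g x - t * g1 x - t^2 / 2 * g2 x = g3 (x + s) * t ^ 3 / 6"
    unfolding s by (simp add: D_def eval_nat_numeral algebra_simps)
  also have "\<bar>...\<bar> = \<bar>g3 (x + s)\<bar> * abs t ^ 3 / 6" by (simp add: abs_mult power_abs)
  also have "... \<le> B * abs t ^ 3 / 6" by (intro divide_right_mono mult_right_mono B) auto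
  also have "... \<le> B * abs t ^ 3"
  proof -
    have "0 \<le> B * abs t ^ 3" using order_trans[OF abs_ge_zero B] by simp
    then show ?thesis by simp
  qed
  finally show ?thesis .
qed

lemma Ck_euclid_continuous: assumes "Ck_euclid n k f" shows "continuous_on UNIV f"
proof -
  have "\<forall>js. set js \<subseteq> {..<n} \<longrightarrow> length js \<le> k \<longrightarrow> continuous_on UNIV (partial_derivs js f)"
    using assms unfolding Ck_euclid_def by (elim conjE)
  from this[rule_format, of "[]"] show ?thesis by simp
qed

section \<open>Second-order expansion in several variables\<close>

definition l1 :: "nat \<Rightarrow> (nat \<Rightarrow> real) \<Rightarrow> real"
  where "l1 n v = (\<Sum>i<n. \<bar>v i\<bar>)"

text \<open>A path from \<open>w\<close> to the endpoint of the increment \<open>v\<close> that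
  changes one coordinate at a time, so that one-variable expansions can be telescoped.\<close>

definition trunc_add :: "(nat \<Rightarrow> real) \<Rightarrow> nat \<Rightarrow> (nat \<Rightarrow> real) \<Rightarrow> nat \<Rightarrow> real"
  where "trunc_add w n v = (\<lambda>i. w i + (if i < n then v i else 0))"

lemma trunc_add_0: "trunc_add w 0 v = w"
  by (simp add: trunc_add_def)

lemma trunc_add_Suc: "trunc_add w (Suc n) v = (trunc_add w n v)(n := w n + v n)"
  by (auto simp: trunc_add_def fun_eq_iff less_Suc_eq)

lemma trunc_add_upd: "(trunc_add w n v)(n := w n) = trunc_add w n v"
  by (auto simp: trunc_add_def fun_eq_iff)

lemma l1_nonneg: "0 \<le> l1 n v"
  by (simp add: l1_def sum_nonneg)

lemma l1_mono: "k \<le> n \<Longrightarrow> l1 k v \<le> l1 n v"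
  unfolding l1_def by (rule sum_mono2) auto

lemma l1_component: "i < n \<Longrightarrow> \<bar>v i\<bar> \<le> l1 n v"
  unfolding l1_def by (rule member_le_sum) auto

lemma telescoping_bound:
  fixes u d :: "nat \<Rightarrow> real"
  assumes "\<And>i. i < n \<Longrightarrow> \<bar>u (Suc i) - u i - d i\<bar> \<le> c * \<bar>v i\<bar>"
  shows "\<bar>u n - u 0 - (\<Sum>i<n. d i)\<bar> \<le> c * l1 n v"
proof -
  have "u n - u 0 - (\<Sum>i<n. d i) = (\<Sum>i<n. u (Suc i) - u i - d i)"
    unfolding sum_subtractf[of "\<lambda>i. u (Suc i) - u i" d] sum_lessThan_telescope ..
  also have "\<bar>...\<bar> \<le> (\<Sum>i<n. c * \<bar>v i\<bar>)" by (intro order_trans[OF sum_abs] sum_mono) (use assms in auto)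
  finally show ?thesis by (simp add: l1_def sum_distrib_left)
qed

context
  fixes m :: nat and B :: real and \<Psi> :: "(nat \<Rightarrow> real) \<Rightarrow> real"
  assumes \<Psi>: "Ck_euclid m 3 \<Psi>"
    and bound: "\<And>js x. set js \<subseteq> {..<m} \<Longrightarrow> length js \<le> 3 \<Longrightarrow> \<bar>partial_derivs js \<Psi> x\<bar> \<le> B"
begin

lemma B_nonneg: "0 \<le> B"
  using order_trans[OF abs_ge_zero bound[of "[]"]] by simp

lemma increment_0:
  assumes "set js \<subseteq> {..<m}" "length js < 3" "n \<le> m"
  shows "\<bar>partial_derivs js \<Psi> (trunc_add w n v) - partial_derivs js \<Psi> w\<bar> \<le> B * l1 m v"
proof -
  let ?u = "\<lambda>k. partial_derivs js \<Psi> (trunc_add w k v)"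
  have "\<bar>?u n - ?u 0 - (\<Sum>i<n. 0)\<bar> \<le> B * l1 n v"
  proof (rule telescoping_bound)
    fix i assume "i < n"
    with assms have i: "i < m" "set (i # js) \<subseteq> {..<m}" "length (i # js) \<le> 3" by auto
    show "\<bar>?u (Suc i) - ?u i - 0\<bar> \<le> B * \<bar>v i\<bar>"
      using real_lip_of_deriv[OF Ck_euclid_DERIV[OF \<Psi> assms(1,2) i(1)] bound[OF i(2,3)], of "trunc_add w i v" "w i + v i" "w i"]
      unfolding trunc_add_Suc trunc_add_upd by simp
  qed
  also have "... \<le> B * l1 m v" by (intro mult_left_mono l1_mono B_nonneg assms)
  finally show ?thesis by (simp add: trunc_add_0)
qed

lemma increment_1:
  assumes "set js \<subseteq> {..<m}" "length js < 2" "n \<le> m"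
  shows "\<bar>partial_derivs js \<Psi> (trunc_add w n v) - partial_derivs js \<Psi> w - (\<Sum>i<n. v i * partial_derivs (i # js) \<Psi> w)\<bar>
    \<le> 2 * B * (l1 m v)^2"
proof -
  let ?u = "\<lambda>k. partial_derivs js \<Psi> (trunc_add w k v)"
  have "\<bar>?u n - ?u 0 - (\<Sum>i<n. v i * partial_derivs (i # js) \<Psi> w)\<bar> \<le> (2 * B * l1 m v) * l1 n v"
  proof (rule telescoping_bound)
    fix i assume "i < n"
    with assms have i: "i < m" "set (i # js) \<subseteq> {..<m}" "length (i # js) < 3"
      "set (i # i # js) \<subseteq> {..<m}" "length (i # i # js) \<le> 3" "i \<le> m" "length js < 3" by auto
    have "\<bar>?u (Suc i) - ?u i - v i * partial_derivs (i # js) \<Psi> (trunc_add w i v)\<bar> \<le> B * (v i)^2"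
      using real_taylor1[OF Ck_euclid_DERIV[OF \<Psi> assms(1) i(7) i(1)]
        real_lip_of_deriv[OF Ck_euclid_DERIV[OF \<Psi> i(2,3,1)] bound[OF i(4,5)]], of "trunc_add w i v" "w i" "v i"]
      unfolding trunc_add_Suc trunc_add_upd .
    moreover have "B * (v i)^2 \<le> B * l1 m v * \<bar>v i\<bar>"
    proof -
      have "(v i)^2 \<le> l1 m v * \<bar>v i\<bar>"
        using mult_right_mono[OF l1_component[OF i(1), of v] abs_ge_zero[of "v i"]] by (simp add: power2_eq_square)
      from mult_left_mono[OF this B_nonneg] show ?thesis by (simp add: mult.assoc)
    qed
    moreover have "\<bar>v i * partial_derivs (i # js) \<Psi> (trunc_add w i v) - v i * partial_derivs (i # js) \<Psi> w\<bar> \<le> B * l1 m v * \<bar>v i\<bar>"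
      using mult_left_mono[OF increment_0[OF i(2,3,6), of w v] abs_ge_zero[of "v i"]]
      by (simp add: abs_mult[symmetric] right_diff_distrib mult_ac del: partial_derivs.simps)
    ultimately show "\<bar>?u (Suc i) - ?u i - v i * partial_derivs (i # js) \<Psi> w\<bar> \<le> 2 * B * l1 m v * \<bar>v i\<bar>" by linarith
  qed
  also have "... \<le> (2 * B * l1 m v) * l1 m v"
    by (intro mult_left_mono l1_mono mult_nonneg_nonneg B_nonneg assms l1_nonneg) auto
  finally show ?thesis by (simp add: trunc_add_0 power2_eq_square mult_ac)
qed

text \<open>The second-order Taylor polynomial with open slots: \<open>a\<close> for the increment,
  \<open>b\<close> for its products. It is affine in the slots, so taking means amounts to inserting
  moments. The coordinate path produces each mixed derivative once, for
  \<open>j < i\<close>.\<close>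

definition quad where
  "quad w a b = \<Psi> w + (\<Sum>i<m. a i * partial_derivs [i] \<Psi> w + b i i * (partial_derivs [i, i] \<Psi> w / 2)
    + (\<Sum>j<i. b i j * partial_derivs [j, i] \<Psi> w))"

text \<open>In step \<open>i\<close> a second-order expansion is made at the partly moved point, and
  its two coefficients are moved back to \<open>w\<close>. The errors are at most \<open>X\<close>,
  \<open>2 * X\<close> and \<open>X / 2\<close>, where \<open>X\<close> is
  \<open>B * (l1 m v)^2\<close> times the size of \<open>v i\<close>.\<close>

lemma euclid_taylor: "\<bar>\<Psi> (\<lambda>i. w i + v i) - quad w v (\<lambda>i j. v i * v j)\<bar> \<le> 4 * B * (l1 m v) ^ 3"
proof -
  let ?u = "\<lambda>k. \<Psi> (trunc_add w k v)"
  let ?d = "\<lambda>i. v i * partial_derivs [i] \<Psi> w + (v i * v i) * (partial_derivs [i, i] \<Psi> w / 2) + (\<Sum>j<i. (v i * v j) * partial_derivs [j, i] \<Psi> w)"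
  have "\<bar>?u m - ?u 0 - (\<Sum>i<m. ?d i)\<bar> \<le> (4 * B * (l1 m v)^2) * l1 m v"
  proof (rule telescoping_bound)
    fix i assume i: "i < m"
    define p D1 D2 D3 where "p = trunc_add w i v" and "D1 = (\<lambda>x. partial_derivs [i] \<Psi> x)"
      and "D2 = (\<lambda>x. partial_derivs [i, i] \<Psi> x)" and "D3 = (\<lambda>x. partial_derivs [i, i, i] \<Psi> x)"
    define S where "S = (\<Sum>j<i. v j * partial_derivs (j # [i]) \<Psi> w)"
    have c: "\<bar>v i\<bar> \<le> l1 m v" by (rule l1_component[OF i])
    have l0: "0 \<le> l1 m v" by (rule l1_nonneg)
    have D: "((\<lambda>s. \<Psi> (x(i := s))) has_real_derivative D1 (x(i := s))) (at s)"
        "((\<lambda>s. D1 (x(i := s))) has_real_derivative D2 (x(i := s))) (at s)"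
        "((\<lambda>s. D2 (x(i := s))) has_real_derivative D3 (x(i := s))) (at s)" for x s
      using Ck_euclid_DERIV[OF \<Psi>, of "[]" i x s] Ck_euclid_DERIV[OF \<Psi>, of "[i]" i x s] Ck_euclid_DERIV[OF \<Psi>, of "[i, i]" i x s] i
      unfolding D1_def D2_def D3_def by simp_all
    have b3: "\<bar>D3 x\<bar> \<le> B" for x unfolding D3_def using bound[of "[i, i, i]" x] i by simp
    have e1: "\<bar>?u (Suc i) - ?u i - v i * D1 p - (v i)^2 / 2 * D2 p\<bar> \<le> B * \<bar>v i\<bar> ^ 3"
      using real_taylor2[OF D b3, of p "w i" "v i"] unfolding p_def trunc_add_Suc trunc_add_upd .
    have "\<bar>v i\<bar> ^ 3 = \<bar>v i\<bar>\<^sup>2 * \<bar>v i\<bar>" by (simp add: eval_nat_numeral)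
    also have "... \<le> (l1 m v)^2 * \<bar>v i\<bar>" by (intro mult_right_mono power_mono c) auto
    finally have e1': "B * \<bar>v i\<bar> ^ 3 \<le> B * ((l1 m v)^2 * \<bar>v i\<bar>)" by (rule mult_left_mono[OF _ B_nonneg])
    have "\<bar>D1 p - D1 w - S\<bar> \<le> 2 * B * (l1 m v)^2"
      using increment_1[of "[i]" i w v] i unfolding D1_def S_def p_def by simp
    then have e2: "\<bar>v i * (D1 p - D1 w - S)\<bar> \<le> \<bar>v i\<bar> * (2 * B * (l1 m v)^2)"
      unfolding abs_mult by (rule mult_left_mono) simp
    have "\<bar>D2 p - D2 w\<bar> \<le> B * l1 m v" using increment_0[of "[i, i]" i w v] i unfolding D2_def p_def by simp
    then have "\<bar>(v i)\<^sup>2 / 2 * (D2 p - D2 w)\<bar> \<le> (v i)^2 / 2 * (B * l1 m v)"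
      unfolding abs_mult by (intro mult_mono) auto
    also have "... = (\<bar>v i\<bar> * \<bar>v i\<bar>) * (B * l1 m v) / 2" by (simp add: power2_eq_square)
    also have "... \<le> (\<bar>v i\<bar> * l1 m v) * (B * l1 m v) / 2"
      by (intro divide_right_mono mult_right_mono mult_left_mono c mult_nonneg_nonneg B_nonneg l0) auto
    also have "... = B * ((l1 m v)^2 * \<bar>v i\<bar>) / 2" by (simp add: power2_eq_square)
    finally have e3: "\<bar>(v i)\<^sup>2 / 2 * (D2 p - D2 w)\<bar> \<le> B * ((l1 m v)^2 * \<bar>v i\<bar>) / 2" .
    define X where "X = B * ((l1 m v)^2 * \<bar>v i\<bar>)"
    have X0: "0 \<le> X" unfolding X_def by (intro mult_nonneg_nonneg B_nonneg) auto
    have d: "?d i = v i * D1 w + (v i)^2 / 2 * D2 w + v i * S"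
      unfolding D1_def D2_def S_def by (simp add: sum_distrib_left power2_eq_square mult_ac)
    have e2': "\<bar>v i * D1 p - v i * D1 w - v i * S\<bar> \<le> 2 * X" using e2 by (simp add: right_diff_distrib X_def mult_ac)
    have e3': "\<bar>(v i)\<^sup>2 / 2 * D2 p - (v i)^2 / 2 * D2 w\<bar> \<le> X / 2" using e3 unfolding right_diff_distrib X_def .
    have e1'': "\<bar>?u (Suc i) - ?u i - v i * D1 p - (v i)^2 / 2 * D2 p\<bar> \<le> X" using e1 e1' unfolding X_def by linarith
    have "\<bar>?u (Suc i) - ?u i - ?d i\<bar> \<le> X + 2 * X + X / 2" unfolding d using e1'' e2' e3' by linarith
    also have "... \<le> 4 * X" using X0 by simp
    finally show "\<bar>?u (Suc i) - ?u i - ?d i\<bar> \<le> 4 * B * (l1 m v)^2 * \<bar>v i\<bar>" unfolding X_def by (simp only: mult.assoc)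
  qed
  moreover have "?u m = \<Psi> (\<lambda>i. w i + v i)" using \<Psi> unfolding Ck_euclid_def by (elim conjE) (simp add: trunc_add_def)
  ultimately show ?thesis
    by (simp add: quad_def trunc_add_0 diff_diff_eq eval_nat_numeral mult_ac del: partial_derivs.simps)
qed

lemma taylor_mean:
  assumes M: "prob_space M" and Y[measurable]: "\<And>i. (\<lambda>z. Y z i) \<in> borel_measurable M"
    and i1: "\<And>i. i < m \<Longrightarrow> integrable M (\<lambda>z. Y z i)" and i2: "\<And>i j. i < m \<Longrightarrow> j < m \<Longrightarrow> integrable M (\<lambda>z. Y z i * Y z j)"
    and i3: "integrable M (\<lambda>z. (l1 m (Y z)) ^ 3)"
  shows "\<bar>(LINT z|M. \<Psi> (\<lambda>i. w i + Y z i)) - quad w (\<lambda>i. LINT z|M. Y z i) (\<lambda>i j. LINT z|M. Y z i * Y z j)\<bar> \<le> 4 * B * (LINT z|M. (l1 m (Y z)) ^ 3)"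
proof -
  interpret prob_space M by fact
  have \<Psi>m: "\<Psi> \<in> borel_measurable borel" by (rule borel_measurable_continuous_onI[OF Ck_euclid_continuous[OF \<Psi>]])
  let ?P = "\<lambda>z. quad w (Y z) (\<lambda>i j. Y z i * Y z j)"
  have "has_bochner_integral M (\<lambda>_. \<Psi> w) (\<Psi> w)" by (simp add: has_bochner_integral_iff prob_space)
  then have P: "has_bochner_integral M ?P (quad w (\<lambda>i. LINT z|M. Y z i) (\<lambda>i j. LINT z|M. Y z i * Y z j))"
    unfolding quad_def
    by (intro has_bochner_integral_add has_bochner_integral_sum has_bochner_integral_mult_left has_bochner_integral_integrable i1 i2) auto
  have [measurable]: "(\<lambda>z. \<Psi> (\<lambda>i. w i + Y z i)) \<in> borel_measurable M"
    by (rule measurable_compose[OF measurable_coordinatewise_then_product \<Psi>m]) measurable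
  have \<Psi>i: "integrable M (\<lambda>z. \<Psi> (\<lambda>i. w i + Y z i))"
    by (rule integrable_const_bound[of _ B]) (use bound[of "[]"] in auto)
  have "\<bar>LINT z|M. \<Psi> (\<lambda>i. w i + Y z i) - ?P z\<bar> \<le> (LINT z|M. 4 * B * (l1 m (Y z)) ^ 3)"
    by (rule order_trans[OF integral_abs_bound], rule integral_mono) (use \<Psi>i P i3 euclid_taylor in \<open>auto simp: has_bochner_integral_iff\<close>)
  then show ?thesis using \<Psi>i P by (simp add: has_bochner_integral_iff)
qed

text \<open>Equal first and second moments give equal values of \<open>quad\<close>; only the
  third-order remainders are left.\<close>

lemma lindeberg_step:
  assumes M: "prob_space M" and Y[measurable]: "\<And>i. (\<lambda>z. Y z i) \<in> borel_measurable M"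
    and iM: "\<And>i. i < m \<Longrightarrow> integrable M (\<lambda>z. Y z i)" "\<And>i j. i < m \<Longrightarrow> j < m \<Longrightarrow> integrable M (\<lambda>z. Y z i * Y z j)"
      "integrable M (\<lambda>z. (l1 m (Y z)) ^ 3)"
    and N: "prob_space N" and Z[measurable]: "\<And>i. (\<lambda>z. Z z i) \<in> borel_measurable N"
    and iN: "\<And>i. i < m \<Longrightarrow> integrable N (\<lambda>z. Z z i)" "\<And>i j. i < m \<Longrightarrow> j < m \<Longrightarrow> integrable N (\<lambda>z. Z z i * Z z j)"
      "integrable N (\<lambda>z. (l1 m (Z z)) ^ 3)"
    and eq1: "\<And>i. i < m \<Longrightarrow> (LINT z|M. Y z i) = (LINT z|N. Z z i)"
    and eq2: "\<And>i j. i < m \<Longrightarrow> j < m \<Longrightarrow> (LINT z|M. Y z i * Y z j) = (LINT z|N. Z z i * Z z j)"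
  shows "\<bar>(LINT z|M. \<Psi> (\<lambda>i. w i + Y z i)) - (LINT z|N. \<Psi> (\<lambda>i. w i + Z z i))\<bar>
    \<le> 4 * B * ((LINT z|M. (l1 m (Y z)) ^ 3) + (LINT z|N. (l1 m (Z z)) ^ 3))"
proof -
  have "\<bar>(LINT z|M. \<Psi> (\<lambda>i. w i + Y z i)) - quad w (\<lambda>i. LINT z|M. Y z i) (\<lambda>i j. LINT z|M. Y z i * Y z j)\<bar> \<le> 4 * B * (LINT z|M. (l1 m (Y z)) ^ 3)"
    by (rule taylor_mean; fact M Y iM)
  moreover have "\<bar>(LINT z|N. \<Psi> (\<lambda>i. w i + Z z i)) - quad w (\<lambda>i. LINT z|N. Z z i) (\<lambda>i j. LINT z|N. Z z i * Z z j)\<bar> \<le> 4 * B * (LINT z|N. (l1 m (Z z)) ^ 3)"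
    by (rule taylor_mean; fact N Z iN)
  moreover have "quad w (\<lambda>i. LINT z|M. Y z i) (\<lambda>i j. LINT z|M. Y z i * Y z j) = quad w (\<lambda>i. LINT z|N. Z z i) (\<lambda>i j. LINT z|N. Z z i * Z z j)"
    unfolding quad_def
    by (intro arg_cong2[where f = "(+)"] refl sum.cong) (simp_all add: eq1 eq2)
  ultimately show ?thesis by (simp add: distrib_left)
qed

end

section \<open>Averaging over translations and the exchange of summands\<close>

definition translate_mean :: "'a measure \<Rightarrow> ('a \<Rightarrow> nat \<Rightarrow> real) \<Rightarrow> ((nat \<Rightarrow> real) \<Rightarrow> real) \<Rightarrow> (nat \<Rightarrow> real) \<Rightarrow> real"
  where "translate_mean M Y g v = (LINT w|M. g (\<lambda>i. v i + Y w i))"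

definition bounded_borel :: "real \<Rightarrow> ((nat \<Rightarrow> real) \<Rightarrow> real) \<Rightarrow> bool"
  where "bounded_borel c g \<longleftrightarrow> g \<in> borel_measurable borel \<and> (\<forall>v. \<bar>g v\<bar> \<le> c)"

lemma measurable_fun_add:
  fixes a b :: "'a \<Rightarrow> nat \<Rightarrow> real"
  assumes "a \<in> borel_measurable M" "b \<in> borel_measurable M"
  shows "(\<lambda>x i. a x i + b x i) \<in> borel_measurable M"
  by (intro measurable_coordinatewise_then_product borel_measurable_add measurable_product_then_coordinatewise[OF assms(1)]
      measurable_product_then_coordinatewise[OF assms(2)])

lemma translate_measurable:
  fixes Y :: "'a \<Rightarrow> nat \<Rightarrow> real" and g :: "(nat \<Rightarrow> real) \<Rightarrow> real"
  assumes "Y \<in> borel_measurable M" "g \<in> borel_measurable borel"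
  shows "(\<lambda>w. g (\<lambda>i. v i + Y w i)) \<in> borel_measurable M"
  by (rule measurable_compose[OF measurable_fun_add[OF measurable_const assms(1)] assms(2)]) simp

lemma translate_mean_bounded:
  assumes M: "prob_space M" and Y: "Y \<in> borel_measurable M" and g: "bounded_borel c g"
  shows "bounded_borel c (translate_mean M Y g)"
proof -
  interpret prob_space M by fact
  have gm: "g \<in> borel_measurable borel" using g by (simp add: bounded_borel_def)
  have "(\<lambda>p. g (\<lambda>i. fst p i + Y (snd p) i)) \<in> borel_measurable (borel \<Otimes>\<^sub>M M)"
    by (rule measurable_compose[OF measurable_fun_add[OF measurable_fst measurable_compose[OF measurable_snd Y]] gm])
  then have "(\<lambda>v. LINT w|M. g (\<lambda>i. v i + Y w i)) \<in> borel_measurable borel"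
    by (intro borel_measurable_lebesgue_integral) (simp add: split_beta')
  moreover have "\<bar>LINT w|M. g (\<lambda>i. v i + Y w i)\<bar> \<le> c" for v
    by (rule average_bound(1)[OF M translate_measurable[OF Y gm]]) (use g in \<open>simp add: bounded_borel_def\<close>)
  ultimately show ?thesis by (simp add: bounded_borel_def translate_mean_def[abs_def])
qed

lemma translate_mean_power_bounded:
  assumes "prob_space M" "Y \<in> borel_measurable M" "bounded_borel c g"
  shows "bounded_borel c ((translate_mean M Y ^^ n) g)"
  by (induct n) (simp_all add: assms translate_mean_bounded)

lemma translate_mean_contraction:
  assumes M: "prob_space M" and Y: "Y \<in> borel_measurable M" and g: "bounded_borel c g" and g': "bounded_borel c' g'"
    and e: "\<And>v. \<bar>g v - g' v\<bar> \<le> e"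
  shows "\<bar>translate_mean M Y g v - translate_mean M Y g' v\<bar> \<le> e"
proof -
  have m: "g \<in> borel_measurable borel" "g' \<in> borel_measurable borel" using g g' by (simp_all add: bounded_borel_def)
  note tm = translate_measurable[OF Y m(1)] translate_measurable[OF Y m(2)]
  have "integrable M (\<lambda>w. g (\<lambda>i. v i + Y w i))"
    by (rule average_bound(2)[OF M tm(1), of _ c]) (use g in \<open>simp add: bounded_borel_def\<close>)
  moreover have "integrable M (\<lambda>w. g' (\<lambda>i. v i + Y w i))"
    by (rule average_bound(2)[OF M tm(2), of _ c']) (use g' in \<open>simp add: bounded_borel_def\<close>)
  ultimately have "translate_mean M Y g v - translate_mean M Y g' v = (LINT w|M. g (\<lambda>i. v i + Y w i) - g' (\<lambda>i. v i + Y w i))"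
    by (simp add: translate_mean_def)
  also have "\<bar>...\<bar> \<le> e" by (rule average_bound(1)[OF M borel_measurable_diff[OF tm] e])
  finally show ?thesis .
qed

lemma translate_mean_commute:
  assumes M: "prob_space M" and Y: "Y \<in> borel_measurable M" and N: "prob_space N" and Z: "Z \<in> borel_measurable N"
    and g: "bounded_borel c g"
  shows "translate_mean M Y (translate_mean N Z g) = translate_mean N Z (translate_mean M Y g)"
proof
  fix v
  have gm: "g \<in> borel_measurable borel" using g by (simp add: bounded_borel_def)
  have "(\<lambda>p i. v i + Y (fst p) i + Z (snd p) i) \<in> borel_measurable (M \<Otimes>\<^sub>M N)"
    by (intro measurable_fun_add measurable_const measurable_compose[OF measurable_fst Y] measurable_compose[OF measurable_snd Z]) simp
  from measurable_compose[OF this gm]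
  have "(\<lambda>(x, z). g (\<lambda>i. v i + Y x i + Z z i)) \<in> borel_measurable (M \<Otimes>\<^sub>M N)" by (simp add: split_beta')
  from bounded_integral_swap[OF M N this, of c] g
  have "(LINT z|N. LINT x|M. g (\<lambda>i. v i + Y x i + Z z i)) = (LINT x|M. LINT z|N. g (\<lambda>i. v i + Y x i + Z z i))"
    by (simp add: bounded_borel_def)
  then show "translate_mean M Y (translate_mean N Z g) v = translate_mean N Z (translate_mean M Y g) v"
    by (simp add: translate_mean_def add.assoc add.left_commute) (simp add: add.commute add.left_commute)
qed

text \<open>Lindeberg's exchange in operator form. The averages \<open>U\<close> and
  \<open>V\<close> commute and contract the sup norm, and \<open>U^(n+1) - V^(n+1)\<close> is
  \<open>U\<close> applied to \<open>U^n - V^n\<close> plus \<open>V^n\<close> applied to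
  \<open>U - V\<close>; each exchanged summand costs one \<open>e\<close>.\<close>

lemma translate_mean_power_diff:
  assumes M: "prob_space M" and Y: "Y \<in> borel_measurable M" and N: "prob_space N" and Z: "Z \<in> borel_measurable N"
    and g: "bounded_borel c g" and e: "\<And>v. \<bar>translate_mean M Y g v - translate_mean N Z g v\<bar> \<le> e"
  shows "\<bar>(translate_mean M Y ^^ n) g v - (translate_mean N Z ^^ n) g v\<bar> \<le> real n * e"
proof -
  let ?U = "translate_mean M Y" and ?V = "translate_mean N Z"
  note UB = translate_mean_power_bounded[OF M Y] and VB = translate_mean_power_bounded[OF N Z]
  have U1: "bounded_borel c (?U g)" and V1: "bounded_borel c (?V g)"
    using translate_mean_bounded M Y N Z g by blast+
  have comm: "?U ((?V ^^ k) g) = (?V ^^ k) (?U g)" for k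
    by (induct k) (simp_all add: translate_mean_commute[OF M Y N Z VB[OF g]])
  have contr: "\<bar>(?V ^^ k) (?U g) v - (?V ^^ k) (?V g) v\<bar> \<le> e" for k v
  proof (induct k arbitrary: v)
    case (Suc k)
    then show ?case using translate_mean_contraction[OF N Z VB[OF U1] VB[OF V1]] by simp
  qed (simp add: e)
  show ?thesis
  proof (induct n arbitrary: v)
    case (Suc n)
    have "\<bar>?U ((?U ^^ n) g) v - ?U ((?V ^^ n) g) v\<bar> \<le> real n * e"
      by (rule translate_mean_contraction[OF M Y UB[OF g] VB[OF g] Suc])
    moreover have "\<bar>?U ((?V ^^ n) g) v - (?V ^^ n) (?V g) v\<bar> \<le> e" unfolding comm by (rule contr)
    ultimately show ?case by (simp add: funpow_swap1 algebra_simps)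
  qed simp
qed

lemma translate_mean_power_PiM:
  assumes M: "prob_space M" and Y: "Y \<in> borel_measurable M" and g: "bounded_borel c g"
  shows "(translate_mean M Y ^^ n) g v = (LINT x|iid n M. g (\<lambda>i. v i + (\<Sum>k<n. Y (x k) i)))"
  using g
proof (induct n arbitrary: g)
  case 0
  interpret P: prob_space "PiM {} (\<lambda>_::nat. M)" by (intro prob_space_PiM M)
  show ?case by (simp add: P.prob_space)
next
  case (Suc n)
  interpret prob_space M by (rule M)
  interpret P: product_sigma_finite "\<lambda>_::nat. M" by standard
  interpret PN: prob_space "iid (Suc n) M" by (intro prob_space_PiM M)
  have gm: "g \<in> borel_measurable borel" using Suc.prems by (simp add: bounded_borel_def)
  have S: "(\<lambda>x i. \<Sum>k<Suc n. Y (x k) i) \<in> borel_measurable (iid (Suc n) M)"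
  proof (intro measurable_coordinatewise_then_product borel_measurable_sum)
    fix i k assume "k \<in> {..<Suc n}"
    then have "(\<lambda>x. x k) \<in> measurable (iid (Suc n) M) M" by (rule measurable_component_singleton)
    from measurable_compose[OF this measurable_product_then_coordinatewise[OF Y, of i]]
    show "(\<lambda>x. Y (x k) i) \<in> borel_measurable (iid (Suc n) M)" .
  qed
  have int: "integrable (iid (Suc n) M) (\<lambda>x. g (\<lambda>i. v i + (\<Sum>k<Suc n. Y (x k) i)))"
    by (rule average_bound(2)[OF PN.prob_space_axioms translate_measurable[OF S gm], of _ c])
       (use Suc.prems in \<open>simp add: bounded_borel_def\<close>)
  have "(translate_mean M Y ^^ Suc n) g v = (translate_mean M Y ^^ n) (translate_mean M Y g) v" by (simp add: funpow_swap1)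
  also have "... = (LINT x|iid n M. LINT w|M. g (\<lambda>i. v i + (\<Sum>k<n. Y (x k) i) + Y w i))"
    unfolding Suc.hyps[OF translate_mean_bounded[OF M Y Suc.prems]] by (simp add: translate_mean_def)
  also have "... = (LINT x|iid n M. LINT w|M. g (\<lambda>i. v i + (\<Sum>k<Suc n. Y ((x(n := w)) k) i)))"
    by (simp add: add.assoc)
  also have "... = (LINT x|iid (Suc n) M. g (\<lambda>i. v i + (\<Sum>k<Suc n. Y (x k) i)))"
    using P.product_integral_insert[of "{..<n}" n "\<lambda>x. g (\<lambda>i. v i + (\<Sum>k<Suc n. Y (x k) i))"] int
    unfolding lessThan_Suc by simp
  finally show ?case .
qed

section \<open>The Cramer-Wold device\<close>

text \<open>Trigonometric polynomials in linear forms of the first \<open>m\<close> coordinates. The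
  phase \<open>b\<close> covers sines, and the product formula for cosines makes the class an
  algebra.\<close>

inductive trig :: "nat \<Rightarrow> ((nat \<Rightarrow> real) \<Rightarrow> real) \<Rightarrow> bool" for m where
  trig_cos: "trig m (\<lambda>x. cos (b + (\<Sum>i<m. a i * x i)))"
| trig_add: "trig m f \<Longrightarrow> trig m g \<Longrightarrow> trig m (\<lambda>x. f x + g x)"
| trig_cmult: "trig m f \<Longrightarrow> trig m (\<lambda>x. c * f x)"

lemma trig_const: "trig m (\<lambda>_. c)"
  using trig_cmult[OF trig_cos[of m 0 "\<lambda>_. 0"], of c] by simp

lemma trig_mult_cos: "trig m g \<Longrightarrow> trig m (\<lambda>x. cos (b + (\<Sum>i<m. a i * x i)) * g x)"
proof (induct rule: trig.induct)
  case (trig_cos b' a')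
  have "trig m (\<lambda>x. 1/2 * (cos ((b - b') + (\<Sum>i<m. (a i - a' i) * x i)) + cos ((b + b') + (\<Sum>i<m. (a i + a' i) * x i))))"
    by (intro trig.intros)
  moreover have "(b - b') + (\<Sum>i<m. (a i - a' i) * x i) = (b + (\<Sum>i<m. a i * x i)) - (b' + (\<Sum>i<m. a' i * x i))"
    "(b + b') + (\<Sum>i<m. (a i + a' i) * x i) = (b + (\<Sum>i<m. a i * x i)) + (b' + (\<Sum>i<m. a' i * x i))" for x
    by (simp_all add: algebra_simps sum_subtractf sum.distrib)
  ultimately show ?case by (simp only: cos_times_cos mult_1 times_divide_eq_left)
next
  case (trig_add f g)
  then show ?case using trig.trig_add by (fastforce simp: distrib_left)
next
  case (trig_cmult f c)
  from trig.trig_cmult[OF trig_cmult(2), of c] show ?case by (simp add: mult.left_commute)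
qed

lemma trig_mult: "trig m f \<Longrightarrow> trig m g \<Longrightarrow> trig m (\<lambda>x. f x * g x)"
proof (induct rule: trig.induct)
  case (trig_add f f')
  then show ?case using trig.trig_add by (fastforce simp: distrib_right)
next
  case (trig_cmult f c)
  from trig.trig_cmult[OF trig_cmult(2)[OF trig_cmult(3)], of c] show ?case by (simp add: mult.assoc)
qed (rule trig_mult_cos)

text \<open>Fixing the coordinates from \<open>m\<close> on at 0 lets the first \<open>m\<close>
  coordinate functions separate the points of the set.\<close>

lemma compact_box: "compact {x :: nat \<Rightarrow> real. \<forall>i. x i \<in> (if i < m then {-1..1} else {0})}" (is "compact ?S")
proof -
  have "?S = PiE UNIV (\<lambda>i. if i < m then {-1..1} else {0})" by (intro set_eqI) (simp only: mem_Collect_eq PiE_iff extensional_UNIV UNIV_I simp_thms Ball_def)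
  moreover have "compactin (product_topology (\<lambda>_. euclidean) UNIV) (PiE UNIV (\<lambda>i. if i < m then {-1..1::real} else {0}))"
    unfolding compactin_PiE by (auto simp: compactin_euclidean_iff)
  ultimately show ?thesis by (simp add: euclidean_product_topology compactin_euclidean_iff)
qed

context
  fixes m :: nat and M :: "'a measure" and X :: "'a \<Rightarrow> nat \<Rightarrow> real" and N :: "'b measure" and Y :: "'b \<Rightarrow> nat \<Rightarrow> real"
  assumes M: "prob_space M" and X: "X \<in> borel_measurable M" and N: "prob_space N" and Y: "Y \<in> borel_measurable N"
    and char_eq: "\<And>a. (LINT w|M. iexp (\<Sum>i<m. a i * X w i)) = (LINT w|N. iexp (\<Sum>i<m. a i * Y w i))"
begin

lemma trig_integral:
  assumes "trig m f"
  shows "integrable M (\<lambda>w. f (X w)) \<and> integrable N (\<lambda>w. f (Y w)) \<and> (LINT w|M. f (X w)) = (LINT w|N. f (Y w))"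
  using assms
proof (induct rule: trig.induct)
  case (trig_cos b a)
  have *: "integrable K (\<lambda>w. cos (b + (\<Sum>i<m. a i * W w i))) \<and>
      (LINT w|K. cos (b + (\<Sum>i<m. a i * W w i))) = Re (iexp b * (LINT w|K. iexp (\<Sum>i<m. a i * W w i)))"
    if K: "prob_space K" and W: "W \<in> borel_measurable K" for K :: "'c measure" and W
  proof -
    interpret prob_space K by fact
    note [measurable] = measurable_product_then_coordinatewise[OF W]
    have i: "integrable K (\<lambda>w. iexp (\<Sum>i<m. a i * W w i))" by (rule integrable_const_bound[of _ 1]) auto
    have e: "cos (b + (\<Sum>i<m. a i * W w i)) = Re (iexp b * iexp (\<Sum>i<m. a i * W w i))" for w
      by (simp add: exp_add[symmetric] distrib_left[symmetric] of_real_add[symmetric] Re_exp del: of_real_add of_real_sum of_real_mult)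
    show ?thesis unfolding e using i by simp
  qed
  show ?case using *[OF M X] *[OF N Y] unfolding char_eq by simp
qed auto

text \<open>Each coordinate is replaced by \<open>L * sin (x i / L)\<close>, which stays in a
  compact box. On the box Stone-Weierstrass approximates by functions whose composition with this
  replacement is a trigonometric polynomial on the whole space, so no tails have to be estimated;
  then \<open>L\<close> tends to infinity.\<close>

lemma cramer_wold:
  assumes \<Psi>: "continuous_on UNIV \<Psi>" and bd: "\<And>x. \<bar>\<Psi> x\<bar> \<le> (B::real)" and dep: "\<And>x y. (\<And>i. i < m \<Longrightarrow> x i = y i) \<Longrightarrow> \<Psi> x = \<Psi> y"
  shows "(LINT p|M. \<Psi> (X p)) = (LINT p|N. \<Psi> (Y p))"
proof -
  define S where "S = {x :: nat \<Rightarrow> real. \<forall>i. x i \<in> (if i < m then {-1..1} else {0})}"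
  define sn where "sn L x i = (if i < m then sin (x i / L) else 0)" for L :: real and x :: "nat \<Rightarrow> real" and i
  define \<Psi>L where "\<Psi>L L x = \<Psi> (\<lambda>i. L * sn L x i)" for L x
  interpret M: prob_space M by (rule M)
  interpret N: prob_space N by (rule N)
  have snS: "sn L x \<in> S" for L x by (simp add: sn_def S_def)
  have \<Psi>m: "\<Psi> \<in> borel_measurable borel" by (rule borel_measurable_continuous_onI[OF \<Psi>])
  have \<Psi>Lb: "\<Psi>L L \<in> borel_measurable borel" for L
  proof -
    note [measurable] = measurable_product_then_coordinatewise[OF measurable_ident_sets[OF refl]]
    have "(\<lambda>x. L * sn L x i) \<in> borel_measurable borel" for i unfolding sn_def by (cases "i < m") simp_all
    then have "(\<lambda>x i. L * sn L x i) \<in> borel_measurable borel" by (rule measurable_coordinatewise_then_product)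
    from measurable_compose[OF this \<Psi>m] show ?thesis unfolding \<Psi>L_def .
  qed
  have \<Psi>Lm: "(\<lambda>p. \<Psi>L L (W p)) \<in> borel_measurable K" if "W \<in> borel_measurable K" for L W and K :: "'c measure"
    by (rule measurable_compose[OF that \<Psi>Lb])
  have \<Psi>Lbd: "\<bar>\<Psi>L L x\<bar> \<le> B" for L x by (simp add: \<Psi>L_def bd)
  have approx: "(LINT p|M. \<Psi>L L (X p)) = (LINT p|N. \<Psi>L L (Y p))" for L
  proof -
    define R where "R = {g. continuous_on S g \<and> trig m (\<lambda>x. g (sn L x))}"
    interpret function_ring_on R S
    proof
      show "compact S" unfolding S_def by (rule compact_box)
      fix x y assume xy: "x \<in> S" "y \<in> S" "x \<noteq> y"
      then obtain i where i: "x i \<noteq> y i" by auto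
      have "z i \<in> (if i < m then {-1..1} else {0})" if "z \<in> S" for z using that unfolding S_def by blast
      from this[OF xy(1)] this[OF xy(2)] i have im: "i < m" by (auto split: if_splits)
      \<comment> \<open>The phase \<open>- pi / 2\<close> presents the sine of a single coordinate
        as a cosine.\<close>
      have "trig m (\<lambda>x. cos (- (pi / 2) + (\<Sum>j<m. (if j = i then 1 / L else 0) * x j)))" by (rule trig_cos)
      then have t: "trig m (\<lambda>x. sn L x i)"
      proof (rule back_subst[of "trig m"], intro ext)
        fix x
        show "cos (- (pi / 2) + (\<Sum>j<m. (if j = i then 1 / L else 0) * x j)) = sn L x i"
        proof -
          have "(\<Sum>j<m. (if j = i then 1 / L else 0) * x j) = (\<Sum>j<m. if j = i then x j / L else 0)"
            by (rule sum.cong) auto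
          then show ?thesis using im by (simp add: sn_def cos_diff)
        qed
      qed
      have xi: "(\<lambda>x. x i) \<in> R"
        unfolding R_def by (intro CollectI conjI t continuous_on_subset[OF continuous_on_product_coordinates subset_UNIV])
      show "\<exists>f\<in>R. f x \<noteq> f y" by (rule bexI[of "\<lambda>f. f x \<noteq> f y" "\<lambda>x. x i"]) (rule i, rule xi)
    next
      fix f g assume "f \<in> R" "g \<in> R"
      then have "continuous_on S f" "continuous_on S g" "trig m (\<lambda>x. f (sn L x))" "trig m (\<lambda>x. g (sn L x))" by (simp_all add: R_def)
      note fg = continuous_on_add[OF this(1,2)] continuous_on_mult[OF this(1,2)] trig_add[OF this(3,4)] trig_mult[OF this(3,4)]
      show "(\<lambda>x. f x + g x) \<in> R" unfolding R_def using fg(1,3) by (intro CollectI conjI)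
      show "(\<lambda>x. f x * g x) \<in> R" unfolding R_def using fg(2,4) by (intro CollectI conjI)
    qed (simp_all add: R_def trig_const)
    have "continuous_on S (\<lambda>y. \<Psi> (\<lambda>i. L * y i))"
      by (rule continuous_on_compose2[OF \<Psi>], rule continuous_on_coordinatewise_then_product)
         (intro continuous_intros continuous_on_subset[OF continuous_on_product_coordinates subset_UNIV], simp)
    note sw = Stone_Weierstrass_basic[OF this]
    have "\<bar>(LINT p|M. \<Psi>L L (X p)) - (LINT p|N. \<Psi>L L (Y p))\<bar> \<le> 2 * e" if "0 < e" for e
    proof -
      obtain g where g: "continuous_on S g" "trig m (\<lambda>x. g (sn L x))" "\<And>y. y \<in> S \<Longrightarrow> \<bar>\<Psi> (\<lambda>i. L * y i) - g y\<bar> < e"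
        using sw[OF \<open>0 < e\<close>] unfolding R_def by auto
      note t = trig_integral[OF g(2)]
      have d: "\<bar>\<Psi>L L x - g (sn L x)\<bar> \<le> e" for x using g(3)[OF snS, of L x] by (simp add: \<Psi>L_def)
      have i: "integrable M (\<lambda>p. \<Psi>L L (X p))"
        by (rule average_bound(2)[OF M \<Psi>Lm[OF X], of _ B]) (simp add: \<Psi>L_def bd)
      have i': "integrable N (\<lambda>p. \<Psi>L L (Y p))"
        by (rule average_bound(2)[OF N \<Psi>Lm[OF Y], of _ B]) (simp add: \<Psi>L_def bd)
      have "\<bar>LINT p|M. \<Psi>L L (X p) - g (sn L (X p))\<bar> \<le> e" by (rule average_bound(1)[OF M _ d]) (use i t in auto)
      moreover have "\<bar>LINT p|N. \<Psi>L L (Y p) - g (sn L (Y p))\<bar> \<le> e"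
        by (rule average_bound(1)[OF N _ d]) (use i' t in auto)
      ultimately show ?thesis using i i' t by simp
    qed
    from this[of "\<bar>(LINT p|M. \<Psi>L L (X p)) - (LINT p|N. \<Psi>L L (Y p))\<bar> / 4"] show ?thesis by (cases "(LINT p|M. \<Psi>L L (X p)) = (LINT p|N. \<Psi>L L (Y p))") auto
  qed
  have lim: "(\<lambda>n. \<Psi>L (real (Suc n)) x) \<longlonglongrightarrow> \<Psi> x" for x
  proof -
    \<comment> \<open>\<open>L * sin (x / L)\<close> equals \<open>x * sinc (x / L)\<close>, so with
      \<open>s = 1 / L\<close> the limit is continuity at \<open>s = 0\<close>.\<close>
    define c where "c s = (\<lambda>i. x i * sinc (s * x i))" for s :: real
    have "continuous_on UNIV c" unfolding c_def
      by (intro continuous_on_coordinatewise_then_product continuous_intros continuous_on_compose2[OF continuous_on_sinc[of UNIV "\<lambda>x. x"]]) auto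
    then have "continuous_on UNIV (\<lambda>s. \<Psi> (c s))" by (intro continuous_on_compose2[OF \<Psi>]) auto
    then have "isCont (\<lambda>s. \<Psi> (c s)) 0" by (simp add: continuous_on_eq_continuous_at)
    from isCont_tendsto_compose[OF this LIMSEQ_inverse_real_of_nat]
    have "(\<lambda>n. \<Psi> (c (inverse (real (Suc n))))) \<longlonglongrightarrow> \<Psi> (c 0)" .
    moreover have "\<Psi> (c (inverse (real (Suc n)))) = \<Psi>L (real (Suc n)) x" for n
      unfolding \<Psi>L_def by (rule dep) (auto simp: c_def sn_def divide_inverse mult.commute)
    moreover have "c 0 = x" by (auto simp: c_def)
    ultimately show ?thesis by simp
  qed
  have l1: "(\<lambda>n. LINT p|M. \<Psi>L (real (Suc n)) (X p)) \<longlonglongrightarrow> (LINT p|M. \<Psi> (X p))"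
    by (rule integral_dominated_convergence[where w = "\<lambda>_. B"])
       (use measurable_compose[OF X \<Psi>m] measurable_compose[OF X \<Psi>Lb] lim in \<open>auto simp: bd \<Psi>Lbd\<close>)
  have l2: "(\<lambda>n. LINT p|N. \<Psi>L (real (Suc n)) (Y p)) \<longlonglongrightarrow> (LINT p|N. \<Psi> (Y p))"
    by (rule integral_dominated_convergence[where w = "\<lambda>_. B"])
       (use measurable_compose[OF Y \<Psi>m] measurable_compose[OF Y \<Psi>Lb] lim in \<open>auto simp: bd \<Psi>Lbd\<close>)
  show ?thesis by (rule LIMSEQ_unique[OF l1]) (use l2 approx in simp)
qed

end

section \<open>A central limit theorem with rate\<close>

lemma centered_normal_std:
  assumes "0 \<le> a"
  shows "centered_normal a = distr std_normal_distribution borel (\<lambda>x. sqrt a * x)"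
proof (cases "a = 0")
  case True
  interpret prob_space std_normal_distribution by (rule prob_space_normal_density) simp
  show ?thesis using True by (simp add: centered_normal_def distr_const)
next
  case False
  interpret prob_space std_normal_distribution by (rule prob_space_normal_density) simp
  have "distributed std_normal_distribution lborel (\<lambda>x. x) (normal_density 0 1)"
    unfolding distributed_def by (auto simp: distr_id2)
  from normal_density_affine[OF this, of "sqrt a" 0] False assms
  have "distributed std_normal_distribution lborel (\<lambda>x. sqrt a * x) (normal_density 0 (sqrt a))" by simp
  then have "distr std_normal_distribution lborel (\<lambda>x. sqrt a * x) = density lborel (normal_density 0 (sqrt a))"
    by (simp add: distributed_def)
  moreover have "distr std_normal_distribution borel (\<lambda>x. sqrt a * x) = distr std_normal_distribution lborel (\<lambda>x. sqrt a * x)"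
    by (rule distr_cong) auto
  ultimately show ?thesis using False by (simp add: centered_normal_def)
qed

lemma normal_law:
  assumes L: "L \<in> borel_measurable Q" and law: "distr Q borel L = centered_normal a" and a: "0 \<le> a"
  shows "(LINT w|Q. iexp (L w)) = of_real (exp (- a / 2))"
    and "integrable Q (\<lambda>w. L w ^ k)" and "(LINT w|Q. L w) = 0" and "(LINT w|Q. (L w)^2) = a" and "(LINT w|Q. L w ^ 4) = 3 * a^2"
proof -
  note law' = law[unfolded centered_normal_std[OF a]]
  have tr: "(LINT w|Q. g (L w)) = (LINT x|std_normal_distribution. g (sqrt a * x))"
    if "g \<in> borel_measurable borel" for g :: "real \<Rightarrow> 'c::{banach, second_countable_topology}"
  proof -
    have "(LINT w|Q. g (L w)) = (LINT x|distr Q borel L. g x)" by (rule integral_distr[symmetric, OF L that])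
    also have "... = (LINT x|std_normal_distribution. g (sqrt a * x))"
      unfolding law' by (rule integral_distr[OF _ that]) simp
    finally show ?thesis .
  qed
  have "(LINT w|Q. iexp (L w)) = char std_normal_distribution (sqrt a)" unfolding char_def by (subst tr) simp_all
  also have "... = of_real (exp (- a / 2))" using a by (simp add: char_std_normal_distribution)
  finally show "(LINT w|Q. iexp (L w)) = of_real (exp (- a / 2))" .
  have "integrable (distr Q borel L) (\<lambda>x. x ^ k)"
    unfolding law' by (subst integrable_distr_eq) (auto simp: power_mult_distrib integrable_std_normal_distribution_moment)
  then show "integrable Q (\<lambda>w. L w ^ k)" by (subst (asm) integrable_distr_eq) (use L in auto)
  have p: "(LINT w|Q. L w ^ k) = sqrt a ^ k * (LINT x|std_normal_distribution. x ^ k)" for k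
    by (subst tr) (simp_all add: power_mult_distrib)
  have "(LINT x|std_normal_distribution. x ^ 1) = 0" by (rule integral_std_normal_distribution_moment_odd) simp
  with p[of 1] show "(LINT w|Q. L w) = 0" by simp
  show "(LINT w|Q. (L w)^2) = a" using p[of 2] std_normal_distribution_even_moments(1)[of 1] a by simp
  have "(LINT x|std_normal_distribution. x ^ 4) = 3"
    using std_normal_distribution_even_moments(1)[of 2] by (simp add: fact_numeral)
  moreover have "sqrt a ^ 4 = a^2" using a power_mult[of "sqrt a" 2 2] by simp
  ultimately show "(LINT w|Q. L w ^ 4) = 3 * a^2" using p[of 4] by simp
qed

text \<open>The prescribed laws of all linear combinations determine the joint moments and
  characteristic functions of the \<open>G i\<close>; these match the covariances of the
  \<open>f i\<close> under \<open>M\<close>.\<close>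

locale matched_gaussian =
  fixes M :: "'a measure" and Q :: "'b measure" and f :: "nat \<Rightarrow> 'a \<Rightarrow> real" and G :: "nat \<Rightarrow> 'b \<Rightarrow> real"
    and m :: nat and q :: real
  assumes M: "prob_space M" and Q: "prob_space Q"
    and f: "\<And>i. i < m \<Longrightarrow> f i \<in> borel_measurable M" and fq: "\<And>i x. i < m \<Longrightarrow> \<bar>f i x\<bar> \<le> q" and q: "0 < q"
    and G: "\<And>i. i < m \<Longrightarrow> G i \<in> borel_measurable Q"
    and law: "\<And>a. distr Q borel (\<lambda>w. \<Sum>i<m. a i * G i w) =
      centered_normal ((LINT x|M. (\<Sum>i<m. a i * f i x)^2) - (LINT x|M. (\<Sum>i<m. a i * f i x))^2)"
begin

interpretation M: prob_space M by (rule M)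
interpretation Q: prob_space Q by (rule Q)

definition \<xi> where "\<xi> i x = f i x - (LINT x|M. f i x)"
definition var where "var a = (LINT x|M. (\<Sum>i<m. a i * \<xi> i x)^2)"

lemma f_integrable: "i < m \<Longrightarrow> integrable M (f i)"
  using average_bound(2)[OF M f fq] by blast

lemma \<xi>_measurable: "i < m \<Longrightarrow> \<xi> i \<in> borel_measurable M"
  unfolding \<xi>_def[abs_def] using f by simp

lemma \<xi>_bound: assumes i: "i < m" shows "\<bar>\<xi> i x\<bar> \<le> 2 * q"
  using fq[OF i, of x] average_bound(1)[OF M f[OF i] fq[OF i]] unfolding \<xi>_def by linarith

lemma \<xi>_integrable: "i < m \<Longrightarrow> integrable M (\<xi> i)" "i < m \<Longrightarrow> j < m \<Longrightarrow> integrable M (\<lambda>x. \<xi> i x * \<xi> j x)"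
proof -
  show "i < m \<Longrightarrow> integrable M (\<xi> i)" using average_bound(2)[OF M \<xi>_measurable \<xi>_bound] by blast
  assume ij: "i < m" "j < m"
  show "integrable M (\<lambda>x. \<xi> i x * \<xi> j x)"
    by (rule average_bound(2)[OF M _ abs_le_mult[OF \<xi>_bound[OF ij(1)] \<xi>_bound[OF ij(2)]]])
       (intro borel_measurable_times \<xi>_measurable ij)
qed

lemma \<xi>_mean: "i < m \<Longrightarrow> (LINT x|M. \<xi> i x) = 0"
  unfolding \<xi>_def using f_integrable by (simp add: M.prob_space)

lemma \<xi>_variance: assumes i: "i < m" shows "(LINT x|M. \<xi> i x * \<xi> i x) \<le> q^2"
proof -
  have i2: "integrable M (\<lambda>x. f i x * f i x)"
    by (rule average_bound(2)[OF M _ abs_le_mult[OF fq[OF i] fq[OF i]]]) (intro borel_measurable_times f i)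
  define e where "e = (LINT x|M. f i x)"
  have "(LINT x|M. \<xi> i x * \<xi> i x) = (LINT x|M. f i x * f i x - 2 * e * f i x + e^2)"
    unfolding \<xi>_def e_def[symmetric] by (simp add: power2_eq_square algebra_simps)
  also have "... = (LINT x|M. f i x * f i x) - e^2"
    using i2 f_integrable[OF i] by (simp add: M.prob_space e_def[symmetric] power2_eq_square)
  also have "... \<le> (LINT x|M. f i x * f i x)" by simp
  also have "... \<le> q * q"
    using average_bound(1)[OF M borel_measurable_times[OF f[OF i] f[OF i]] abs_le_mult[OF fq[OF i] fq[OF i]]] by simp
  finally show ?thesis by (simp add: power2_eq_square)
qed

lemma law_var: "distr Q borel (\<lambda>w. \<Sum>i<m. a i * G i w) = centered_normal (var a)"
proof -
  define g where "g x = (\<Sum>i<m. a i * f i x)" for x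
  define e where "e = (LINT x|M. g x)"
  have gm: "g \<in> borel_measurable M" unfolding g_def[abs_def] using f by simp
  have gb: "\<bar>g x\<bar> \<le> (\<Sum>i<m. \<bar>a i\<bar> * q)" for x
    unfolding g_def by (intro order_trans[OF sum_abs] sum_mono) (auto simp: abs_mult intro!: mult_left_mono fq)
  have gi: "integrable M g" by (rule average_bound(2)[OF M gm gb])
  have gi2: "integrable M (\<lambda>x. g x * g x)"
    by (rule average_bound(2)[OF M _ abs_le_mult[OF gb gb]]) (intro borel_measurable_times gm)
  have "e = (\<Sum>i<m. a i * (LINT x|M. f i x))"
    unfolding e_def g_def by (subst Bochner_Integration.integral_sum) (auto simp: f_integrable)
  then have *: "(\<Sum>i<m. a i * \<xi> i x) = g x - e" for x by (simp add: g_def \<xi>_def right_diff_distrib sum_subtractf)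
  have "var a = (LINT x|M. g x * g x - 2 * e * g x + e^2)"
    unfolding var_def * by (simp add: power2_eq_square algebra_simps)
  also have "... = (LINT x|M. g x * g x) - e^2"
    using gi gi2 by (simp add: M.prob_space e_def[symmetric] power2_eq_square)
  finally show ?thesis using law[of a] by (simp add: g_def e_def power2_eq_square)
qed

lemma var_nonneg: "0 \<le> var a"
  unfolding var_def by simp

lemma combination_measurable: "(\<lambda>w. \<Sum>i<m. a i * G i w) \<in> borel_measurable Q"
  using G by simp

lemmas combination = normal_law[OF combination_measurable law_var var_nonneg]

lemma single: "i < m \<Longrightarrow> (\<Sum>k<m. (if k = i then 1 else 0) * g k) = (g i :: real)"
proof -
  assume "i < m"
  have "(\<Sum>k<m. (if k = i then 1 else 0) * g k) = (\<Sum>k<m. if k = i then g k else 0)" by (rule sum.cong) auto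
  then show ?thesis using \<open>i < m\<close> by simp
qed

lemma G_moments:
  assumes i: "i < m"
  shows "integrable Q (\<lambda>w. G i w ^ k)" "(LINT w|Q. G i w) = 0" "(LINT w|Q. (G i w)^2) = (LINT x|M. (\<xi> i x)^2)"
    "(LINT w|Q. G i w ^ 4) = 3 * (LINT x|M. (\<xi> i x)^2)^2"
  using combination(2-5)[of "\<lambda>k. if k = i then 1 else 0"] unfolding var_def single[OF i] by blast+

text \<open>Polarisation of the variance of \<open>G i + G j\<close>. The coefficient vector is a
  sum of two unit vectors, so the case \<open>i = j\<close> is included.\<close>

lemma G_product:
  assumes i: "i < m" and j: "j < m"
  shows "integrable Q (\<lambda>w. G i w * G j w)" "(LINT w|Q. G i w * G j w) = (LINT x|M. \<xi> i x * \<xi> j x)"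
proof -
  let ?a = "\<lambda>k. (if k = i then 1 else 0) + (if k = j then 1 else 0) :: real"
  have e: "(\<Sum>k<m. ?a k * g k) = g i + g j" for g :: "nat \<Rightarrow> real"
    unfolding distrib_right sum.distrib single[OF i] single[OF j] ..
  have s: "integrable Q (\<lambda>w. (G i w + G j w)^2)" "(LINT w|Q. (G i w + G j w)^2) = (LINT x|M. (\<xi> i x + \<xi> j x)^2)"
    using combination(2)[of ?a 2] combination(4)[of ?a] unfolding var_def e by blast+
  note Gi = G_moments(1)[OF i, of 2] and Gj = G_moments(1)[OF j, of 2]
  have eq: "G i w * G j w = ((G i w + G j w)^2 - (G i w)^2 - (G j w)^2) / 2" for w
    by (simp add: power2_eq_square algebra_simps)
  show "integrable Q (\<lambda>w. G i w * G j w)" unfolding eq using s(1) Gi Gj by simp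
  have "(LINT w|Q. G i w * G j w) = ((LINT x|M. (\<xi> i x + \<xi> j x)^2) - (LINT x|M. (\<xi> i x)^2) - (LINT x|M. (\<xi> j x)^2)) / 2"
    unfolding eq using s Gi Gj G_moments(3)[OF i] G_moments(3)[OF j] by simp
  also have "(LINT x|M. (\<xi> i x + \<xi> j x)^2) = (LINT x|M. \<xi> i x * \<xi> i x + \<xi> j x * \<xi> j x + 2 * (\<xi> i x * \<xi> j x))"
    by (simp add: power2_eq_square algebra_simps)
  also have "... = (LINT x|M. (\<xi> i x)^2) + (LINT x|M. (\<xi> j x)^2) + 2 * (LINT x|M. \<xi> i x * \<xi> j x)"
    using \<xi>_integrable(2)[OF i i] \<xi>_integrable(2)[OF j j] \<xi>_integrable(2)[OF i j] by (simp add: power2_eq_square)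
  finally show "(LINT w|Q. G i w * G j w) = (LINT x|M. \<xi> i x * \<xi> j x)" by simp
qed

text \<open>Only even powers of a Gaussian variable have convenient moments. From
  \<open>2 * S^3 \<le> c * S^2 + S^4 / c\<close> the third power is reached through the second and
  the fourth; \<open>c = m * q\<close> balances the two.\<close>

lemma l1_cube_le: "(l1 m v) ^ 3 \<le> ((real m)^2 * q * (\<Sum>i<m. (v i)^2) + (real m)^2 / q * (\<Sum>i<m. v i ^ 4)) / 2"
proof (cases "m = 0")
  case False
  define S c where "S = l1 m v" and "c = real m * q"
  have c: "0 < c" using False q by (simp add: c_def)
  have S2: "S^2 \<le> real m * (\<Sum>i<m. (v i)^2)"
    using sum_squared_le_sum_of_squares[of "\<lambda>i. \<bar>v i\<bar>" "{..<m}"] by (simp add: S_def l1_def mult.commute)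
  have "(S^2)^2 \<le> (real m * (\<Sum>i<m. (v i)^2))^2" by (intro power_mono S2) simp
  also have "... = (real m)^2 * (\<Sum>i<m. (v i)^2)^2" by (simp add: power_mult_distrib)
  also have "... \<le> (real m)^2 * (real m * (\<Sum>i<m. v i ^ 4))"
    using sum_squared_le_sum_of_squares[of "\<lambda>i. (v i)^2" "{..<m}"]
    by (intro mult_left_mono) (auto simp: mult.commute power_mult[symmetric])
  finally have S4: "(S^2)^2 \<le> (real m)^2 * (real m * (\<Sum>i<m. v i ^ 4))" .
  have "0 \<le> S^2 / c * (S - c)^2" using c by simp
  also have "... = (S^2)^2 / c + c * S^2 - 2 * S ^ 3"
    using c by (simp add: power2_eq_square power3_eq_cube field_simps)
  finally have "2 * S ^ 3 \<le> c * S^2 + (S^2)^2 / c" by simp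
  also have "... \<le> c * (real m * (\<Sum>i<m. (v i)^2)) + ((real m)^2 * (real m * (\<Sum>i<m. v i ^ 4))) / c"
    using c by (intro add_mono mult_left_mono divide_right_mono S2 S4) auto
  also have "... = (real m)^2 * q * (\<Sum>i<m. (v i)^2) + (real m)^2 / q * (\<Sum>i<m. v i ^ 4)"
    using False q by (simp add: c_def power2_eq_square field_simps)
  finally show ?thesis by (simp add: S_def)
qed (simp add: l1_def)

definition G_cube where "G_cube w = ((real m)^2 * q * (\<Sum>i<m. (G i w)^2) + (real m)^2 / q * (\<Sum>i<m. G i w ^ 4)) / 2"

lemma G_cube_integral: "integrable Q G_cube" "(LINT w|Q. G_cube w) \<le> 2 * (real m) ^ 3 * q ^ 3"
proof -
  have v: "(LINT x|M. (\<xi> i x)^2) \<le> q^2" "0 \<le> (LINT x|M. (\<xi> i x)^2)" if "i < m" for i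
    using \<xi>_variance[OF that] by (simp_all add: power2_eq_square)
  have v2: "(LINT x|M. (\<xi> i x)^2)^2 \<le> (q^2)^2" if "i < m" for i by (rule power_mono[OF v[OF that]])
  have i2: "integrable Q (\<lambda>w. \<Sum>i<m. G i w ^ k)" for k by (intro Bochner_Integration.integrable_sum G_moments) auto
  show "integrable Q G_cube" unfolding G_cube_def[abs_def] using i2[of 2] i2[of 4] by simp
  have "(LINT w|Q. G_cube w) = ((real m)^2 * q * (\<Sum>i<m. LINT w|Q. (G i w)^2) + (real m)^2 / q * (\<Sum>i<m. LINT w|Q. G i w ^ 4)) / 2"
  proof -
    have "(LINT w|Q. (\<Sum>i<m. G i w ^ k)) = (\<Sum>i<m. LINT w|Q. G i w ^ k)" for k
      by (intro Bochner_Integration.integral_sum G_moments) auto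
    then show ?thesis unfolding G_cube_def using i2[of 2] i2[of 4] by simp
  qed
  also have "... \<le> ((real m)^2 * q * (\<Sum>i<m. q^2) + (real m)^2 / q * (\<Sum>i<m. 3 * (q^2)^2)) / 2"
    using q v v2 by (intro divide_right_mono add_mono mult_left_mono sum_mono) (simp_all add: G_moments)
  also have "... = 2 * (real m) ^ 3 * q ^ 3" using q by (simp add: power2_eq_square power3_eq_cube)
  finally show "(LINT w|Q. G_cube w) \<le> 2 * (real m) ^ 3 * q ^ 3" .
qed

context
  fixes N :: nat and B :: real and \<Psi> :: "(nat \<Rightarrow> real) \<Rightarrow> real"
  assumes N: "0 < N" and \<Psi>: "Ck_euclid m 3 \<Psi>"
    and bound: "\<And>js x. set js \<subseteq> {..<m} \<Longrightarrow> length js \<le> 3 \<Longrightarrow> \<bar>partial_derivs js \<Psi> x\<bar> \<le> B"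
begin

definition r where "r = 1 / sqrt (real N)"
definition Y where "Y x i = (if i < m then \<xi> i x * r else 0)"
definition Z where "Z w i = (if i < m then G i w * r else 0)"

lemma r_pos: "0 < r" and r_sq: "real N * r^2 = 1"
  using N by (simp_all add: r_def power_divide)

lemma Y_measurable: "(\<lambda>x. Y x i) \<in> borel_measurable M" and Z_measurable: "(\<lambda>w. Z w i) \<in> borel_measurable Q"
  unfolding Y_def Z_def using \<xi>_measurable G by (cases "i < m"; simp)+

lemma \<Psi>_depends: "(\<And>i. i < m \<Longrightarrow> x i = y i) \<Longrightarrow> \<Psi> x = \<Psi> y"
  using \<Psi> unfolding Ck_euclid_def by blast

lemma \<Psi>_bound: "\<bar>\<Psi> x\<bar> \<le> B"
  using bound[of "[]" x] by simp

lemma l1_scale: "l1 m (\<lambda>i. if i < m then v i * r else 0) = r * l1 m v"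
  using r_pos by (simp add: l1_def sum_distrib_left abs_mult mult.commute cong: if_cong)

text \<open>The constant is \<open>40 = 4 * (8 + 2)\<close>: the Taylor factor, the cube of the
  bound \<open>2 * q\<close> on the centred functions, and the Gaussian contribution from
  \<open>G_cube_integral\<close>.\<close>

lemma one_step: "\<bar>translate_mean M Y \<Psi> w - translate_mean Q Z \<Psi> w\<bar> \<le> 40 * B * (real m) ^ 3 * q ^ 3 * r ^ 3"
proof -
  have lY: "l1 m (Y x) \<le> r * (real m * (2 * q))" for x
  proof -
    have "l1 m (\<lambda>i. \<xi> i x) \<le> (\<Sum>i<m. 2 * q)" unfolding l1_def by (rule sum_mono) (simp add: \<xi>_bound)
    then show ?thesis unfolding Y_def[abs_def] l1_scale using r_pos by (intro mult_left_mono) auto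
  qed
  have lY3: "(l1 m (Y x)) ^ 3 \<le> (r * (real m * (2 * q))) ^ 3" for x by (rule power_mono[OF lY l1_nonneg])
  have Y3m: "(\<lambda>x. (l1 m (Y x)) ^ 3) \<in> borel_measurable M" and Z3m: "(\<lambda>x. (l1 m (Z x)) ^ 3) \<in> borel_measurable Q"
    unfolding l1_def by (intro borel_measurable_power borel_measurable_sum borel_measurable_abs Y_measurable Z_measurable)+
  have "\<bar>(l1 m (Y x)) ^ 3\<bar> \<le> (r * (real m * (2 * q))) ^ 3" for x using lY3[of x] l1_nonneg[of m "Y x"] by simp
  note Y3 = average_bound(2,1)[OF M Y3m this]
  have lZ3: "(l1 m (Z z)) ^ 3 \<le> r ^ 3 * G_cube z" for z
    unfolding Z_def[abs_def] l1_scale power_mult_distrib G_cube_def using r_pos by (intro mult_left_mono l1_cube_le) auto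
  have Z3: "integrable Q (\<lambda>z. (l1 m (Z z)) ^ 3)"
    by (rule Bochner_Integration.integrable_bound[of _ "\<lambda>z. r ^ 3 * G_cube z"])
       (use G_cube_integral Z3m lZ3 l1_nonneg in \<open>auto intro!: order_trans[OF lZ3 abs_ge_self]\<close>)
  have "(LINT z|Q. (l1 m (Z z)) ^ 3) \<le> (LINT z|Q. r ^ 3 * G_cube z)"
    by (rule integral_mono[OF Z3 _ lZ3]) (simp add: G_cube_integral)
  also have "... \<le> r ^ 3 * (2 * (real m) ^ 3 * q ^ 3)" using G_cube_integral r_pos by simp
  finally have Z3': "(LINT z|Q. (l1 m (Z z)) ^ 3) \<le> r ^ 3 * (2 * (real m) ^ 3 * q ^ 3)" .
  have "\<bar>(LINT x|M. \<Psi> (\<lambda>i. w i + Y x i)) - (LINT z|Q. \<Psi> (\<lambda>i. w i + Z z i))\<bar>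
    \<le> 4 * B * ((LINT x|M. (l1 m (Y x)) ^ 3) + (LINT z|Q. (l1 m (Z z)) ^ 3))"
  proof (rule lindeberg_step[where Y = Y and Z = Z and w = w, OF \<Psi>])
    fix js x assume "set js \<subseteq> {..<m}" "length js \<le> 3"
    then show "\<bar>partial_derivs js \<Psi> x\<bar> \<le> B" by (rule bound)
  next
    fix i j assume i: "i < m" and j: "j < m"
    have e: "Y x i * Y x j = r^2 * (\<xi> i x * \<xi> j x)" "Z z i * Z z j = r^2 * (G i z * G j z)" for x z
      using i j by (simp_all add: Y_def Z_def power2_eq_square)
    show "integrable M (\<lambda>x. Y x i * Y x j)" "integrable Q (\<lambda>z. Z z i * Z z j)"
      unfolding e using \<xi>_integrable(2)[OF i j] G_product[OF i j] by simp_all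
    show "(LINT x|M. Y x i * Y x j) = (LINT z|Q. Z z i * Z z j)" unfolding e using G_product[OF i j] by simp
  next
    fix i assume i: "i < m"
    show "integrable M (\<lambda>x. Y x i)" "integrable Q (\<lambda>z. Z z i)" "(LINT x|M. Y x i) = (LINT z|Q. Z z i)"
      using i \<xi>_integrable(1)[OF i] G_moments(1)[OF i, of 1] G_moments(2)[OF i] \<xi>_mean[OF i] by (simp_all add: Y_def Z_def)
  qed (fact M Q Y_measurable Z_measurable Y3(1) Z3)+
  also have "... \<le> 4 * B * ((r * (real m * (2 * q))) ^ 3 + r ^ 3 * (2 * (real m) ^ 3 * q ^ 3))"
    using Y3(2) Z3' order_trans[OF abs_ge_zero \<Psi>_bound] by (intro mult_left_mono add_mono) auto
  also have "... = 40 * B * (real m) ^ 3 * q ^ 3 * r ^ 3" by (simp add: power_mult_distrib algebra_simps)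
  finally show ?thesis unfolding translate_mean_def .
qed

text \<open>Stability of Gaussian laws: the characteristic function of the sum has exponent
  \<open>real N * r^2\<close> times that of a single copy, and this factor is 1.\<close>

lemma gaussian_sum: "(LINT x|iid N Q. \<Psi> (\<lambda>i. \<Sum>k<N. Z (x k) i)) = (LINT w|Q. \<Psi> (\<lambda>i. if i < m then G i w else 0))"
proof (rule cramer_wold[where m = m and B = B and X = "\<lambda>x i. \<Sum>k<N. Z (x k) i" and Y = "\<lambda>w i. if i < m then G i w else 0"])
  interpret P: product_sigma_finite "\<lambda>_::nat. Q" by standard
  show PQ: "prob_space (iid N Q)" by (intro prob_space_PiM Q)
  show "prob_space Q" by (rule Q)
  show "(\<lambda>x i. \<Sum>k<N. Z (x k) i) \<in> borel_measurable (iid N Q)"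
  proof (intro measurable_coordinatewise_then_product borel_measurable_sum)
    fix i k assume "k \<in> {..<N}"
    then have "(\<lambda>x. x k) \<in> measurable (iid N Q) Q" by (rule measurable_component_singleton)
    from measurable_compose[OF this Z_measurable]
    show "(\<lambda>x. Z (x k) i) \<in> borel_measurable (iid N Q)" .
  qed
  have "(\<lambda>w. if i < m then G i w else 0) \<in> borel_measurable Q" for i using G by (cases "i < m") auto
  then show "(\<lambda>w i. if i < m then G i w else 0) \<in> borel_measurable Q" by (rule measurable_coordinatewise_then_product)
  fix a :: "nat \<Rightarrow> real"
  have "(\<Sum>i<m. a i * (\<Sum>k<N. Z (x k) i)) = (\<Sum>k<N. \<Sum>i<m. (a i * r) * G i (x k))" for x :: "nat \<Rightarrow> 'b"
    unfolding sum_distrib_left by (subst sum.swap) (simp add: Z_def mult_ac)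
  then have "iexp (\<Sum>i<m. a i * (\<Sum>k<N. Z (x k) i)) = (\<Prod>k<N. iexp (\<Sum>i<m. (a i * r) * G i (x k)))" for x :: "nat \<Rightarrow> 'b"
    by (simp only: exp_sum[OF finite_lessThan, symmetric] of_real_sum sum_distrib_left)
  then have "(LINT x|iid N Q. iexp (\<Sum>i<m. a i * (\<Sum>k<N. Z (x k) i))) =
      (\<Prod>k<N. LINT w|Q. iexp (\<Sum>i<m. (a i * r) * G i w))"
  proof (simp only:, intro P.product_integral_prod finite_lessThan)
    show "integrable Q (\<lambda>w. iexp (\<Sum>i<m. (a i * r) * G i w))"
    proof -
      define L where "L w = (\<Sum>i<m. (a i * r) * G i w)" for w
      have [measurable]: "L \<in> borel_measurable Q" unfolding L_def by (rule combination_measurable)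
      have "integrable Q (\<lambda>w. iexp (L w))" by (rule Q.integrable_const_bound[of _ 1]) auto
      then show ?thesis unfolding L_def .
    qed
  qed
  also have "... = of_real (exp (- var (\<lambda>i. a i * r) / 2)) ^ N"
    by (simp add: combination(1)[of "\<lambda>i. a i * r"] del: of_real_sum of_real_mult)
  also have "... = of_real (exp (real N * (- var (\<lambda>i. a i * r) / 2)))" by (simp only: exp_of_nat_mult of_real_power)
  also have "var (\<lambda>i. a i * r) = r^2 * var a"
  proof -
    have "(\<Sum>i<m. a i * r * \<xi> i x)^2 = r^2 * (\<Sum>i<m. a i * \<xi> i x)^2" for x
      by (simp add: power_mult_distrib[symmetric] sum_distrib_left mult_ac)
    then show ?thesis by (simp add: var_def)
  qed
  also have "real N * (- (r^2 * var a) / 2) = - var a / 2" using r_sq by (simp add: mult.assoc[symmetric])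
  also have "of_real (exp (- var a / 2)) = (LINT w|Q. iexp (\<Sum>i<m. a i * G i w))" by (rule combination(1)[symmetric])
  finally have *: "(LINT x|iid N Q. iexp (\<Sum>i<m. a i * (\<Sum>k<N. Z (x k) i))) = (LINT w|Q. iexp (\<Sum>i<m. a i * G i w))" .
  show "(LINT x|iid N Q. iexp (\<Sum>i<m. a i * (\<Sum>k<N. Z (x k) i))) =
    (LINT w|Q. iexp (\<Sum>i<m. a i * (if i < m then G i w else 0)))"
  proof -
    have "(\<Sum>i<m. a i * (if i < m then G i w else 0)) = (\<Sum>i<m. a i * G i w)" for w by (rule sum.cong) auto
    then show ?thesis using * by (simp only:)
  qed
qed (use Ck_euclid_continuous[OF \<Psi>] \<Psi>_bound \<Psi>_depends in \<open>blast+\<close>)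

theorem normal_approximation:
  "\<bar>(LINT x|iid N M. \<Psi> (\<lambda>i. (\<Sum>k<N. f i (x k) - (LINT y|M. f i y)) / sqrt (real N))) - (LINT w|Q. \<Psi> (\<lambda>i. G i w))\<bar>
    \<le> 40 * B * (real m) ^ 3 * q ^ 3 / sqrt (real N)"
proof -
  have g: "bounded_borel B \<Psi>"
    unfolding bounded_borel_def using \<Psi>_bound borel_measurable_continuous_onI[OF Ck_euclid_continuous[OF \<Psi>]] by blast
  have Y: "Y \<in> borel_measurable M" and Z: "Z \<in> borel_measurable Q"
    by (rule measurable_coordinatewise_then_product[OF Y_measurable], rule measurable_coordinatewise_then_product[OF Z_measurable])
  have 1: "(LINT x|iid N M. \<Psi> (\<lambda>i. (\<Sum>k<N. f i (x k) - (LINT y|M. f i y)) / sqrt (real N))) = (translate_mean M Y ^^ N) \<Psi> (\<lambda>_. 0)"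
    unfolding translate_mean_power_PiM[OF M Y g]
    by (intro bochner_cong refl \<Psi>_depends) (simp add: Y_def \<xi>_def r_def sum_divide_distrib)
  have 2: "(LINT w|Q. \<Psi> (\<lambda>i. G i w)) = (translate_mean Q Z ^^ N) \<Psi> (\<lambda>_. 0)"
    unfolding translate_mean_power_PiM[OF Q Z g] add_0 gaussian_sum by (intro bochner_cong refl \<Psi>_depends) simp
  \<comment> \<open>There are \<open>N\<close> exchanges, each at a cost proportional to the cube of
    \<open>1 / sqrt N\<close>.\<close>
  have "real N * r ^ 3 = (real N * r^2) * r" by (simp add: power2_eq_square power3_eq_cube)
  then have "real N * r ^ 3 = 1 / sqrt (real N)" unfolding r_sq by (simp add: r_def)
  then have N3: "40 * B * (real m) ^ 3 * q ^ 3 * (real N * r ^ 3) = 40 * B * (real m) ^ 3 * q ^ 3 / sqrt (real N)" by simp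
  have "real N * (40 * B * (real m) ^ 3 * q ^ 3 * r ^ 3) = 40 * B * (real m) ^ 3 * q ^ 3 / sqrt (real N)"
    unfolding N3[symmetric] by (simp only: ac_simps)
  then show ?thesis unfolding 1 2 using translate_mean_power_diff[OF M Y Q Z g one_step, of N "\<lambda>_. 0"] by simp
qed

end

end

section \<open>The duality pairing on functions with Lipschitz derivative\<close>

definition cosT :: "int \<Rightarrow> torus \<Rightarrow> real" where "cosT k x = cos (2 * pi * of_int k * rep_torus x)"
definition sinT :: "int \<Rightarrow> torus \<Rightarrow> real" where "sinT k x = sin (2 * pi * of_int k * rep_torus x)"

lemma trig_proj: "cosT k (proj s) = cos (2 * pi * of_int k * s)" "sinT k (proj s) = sin (2 * pi * of_int k * s)"
proof -
  have "rep_torus (proj s) - s \<in> \<int>" using proj_eq_iff[of "rep_torus (proj s)" s] by simp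
  then obtain n where "rep_torus (proj s) - s = of_int n" by (auto elim: Ints_cases)
  then have "2 * pi * of_int k * rep_torus (proj s) = 2 * pi * of_int k * s + 2 * pi * of_int (k * n)"
    by (simp add: algebra_simps)
  then have "sin (2 * pi * of_int k * rep_torus (proj s)) = sin (2 * pi * of_int k * s) \<and>
      cos (2 * pi * of_int k * rep_torus (proj s)) = cos (2 * pi * of_int k * s)" unfolding sin_cos_eq_iff by blast
  then show "cosT k (proj s) = cos (2 * pi * of_int k * s)" "sinT k (proj s) = sin (2 * pi * of_int k * s)"
    by (simp_all add: cosT_def sinT_def)
qed

lemma trig_measurable [measurable]: "cosT k \<in> borel_measurable borel" "sinT k \<in> borel_measurable borel"
  by (rule measurable_torusI, simp add: trig_proj)+

lemma trig_bound: "\<bar>cosT k x\<bar> \<le> 1" "\<bar>sinT k x\<bar> \<le> 1"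
  by (simp_all add: cosT_def sinT_def)

lemma trig_half_period:
  assumes "k \<noteq> 0" "t = 1 / (2 * of_int k) \<or> t = - 1 / (2 * of_int k)"
  shows "cosT k (x \<oplus> t) = - cosT k x" "sinT k (x \<oplus> t) = - sinT k x"
proof -
  have "\<forall>s. cosT k (proj s \<oplus> t) = - cosT k (proj s) \<and> sinT k (proj s \<oplus> t) = - sinT k (proj s)"
  proof
    fix s
    have "2 * pi * of_int k * (s + t) = 2 * pi * of_int k * s + pi \<or> 2 * pi * of_int k * (s + t) = 2 * pi * of_int k * s - pi"
      using assms by (auto simp: field_simps)
    then show "cosT k (proj s \<oplus> t) = - cosT k (proj s) \<and> sinT k (proj s \<oplus> t) = - sinT k (proj s)"
      by (elim disjE) (simp_all add: trig_proj)
  qed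
  then show "cosT k (x \<oplus> t) = - cosT k x" "sinT k (x \<oplus> t) = - sinT k x"
    using torus_induct[of "\<lambda>x. cosT k (x \<oplus> t) = - cosT k x \<and> sinT k (x \<oplus> t) = - sinT k x"] by blast+
qed

text \<open>Replaces two integrations by parts. Shifting by a half period in either direction flips
  the sign of \<open>e\<close>, so integrating \<open>e\<close> against the second difference of
  \<open>f\<close> gives \<open>- 4\<close> times the integral to be bounded.\<close>

lemma antiperiodic_integral_le:
  assumes f: "C11 q f f'" and e[measurable]: "e \<in> borel_measurable borel" and e1: "\<And>x. \<bar>e x\<bar> \<le> 1"
    and anti: "\<And>x. e (x \<oplus> t) = - e x" "\<And>x. e (x \<oplus> - t) = - e x"
  shows "\<bar>LINT x|leb. e x * f x\<bar> \<le> q * t^2 / 2"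
proof -
  note [measurable] = C11_measurable[OF f]
  have int: "integrable leb (\<lambda>x. e x * f (x \<oplus> s))" for s
    by (rule average_bound(2)[OF leb.prob_space_axioms _ abs_le_mult[OF e1 C11D(1)[OF f]]]) measurable
  have "(LINT x|leb. e x * f x) = (LINT x|leb. e (x \<oplus> s) * f (x \<oplus> s))" for s
    by (rule integral_leb_shift[symmetric]) measurable
  from this[of t] this[of "- t"]
  have sh: "(LINT x|leb. e x * f (x \<oplus> t)) = - (LINT x|leb. e x * f x)" "(LINT x|leb. e x * f (x \<oplus> - t)) = - (LINT x|leb. e x * f x)"
    by (simp_all add: anti)
  have "(LINT x|leb. e x * (f (x \<oplus> t) + f (x \<oplus> - t) - 2 * f x)) =
      (LINT x|leb. e x * f (x \<oplus> t) + e x * f (x \<oplus> - t) - 2 * (e x * f x))" by (simp add: algebra_simps)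
  also have "... = - 4 * (LINT x|leb. e x * f x)" using int[of t] int[of "- t"] int[of 0] sh by simp
  finally have "4 * \<bar>LINT x|leb. e x * f x\<bar> = \<bar>LINT x|leb. e x * (f (x \<oplus> t) + f (x \<oplus> - t) - 2 * f x)\<bar>" by simp
  also have "... \<le> 1 * (2 * q * t^2)"
    by (rule average_bound(1)[OF leb.prob_space_axioms _ abs_le_mult[OF e1 second_difference_le[OF C11D(3)[OF f]]]]) measurable
  finally show ?thesis by simp
qed

definition fourier_cos where "fourier_cos f k = (LINT x|leb. cosT k x * f x)"
definition fourier_sin where "fourier_sin f k = (LINT x|leb. sinT k x * f x)"

text \<open>The half period \<open>1 / (2 * k)\<close> gives \<open>q / (8 * k^2)\<close>, and
  \<open>1 + k^2 \<le> 16 * k^2\<close> puts it into a form that also covers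
  \<open>k = 0\<close>.\<close>

lemma coeff_bound:
  assumes f: "C11 q f f'"
  shows "\<bar>fourier_cos f k\<bar> \<le> 2 * q / (1 + (of_int k)^2)" "\<bar>fourier_sin f k\<bar> \<le> 2 * q / (1 + (of_int k)^2)"
proof -
  have *: "\<bar>LINT x|leb. e x * f x\<bar> \<le> 2 * q / (1 + (of_int k)^2)"
    if e[measurable]: "e \<in> borel_measurable borel" and e1: "\<And>x. \<bar>e x\<bar> \<le> 1"
      and anti: "\<And>x t. k \<noteq> 0 \<Longrightarrow> t = 1 / (2 * of_int k) \<or> t = - 1 / (2 * of_int k) \<Longrightarrow> e (x \<oplus> t) = - e x" for e
  proof (cases "k = 0")
    case True
    note [measurable] = C11_measurable[OF f]
    have "\<bar>LINT x|leb. e x * f x\<bar> \<le> 1 * q"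
      by (rule average_bound(1)[OF leb.prob_space_axioms _ abs_le_mult[OF e1 C11D(1)[OF f]]]) measurable
    then show ?thesis using True C11D(4)[OF f] by simp
  next
    case False
    then have "1 \<le> abs k" by simp
    then have "1 \<le> (real_of_int k)^2"
      by (metis abs_1 of_int_1_le_iff of_int_abs one_power2 power2_abs power2_le_iff_abs_le zero_le_one abs_le_square_iff)
    then have k: "0 < (real_of_int k)^2" "1 + (real_of_int k)^2 \<le> 16 * (real_of_int k)^2" by linarith+
    have "\<bar>LINT x|leb. e x * f x\<bar> \<le> q * (1 / (2 * of_int k))^2 / 2"
      by (rule antiperiodic_integral_le[OF f e e1]) (rule anti, use False in auto)+
    also have "... = 2 * q / (16 * (real_of_int k)^2)" by (simp add: power2_eq_square)
    also have "... \<le> 2 * q / (1 + (real_of_int k)^2)"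
      using k C11D(4)[OF f] by (intro divide_left_mono mult_pos_pos) (auto intro: add_pos_pos)
    finally show ?thesis .
  qed
  show "\<bar>fourier_cos f k\<bar> \<le> 2 * q / (1 + (of_int k)^2)" "\<bar>fourier_sin f k\<bar> \<le> 2 * q / (1 + (of_int k)^2)"
    unfolding fourier_cos_def fourier_sin_def by (rule *; (rule trig_measurable trig_bound trig_half_period; assumption?))+
qed

section \<open>The pairing as an integral over frequencies\<close>

lemma summable_on_iff_integrable_count_space:
  fixes f :: "'a \<Rightarrow> 'b :: {banach, second_countable_topology}"
  shows "(\<lambda>x. norm (f x)) summable_on A \<longleftrightarrow> integrable (count_space A) f"
  using abs_summable_equivalent[of f A] by (simp add: Infinite_Set_Sum.abs_summable_on_def)

lemma infsum_eq_integral_count_space: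
  fixes f :: "'a \<Rightarrow> 'b :: {banach, second_countable_topology}"
  assumes "integrable (count_space A) f"
  shows "infsum f A = (LINT x|count_space A. f x)"
  using infsetsum_infsum[of f A] assms by (simp add: Infinite_Set_Sum.abs_summable_on_def infsetsum_def)

abbreviation "CS \<equiv> count_space (UNIV :: int set)"

lemma integrable_inverse_squares: "integrable CS (\<lambda>k. 1 / (1 + (real_of_int k)^2))"
proof -
  define g where "g k = 1 / (1 + (real_of_int k)^2)" for k
  have s: "summable (\<lambda>n. 1 / (1 + (real n)^2))"
  proof (rule summable_comparison_test')
    show "summable (\<lambda>n. inverse (real n ^ 2))" by (rule inverse_power_summable) simp
    show "norm (1 / (1 + (real n)^2)) \<le> inverse (real n ^ 2)" if "1 \<le> n" for n
    proof -
      have "0 < (real n)^2" using that by simp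
      moreover from this have "0 < 1 + (real n)^2" by linarith
      ultimately show ?thesis by (simp add: divide_simps)
    qed
  qed
  then have s': "summable (\<lambda>n. 1 / (1 + (real (Suc n))^2))" by (subst summable_Suc_iff)
  have "g summable_on range int"
    by (subst summable_on_reindex) (auto simp: inj_on_def g_def comp_def intro!: norm_summable_imp_summable_on s)
  moreover have "g summable_on range (\<lambda>n. - int (Suc n))"
  proof -
    have "g (- int (Suc n)) = 1 / (1 + (real (Suc n))^2)" for n
      unfolding g_def by (simp only: of_int_minus of_int_of_nat_eq power2_minus)
    then have "(\<lambda>n. g (- int (Suc n))) summable_on UNIV"
      using s' by (simp only:) (intro norm_summable_imp_summable_on, simp)
    then show ?thesis by (subst summable_on_reindex) (auto simp: inj_on_def comp_def)
  qed
  ultimately have "g summable_on (range int \<union> range (\<lambda>n. - int (Suc n)))" by (rule summable_on_Un_disjoint) auto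
  moreover have "range int \<union> range (\<lambda>n. - int (Suc n)) = UNIV"
  proof -
    have "k \<in> range int \<union> range (\<lambda>n. - int (Suc n))" for k by (cases k rule: int_cases) auto
    then show ?thesis by blast
  qed
  moreover have "norm (g k) = g k" for k by (simp add: g_def)
  ultimately have "(\<lambda>k. norm (g k)) summable_on UNIV" by simp
  then show ?thesis unfolding summable_on_iff_integrable_count_space g_def[abs_def] .
qed

definition weight where "weight u k = (\<bar>u (cosT k)\<bar> + \<bar>u (sinT k)\<bar>) / (1 + (real_of_int k)^2)"
definition pair_term where "pair_term f u k = fourier_cos f k * u (cosT k) + fourier_sin f k * u (sinT k)"

lemma fourier_eq: "fourier u k = Complex (u (cosT k)) (u (sinT k))"
  by (simp add: fourier_def cosT_def[abs_def] sinT_def[abs_def])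

lemma fourier_function: "fourier (\<lambda>g. LINT x|leb. g x * f x) k = Complex (fourier_cos f k) (fourier_sin f k)"
  by (simp add: fourier_eq fourier_cos_def fourier_sin_def)

lemma Sobolev_summand: "(1 + (real_of_int k)^2) powr - 1 * (cmod (fourier u k))^2 = ((u (cosT k))^2 + (u (sinT k))^2) / (1 + (real_of_int k)^2)"
proof -
  have "0 < 1 + (real_of_int k)^2" by (simp add: add_pos_nonneg)
  then show ?thesis by (simp add: fourier_eq complex_norm powr_minus divide_inverse mult.commute)
qed

lemma weight_nonneg: "0 \<le> weight u k"
  by (simp add: weight_def add_nonneg_nonneg)

text \<open>Sobolev order \<open>- 1\<close> matches C^{1,1}: Fourier coefficients of such functions
  decay like \<open>1 / (1 + k^2)\<close>, and \<open>abs x \<le> 1/2 + x^2\<close> compares the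
  resulting series with the Sobolev series. \<open>weight\<close> then dominates the pairing
  uniformly over bounded sets in C^{1,1}.\<close>

lemma weight_integrable:
  assumes "u \<in> Sobolev (- 1)"
  shows "integrable CS (weight u)"
proof -
  have "(\<lambda>k. ((u (cosT k))^2 + (u (sinT k))^2) / (1 + (real_of_int k)^2)) summable_on UNIV"
    using assms unfolding Sobolev_def mem_Collect_eq Sobolev_summand by (elim conjE)
  moreover have "norm (((u (cosT k))^2 + (u (sinT k))^2) / (1 + (real_of_int k)^2)) = ((u (cosT k))^2 + (u (sinT k))^2) / (1 + (real_of_int k)^2)" for k
    by (simp add: add_nonneg_nonneg)
  ultimately have i: "integrable CS (\<lambda>k. ((u (cosT k))^2 + (u (sinT k))^2) / (1 + (real_of_int k)^2))"
    unfolding summable_on_iff_integrable_count_space[symmetric] by simp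
  show ?thesis
  proof (rule Bochner_Integration.integrable_bound[OF Bochner_Integration.integrable_add[OF integrable_inverse_squares i]])
    have a: "abs x \<le> 1/2 + x^2" for x :: real
    proof -
      have "0 \<le> (abs x - 1/2)^2" by simp
      then show ?thesis by (simp add: power2_diff power_divide)
    qed
    have "weight u k \<le> 1 / (1 + (real_of_int k)^2) + ((u (cosT k))^2 + (u (sinT k))^2) / (1 + (real_of_int k)^2)" for k
      unfolding weight_def add_divide_distrib[symmetric]
      using a[of "u (cosT k)"] a[of "u (sinT k)"] by (intro divide_right_mono) (auto simp: add_nonneg_nonneg)
    then show "AE k in CS. norm (weight u k) \<le> norm (1 / (1 + (real_of_int k)^2) + ((u (cosT k))^2 + (u (sinT k))^2) / (1 + (real_of_int k)^2))"
      using weight_nonneg by (intro AE_I2) (simp add: order_trans[OF _ abs_ge_self])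
  qed simp
qed

lemma pair_term_bound:
  assumes f: "C11 q f f'"
  shows "\<bar>pair_term f u k\<bar> \<le> 2 * q * weight u k"
proof -
  have "\<bar>pair_term f u k\<bar> \<le> \<bar>fourier_cos f k\<bar> * \<bar>u (cosT k)\<bar> + \<bar>fourier_sin f k\<bar> * \<bar>u (sinT k)\<bar>"
    unfolding pair_term_def by (intro order_trans[OF abs_triangle_ineq]) (simp add: abs_mult)
  also have "... \<le> 2 * q / (1 + (of_int k)^2) * \<bar>u (cosT k)\<bar> + 2 * q / (1 + (of_int k)^2) * \<bar>u (sinT k)\<bar>"
    by (intro add_mono mult_right_mono coeff_bound[OF f]) auto
  also have "... = 2 * q * weight u k" by (simp add: weight_def add_divide_distrib distrib_left)
  finally show ?thesis .
qed

lemma pair_term_integrable: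
  assumes "C11 q f f'" "u \<in> Sobolev (- 1)"
  shows "integrable CS (pair_term f u)"
  by (rule Bochner_Integration.integrable_bound[of _ "\<lambda>k. 2 * q * weight u k"])
     (use weight_integrable[OF assms(2)] pair_term_bound[OF assms(1)] in \<open>auto intro!: AE_I2 order_trans[OF _ abs_ge_self]\<close>)

lemma dual_pair_eq:
  assumes f: "C11 q f f'" and u: "u \<in> Sobolev (- 1)"
  shows "dual_pair f u = (LINT k|CS. pair_term f u k)"
proof -
  let ?z = "\<lambda>k. cnj (fourier (\<lambda>g. LINT x|leb. g x * f x) k) * fourier u k"
  have re: "Re (?z k) = pair_term f u k" for k by (simp add: fourier_function fourier_eq[of u] pair_term_def)
  have bd: "norm (?z k) \<le> 4 * q * weight u k" for k
  proof -
    have "norm (?z k) \<le> (\<bar>fourier_cos f k\<bar> + \<bar>fourier_sin f k\<bar>) * (\<bar>u (cosT k)\<bar> + \<bar>u (sinT k)\<bar>)"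
      unfolding norm_mult complex_mod_cnj fourier_function fourier_eq[of u]
      using cmod_le[of "Complex (fourier_cos f k) (fourier_sin f k)"] cmod_le[of "Complex (u (cosT k)) (u (sinT k))"]
      by (intro mult_mono) auto
    also have "... \<le> (2 * q / (1 + (of_int k)^2) + 2 * q / (1 + (of_int k)^2)) * (\<bar>u (cosT k)\<bar> + \<bar>u (sinT k)\<bar>)"
      by (intro mult_right_mono add_mono coeff_bound[OF f]) auto
    also have "... = 4 * q * weight u k" by (simp add: weight_def)
    finally show ?thesis .
  qed
  have int: "integrable CS ?z" by (rule Bochner_Integration.integrable_bound[of _ "\<lambda>k. 4 * q * weight u k"])
       (use weight_integrable[OF u] bd in \<open>auto intro!: AE_I2 order_trans[OF bd abs_ge_self]\<close>)
  have "dual_pair f u = Re (LINT k|CS. ?z k)" unfolding dual_pair_def infsum_eq_integral_count_space[OF int] ..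
  also have "... = (LINT k|CS. Re (?z k))" using int by (rule integral_Re[symmetric])
  finally show ?thesis unfolding re .
qed

lemma trig_coeff_integrable:
  assumes f: "C11 q f f'"
  shows "integrable leb (\<lambda>x. cosT k x * f x)" "integrable leb (\<lambda>x. sinT k x * f x)"
proof -
  note [measurable] = C11_measurable[OF f]
  show "integrable leb (\<lambda>x. cosT k x * f x)"
    by (rule average_bound(2)[OF leb.prob_space_axioms _ abs_le_mult[OF trig_bound(1) C11D(1)[OF f]]]) measurable
  show "integrable leb (\<lambda>x. sinT k x * f x)"
    by (rule average_bound(2)[OF leb.prob_space_axioms _ abs_le_mult[OF trig_bound(2) C11D(1)[OF f]]]) measurable
qed

lemma dual_pair_linear:
  assumes f: "C11 q f f'" and g: "C11 p g g'" and fg: "C11 r (\<lambda>x. f x + a * g x) s'" and u: "u \<in> Sobolev (- 1)"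
  shows "dual_pair (\<lambda>x. f x + a * g x) u = dual_pair f u + a * dual_pair g u"
proof -
  note i = trig_coeff_integrable[OF f] trig_coeff_integrable[OF g]
  have "fourier_cos (\<lambda>x. f x + a * g x) k = fourier_cos f k + a * fourier_cos g k"
       "fourier_sin (\<lambda>x. f x + a * g x) k = fourier_sin f k + a * fourier_sin g k" for k
    unfolding fourier_cos_def fourier_sin_def using i[of k] by (simp_all add: distrib_left mult.left_commute)
  then have "pair_term (\<lambda>x. f x + a * g x) u = (\<lambda>k. pair_term f u k + a * pair_term g u k)"
    by (simp add: fun_eq_iff pair_term_def algebra_simps)
  then show ?thesis unfolding dual_pair_eq[OF f u] dual_pair_eq[OF g u] dual_pair_eq[OF fg u]
    using pair_term_integrable[OF f u] pair_term_integrable[OF g u] by simp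
qed

text \<open>A common C^{1,1} constant gives the dominating series, and pointwise convergence gives
  convergence of each Fourier coefficient.\<close>

lemma dual_pair_tendsto:
  assumes fn: "\<And>n. C11 q (fn n) (fn' n)" and f: "C11 q f f'" and lim: "\<And>x. (\<lambda>n. fn n x) \<longlonglongrightarrow> f x" and u: "u \<in> Sobolev (- 1)"
  shows "(\<lambda>n. dual_pair (fn n) u) \<longlonglongrightarrow> dual_pair f u"
  unfolding dual_pair_eq[OF fn u] dual_pair_eq[OF f u]
proof (rule integral_dominated_convergence[where w = "\<lambda>k. 2 * q * weight u k"])
  have *: "(\<lambda>n. LINT x|leb. e x * fn n x) \<longlonglongrightarrow> (LINT x|leb. e x * f x)" if [measurable]: "e \<in> borel_measurable borel" and e1: "\<And>x. \<bar>e x\<bar> \<le> 1" for e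
  proof (rule integral_dominated_convergence[where w = "\<lambda>_. 1 * q"])
    show "AE x in leb. norm (e x * fn n x) \<le> 1 * q" for n
      using abs_le_mult[OF e1 C11D(1)[OF fn[of n]]] by (intro AE_I2) simp
    show "AE x in leb. (\<lambda>n. e x * fn n x) \<longlonglongrightarrow> e x * f x" by (intro AE_I2 tendsto_intros lim)
    show "(\<lambda>x. e x * f x) \<in> borel_measurable leb" "(\<lambda>x. e x * fn n x) \<in> borel_measurable leb" for n
      using C11_measurable(1)[OF f] C11_measurable(1)[OF fn[of n]] by simp_all
  qed simp
  have "(\<lambda>n. pair_term (fn n) u k) \<longlonglongrightarrow> pair_term f u k" for k unfolding pair_term_def fourier_cos_def fourier_sin_def
    by (intro tendsto_intros * trig_measurable trig_bound)
  then show "AE k in CS. (\<lambda>n. pair_term (fn n) u k) \<longlonglongrightarrow> pair_term f u k" by simp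
  show "AE k in CS. norm (pair_term (fn n) u k) \<le> 2 * q * weight u k" for n using pair_term_bound[OF fn] by simp
qed (use weight_integrable[OF u] in auto)

text \<open>Fubini twice: inside each Fourier coefficient, and between the sum over frequencies and
  the average over \<open>x\<close>, where \<open>weight\<close> ensures integrability.\<close>

lemma dual_pair_average:
  fixes h :: "torus \<Rightarrow> torus \<Rightarrow> real"
  assumes M: "prob_space M" and M_sets[measurable_cong]: "sets M = sets borel" and g[measurable]: "g \<in> borel_measurable borel" and gB: "\<And>x. \<bar>g x\<bar> \<le> B"
    and h: "\<And>x. C11 b (h x) (h' x)" and hm[measurable]: "(\<lambda>(x, z). h x z) \<in> borel_measurable (borel \<Otimes>\<^sub>M borel)"
    and gh: "C11 c (\<lambda>z. LINT x|M. g x * h x z) k'" and u: "u \<in> Sobolev (- 1)"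
  shows "(LINT x|M. g x * dual_pair (h x) u) = dual_pair (\<lambda>z. LINT x|M. g x * h x z) u"
proof -
  interpret M: prob_space M by (rule M)
  interpret CS: sigma_finite_measure CS by (rule sigma_finite_measure_count_space)
  interpret P: pair_sigma_finite CS M ..
  have e: "fourier_cos (\<lambda>z. LINT x|M. g x * h x z) k = (LINT x|M. g x * fourier_cos (h x) k)"
    "fourier_sin (\<lambda>z. LINT x|M. g x * h x z) k = (LINT x|M. g x * fourier_sin (h x) k)" 
    and cm: "(\<lambda>x. fourier_cos (h x) k) \<in> borel_measurable M" "(\<lambda>x. fourier_sin (h x) k) \<in> borel_measurable M" for k
  proof -
    have *: "(LINT z|leb. e z * (LINT x|M. g x * h x z)) = (LINT x|M. g x * (LINT z|leb. e z * h x z))"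
      if e[measurable]: "e \<in> borel_measurable borel" and e1: "\<And>x. \<bar>e x\<bar> \<le> 1" for e
    proof -
      have m: "(\<lambda>(x, z). e z * (g x * h x z)) \<in> borel_measurable (M \<Otimes>\<^sub>M leb)" by measurable
      have "(LINT z|leb. LINT x|M. e z * (g x * h x z)) = (LINT x|M. LINT z|leb. e z * (g x * h x z))"
        by (rule bounded_integral_swap[OF M leb.prob_space_axioms m]) (rule abs_le_mult[OF e1 abs_le_mult[OF gB C11D(1)[OF h]]])
      moreover have "e z * (LINT x|M. g x * h x z) = (LINT x|M. e z * (g x * h x z))" for z by simp
      moreover have "(LINT z|leb. e z * (g x * h x z)) = g x * (LINT z|leb. e z * h x z)" for x
        by (subst integral_mult_right_zero[symmetric]) (simp add: mult.left_commute)
      ultimately show ?thesis by (simp only:)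
    qed
    show "fourier_cos (\<lambda>z. LINT x|M. g x * h x z) k = (LINT x|M. g x * fourier_cos (h x) k)"
      "fourier_sin (\<lambda>z. LINT x|M. g x * h x z) k = (LINT x|M. g x * fourier_sin (h x) k)"
      unfolding fourier_cos_def fourier_sin_def by (intro * trig_measurable trig_bound)+
    show "(\<lambda>x. fourier_cos (h x) k) \<in> borel_measurable M" "(\<lambda>x. fourier_sin (h x) k) \<in> borel_measurable M"
      unfolding fourier_cos_def fourier_sin_def by measurable
  qed
  have tm: "(\<lambda>x. g x * pair_term (h x) u k) \<in> borel_measurable M" for k
    unfolding pair_term_def using cm[of k] by measurable
  have tb: "\<bar>g x * pair_term (h x) u k\<bar> \<le> B * (2 * b * weight u k)" for x k
    by (rule abs_le_mult[OF gB pair_term_bound[OF h]])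
  have jm: "(\<lambda>p. g (snd p) * pair_term (h (snd p)) u (fst p)) \<in> borel_measurable (CS \<Otimes>\<^sub>M M)"
    by (rule measurable_pair_measure_countable1) (use tm in auto)
  have int: "integrable (CS \<Otimes>\<^sub>M M) (\<lambda>(k, x). g x * pair_term (h x) u k)"
  proof (rule P.Fubini_integrable)
    show "(\<lambda>(k, x). g x * pair_term (h x) u k) \<in> borel_measurable (CS \<Otimes>\<^sub>M M)" using jm by (simp add: split_beta')
    show "integrable CS (\<lambda>k. LINT x|M. norm (case (k, x) of (k, x) \<Rightarrow> g x * pair_term (h x) u k))"
    proof (rule Bochner_Integration.integrable_bound[of _ "\<lambda>k. B * (2 * b * weight u k)"])
      show "AE k in CS. norm (LINT x|M. norm (case (k, x) of (k, x) \<Rightarrow> g x * pair_term (h x) u k)) \<le> norm (B * (2 * b * weight u k))"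
      proof (rule AE_I2)
        fix k
        have "\<bar>LINT x|M. \<bar>g x * pair_term (h x) u k\<bar>\<bar> \<le> B * (2 * b * weight u k)"
          by (rule average_bound(1)[OF M borel_measurable_abs[OF tm]]) (simp only: abs_abs tb)
        then show "norm (LINT x|M. norm (case (k, x) of (k, x) \<Rightarrow> g x * pair_term (h x) u k)) \<le> norm (B * (2 * b * weight u k))" by simp
      qed
    qed (use weight_integrable[OF u] in auto)
    show "AE k in CS. integrable M (\<lambda>x. case (k, x) of (k, x) \<Rightarrow> g x * pair_term (h x) u k)"
      using average_bound(2)[OF M tm tb] by simp
  qed
  have "(LINT x|M. g x * dual_pair (h x) u) = (LINT x|M. LINT k|CS. g x * pair_term (h x) u k)"
    unfolding dual_pair_eq[OF h u] by simp
  also have "... = (LINT k|CS. LINT x|M. g x * pair_term (h x) u k)" by (rule P.Fubini_integral[OF int])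
  also have "... = (LINT k|CS. pair_term (\<lambda>z. LINT x|M. g x * h x z) u k)"
  proof (rule bochner_cong[OF refl])
    fix k
    have c: "\<bar>g x * fourier_cos (h x) k\<bar> \<le> B * (2 * b / (1 + (of_int k)^2))" "\<bar>g x * fourier_sin (h x) k\<bar> \<le> B * (2 * b / (1 + (of_int k)^2))" for x
      by (intro abs_le_mult gB coeff_bound[OF h])+
    have "integrable M (\<lambda>x. g x * fourier_cos (h x) k)"
      by (rule average_bound(2)[OF M _ c(1)]) (use cm[of k] in measurable)
    moreover have "integrable M (\<lambda>x. g x * fourier_sin (h x) k)"
      by (rule average_bound(2)[OF M _ c(2)]) (use cm[of k] in measurable)
    ultimately show "(LINT x|M. g x * pair_term (h x) u k) = pair_term (\<lambda>z. LINT x|M. g x * h x z) u k"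
      by (simp add: pair_term_def e distrib_left mult.assoc[symmetric])
  qed
  finally show ?thesis unfolding dual_pair_eq[OF gh u] .
qed

section \<open>Smooth approximation by trigonometric polynomials\<close>

text \<open>Closed under products and derivatives, which gives smoothness of all orders at
  once.\<close>

inductive trig_poly :: "(real \<Rightarrow> real) \<Rightarrow> bool" where
  tp_const: "trig_poly (\<lambda>_. c)"
| tp_cos: "trig_poly (\<lambda>s. cos (2 * pi * s))"
| tp_sin: "trig_poly (\<lambda>s. sin (2 * pi * s))"
| tp_add: "trig_poly f \<Longrightarrow> trig_poly g \<Longrightarrow> trig_poly (\<lambda>s. f s + g s)"
| tp_mult: "trig_poly f \<Longrightarrow> trig_poly g \<Longrightarrow> trig_poly (\<lambda>s. f s * g s)"

lemma trig_poly_DERIV: "trig_poly f \<Longrightarrow> \<exists>f'. trig_poly f' \<and> (\<forall>s. (f has_real_derivative f' s) (at s))"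
proof (induct rule: trig_poly.induct)
  case (tp_const c)
  show ?case by (rule exI[of _ "\<lambda>_. 0"]) (auto intro: trig_poly.intros)
next
  case tp_cos
  have "((\<lambda>s. cos (2 * pi * s)) has_real_derivative (- (2 * pi)) * sin (2 * pi * s)) (at s)" for s
    by (auto intro!: derivative_eq_intros)
  then show ?case using tp_mult[OF trig_poly.tp_const tp_sin] by blast
next
  case tp_sin
  have "((\<lambda>s. sin (2 * pi * s)) has_real_derivative (2 * pi) * cos (2 * pi * s)) (at s)" for s
    by (auto intro!: derivative_eq_intros)
  then show ?case using tp_mult[OF trig_poly.tp_const tp_cos] by blast
next
  case (tp_add f g)
  then obtain f' g' where "trig_poly f'" "trig_poly g'" "\<forall>s. (f has_real_derivative f' s) (at s)" "\<forall>s. (g has_real_derivative g' s) (at s)" by blast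
  then show ?case by (intro exI[of _ "\<lambda>s. f' s + g' s"]) (auto intro: trig_poly.intros DERIV_add)
next
  case (tp_mult f g)
  then obtain f' g' where "trig_poly f'" "trig_poly g'" "\<forall>s. (f has_real_derivative f' s) (at s)" "\<forall>s. (g has_real_derivative g' s) (at s)" by blast
  with tp_mult show ?case
    by (intro exI[of _ "\<lambda>s. f' s * g s + g' s * f s"]) (auto intro!: trig_poly.intros DERIV_mult)
qed

lemma trig_poly_funpow_deriv: "trig_poly f \<Longrightarrow> trig_poly ((deriv ^^ j) f)"
proof (induct j)
  case (Suc j)
  then obtain f' where f': "trig_poly f'" "\<And>s. ((deriv ^^ j) f has_real_derivative f' s) (at s)" using trig_poly_DERIV by blast
  then have "(deriv ^^ Suc j) f = f'" by (auto intro: DERIV_imp_deriv)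
  then show ?case using f' by simp
qed simp

lemma trig_poly_smooth: "trig_poly (\<lambda>s. f (proj s)) \<Longrightarrow> smooth_torus f"
  unfolding smooth_torus_def Ck_torus_def Ck_real_def
proof (intro allI conjI impI)
  fix j x assume f: "trig_poly (\<lambda>s. f (proj s))"
  then show "(deriv ^^ j) (\<lambda>s. f (proj s)) differentiable at x"
    using trig_poly_DERIV[OF trig_poly_funpow_deriv[OF f, of j]] by (auto simp: real_differentiable_def)
next
  fix k assume f: "trig_poly (\<lambda>s. f (proj s))"
  then show "continuous_on UNIV ((deriv ^^ k) (\<lambda>s. f (proj s)))"
    using trig_poly_DERIV[OF trig_poly_funpow_deriv[OF f, of k]] by (auto intro: DERIV_continuous_on)
qed

text \<open>\<open>vp\<close> is \<open>cos\<^sup>2(\<pi>y)\<close>; its powers are the de la Vallee Poussin kernels.\<close>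

definition vp :: "torus \<Rightarrow> real" where "vp y = (1 + cosT 1 y) / 2"
text \<open>The kernel \<open>vp\<close> at the difference of \<open>x\<close> and \<open>y\<close>,
  expanded by the addition formula so that \<open>x\<close> and \<open>y\<close> separate.\<close>

definition vp2 :: "torus \<Rightarrow> torus \<Rightarrow> real" where "vp2 x y = (1 + cosT 1 x * cosT 1 y + sinT 1 x * sinT 1 y) / 2"

lemma vp_measurable [measurable]: "vp \<in> borel_measurable borel" "vp2 x \<in> borel_measurable borel"
  unfolding vp_def[abs_def] vp2_def[abs_def] by measurable

lemma trig_crep: "cosT 1 x = cos (2 * pi * crep x)" "sinT 1 x = sin (2 * pi * crep x)"
  using trig_proj[of 1 "crep x"] by simp_all

lemma vp_nonneg: "0 \<le> vp y" and vp_le_1: "vp y \<le> 1"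
  using trig_bound(1)[of 1 y] by (simp_all add: vp_def abs_le_iff)

lemma vp_sin: "1 - vp y = (sin (pi * crep y))^2"
  using cos_double_sin[of "pi * crep y"] by (simp add: vp_def trig_crep field_simps)

lemma shift_crep: "y \<oplus> crep x = x \<oplus> crep y"
  by (metis add.commute proj_crep torus_add_proj)

lemma vp2_shift: "vp2 x (y \<oplus> crep x) = vp y"
proof -
  have e: "cosT 1 (y \<oplus> crep x) = cos (2 * pi * crep y + 2 * pi * crep x)" "sinT 1 (y \<oplus> crep x) = sin (2 * pi * crep y + 2 * pi * crep x)"
    using trig_proj[of 1 "crep y + crep x"] torus_add_proj[of "crep y" "crep x"] by (simp_all add: distrib_left)
  define a b where "a = 2 * pi * crep x" and "b = 2 * pi * crep y"
  have "cos a * cos (b + a) + sin a * sin (b + a) = cos b" using cos_diff[of "b + a" a] by (simp add: mult.commute)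
  then show ?thesis by (simp add: vp2_def vp_def e trig_crep[of x] trig_crep[of y] a_def b_def add.assoc)
qed

lemma vp_shift_integral:
  assumes [measurable]: "\<phi> \<in> borel_measurable borel"
  shows "(LINT y|leb. \<phi> (x \<oplus> crep y) * vp y ^ n) = (LINT y|leb. \<phi> y * vp2 x y ^ n)"
proof -
  have "(LINT y|leb. \<phi> (y \<oplus> crep x) * vp2 x (y \<oplus> crep x) ^ n) = (LINT y|leb. \<phi> y * vp2 x y ^ n)"
    by (rule integral_leb_shift) measurable
  then show ?thesis by (simp add: vp2_shift shift_crep)
qed

text \<open>One factor of the kernel is expanded at a time: its dependence on \<open>s\<close> comes
  out as a cosine or sine, its dependence on \<open>y\<close> is absorbed into \<phi>, which
  therefore varies in the induction.\<close>

lemma vp2_trig_poly: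
  assumes "\<phi> \<in> borel_measurable borel" "\<And>y. \<bar>\<phi> y\<bar> \<le> B"
  shows "trig_poly (\<lambda>s. LINT y|leb. \<phi> y * vp2 (proj s) y ^ n)"
  using assms
proof (induct n arbitrary: \<phi> B)
  case (Suc n)
  note [measurable] = Suc.prems(1)
  let ?I = "\<lambda>\<phi> s. LINT y|leb. \<phi> y * vp2 (proj s) y ^ n"
  have v: "\<bar>vp2 (proj s) y ^ n\<bar> \<le> (3/2) ^ n" for s y
  proof -
    have "\<bar>(1 + a + b) / 2\<bar> \<le> 3/2" if "abs a \<le> 1 * 1" "abs b \<le> 1 * 1" for a b :: real
    proof -
      have "\<bar>1 + a + b\<bar> \<le> 3" using that by linarith
      then show ?thesis by (simp add: abs_divide)
    qed
    then have "\<bar>vp2 (proj s) y\<bar> \<le> 3/2"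
      unfolding vp2_def using abs_le_mult[OF trig_bound(1) trig_bound(1)] abs_le_mult[OF trig_bound(2) trig_bound(2)] by blast
    then show ?thesis unfolding power_abs by (rule power_mono) simp
  qed
  have b: "\<bar>\<phi> y * cosT 1 y\<bar> \<le> B * 1" "\<bar>\<phi> y * sinT 1 y\<bar> \<le> B * 1" for y
    by (intro abs_le_mult Suc.prems(2) trig_bound)+
  have int: "integrable leb (\<lambda>y. \<psi> y * vp2 (proj s) y ^ n)" if [measurable]: "\<psi> \<in> borel_measurable borel" and "\<And>y. \<bar>\<psi> y\<bar> \<le> B'" for \<psi> B' s
    by (rule average_bound(2)[OF leb.prob_space_axioms _ abs_le_mult[OF that(2) v]]) measurable
  have "(LINT y|leb. \<phi> y * vp2 (proj s) y ^ Suc n) =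
    1/2 * (?I \<phi> s + (cos (2 * pi * s) * ?I (\<lambda>y. \<phi> y * cosT 1 y) s + sin (2 * pi * s) * ?I (\<lambda>y. \<phi> y * sinT 1 y) s))" for s
  proof -
    have "(LINT y|leb. \<phi> y * vp2 (proj s) y ^ Suc n) = (LINT y|leb. 1/2 * (\<phi> y * vp2 (proj s) y ^ n +
      (cos (2 * pi * s) * (\<phi> y * cosT 1 y * vp2 (proj s) y ^ n) + sin (2 * pi * s) * (\<phi> y * sinT 1 y * vp2 (proj s) y ^ n))))"
      using trig_proj[of 1 s] by (intro bochner_cong refl) (simp add: vp2_def[of "proj s"] field_simps)
    also have "... = 1/2 * (?I \<phi> s + (cos (2 * pi * s) * ?I (\<lambda>y. \<phi> y * cosT 1 y) s + sin (2 * pi * s) * ?I (\<lambda>y. \<phi> y * sinT 1 y) s))"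
      using int[OF Suc.prems] int[OF _ b(1)] int[OF _ b(2)] by simp
    finally show ?thesis .
  qed
  moreover have "trig_poly (\<lambda>s. 1/2 * (?I \<phi> s + (cos (2 * pi * s) * ?I (\<lambda>y. \<phi> y * cosT 1 y) s + sin (2 * pi * s) * ?I (\<lambda>y. \<phi> y * sinT 1 y) s)))"
    by (intro trig_poly.intros Suc.hyps[OF Suc.prems] Suc.hyps[OF _ b(1)] Suc.hyps[OF _ b(2)]) measurable
  ultimately show ?case by (simp only:)
qed (simp add: tp_const)

definition vp_mass where "vp_mass n = (LINT y|leb. vp y ^ n)"

lemma vp_power_bound: "\<bar>vp y ^ n\<bar> \<le> 1"
  using vp_nonneg vp_le_1 by (simp add: power_le_one)

lemma vp_power_integrable: "integrable leb (\<lambda>y. vp y ^ n)"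
  by (rule average_bound(2)[OF leb.prob_space_axioms _ vp_power_bound]) measurable

text \<open>On an arc of length \<open>\<delta> = 1 / (8 * j^2)\<close> the kernel is at least
  \<open>1 - 1 / (4 * j^4)\<close>, and by Bernoulli's inequality its power \<open>j^4\<close> is at
  least 3/4. Finally \<open>3 / 32 \<ge> 1 / 11\<close>.\<close>

lemma vp_mass_lower: assumes "1 \<le> j" shows "1 / (11 * real j ^ 2) \<le> vp_mass (j ^ 4)"
proof -
  define \<delta> where "\<delta> = 1 / (8 * real j ^ 2)"
  have j2: "1 \<le> real j ^ 2" using assms by simp
  have "1 < 8 * real j ^ 2" using j2 by linarith
  then have \<delta>: "0 < \<delta>" "\<delta> < 1" using assms by (simp_all add: \<delta>_def)
  have pt: "3/4 * indicator {y. crep y \<le> \<delta>} y \<le> vp y ^ (j ^ 4)" for y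
  proof (cases "crep y \<le> \<delta>")
    case True
    define s where "s = crep y"
    have s: "0 \<le> s" "s \<le> \<delta>" using True by (simp_all add: s_def)
    have "0 \<le> pi * s" "pi * s \<le> pi" using s \<delta> by simp_all
    then have "0 \<le> sin (pi * s)" "sin (pi * s) \<le> pi * s" by (simp_all add: sin_ge_zero sin_x_le_x)
    moreover have "pi * s \<le> 4 * \<delta>" using s pi_less_4 by (intro mult_mono) auto
    ultimately have "(sin (pi * s))^2 \<le> (4 * \<delta>)^2" by (intro power_mono) auto
    also have "(4 * \<delta>)^2 = 1 / (4 * real j ^ 4)" using assms by (simp add: \<delta>_def power_divide power_mult_distrib flip: power_mult)
    finally have v: "1 - 1 / (4 * real j ^ 4) \<le> vp y" using vp_sin[of y] by (simp add: s_def)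
    have "1 \<le> real j ^ 4" using assms by simp
    then have g: "0 \<le> 1 - 1 / (4 * real j ^ 4)" "-1 \<le> - (1 / (4 * real j ^ 4))" by (simp_all add: divide_simps)
    have "3/4 \<le> 1 + real (j ^ 4) * (- (1 / (4 * real j ^ 4)))" using assms by simp
    also have "... \<le> (1 + - (1 / (4 * real j ^ 4))) ^ (j ^ 4)" by (rule Bernoulli_inequality[OF g(2)])
    also have "... \<le> vp y ^ (j ^ 4)" using v g(1) by (intro power_mono) auto
    finally show ?thesis using True by simp
  qed (simp add: vp_nonneg)
  have [measurable]: "{y. crep y \<le> \<delta>} \<in> sets borel"
    using measurable_sets[OF measurable_crep, of "{..\<delta>}"] by (simp add: vimage_def)
  have "emeasure leb {y. crep y \<le> \<delta>} = (\<integral>\<^sup>+y. indicator {y. crep y \<le> \<delta>} y \<partial>leb)" by simp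
  also have "... = (\<integral>\<^sup>+s. indicator {y. crep y \<le> \<delta>} (proj s) * indicator {0..<1} s \<partial>lborel)"
    by (rule nn_integral_leb) measurable
  also have "... = (\<integral>\<^sup>+s. indicator {0..\<delta>} s \<partial>lborel)"
    using \<delta> by (intro nn_integral_cong) (auto simp: indicator_def frac_eq)
  also have "... = ennreal \<delta>" using \<delta> by simp
  finally have "measure leb {y. crep y \<le> \<delta>} = \<delta>" using \<delta> by (simp add: measure_def)
  then have "3/4 * \<delta> = (LINT y|leb. 3/4 * indicator {y. crep y \<le> \<delta>} y)" by simp
  also have "... \<le> vp_mass (j ^ 4)"
    unfolding vp_mass_def by (intro integral_mono pt vp_power_integrable) (auto simp: integrable_indicator_iff leb.emeasure_finite less_top[symmetric])
  finally have "3/4 * \<delta> \<le> vp_mass (j ^ 4)" .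
  moreover have "1 / (11 * real j ^ 2) \<le> 3/4 * \<delta>" using assms by (simp add: \<delta>_def divide_simps)
  ultimately show ?thesis by (rule order_trans[rotated])
qed

text \<open>The term \<open>t ^ n\<close> is the smallest of \<open>n + 1\<close> terms of a
  geometric sum, which multiplied by \<open>1 - t\<close> is at most 1.\<close>

lemma one_minus_mult_power_le: "0 \<le> t \<Longrightarrow> t \<le> 1 \<Longrightarrow> (1 - t) * t ^ n \<le> 1 / (real n + 1)" for t :: real
proof -
  assume t: "0 \<le> t" "t \<le> 1"
  have "(real n + 1) * t ^ n = (\<Sum>i<Suc n. t ^ n)" by simp
  also have "... \<le> (\<Sum>i<Suc n. t ^ i)" using t by (intro sum_mono power_decreasing) auto
  finally have "(1 - t) * ((real n + 1) * t ^ n) \<le> (1 - t) * (\<Sum>i<Suc n. t ^ i)" using t by (intro mult_left_mono) auto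
  also have "... = 1 - t ^ Suc n" by (rule sum_gp_basic[of t n, unfolded lessThan_Suc_atMost[symmetric]])
  also have "... \<le> 1" using t by simp
  finally show ?thesis by (simp add: field_simps)
qed

text \<open>With exponent \<open>j^4\<close> the mean of \<open>1 - vp\<close> is of order
  \<open>1 / j^4\<close> divided by a mass of order at least \<open>1 / j^2\<close>; so the mean
  distance to the origin is of order \<open>1 / j\<close>.\<close>

definition vp_dens :: "nat \<Rightarrow> torus \<Rightarrow> real" where "vp_dens j y = vp y ^ (j ^ 4) / vp_mass (j ^ 4)"

context
  fixes j :: nat
  assumes j: "1 \<le> j"
begin

lemma vp_mass_pos: "0 < vp_mass (j ^ 4)"
  by (rule less_le_trans[OF _ vp_mass_lower[OF j]]) (use j in simp)

lemma vp_dens_measurable: "vp_dens j \<in> borel_measurable borel"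
  unfolding vp_dens_def[abs_def] by measurable

lemma vp_dens_nonneg: "0 \<le> vp_dens j y"
  using vp_mass_pos vp_nonneg by (simp add: vp_dens_def)

lemma vp_dens_prob: "prob_space (dens (vp_dens j))"
proof
  note [measurable] = vp_dens_measurable
  have "emeasure (dens (vp_dens j)) (space (dens (vp_dens j))) = (\<integral>\<^sup>+y. ennreal (vp_dens j y) \<partial>leb)"
    unfolding dens_def by (simp add: emeasure_density)
  also have "... = ennreal (LINT y|leb. vp_dens j y)"
    using vp_power_integrable vp_dens_nonneg by (intro nn_integral_eq_integral) (auto simp: vp_dens_def)
  also have "(LINT y|leb. vp_dens j y) = 1" using vp_mass_pos by (simp add: vp_dens_def vp_mass_def)
  finally show "emeasure (dens (vp_dens j)) (space (dens (vp_dens j))) = 1" by simp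
qed

lemma vp_dens_integral:
  assumes [measurable]: "g \<in> borel_measurable borel"
  shows "(LINT y|dens (vp_dens j). g y) = (LINT y|leb. g y * vp y ^ (j ^ 4)) / vp_mass (j ^ 4)"
proof -
  note [measurable] = vp_dens_measurable
  have "(LINT y|dens (vp_dens j). g y) = (LINT y|leb. vp_dens j y *\<^sub>R g y)"
    unfolding dens_def using vp_dens_nonneg by (intro integral_density) auto
  also have "... = (LINT y|leb. g y * vp y ^ (j ^ 4) / vp_mass (j ^ 4))"
    by (intro bochner_cong refl) (simp add: vp_dens_def)
  finally show ?thesis by simp
qed

text \<open>The representative in \<open>(-1/2, 1/2]\<close>. Its absolute value is the distance to
  the origin, whereas \<open>crep\<close> is close to 1 just to the left of 0.\<close>

definition near where "near y = (if crep y \<le> 1/2 then crep y else crep y - 1)"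

lemma near_measurable: "near \<in> borel_measurable borel"
  unfolding near_def[abs_def] by measurable

lemma torus_add_near: "x \<oplus> crep y = x \<oplus> near y"
  using torus_add_Ints[of "-1" "x \<oplus> crep y"] by (simp add: near_def torus_add_add)

lemma near_le: "\<bar>near y\<bar> \<le> 1/2"
proof -
  have "\<bar>if c \<le> 1/2 then c else c - 1\<bar> \<le> 1/2" if "0 \<le> c" "c < 1" for c :: real using that by (auto simp: abs_if)
  then show ?thesis unfolding near_def by simp
qed

text \<open>The cubic Taylor bound gives \<open>z / 3 \<le> sin z\<close> on \<open>[0, 2]\<close>,
  and \<open>pi > 3\<close> bounds the size of \<open>near y\<close> by
  \<open>z / 3\<close>.\<close>

lemma near_sq_le: "(near y)^2 \<le> 1 - vp y"
proof -
  define z where "z = pi * \<bar>near y\<bar>"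
  have z0: "0 \<le> z" by (simp add: z_def)
  have z2: "z \<le> 2" unfolding z_def using mult_mono[OF less_imp_le[OF pi_less_4] near_le] by simp
  have "sin (pi * crep y) = sin (pi * near y) \<or> sin (pi * crep y) = - sin (pi * near y)"
    by (simp add: near_def right_diff_distrib)
  then have s: "(sin (pi * crep y))^2 = (sin z)^2" unfolding z_def by (auto simp: abs_if)
  have "\<bar>sin z - (\<Sum>m<3. sin_coeff m * z ^ m)\<bar> \<le> inverse (fact 3) * abs z ^ 3" by (rule Maclaurin_sin_bound)
  moreover have "(\<Sum>m<3. sin_coeff m * z ^ m) = z" by (simp add: sin_coeff_def eval_nat_numeral)
  moreover have "z ^ 3 \<le> 4 * z"
    using mult_right_mono[OF power_mono[OF z2 z0, of 2] z0] by (simp add: power2_eq_square power3_eq_cube)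
  ultimately have "z / 3 \<le> sin z" using z0 by (simp add: fact_numeral abs_if split: if_splits)
  then have "(z / 3)^2 \<le> (sin z)^2" using z0 by (intro power_mono) auto
  moreover have "\<bar>near y\<bar> \<le> z / 3" unfolding z_def using mult_right_mono[OF less_imp_le[OF pi_gt3] abs_ge_zero[of "near y"]] by simp
  then have "(near y)^2 \<le> (z / 3)^2" by (metis abs_ge_zero power2_abs power_mono)
  ultimately show ?thesis unfolding vp_sin s by linarith
qed

text \<open>The weighted inequality between means gives at most
  \<open>1 / j + j * (1 - vp y)\<close> for the distance; the mean of \<open>1 - vp\<close> is at
  most \<open>11 / j^2\<close>.\<close>

lemma near_moment: "(LINT y|dens (vp_dens j). \<bar>near y\<bar>) \<le> 12 / real j"
proof -
  note [measurable] = near_measurable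
  have j0: "0 < real j" using j by simp
  have nb: "\<bar>\<bar>near y\<bar>\<bar> \<le> 1" for y using near_le[of y] by simp
  have vb: "\<bar>1 - vp y\<bar> \<le> 1" for y using vp_nonneg[of y] vp_le_1[of y] by simp
  have i1: "integrable (dens (vp_dens j)) (\<lambda>y. \<bar>near y\<bar>)" "integrable (dens (vp_dens j)) (\<lambda>y. 1 - vp y)"
    by (rule average_bound(2)[OF vp_dens_prob _ nb], measurable) (rule average_bound(2)[OF vp_dens_prob _ vb], measurable)
  interpret V: prob_space "dens (vp_dens j)" by (rule vp_dens_prob)
  have "\<bar>near y\<bar> \<le> 1 / real j + real j * (1 - vp y)" for y
  proof -
    have "0 \<le> (\<bar>near y\<bar> * real j - 1)^2" by simp
    then have "2 * (\<bar>near y\<bar> * real j) \<le> 1 + (near y)^2 * (real j)^2" by (simp add: power2_diff power_mult_distrib)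
    also have "... \<le> 1 + (1 - vp y) * (real j)^2" using near_sq_le by (intro add_left_mono mult_right_mono) auto
    finally have "\<bar>near y\<bar> * real j \<le> 1 + (1 - vp y) * (real j)^2" using vp_le_1[of y] by (smt (verit) abs_ge_zero j0 mult_nonneg_nonneg)
    then show ?thesis using j0 by (simp add: field_simps power2_eq_square)
  qed
  then have "(LINT y|dens (vp_dens j). \<bar>near y\<bar>) \<le> (LINT y|dens (vp_dens j). 1 / real j + real j * (1 - vp y))"
    using i1 by (intro integral_mono) auto
  also have "... = 1 / real j + real j * (LINT y|dens (vp_dens j). 1 - vp y)" using i1 V.prob_space by simp
  also have "(LINT y|dens (vp_dens j). 1 - vp y) = (LINT y|leb. (1 - vp y) * vp y ^ (j ^ 4)) / vp_mass (j ^ 4)"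
    by (rule vp_dens_integral) measurable
  also have "... \<le> (1 / real j ^ 4) / (1 / (11 * real j ^ 2))"
  proof (rule frac_le)
    have b: "\<bar>(1 - vp y) * vp y ^ (j ^ 4)\<bar> \<le> 1 / real j ^ 4" for y
    proof -
      have "(1 - vp y) * vp y ^ (j ^ 4) \<le> 1 / (real (j ^ 4) + 1)"
        using one_minus_mult_power_le[OF vp_nonneg vp_le_1] by blast
      also have "... \<le> 1 / real j ^ 4"
      proof -
        have "0 < real j ^ 4" using j0 by simp
        then show ?thesis by (intro frac_le) simp_all
      qed
      finally show ?thesis using vp_nonneg[of y] vp_le_1[of y] by simp
    qed
    have "\<bar>LINT y|leb. (1 - vp y) * vp y ^ (j ^ 4)\<bar> \<le> 1 / real j ^ 4"
      by (rule average_bound(1)[OF leb.prob_space_axioms _ b]) measurable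
    then show "(LINT y|leb. (1 - vp y) * vp y ^ (j ^ 4)) \<le> 1 / real j ^ 4" by simp
  qed (use j0 vp_mass_lower[OF j] in auto)
  also have "real j * ((1 / real j ^ 4) / (1 / (11 * real j ^ 2))) = 11 / real j"
    using j0 by (simp add: eval_nat_numeral)
  finally show ?thesis using j0 by (simp add: mult_left_mono add_divide_distrib[symmetric])
qed

definition mollify :: "(torus \<Rightarrow> real) \<Rightarrow> torus \<Rightarrow> real"
  where "mollify \<phi> x = (LINT y|dens (vp_dens j). \<phi> (x \<oplus> crep y))"

lemma mollify_smooth: assumes \<phi>: "C11 q \<phi> \<phi>'" shows "smooth_torus (mollify \<phi>)"
proof (rule trig_poly_smooth)
  note [measurable] = C11_measurable(1)[OF \<phi>]
  have "mollify \<phi> x = inverse (vp_mass (j ^ 4)) * (LINT y|leb. \<phi> y * vp2 x y ^ (j ^ 4))" for x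
    unfolding mollify_def by (subst vp_dens_integral) (simp_all add: vp_shift_integral divide_inverse mult.commute)
  then show "trig_poly (\<lambda>s. mollify \<phi> (proj s))"
    by (simp only:) (intro trig_poly.intros vp2_trig_poly[OF _ C11D(1)[OF \<phi>]], measurable)
qed

lemma shift_swap: "x \<oplus> s \<oplus> t = x \<oplus> t \<oplus> s"
  by (simp add: torus_add_add add.commute)

text \<open>An average of translates satisfies every bound that all translates share, hence the same
  constant \<open>q\<close>.\<close>

lemma mollify_C11: assumes \<phi>: "C11 q \<phi> \<phi>'" shows "C11 q (mollify \<phi>) (mollify \<phi>')"
proof -
  note [measurable] = C11_measurable[OF \<phi>]
  note C = C11D[OF \<phi>]
  show ?thesis unfolding C11_def
  proof (intro conjI allI)
    show "\<bar>mollify \<phi> x\<bar> \<le> q" for x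
      unfolding mollify_def by (rule average_bound(1)[OF vp_dens_prob _ C(1)]) measurable
    show "lip q (mollify \<phi>)" unfolding mollify_def[abs_def]
    proof (rule lip_average[OF vp_dens_prob _ C(1)])
      show "lip q (\<lambda>x. \<phi> (x \<oplus> crep y))" for y
        unfolding lip_def shift_swap[of _ _ "crep y"] using lipD[OF C(2)] by blast
    qed measurable
    show "qd q (mollify \<phi>) (mollify \<phi>')" unfolding mollify_def[abs_def]
    proof (rule qd_average[OF vp_dens_prob _ C(1) _ C11_deriv_bound[OF \<phi>]])
      show "qd q (\<lambda>x. \<phi> (x \<oplus> crep y)) (\<lambda>x. \<phi>' (x \<oplus> crep y))" for y
        unfolding qd_def shift_swap[of _ _ "crep y"] using qdD[OF C(3)] by blast
    qed measurable
  qed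
qed

lemma mollify_error: assumes \<phi>: "lip L \<phi>" shows "\<bar>mollify \<phi> x - \<phi> x\<bar> \<le> L * (12 / real j)"
proof -
  note [measurable] = lip_measurable[OF \<phi>] near_measurable
  interpret V: prob_space "dens (vp_dens j)" by (rule vp_dens_prob)
  have nb: "\<bar>L * \<bar>near y\<bar>\<bar> \<le> L * 1" for y using near_le[of y] lip_nonneg[OF \<phi>] by (intro abs_le_mult) auto
  have d: "\<bar>\<phi> (x \<oplus> crep y) - \<phi> x\<bar> \<le> L * \<bar>near y\<bar>" for y unfolding torus_add_near by (rule lipD[OF \<phi>])
  have in1: "integrable (dens (vp_dens j)) (\<lambda>y. L * \<bar>near y\<bar>)"
    by (rule average_bound(2)[OF vp_dens_prob _ nb]) measurable
  have in2: "integrable (dens (vp_dens j)) (\<lambda>y. \<phi> (x \<oplus> crep y) - \<phi> x)"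
    by (rule average_bound(2)[OF vp_dens_prob _ lip_oscillation[OF \<phi>]]) measurable
  have "integrable (dens (vp_dens j)) (\<lambda>y. (\<phi> (x \<oplus> crep y) - \<phi> x) + \<phi> x)"
    by (intro Bochner_Integration.integrable_add in2 V.integrable_const)
  then have "mollify \<phi> x - \<phi> x = (LINT y|dens (vp_dens j). \<phi> (x \<oplus> crep y) - \<phi> x)"
    unfolding mollify_def using V.prob_space by simp
  also have "\<bar>...\<bar> \<le> (LINT y|dens (vp_dens j). L * \<bar>near y\<bar>)"
    by (rule order_trans[OF integral_abs_bound], rule integral_mono) (use in1 in2 d in auto)
  also have "... = L * (LINT y|dens (vp_dens j). \<bar>near y\<bar>)" by simp
  also have "... \<le> L * (12 / real j)" by (intro mult_left_mono near_moment lip_nonneg[OF \<phi>])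
  finally show ?thesis .
qed

end

lemma mollify_tendsto: assumes "lip L \<phi>" shows "(\<lambda>n. mollify (Suc n) \<phi> x) \<longlonglongrightarrow> \<phi> x"
proof (rule LIM_zero_cancel, rule Lim_null_comparison)
  show "\<forall>\<^sub>F n in sequentially. norm (mollify (Suc n) \<phi> x - \<phi> x) \<le> L * 12 * inverse (real (Suc n))"
    using mollify_error[OF _ assms, of "Suc _" x] by (intro always_eventually) (auto simp: divide_inverse mult.assoc)
  show "(\<lambda>n. L * 12 * inverse (real (Suc n))) \<longlonglongrightarrow> 0"
    using tendsto_mult_right_zero[OF LIMSEQ_inverse_real_of_nat] by simp
qed

text \<open>The derivatives must converge too, since \<open>back_step\<close> contains the
  derivative of the test function.\<close>

lemma smooth_approximation:
  assumes \<phi>: "C11 q \<phi> \<phi>'"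
  obtains \<phi>n \<phi>n' where "\<And>n. smooth_torus (\<phi>n n)" "\<And>n. C11 q (\<phi>n n) (\<phi>n' n)"
    "\<And>x. (\<lambda>n. \<phi>n n x) \<longlonglongrightarrow> \<phi> x" "\<And>x. (\<lambda>n. \<phi>n' n x) \<longlonglongrightarrow> \<phi>' x"
proof
  show "smooth_torus (mollify (Suc n) \<phi>)" "C11 q (mollify (Suc n) \<phi>) (mollify (Suc n) \<phi>')" for n
    using mollify_smooth[OF _ \<phi>] mollify_C11[OF _ \<phi>] by simp_all
  show "(\<lambda>n. mollify (Suc n) \<phi> x) \<longlonglongrightarrow> \<phi> x" "(\<lambda>n. mollify (Suc n) \<phi>' x) \<longlonglongrightarrow> \<phi>' x" for x
    using mollify_tendsto C11D(2)[OF \<phi>] qd_deriv_lip[OF C11D(3)[OF \<phi>]] by blast+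
qed

section \<open>The limit field\<close>

context interaction
begin

context
  fixes \<rho> :: "torus \<Rightarrow> real" and u u' :: "(torus \<Rightarrow> real) \<Rightarrow> real"
  assumes M: "prob_space (dens \<rho>)" and u: "u \<in> Sobolev (- 1)" and u': "u' \<in> Sobolev (- 1)"
begin

lemma back_step_dual_pair:
  assumes \<phi>: "C11 q \<phi> \<phi>'"
  shows "dual_pair (back_step dt h F \<rho> \<phi>) u = dual_pair (\<phi> \<circ> F_mu dt h F (dens \<rho>)) u +
      dt * (LINT x|dens \<rho>. torus_deriv (\<phi> \<circ> F) (phi dt h (dens \<rho>) x) * dual_pair (h x) u)"
proof -
  note i = C11_interaction[OF \<phi> M]
  have hm: "(\<lambda>(x, z). h x z) \<in> borel_measurable (borel \<Otimes>\<^sub>M borel)" by measurable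
  show ?thesis
    unfolding i(5) dual_pair_linear[OF i(3,4) C11_lin[OF i(3,4)] u] dual_pair_average[OF M sets_dens i(1,2) h_C11 hm i(4) u] ..
qed

text \<open>By the chain rule the interaction term contains \<open>\<phi>n'\<close> at the image
  under \<open>F\<close>; the common C^{1,1} constant allows dominated convergence.\<close>

lemma back_step_tendsto:
  assumes \<phi>n: "\<And>n. C11 q (\<phi>n n) (\<phi>n' n)" and \<phi>: "C11 q \<phi> \<phi>'"
    and lim: "\<And>x. (\<lambda>n. \<phi>n n x) \<longlonglongrightarrow> \<phi> x" and lim': "\<And>x. (\<lambda>n. \<phi>n' n x) \<longlonglongrightarrow> \<phi>' x"
  shows "(\<lambda>n. back_step dt h F \<rho> (\<phi>n n) z) \<longlonglongrightarrow> back_step dt h F \<rho> \<phi> z"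
proof -
  have d: "torus_deriv (\<psi> \<circ> F) y = map_deriv F y * \<psi>' (F y)" if "C11 q \<psi> \<psi>'" for \<psi> \<psi>' y
    using qd_torus_deriv[OF C11D(3)[OF C11_comp_map[OF F_c11 that]]] by (simp add: comp_def)
  have m: "(\<lambda>x. torus_deriv (\<psi> \<circ> F) (phi dt h (dens \<rho>) x) * h x z) \<in> borel_measurable (dens \<rho>)"
    and bd: "\<bar>torus_deriv (\<psi> \<circ> F) (phi dt h (dens \<rho>) x) * h x z\<bar> \<le> q * fh * b" if \<psi>: "C11 q \<psi> \<psi>'" for \<psi> \<psi>' x
  proof -
    have [measurable]: "(\<lambda>x. torus_deriv (\<psi> \<circ> F) (phi dt h (dens \<rho>) x)) \<in> borel_measurable borel"
      by (rule measurable_compose[OF phi_measurable[OF M sets_dens] C11_measurable(2)[OF C11_comp_F[OF \<psi>]]])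
    show "(\<lambda>x. torus_deriv (\<psi> \<circ> F) (phi dt h (dens \<rho>) x) * h x z) \<in> borel_measurable (dens \<rho>)" by measurable
    show "\<bar>torus_deriv (\<psi> \<circ> F) (phi dt h (dens \<rho>) x) * h x z\<bar> \<le> q * fh * b"
      by (rule abs_le_mult[OF C11_deriv_bound[OF C11_comp_F[OF \<psi>]] h_bounds(1)])
  qed
  interpret prob_space "dens \<rho>" by (rule M)
  have "(\<lambda>n. LINT x|dens \<rho>. torus_deriv (\<phi>n n \<circ> F) (phi dt h (dens \<rho>) x) * h x z) \<longlonglongrightarrow>
      (LINT x|dens \<rho>. torus_deriv (\<phi> \<circ> F) (phi dt h (dens \<rho>) x) * h x z)"
  proof (rule integral_dominated_convergence[where w = "\<lambda>_. q * fh * b"])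
    show "AE x in dens \<rho>. (\<lambda>n. torus_deriv (\<phi>n n \<circ> F) (phi dt h (dens \<rho>) x) * h x z) \<longlonglongrightarrow> torus_deriv (\<phi> \<circ> F) (phi dt h (dens \<rho>) x) * h x z"
      unfolding d[OF \<phi>n] d[OF \<phi>] by (intro AE_I2 tendsto_intros lim')
    show "AE x in dens \<rho>. norm (torus_deriv (\<phi>n n \<circ> F) (phi dt h (dens \<rho>) x) * h x z) \<le> q * fh * b" for n
      using bd[OF \<phi>n] by (intro AE_I2) (simp only: real_norm_def)
  qed (rule m[OF \<phi>] m[OF \<phi>n] integrable_const)+
  then show ?thesis unfolding back_step_def by (intro tendsto_intros lim)
qed

text \<open>The weak equation is only given for smooth test functions; both sides are continuous along
  approximations that are bounded in \<open>C\<^sup>1\<^sup>,\<^sup>1\<close>.\<close>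

lemma fluctuation_equation_C11:
  assumes eq: "fluctuation_equation dt h F \<rho> u u'" and \<phi>: "C11 q \<phi> \<phi>'"
  shows "dual_pair \<phi> u' = dual_pair (back_step dt h F \<rho> \<phi>) u"
proof -
  obtain \<phi>n \<phi>n' where n: "\<And>n. smooth_torus (\<phi>n n)" "\<And>n. C11 q (\<phi>n n) (\<phi>n' n)"
    "\<And>x. (\<lambda>n. \<phi>n n x) \<longlonglongrightarrow> \<phi> x" "\<And>x. (\<lambda>n. \<phi>n' n x) \<longlonglongrightarrow> \<phi>' x"
    using smooth_approximation[OF \<phi>] by metis
  have "dual_pair (\<phi>n n) u' = dual_pair (back_step dt h F \<rho> (\<phi>n n)) u" for n
    using eq n(1)[of n] unfolding fluctuation_equation_def back_step_dual_pair[OF n(2)] by blast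
  then have l: "(\<lambda>n. dual_pair (back_step dt h F \<rho> (\<phi>n n)) u) \<longlonglongrightarrow> dual_pair \<phi> u'"
    using dual_pair_tendsto[OF n(2) \<phi> n(3) u'] by simp
  have "\<exists>\<psi>n'. \<forall>n. C11 (A * q) (back_step dt h F \<rho> (\<phi>n n)) (\<psi>n' n)"
    using C11_back_step[OF n(2) M] by (intro choice) blast
  then obtain \<psi>n' where \<psi>n: "\<And>n. C11 (A * q) (back_step dt h F \<rho> (\<phi>n n)) (\<psi>n' n)" by blast
  obtain \<psi>' where \<psi>: "C11 (A * q) (back_step dt h F \<rho> \<phi>) \<psi>'" using C11_back_step[OF \<phi> M] by blast
  show ?thesis by (rule LIMSEQ_unique[OF l dual_pair_tendsto[OF \<psi>n \<psi> back_step_tendsto[OF n(2) \<phi> n(3,4)] u]])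
qed

end

lemma dual_pair_pull_back:
  assumes "\<And>s. s < t \<Longrightarrow> prob_space (dens (\<rho> s))" "\<And>s. s \<le> t \<Longrightarrow> v s \<in> Sobolev (- 1)"
    and "\<And>s. s < t \<Longrightarrow> fluctuation_equation dt h F (\<rho> s) (v s) (v (Suc s))" and "C11 q \<phi> \<phi>'"
  shows "dual_pair \<phi> (v t) = dual_pair (pull_back dt h F \<rho> t \<phi>) (v 0)"
  using assms
proof (induct t arbitrary: q \<phi> \<phi>')
  case (Suc t)
  obtain \<psi>' where \<psi>: "C11 (A * q) (back_step dt h F (\<rho> t) \<phi>) \<psi>'" using C11_back_step[OF Suc.prems(4)] Suc.prems(1) by blast
  have "dual_pair \<phi> (v (Suc t)) = dual_pair (back_step dt h F (\<rho> t) \<phi>) (v t)"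
    by (rule fluctuation_equation_C11[OF _ _ _ _ Suc.prems(4)]) (use Suc.prems in auto)
  also have "... = dual_pair (pull_back dt h F \<rho> t (back_step dt h F (\<rho> t) \<phi>)) (v 0)"
    by (rule Suc.hyps[OF _ _ _ \<psi>]) (use Suc.prems in auto)
  finally show ?case by simp
qed simp

end

section \<open>Measurability and law of the pairings with the random field\<close>

lemma Sobolev_coordinate_le:
  assumes u: "u \<in> Sobolev (- 1)" and v: "v \<in> Sobolev (- 1)" and e: "e = cosT k \<or> e = sinT k"
  shows "\<bar>v e - u e\<bar> \<le> sqrt (1 + (real_of_int k)^2) * Sobolev_norm (- 1) (\<lambda>f. v f - u f)"
proof -
  define s where "s w k = ((w (cosT k))^2 + (w (sinT k))^2) / (1 + (real_of_int k)^2)" for w :: "(torus \<Rightarrow> real) \<Rightarrow> real" and k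
  let ?w = "\<lambda>f. v f - u f"
  have pos: "0 < 1 + (real_of_int k)^2" for k by (simp add: add_pos_nonneg)
  have s0: "0 \<le> s w k" for w k by (simp add: s_def)
  have sm: "s w summable_on UNIV" if "w \<in> Sobolev (- 1)" for w
    using that unfolding Sobolev_def mem_Collect_eq Sobolev_summand s_def[symmetric] by (elim conjE)
  have sq: "(x - y)^2 \<le> 2 * x^2 + 2 * y^2" for x y :: real
    using zero_le_power2[of "x + y"] by (simp add: power2_sum power2_diff)
  have n: "Sobolev_norm (- 1) w = sqrt (infsum (s w) UNIV)" for w
    unfolding Sobolev_norm_def Sobolev_summand s_def ..
  \<comment> \<open>This has to precede any estimate by the norm, because \<open>infsum\<close> of a
    family that is not summable is 0.\<close>
  have "s ?w summable_on UNIV"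
  proof (rule summable_on_comparison_test[of "\<lambda>k. 2 * s v k + 2 * s u k"])
    show "(\<lambda>k. 2 * s v k + 2 * s u k) summable_on UNIV" by (intro summable_on_add summable_on_cmult_right sm u v)
    fix k
    have "s ?w k \<le> ((2 * (v (cosT k))^2 + 2 * (u (cosT k))^2) + (2 * (v (sinT k))^2 + 2 * (u (sinT k))^2)) / (1 + (real_of_int k)^2)"
      unfolding s_def using pos[of k] by (intro divide_right_mono add_mono sq) auto
    also have "... = 2 * s v k + 2 * s u k" by (simp add: s_def add_divide_distrib)
    finally show "s ?w k \<le> 2 * s v k + 2 * s u k" .
  qed (rule s0)
  then have "sum (s ?w) {k} \<le> infsum (s ?w) UNIV" by (rule finite_sum_le_infsum) (auto simp: s0)
  then have "s ?w k \<le> (Sobolev_norm (- 1) ?w)^2" unfolding n using s0[of ?w k] by simp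
  moreover have "(v e - u e)^2 \<le> (1 + (real_of_int k)^2) * s ?w k" using e pos[of k] by (auto simp: s_def)
  ultimately have "(v e - u e)^2 \<le> (1 + (real_of_int k)^2) * (Sobolev_norm (- 1) ?w)^2"
    using mult_left_mono[of "s ?w k" "(Sobolev_norm (- 1) ?w)^2" "1 + (real_of_int k)^2"] pos[of k] by linarith
  then have "sqrt ((v e - u e)^2) \<le> sqrt ((1 + (real_of_int k)^2) * (Sobolev_norm (- 1) ?w)^2)" by (rule real_sqrt_le_mono)
  moreover have "0 \<le> Sobolev_norm (- 1) ?w" unfolding n by (simp add: infsum_nonneg s0)
  ultimately show ?thesis by (simp add: real_sqrt_mult)
qed

text \<open>Evaluation at a trigonometric function is continuous in the Sobolev norm, so its
  sublevel sets are open, and preimages of open sets are measurable by definition of a random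
  element.\<close>

lemma Sobolev_random_element_coordinate:
  assumes X: "Sobolev_random_element (- 1) Q X" and e: "e = cosT k \<or> e = sinT k"
  shows "(\<lambda>w. X w e) \<in> borel_measurable Q"
  unfolding borel_measurable_iff_less
proof
  fix a
  let ?U = "{u \<in> Sobolev (- 1). u e < a}"
  have "Sobolev_open (- 1) ?U" unfolding Sobolev_open_def
  proof (intro conjI ballI)
    fix u assume u: "u \<in> ?U"
    have pos: "0 < sqrt (1 + (real_of_int k)^2)" by (simp add: add_pos_nonneg)
    show "\<exists>r>0. \<forall>v\<in>Sobolev (- 1). Sobolev_norm (- 1) (\<lambda>f. v f - u f) < r \<longrightarrow> v \<in> ?U"
    proof (intro exI[of _ "(a - u e) / sqrt (1 + (real_of_int k)^2)"] conjI ballI impI)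
      show "0 < (a - u e) / sqrt (1 + (real_of_int k)^2)" using u pos by simp
      fix v assume v: "v \<in> Sobolev (- 1)" "Sobolev_norm (- 1) (\<lambda>f. v f - u f) < (a - u e) / sqrt (1 + (real_of_int k)^2)"
      then have "sqrt (1 + (real_of_int k)^2) * Sobolev_norm (- 1) (\<lambda>f. v f - u f) < a - u e"
        using pos by (simp add: pos_less_divide_eq mult.commute)
      then show "v \<in> ?U" using Sobolev_coordinate_le[OF _ v(1) e, of u] u v(1) by (auto simp: abs_le_iff)
    qed
  qed auto
  then have "X -` ?U \<inter> space Q \<in> sets Q" using X unfolding Sobolev_random_element_def by blast
  moreover have "X -` ?U \<inter> space Q = {w \<in> space Q. X w e < a}" using X by (auto simp: Sobolev_random_element_def)
  ultimately show "{w \<in> space Q. X w e < a} \<in> sets Q" by simp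
qed

lemma dual_pair_measurable:
  assumes X: "Sobolev_random_element (- 1) Q X" and f: "C11 q f f'"
  shows "(\<lambda>w. dual_pair f (X w)) \<in> borel_measurable Q"
proof -
  interpret sigma_finite_measure CS by (rule sigma_finite_measure_count_space)
  have "(\<lambda>w. pair_term f (X w) k) \<in> borel_measurable Q" for k
    unfolding pair_term_def using Sobolev_random_element_coordinate[OF X, of "cosT k" k] Sobolev_random_element_coordinate[OF X, of "sinT k" k] by simp
  then have "(\<lambda>p. pair_term f (X (snd p)) (fst p)) \<in> borel_measurable (CS \<Otimes>\<^sub>M Q)"
    by (intro measurable_pair_measure_countable1) auto
  then have "(\<lambda>(w, k). pair_term f (X w) k) \<in> borel_measurable (Q \<Otimes>\<^sub>M CS)"
    by (subst measurable_pair_swap_iff) (simp add: split_beta')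
  then have "(\<lambda>w. LINT k|CS. pair_term f (X w) k) \<in> borel_measurable Q" by (rule borel_measurable_lebesgue_integral)
  moreover have "dual_pair f (X w) = (LINT k|CS. pair_term f (X w) k)" if "w \<in> space Q" for w
    using X that by (intro dual_pair_eq[OF f]) (simp add: Sobolev_random_element_def)
  ultimately show ?thesis by (simp cong: measurable_cong)
qed

lemma char_centered_normal: "0 \<le> a \<Longrightarrow> char (centered_normal a) s = of_real (exp (- (a * s^2) / 2))"
proof -
  assume a: "0 \<le> a"
  have "char (centered_normal a) s = (LINT x|std_normal_distribution. iexp (s * (sqrt a * x)))"
    unfolding char_def centered_normal_std[OF a] by (subst integral_distr) simp_all
  also have "... = char std_normal_distribution (s * sqrt a)" unfolding char_def by (simp add: mult.assoc)
  finally show ?thesis using a by (simp add: char_std_normal_distribution power_mult_distrib mult.commute)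
qed

lemma real_distribution_centered_normal: "0 \<le> a \<Longrightarrow> real_distribution (centered_normal a)"
proof -
  assume a: "0 \<le> a"
  interpret real_distribution std_normal_distribution by (rule real_dist_normal_dist)
  show ?thesis unfolding centered_normal_std[OF a] by (rule real_distribution_distr) simp
qed

definition field_variance :: "(torus \<Rightarrow> real) \<Rightarrow> (torus \<Rightarrow> real) \<Rightarrow> real"
  where "field_variance \<rho> f = (LINT x|dens \<rho>. (f x)^2) - (LINT x|dens \<rho>. f x)^2"

lemma field_variance_nonneg:
  assumes M: "prob_space (dens \<rho>)" and f: "C11 q f f'"
  shows "0 \<le> field_variance \<rho> f"
proof -
  interpret prob_space "dens \<rho>" by (rule M)
  note [measurable] = C11_measurable(1)[OF f]
  have i: "integrable (dens \<rho>) f" by (rule average_bound(2)[OF M _ C11D(1)[OF f]]) measurable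
  have i2: "integrable (dens \<rho>) (\<lambda>x. (f x)^2)"
    unfolding power2_eq_square by (rule average_bound(2)[OF M _ abs_le_mult[OF C11D(1)[OF f] C11D(1)[OF f]]]) measurable
  have "variance f = field_variance \<rho> f" unfolding field_variance_def by (rule variance_eq[OF i i2])
  then show ?thesis using variance_positive[of f] by simp
qed

text \<open>Along a smooth approximation the pairings converge pointwise and the variances converge,
  so the characteristic functions agree in the limit; Levy's uniqueness theorem identifies the
  law.\<close>

lemma gaussian_field_C11:
  assumes M: "prob_space (dens \<rho>)" and Q: "prob_space Q" and X: "Sobolev_random_element (- 1) Q X"
    and G: "gaussian_field \<rho> Q X" and f: "C11 q f f'"
  shows "distr Q borel (\<lambda>z. dual_pair f (X z)) = centered_normal (field_variance \<rho> f)"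
proof (rule Levy_uniqueness)
  interpret Q: prob_space Q by (rule Q)
  interpret M: prob_space "dens \<rho>" by (rule M)
  obtain fn fn' where n: "\<And>n. smooth_torus (fn n)" "\<And>n. C11 q (fn n) (fn' n)" "\<And>x. (\<lambda>n. fn n x) \<longlonglongrightarrow> f x"
    using smooth_approximation[OF f] by metis
  note [measurable] = dual_pair_measurable[OF X f] dual_pair_measurable[OF X n(2)] C11_measurable(1)[OF f] C11_measurable(1)[OF n(2)]
  show "real_distribution (distr Q borel (\<lambda>z. dual_pair f (X z)))" by (rule Q.real_distribution_distr) measurable
  show "real_distribution (centered_normal (field_variance \<rho> f))"
    by (rule real_distribution_centered_normal[OF field_variance_nonneg[OF M f]])
  show "char (distr Q borel (\<lambda>z. dual_pair f (X z))) = char (centered_normal (field_variance \<rho> f))"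
  proof
    fix s
    have ch: "char (distr Q borel (\<lambda>z. dual_pair g (X z))) s = (LINT z|Q. iexp (s * dual_pair g (X z)))"
      if "C11 q g g'" for g g'
      unfolding char_def using dual_pair_measurable[OF X that] by (subst integral_distr) simp_all
    have "(\<lambda>n. LINT z|Q. iexp (s * dual_pair (fn n) (X z))) \<longlonglongrightarrow> (LINT z|Q. iexp (s * dual_pair f (X z)))"
    proof (rule integral_dominated_convergence[where w = "\<lambda>_. 1"])
      have "(\<lambda>n. dual_pair (fn n) (X z)) \<longlonglongrightarrow> dual_pair f (X z)" if "z \<in> space Q" for z
        using X that by (intro dual_pair_tendsto[OF n(2) f n(3)]) (simp add: Sobolev_random_element_def)
      then show "AE z in Q. (\<lambda>n. iexp (s * dual_pair (fn n) (X z))) \<longlonglongrightarrow> iexp (s * dual_pair f (X z))"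
        by (intro AE_I2 tendsto_intros)
      have mi: "(\<lambda>z. iexp (s * L z)) \<in> borel_measurable Q" if [measurable]: "L \<in> borel_measurable Q" for L
        by measurable
      show "(\<lambda>z. iexp (s * dual_pair f (X z))) \<in> borel_measurable Q" "(\<lambda>z. iexp (s * dual_pair (fn n) (X z))) \<in> borel_measurable Q" for n
        by (intro mi dual_pair_measurable[OF X f] dual_pair_measurable[OF X n(2)])+
    qed auto
    then have l: "(\<lambda>n. char (distr Q borel (\<lambda>z. dual_pair (fn n) (X z))) s) \<longlonglongrightarrow> char (distr Q borel (\<lambda>z. dual_pair f (X z))) s"
      unfolding ch[OF n(2)] ch[OF f] .
    have "distr Q borel (\<lambda>z. dual_pair (fn n) (X z)) = centered_normal (field_variance \<rho> (fn n))" for n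
      using G n(1) unfolding gaussian_field_def field_variance_def by blast
    then have e: "char (distr Q borel (\<lambda>z. dual_pair (fn n) (X z))) s = of_real (exp (- (field_variance \<rho> (fn n) * s^2) / 2))" for n
      using char_centered_normal[OF field_variance_nonneg[OF M n(2)]] by simp
    have "(\<lambda>n. LINT x|dens \<rho>. fn n x) \<longlonglongrightarrow> (LINT x|dens \<rho>. f x)"
      by (rule integral_dominated_convergence[where w = "\<lambda>_. q"]) (use n(3) C11D(1)[OF n(2)] in auto)
    moreover have "(\<lambda>n. LINT x|dens \<rho>. (fn n x)^2) \<longlonglongrightarrow> (LINT x|dens \<rho>. (f x)^2)"
    proof (rule integral_dominated_convergence[where w = "\<lambda>_. q * q"])
      show "AE x in dens \<rho>. (\<lambda>n. (fn n x)^2) \<longlonglongrightarrow> (f x)\<^sup>2" by (intro AE_I2 tendsto_intros n(3))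
      show "AE x in dens \<rho>. norm ((fn n x)^2) \<le> q * q" for n
        unfolding power2_eq_square real_norm_def by (intro AE_I2 abs_le_mult C11D(1)[OF n(2)])
      show "(\<lambda>x. (f x)^2) \<in> borel_measurable (dens \<rho>)" "(\<lambda>x. (fn n x)^2) \<in> borel_measurable (dens \<rho>)" for n by measurable
    qed simp
    ultimately have "(\<lambda>n. field_variance \<rho> (fn n)) \<longlonglongrightarrow> field_variance \<rho> f"
      unfolding field_variance_def by (intro tendsto_intros)
    then have "(\<lambda>n. of_real (exp (- (field_variance \<rho> (fn n) * s^2) / 2)) :: complex) \<longlonglongrightarrow> of_real (exp (- (field_variance \<rho> f * s^2) / 2))"
      by (intro tendsto_intros) auto
    with l have "char (distr Q borel (\<lambda>z. dual_pair f (X z))) s = of_real (exp (- (field_variance \<rho> f * s^2) / 2))"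
      unfolding e by (rule LIMSEQ_unique)
    then show "char (distr Q borel (\<lambda>z. dual_pair f (X z))) s = char (centered_normal (field_variance \<rho> f)) s"
      by (simp only: char_centered_normal[OF field_variance_nonneg[OF M f]])
  qed
qed

lemma dual_pair_sum:
  fixes m :: nat
  assumes "\<And>i. i < m \<Longrightarrow> C11 q (f i) (f' i)"
  shows "\<exists>r s'. C11 r (\<lambda>x. \<Sum>i<m. a i * f i x) s' \<and>
    (\<forall>u\<in>Sobolev (- 1). dual_pair (\<lambda>x. \<Sum>i<m. a i * f i x) u = (\<Sum>i<m. a i * dual_pair (f i) u))" using assms
proof (induct m)
  case 0
  have z: "C11 0 (\<lambda>_. 0) (\<lambda>_. 0)" by (simp add: C11_def lip_def qd_def)
  moreover have "dual_pair (\<lambda>_. 0) u = 0" if "u \<in> Sobolev (- 1)" for u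
    using that by (simp add: dual_pair_eq[OF z] pair_term_def fourier_cos_def fourier_sin_def)
  ultimately show ?case by auto
next
  case (Suc m)
  then obtain r s' where rs: "C11 r (\<lambda>x. \<Sum>i<m. a i * f i x) s'"
    "\<And>u. u \<in> Sobolev (- 1) \<Longrightarrow> dual_pair (\<lambda>x. \<Sum>i<m. a i * f i x) u = (\<Sum>i<m. a i * dual_pair (f i) u)" by auto
  have fm: "C11 q (f m) (f' m)" using Suc.prems by simp
  note l = C11_lin[OF rs(1) fm, of "a m"]
  have "dual_pair (\<lambda>x. \<Sum>i<Suc m. a i * f i x) u = (\<Sum>i<Suc m. a i * dual_pair (f i) u)" if "u \<in> Sobolev (- 1)" for u
    using dual_pair_linear[OF rs(1) fm l that] rs(2)[OF that] by simp
  then show ?case using l by auto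
qed

section \<open>Independent initial data\<close>

text \<open>An explicit upper bound for the Kantorovich distance in terms of the frequencies of the
  tail arcs. As a finite sum it is measurable and its moments can be computed.\<close>

definition initial_gap :: "(torus \<Rightarrow> real) \<Rightarrow> nat \<Rightarrow> (nat \<Rightarrow> torus) \<Rightarrow> real"
  where "initial_gap \<rho> N x = (2 + (\<Sum>k<N. \<bar>measure (empirical N x) (upper N k) - measure (dens \<rho>) (upper N k)\<bar>)) / real N"

context
  fixes \<rho> :: "torus \<Rightarrow> real" and N :: nat
  assumes M: "prob_space (dens \<rho>)" and N: "0 < N"
begin

lemma initial_gap_dual_lip: "dual_lip (initial_gap \<rho> N x) (empirical N x) (dens \<rho>)"
  unfolding dual_lip_def
proof (intro allI impI)
  fix L g assume g: "lip L g"
  let ?D = "\<lambda>k. measure (empirical N x) (upper N k) - measure (dens \<rho>) (upper N k)"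
  have "\<bar>\<Sum>k<N. jump N g k * ?D k\<bar> \<le> (\<Sum>k<N. L / real N * \<bar>?D k\<bar>)"
    by (intro order_trans[OF sum_abs] sum_mono) (unfold abs_mult, intro mult_right_mono jump_le[OF g N], simp)
  then have "\<bar>\<Sum>k<N. jump N g k * ?D k\<bar> \<le> L / real N * (\<Sum>k<N. \<bar>?D k\<bar>)" by (simp add: sum_distrib_left)
  moreover have "\<bar>(LINT x|empirical N x. g x) - (LINT x|dens \<rho>. g x) - (\<Sum>k<N. jump N g k * ?D k)\<bar> \<le> 2 * L / real N"
    by (rule discretise[OF g N empirical_prob[OF N] sets_empirical M sets_dens])
  ultimately have "\<bar>(LINT x|empirical N x. g x) - (LINT x|dens \<rho>. g x)\<bar> \<le> 2 * L / real N + L / real N * (\<Sum>k<N. \<bar>?D k\<bar>)" by linarith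
  also have "... = L * initial_gap \<rho> N x" by (simp add: initial_gap_def add_divide_distrib distrib_left)
  finally show "\<bar>(LINT x|empirical N x. g x) - (LINT x|dens \<rho>. g x)\<bar> \<le> L * initial_gap \<rho> N x" .
qed

abbreviation "product_law \<equiv> iid N (dens \<rho>)"

lemma gap_measurable [measurable]: "(\<lambda>x. measure (empirical N x) (upper N k)) \<in> borel_measurable product_law"
proof -
  have "(\<lambda>x. indicat_real (upper N k) (x i)) \<in> borel_measurable product_law" if "i \<in> {..<N}" for i
  proof -
    have "(\<lambda>x. x i) \<in> measurable product_law (dens \<rho>)" using that by (rule measurable_component_singleton)
    then show ?thesis by (rule measurable_compose) (simp add: borel_measurable_indicator_iff)
  qed
  then show ?thesis unfolding measure_empirical[OF N upper_sets] by (intro borel_measurable_divide borel_measurable_sum) auto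
qed

lemma initial_gap_measurable: "initial_gap \<rho> N \<in> borel_measurable product_law"
  unfolding initial_gap_def[abs_def] by measurable

text \<open>The second moment is read off from the exponential moment through
  \<open>x \<le> exp x\<close>, with \<open>B = 1\<close> and the largest admissible
  \<open>l = 1 / 4\<close>.\<close>

lemma empirical_deviation_moment:
  "(\<integral>\<^sup>+x. ennreal ((measure (empirical N x) (upper N k) - measure (dens \<rho>) (upper N k))^2) \<partial>product_law) \<le> ennreal (8 / real N)"
proof -
  interpret prob_space "dens \<rho>" by (rule M)
  let ?g = "indicat_real (upper N k)"
  let ?D = "\<lambda>x. measure (empirical N x) (upper N k) - measure (dens \<rho>) (upper N k)"
  let ?e = "\<lambda>x. exp (1/4 * (\<Sum>i<N. ?g (x i) - (LINT y|dens \<rho>. ?g y))^2 / real N)"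
  have gm: "?g \<in> borel_measurable (dens \<rho>)" by (simp add: borel_measurable_indicator_iff)
  have em: "(\<integral>\<^sup>+x. ennreal (?e x) \<partial>product_law) \<le> 2"
    by (rule square_sum_exp_moment[OF M gm _ _ _ N, of 1]) (auto simp: indicator_def)
  have "(\<Sum>i<N. ?g (x i) - (LINT y|dens \<rho>. ?g y)) = real N * ?D x" for x
    using N by (simp add: sum_subtractf measure_empirical[OF N upper_sets] right_diff_distrib)
  then have e: "?e x = exp (real N / 4 * (?D x)^2)" for x using N by (simp add: power_mult_distrib power2_eq_square)
  have D: "(?D x)^2 \<le> 4 / real N * ?e x" for x
  proof -
    have "real N / 4 * (?D x)^2 \<le> ?e x" unfolding e using exp_ge_add_one_self[of "real N / 4 * (?D x)^2"] by linarith
    then show ?thesis using N by (simp add: field_simps)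
  qed
  have "(\<integral>\<^sup>+x. ennreal ((?D x)^2) \<partial>product_law) \<le> (\<integral>\<^sup>+x. ennreal (4 / real N) * ennreal (?e x) \<partial>product_law)"
    by (intro nn_integral_mono) (simp only: ennreal_mult''[symmetric] exp_ge_zero, intro ennreal_leI D)
  also have "... = ennreal (4 / real N) * (\<integral>\<^sup>+x. ennreal (?e x) \<partial>product_law)"
    unfolding e by (rule nn_integral_cmult) measurable
  also have "... \<le> ennreal (4 / real N) * ennreal 2" using em by (intro mult_left_mono) auto
  also have "... = ennreal (8 / real N)" by (subst ennreal_mult[symmetric]) auto
  finally show ?thesis .
qed

text \<open>Cauchy-Schwarz for the \<open>N\<close> deviations and
  \<open>(2 + S)^2 \<le> 8 + 2 * S^2\<close>. The deviations contribute \<open>16 / N\<close>, the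
  constant part at most \<open>8 / N\<close>.\<close>

lemma initial_gap_moment:
  "integrable product_law (\<lambda>x. (initial_gap \<rho> N x)^2)" "(LINT x|product_law. (initial_gap \<rho> N x)^2) \<le> 24 / real N"
proof -
  interpret P: prob_space product_law by (intro prob_space_PiM M)
  let ?D = "\<lambda>k x. measure (empirical N x) (upper N k) - measure (dens \<rho>) (upper N k)"
  have N0: "0 < real N" "1 \<le> real N" using N by auto
  have es: "ennreal (a + (\<Sum>k<N. c * d k)) = ennreal a + (\<Sum>k<N. ennreal c * ennreal (d k))"
    if "0 \<le> a" "0 \<le> c" "\<And>k. 0 \<le> d k" for a c and d :: "nat \<Rightarrow> real"
  proof -
    have "(\<Sum>k<N. ennreal c * ennreal (d k)) = (\<Sum>k<N. ennreal (c * d k))"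
      using that by (intro sum.cong refl) (simp add: ennreal_mult)
    also have "... = ennreal (\<Sum>k<N. c * d k)" by (rule sum_ennreal) (use that in simp)
    finally show ?thesis using that by (simp only:) (rule ennreal_plus, simp_all add: sum_nonneg)
  qed
  have pt: "(initial_gap \<rho> N x)^2 \<le> 8 / (real N)^2 + (\<Sum>k<N. 2 / real N * (?D k x)^2)" for x
  proof -
    define S where "S = (\<Sum>k<N. \<bar>?D k x\<bar>)"
    have "S^2 \<le> real N * (\<Sum>k<N. (?D k x)^2)"
      using sum_squared_le_sum_of_squares[of "\<lambda>k. \<bar>?D k x\<bar>" "{..<N}"] by (simp add: S_def mult.commute)
    moreover have "(2 + S)^2 \<le> 8 + 2 * S^2" using zero_le_power2[of "S - 2"] by (simp add: power2_sum power2_diff)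
    ultimately have "(2 + S)^2 \<le> 8 + 2 * (real N * (\<Sum>k<N. (?D k x)^2))" by linarith
    then have "(2 + S)^2 / (real N)^2 \<le> (8 + 2 * (real N * (\<Sum>k<N. (?D k x)^2))) / (real N)^2" by (rule divide_right_mono) simp
    also have "... = 8 / (real N)^2 + 2 / real N * (\<Sum>k<N. (?D k x)^2)"
      using N0 by (simp add: add_divide_distrib power2_eq_square)
    finally show ?thesis unfolding initial_gap_def S_def by (simp add: power_divide sum_distrib_left)
  qed
  have "(\<integral>\<^sup>+x. ennreal ((initial_gap \<rho> N x)^2) \<partial>product_law) \<le>
      (\<integral>\<^sup>+x. ennreal (8 / (real N)^2) + (\<Sum>k<N. ennreal (2 / real N) * ennreal ((?D k x)^2)) \<partial>product_law)"
  proof (rule nn_integral_mono)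
    fix x
    have "ennreal ((initial_gap \<rho> N x)^2) \<le> ennreal (8 / (real N)^2 + (\<Sum>k<N. 2 / real N * (?D k x)^2))"
      by (rule ennreal_leI[OF pt])
    also have "... = ennreal (8 / (real N)^2) + (\<Sum>k<N. ennreal (2 / real N) * ennreal ((?D k x)^2))"
      by (rule es) (use N0 in auto)
    finally show "ennreal ((initial_gap \<rho> N x)^2) \<le> ennreal (8 / (real N)^2) + (\<Sum>k<N. ennreal (2 / real N) * ennreal ((?D k x)^2))" .
  qed
  also have "... = ennreal (8 / (real N)^2) + (\<Sum>k<N. ennreal (2 / real N) * (\<integral>\<^sup>+x. ennreal ((?D k x)^2) \<partial>product_law))"
    by (subst nn_integral_add, measurable) (simp add: nn_integral_sum nn_integral_cmult P.emeasure_space_1)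
  also have "... \<le> ennreal (8 / (real N)^2) + (\<Sum>k<N. ennreal (2 / real N) * ennreal (8 / real N))"
    by (intro add_left_mono sum_mono mult_left_mono empirical_deviation_moment) simp
  also have "... = ennreal (8 / (real N)^2 + (\<Sum>k<N. 2 / real N * (8 / real N)))"
    by (rule es[symmetric]) (use N0 in auto)
  also have "... \<le> ennreal (24 / real N)"
  proof (rule ennreal_leI)
    have "8 / (real N)^2 \<le> 8 / real N" using N0 by (simp add: power2_eq_square divide_simps)
    then show "8 / (real N)^2 + (\<Sum>k<N. 2 / real N * (8 / real N)) \<le> 24 / real N" using N0 by simp
  qed
  finally have nn: "(\<integral>\<^sup>+x. ennreal ((initial_gap \<rho> N x)^2) \<partial>product_law) \<le> ennreal (24 / real N)" .
  show "integrable product_law (\<lambda>x. (initial_gap \<rho> N x)^2)"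
    by (rule integrableI_nonneg) (use initial_gap_measurable nn in \<open>auto simp: order_le_less_trans[OF nn]\<close>)
  show "(LINT x|product_law. (initial_gap \<rho> N x)^2) \<le> 24 / real N" by (rule integral_real_bounded[OF _ nn]) simp
qed

text \<open>Transfers expectations from the infinite independent sequence to the product space of
  \<open>N\<close> particles; the condition on \<open>g\<close> says that only the first
  \<open>N\<close> entries matter.\<close>

lemma independent_product_law:
  fixes P :: "'a measure" and X :: "nat \<Rightarrow> 'a \<Rightarrow> torus"
  assumes P: "prob_space P" and X: "prob_space.indep_vars P (\<lambda>_. borel) X UNIV" and law: "\<And>i. distr P borel (X i) = dens \<rho>"
    and g: "g \<in> borel_measurable product_law" and dep: "\<And>x. g (restrict x {..<N}) = (g x :: real)"
  shows "(LINT w|P. g (\<lambda>j. X j w)) = (LINT x|product_law. g x)"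
proof -
  interpret P: prob_space P by (rule P)
  have Xm: "X i \<in> measurable P borel" for i using X unfolding P.indep_vars_def by auto
  have "P.indep_vars (\<lambda>_. borel) X {..<N}" by (rule P.indep_vars_subset[OF X]) simp
  then have e: "distr P (iid N borel) (\<lambda>w. \<lambda>i\<in>{..<N}. X i w) = product_law"
    using N Xm by (subst (asm) P.indep_vars_iff_distr_eq_PiM) (auto simp: law)
  have r: "(\<lambda>w. \<lambda>i\<in>{..<N}. X i w) \<in> measurable P (iid N borel)" by (intro measurable_restrict Xm)
  have gm: "g \<in> borel_measurable (iid N borel)" using g e by (metis measurable_distr_eq1)
  have "(LINT w|P. g (\<lambda>j. X j w)) = (LINT w|P. g (\<lambda>i\<in>{..<N}. X i w))" using dep by (intro bochner_cong refl) metis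
  also have "... = (LINT x|distr P (iid N borel) (\<lambda>w. \<lambda>i\<in>{..<N}. X i w). g x)"
    by (rule integral_distr[OF r gm, symmetric])
  finally show ?thesis unfolding e .
qed

end

lemma particles_restrict: "k < N \<Longrightarrow> particles dt h F N (restrict x {..<N}) t k = particles dt h F N x t k"
proof (cases t)
  case (Suc s)
  have "particle_step dt h F N (restrict x {..<N}) = particle_step dt h F N x"
    unfolding particle_step_def by (intro restrict_ext) simp
  then show ?thesis by (simp add: Suc particles_def funpow_swap1)
qed (simp add: particles_def)

lemma fluctuation_sum:
  assumes "0 < N" "g \<in> borel_measurable borel"
  shows "fluctuation N x \<rho> g = (\<Sum>k<N. g (x k) - (LINT y|dens \<rho>. g y)) / sqrt (real N)"
proof -
  define s where "s = sqrt (real N)"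
  have s: "0 < s" "real N = s * s" using assms(1) by (simp_all add: s_def)
  have "s * (a / (s * s) - c) = (a - s * s * c) / s" for a c using s(1) by (simp add: field_simps)
  then show ?thesis unfolding fluctuation_def integral_empirical[OF assms] s_def[symmetric]
    by (simp add: sum_subtractf s(2))
qed

section \<open>The fluctuation theorem\<close>

lemma Cb_euclid_bound:
  assumes \<Psi>: "Cb_euclid m k \<Psi>" and js: "set js \<subseteq> {..<m}" "length js \<le> k"
  shows "\<bar>partial_derivs js \<Psi> x\<bar> \<le> Ck_norm_euclid m k \<Psi>"
proof -
  define I where "I = {js. set js \<subseteq> {..<m} \<and> length js \<le> k}"
  have "finite I" unfolding I_def by (rule finite_lists_length_le) simp
  then have "bounded (\<Union>js\<in>I. range (partial_derivs js \<Psi>))"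
    using \<Psi> unfolding Cb_euclid_def I_def by (intro bounded_UN) auto
  then obtain c where c: "\<And>y. y \<in> (\<Union>js\<in>I. range (partial_derivs js \<Psi>)) \<Longrightarrow> \<bar>y\<bar> \<le> c" unfolding bounded_iff by auto
  have "bdd_above {\<bar>partial_derivs js \<Psi> x\<bar> | js x. set js \<subseteq> {..<m} \<and> length js \<le> k}"
    by (rule bdd_aboveI[of _ c]) (use c in \<open>auto simp: I_def\<close>)
  then show ?thesis unfolding Ck_norm_euclid_def by (intro cSup_upper) (use js in auto)
qed

context interaction
begin

text \<open>The first term of the bound is the linearisation error, the second the normal
  approximation at time 0 for the pulled back functions, whose C^{1,1} constant is
  \<open>A ^ t * q\<close>.\<close>

lemma fluctuation_bound:
  fixes P :: "'a measure" and X :: "nat \<Rightarrow> 'a \<Rightarrow> torus" and Q :: "'b measure"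
    and \<eta> :: "nat \<Rightarrow> 'b \<Rightarrow> (torus \<Rightarrow> real) \<Rightarrow> real"
  assumes \<nu>: "\<And>s. s \<le> T \<Longrightarrow> prob_space (dens (\<rho> s))"
    and \<nu>_step: "\<And>s. s < T \<Longrightarrow> dens (\<rho> (Suc s)) = distr (dens (\<rho> s)) borel (F_mu dt h F (dens (\<rho> s)))"
    and P: "prob_space P" and X: "prob_space.indep_vars P (\<lambda>_. borel) X UNIV" and law: "\<And>i. distr P borel (X i) = dens (\<rho> 0)"
    and Q: "prob_space Q" and G: "gaussian_field (\<rho> 0) Q (\<eta> 0)" and \<eta>: "fluctuation_solution dt h F T \<rho> Q \<eta>"
    and \<phi>: "\<And>i. i < m \<Longrightarrow> C11 q (\<phi> i) (\<phi>' i)" and q: "0 < q"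
    and \<Psi>: "Cb_euclid m 3 \<Psi>" and N: "0 < N" and t: "t \<le> T"
  defines "B \<equiv> Ck_norm_euclid m 3 \<Psi>"
  shows "\<bar>(LINT z|P. \<Psi> (\<lambda>i. fluctuation N (particles dt h F N (\<lambda>j. X j z) t) (\<rho> t) (\<phi> i)))
      - (LINT z|Q. \<Psi> (\<lambda>i. dual_pair (\<phi> i) (\<eta> t z)))\<bar>
    \<le> (24 * B * real m * q * real t * A ^ (2 * t) + 40 * B * real m ^ 3 * (A ^ t * q) ^ 3) / sqrt (real N)"
proof -
  interpret Q: prob_space Q by (rule Q)
  let ?M = "dens (\<rho> 0)" and ?PM = "iid N (dens (\<rho> 0))" and ?x = "\<lambda>x t. particles dt h F N x t"
  have M: "prob_space ?M" using \<nu>[of 0] by simp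
  interpret PM: prob_space ?PM by (intro prob_space_PiM M)
  have \<Psi>C: "Ck_euclid m 3 \<Psi>" using \<Psi> by (simp add: Cb_euclid_def)
  have bd: "\<bar>partial_derivs js \<Psi> x\<bar> \<le> B" if "set js \<subseteq> {..<m}" "length js \<le> 3" for js x
    unfolding B_def by (rule Cb_euclid_bound[OF \<Psi> that])
  have B0: "0 \<le> B" using order_trans[OF abs_ge_zero bd[of "[]"]] by simp
  have dep: "\<Psi> x = \<Psi> y" if "\<And>i. i < m \<Longrightarrow> x i = y i" for x y using \<Psi>C that unfolding Ck_euclid_def by blast
  have \<Psi>m: "\<Psi> \<in> borel_measurable borel" by (rule borel_measurable_continuous_onI[OF Ck_euclid_continuous[OF \<Psi>C]])
  have \<Psi>lip: "\<bar>\<Psi> y - \<Psi> w\<bar> \<le> B * l1 m (\<lambda>i. y i - w i)" for y w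
  proof -
    have "\<bar>partial_derivs [] \<Psi> (trunc_add w m (\<lambda>i. y i - w i)) - partial_derivs [] \<Psi> w\<bar> \<le> B * l1 m (\<lambda>i. y i - w i)"
      by (rule increment_0[OF \<Psi>C]) (auto intro: bd)
    moreover have "\<Psi> (trunc_add w m (\<lambda>i. y i - w i)) = \<Psi> y" by (rule dep) (simp add: trunc_add_def)
    ultimately show ?thesis by simp
  qed
  define f where "f i = pull_back dt h F \<rho> t (\<phi> i)" for i
  have "\<exists>f'. \<forall>i<m. C11 (A ^ t * q) (f i) (f' i)"
    using C11_back[OF \<phi>, of _ t \<rho>] \<nu> t unfolding f_def by (intro choice) (metis order.trans less_imp_le)
  then obtain f' where f: "\<And>i. i < m \<Longrightarrow> C11 (A ^ t * q) (f i) (f' i)" by blast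
  have Xr: "Sobolev_random_element (- 1) Q (\<eta> s)" if "s \<le> T" for s
  proof -
    have "\<forall>\<alpha>>1/2. Sobolev_random_element (- \<alpha>) Q (\<eta> s)" using \<eta> that unfolding fluctuation_solution_def by blast
    from this[rule_format, of 1] show ?thesis by simp
  qed
  have S: "\<eta> s z \<in> Sobolev (- 1)" if "s \<le> T" "z \<in> space Q" for s z
    using Xr[OF that(1)] that(2) unfolding Sobolev_random_element_def by blast

  \<comment> \<open>Coordinates from \<open>m\<close> on are set to 0: no assumption is made on
    \<open>\<phi> i\<close> there, while measurability in the product space concerns every
    coordinate.\<close>
  let ?a = "\<lambda>x i. if i < m then fluctuation N (?x x t) (\<rho> t) (\<phi> i) else 0"
  let ?b = "\<lambda>x i. if i < m then fluctuation N x (\<rho> 0) (f i) else 0"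
  define Ft where "Ft x = \<Psi> (\<lambda>i. ?a x i)" for x
  define F0 where "F0 x = \<Psi> (\<lambda>i. ?b x i)" for x
  note f\<phi>m = C11_measurable(1)[OF \<phi>] C11_measurable(1)[OF f]
  have sets_PM: "sets ?PM = sets (torus_pow N)" by (intro sets_PiM_cong) auto
  have component: "(\<lambda>x. g (x k)) \<in> borel_measurable (torus_pow N)" if "g \<in> borel_measurable borel" "k \<in> {..<N}" for g :: "torus \<Rightarrow> real" and k
    by (rule measurable_compose[OF measurable_component_singleton[OF that(2)] that(1)])
  have sum_m: "(\<lambda>x. (\<Sum>k<N. g (x k) - c) / sqrt (real N)) \<in> borel_measurable (torus_pow N)" if "g \<in> borel_measurable borel" for g :: "torus \<Rightarrow> real" and c
    by (intro borel_measurable_divide borel_measurable_sum borel_measurable_diff component[OF that] borel_measurable_const)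
  have Ftm: "Ft \<in> borel_measurable ?PM"
  proof -
    have "(\<lambda>x. ?a x i) \<in> borel_measurable (torus_pow N)" for i
      using measurable_compose[OF particles_measurable[OF h F_measurable] sum_m[OF f\<phi>m(1)]]
      by (cases "i < m") (simp_all add: fluctuation_sum[OF N f\<phi>m(1)])
    then have "(\<lambda>x i. ?a x i) \<in> borel_measurable (torus_pow N)"
      by (rule measurable_coordinatewise_then_product)
    from measurable_compose[OF this \<Psi>m] show ?thesis unfolding Ft_def measurable_cong_sets[OF sets_PM refl] .
  qed
  have F0m: "F0 \<in> borel_measurable ?PM"
  proof -
    have "(\<lambda>x. ?b x i) \<in> borel_measurable (torus_pow N)" for i
      using sum_m[OF f\<phi>m(2)] by (cases "i < m") (simp_all add: fluctuation_sum[OF N f\<phi>m(2)])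
    then have "(\<lambda>x i. ?b x i) \<in> borel_measurable (torus_pow N)"
      by (rule measurable_coordinatewise_then_product)
    from measurable_compose[OF this \<Psi>m] show ?thesis unfolding F0_def measurable_cong_sets[OF sets_PM refl] .
  qed
  have \<Psi>b: "\<bar>\<Psi> x\<bar> \<le> B" for x using bd[of "[]" x] by simp
  have iF: "integrable ?PM Ft" "integrable ?PM F0"
    by (rule average_bound(2)[OF PM.prob_space_axioms Ftm, of B], simp add: Ft_def \<Psi>b)
       (rule average_bound(2)[OF PM.prob_space_axioms F0m, of B], simp add: F0_def \<Psi>b)

  \<comment> \<open>The fluctuation scaling contributes \<open>sqrt N\<close>; with the second
    moment \<open>24 / N\<close> of the initial gap it becomes \<open>1 / sqrt N\<close>.\<close>
  define c where "c = B * (real m * (sqrt (real N) * (q * real t * A ^ (2 * t))))"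
  have c0: "0 \<le> c" using B0 q const_nonneg(4) by (simp add: c_def)
  have diff: "\<bar>Ft x - F0 x\<bar> \<le> c * (initial_gap (\<rho> 0) N x)^2" for x
  proof -
    let ?g = "(initial_gap (\<rho> 0) N x)^2"
    have e: "\<bar>fluctuation N (?x x t) (\<rho> t) (\<phi> i) - fluctuation N x (\<rho> 0) (f i)\<bar> \<le> sqrt (real N) * (q * real t * A ^ (2 * t)) * ?g" if i: "i < m" for i
    proof -
      let ?d = "((LINT y|empirical N (?x x t). \<phi> i y) - (LINT y|dens (\<rho> t). \<phi> i y)) -
          ((LINT y|empirical N (?x x 0). f i y) - (LINT y|dens (\<rho> 0). f i y))"
      have "fluctuation N (?x x t) (\<rho> t) (\<phi> i) - fluctuation N x (\<rho> 0) (f i) = sqrt (real N) * ?d"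
        by (simp add: fluctuation_def particles_0 right_diff_distrib)
      then have d: "\<bar>fluctuation N (?x x t) (\<rho> t) (\<phi> i) - fluctuation N x (\<rho> 0) (f i)\<bar> = sqrt (real N) * abs ?d"
        by (simp add: abs_mult)
      have "abs ?d \<le> q * real t * (A ^ (2 * t) * ?g)" unfolding f_def
      proof (rule back_error[where T = T and \<mu> = "\<lambda>t. empirical N (?x x t)" and \<rho> = \<rho>, OF _ _ _ _ _ _ t \<phi>[OF i]])
        show "empirical N (?x x (Suc s)) = distr (empirical N (?x x s)) borel (F_mu dt h F (empirical N (?x x s)))" for s
          unfolding particles_Suc by (rule empirical_particle_step[OF h F_measurable N])
        show "dual_lip (initial_gap (\<rho> 0) N x) (empirical N (?x x 0)) (dens (\<rho> 0))"
          unfolding particles_0 by (rule initial_gap_dual_lip[OF M N])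
      qed (use \<nu> \<nu>_step empirical_prob[OF N] in auto)
      from mult_left_mono[OF this, of "sqrt (real N)"] show ?thesis unfolding d by (simp add: mult.assoc)
    qed
    have "\<bar>Ft x - F0 x\<bar> \<le> B * l1 m (\<lambda>i. ?a x i - ?b x i)"
      unfolding Ft_def F0_def by (rule \<Psi>lip)
    also have "... \<le> B * (\<Sum>i<m. sqrt (real N) * (q * real t * A ^ (2 * t)) * ?g)"
      unfolding l1_def by (intro mult_left_mono sum_mono B0) (use e in simp)
    also have "... = c * ?g" by (simp add: c_def mult.assoc)
    finally show ?thesis .
  qed
  have "\<bar>(LINT x|?PM. Ft x) - (LINT x|?PM. F0 x)\<bar> = \<bar>LINT x|?PM. Ft x - F0 x\<bar>" using iF by simp
  also have "... \<le> (LINT x|?PM. c * (initial_gap (\<rho> 0) N x)^2)"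
    by (rule order_trans[OF integral_abs_bound], rule integral_mono) (use iF diff initial_gap_moment(1)[OF M N] in auto)
  also have "... \<le> c * (24 / real N)" using mult_left_mono[OF initial_gap_moment(2)[OF M N] c0] by simp
  also have "... = 24 * B * real m * q * real t * A ^ (2 * t) * (sqrt (real N) / real N)" by (simp add: c_def)
  also have "sqrt (real N) / real N = 1 / sqrt (real N)" by (simp add: sqrt_divide_self_eq inverse_eq_divide)
  finally have err1: "\<bar>(LINT x|?PM. Ft x) - (LINT x|?PM. F0 x)\<bar> \<le> 24 * B * real m * q * real t * A ^ (2 * t) / sqrt (real N)" by simp

  \<comment> \<open>A linear combination of the pairings is the pairing with one C^{1,1} function,
    whose Gaussian law is known from \<open>gaussian_field_C11\<close>.\<close>
  interpret MG: matched_gaussian ?M Q f "\<lambda>i z. dual_pair (f i) (\<eta> 0 z)" m "A ^ t * q"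
  proof (rule matched_gaussian.intro)
    show "prob_space ?M" "prob_space Q" by (rule M, rule Q)
    show "f i \<in> borel_measurable ?M" if "i < m" for i using f\<phi>m(2)[OF that] by simp
    show "\<bar>f i x\<bar> \<le> A ^ t * q" if "i < m" for i x by (rule C11D(1)[OF f[OF that]])
    show "0 < A ^ t * q" using const_nonneg(5) q by simp
    show "(\<lambda>z. dual_pair (f i) (\<eta> 0 z)) \<in> borel_measurable Q" if "i < m" for i
      by (rule dual_pair_measurable[OF Xr f[OF that]]) simp
    fix a
    obtain r s' where rs: "C11 r (\<lambda>x. \<Sum>i<m. a i * f i x) s'"
      "\<And>u. u \<in> Sobolev (- 1) \<Longrightarrow> dual_pair (\<lambda>x. \<Sum>i<m. a i * f i x) u = (\<Sum>i<m. a i * dual_pair (f i) u)"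
      using dual_pair_sum[where f = f and a = a and m = m, OF f] by auto
    have "distr Q borel (\<lambda>z. \<Sum>i<m. a i * dual_pair (f i) (\<eta> 0 z)) = distr Q borel (\<lambda>z. dual_pair (\<lambda>x. \<Sum>i<m. a i * f i x) (\<eta> 0 z))"
      by (rule distr_cong) (use S[of 0] rs(2) in auto)
    also have "... = centered_normal (field_variance (\<rho> 0) (\<lambda>x. \<Sum>i<m. a i * f i x))"
      by (rule gaussian_field_C11[OF M Q Xr G rs(1)]) simp
    finally show "distr Q borel (\<lambda>z. \<Sum>i<m. a i * dual_pair (f i) (\<eta> 0 z)) =
      centered_normal ((LINT x|?M. (\<Sum>i<m. a i * f i x)^2) - (LINT x|?M. (\<Sum>i<m. a i * f i x))^2)"
      unfolding field_variance_def .
  qed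
  have "(LINT x|?PM. F0 x) = (LINT x|?PM. \<Psi> (\<lambda>i. (\<Sum>k<N. f i (x k) - (LINT y|?M. f i y)) / sqrt (real N)))"
    unfolding F0_def by (intro bochner_cong refl dep) (simp add: fluctuation_sum[OF N f\<phi>m(2)])
  then have err2: "\<bar>(LINT x|?PM. F0 x) - (LINT z|Q. \<Psi> (\<lambda>i. dual_pair (f i) (\<eta> 0 z)))\<bar> \<le> 40 * B * real m ^ 3 * (A ^ t * q) ^ 3 / sqrt (real N)"
    using MG.normal_approximation[OF N \<Psi>C bd] by simp

  have "AE z in Q. \<forall>t<T. fluctuation_equation dt h F (\<rho> t) (\<eta> t z) (\<eta> (Suc t) z)"
    using \<eta> unfolding fluctuation_solution_def by blast
  \<comment> \<open>The limit equation holds almost surely; on that event all \<open>t\<close> steps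
    can be undone for every \<open>i < m\<close>.\<close>
  then have ae: "AE z in Q. \<Psi> (\<lambda>i. if i < m then dual_pair (\<phi> i) (\<eta> t z) else 0) = \<Psi> (\<lambda>i. if i < m then dual_pair (f i) (\<eta> 0 z) else 0)"
  proof (rule AE_mp, intro AE_I2 impI dep)
    fix z i assume z: "z \<in> space Q" "\<forall>t<T. fluctuation_equation dt h F (\<rho> t) (\<eta> t z) (\<eta> (Suc t) z)" and i: "i < m"
    have "dual_pair (\<phi> i) (\<eta> t z) = dual_pair (f i) (\<eta> 0 z)"
      unfolding f_def by (rule dual_pair_pull_back[where v = "\<lambda>s. \<eta> s z", OF _ _ _ \<phi>[OF i]]) (use \<nu> S z t in auto)
    then show "(if i < m then dual_pair (\<phi> i) (\<eta> t z) else 0) = (if i < m then dual_pair (f i) (\<eta> 0 z) else 0)" by simp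
  qed
  have Qm: "(\<lambda>z. \<Psi> (\<lambda>i. if i < m then dual_pair (g i) (\<eta> s z) else 0)) \<in> borel_measurable Q"
    if g: "\<And>i. i < m \<Longrightarrow> C11 p (g i) (g' i)" and s: "s \<le> T" for g g' p s
  proof -
    have "(\<lambda>z. if i < m then dual_pair (g i) (\<eta> s z) else 0) \<in> borel_measurable Q" for i
      using dual_pair_measurable[OF Xr[OF s] g] by (cases "i < m") auto
    from measurable_compose[OF measurable_coordinatewise_then_product[OF this] \<Psi>m] show ?thesis .
  qed
  have "(LINT z|Q. \<Psi> (\<lambda>i. dual_pair (\<phi> i) (\<eta> t z))) = (LINT z|Q. \<Psi> (\<lambda>i. if i < m then dual_pair (\<phi> i) (\<eta> t z) else 0))"
    by (intro bochner_cong refl dep) simp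
  also have "... = (LINT z|Q. \<Psi> (\<lambda>i. if i < m then dual_pair (f i) (\<eta> 0 z) else 0))"
    by (rule integral_cong_AE[OF Qm[OF \<phi> t] Qm[OF f] ae]) simp_all
  also have "... = (LINT z|Q. \<Psi> (\<lambda>i. dual_pair (f i) (\<eta> 0 z)))" by (intro bochner_cong refl dep) simp
  finally have limit: "(LINT z|Q. \<Psi> (\<lambda>i. dual_pair (\<phi> i) (\<eta> t z))) = (LINT z|Q. \<Psi> (\<lambda>i. dual_pair (f i) (\<eta> 0 z)))" .

  have "(LINT z|P. \<Psi> (\<lambda>i. fluctuation N (?x (\<lambda>j. X j z) t) (\<rho> t) (\<phi> i))) = (LINT z|P. Ft (\<lambda>j. X j z))"
    unfolding Ft_def by (intro bochner_cong refl dep) simp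
  also have "... = (LINT x|?PM. Ft x)"
  proof (rule independent_product_law[OF M N P X law Ftm])
    show "Ft (restrict x {..<N}) = Ft x" for x
      unfolding Ft_def by (rule dep) (simp add: fluctuation_sum[OF N f\<phi>m(1)] particles_restrict)
  qed
  finally have particle: "(LINT z|P. \<Psi> (\<lambda>i. fluctuation N (?x (\<lambda>j. X j z) t) (\<rho> t) (\<phi> i))) = (LINT x|?PM. Ft x)" .
  show ?thesis unfolding particle limit add_divide_distrib using err1 err2 by linarith
qed

end

text \<open>\<open>q\<close> is a common C^{1,1} constant for the test functions. Absolute values
  and the maximum keep the constant positive for arbitrary arguments, not only for actual
  norms.\<close>

definition rate_const :: "real \<Rightarrow> nat \<Rightarrow> real \<Rightarrow> real \<Rightarrow> real \<Rightarrow> real list \<Rightarrow> real"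
  where "rate_const dt m p f b qs =
    (let a = max 1 (interaction.A dt b f); q = 1 + (\<Sum>i<m. \<bar>qs ! i\<bar>)
     in 2 + 24 * abs p * real m * q + 40 * abs p * real m ^ 3 * q ^ 3 + 3 * ln a)"

lemma rate_const_pos: "0 < rate_const dt m p f b qs"
proof -
  have "0 \<le> ln (max 1 (interaction.A dt b f))" by (rule ln_ge_zero) simp
  moreover have "0 \<le> 1 + (\<Sum>i<m. \<bar>qs ! i\<bar>)" by (intro add_nonneg_nonneg sum_nonneg) auto
  ultimately show ?thesis unfolding rate_const_def Let_def by (intro add_pos_nonneg mult_nonneg_nonneg) auto
qed

text \<open>The linear factor \<open>t\<close> is absorbed by \<open>exp t\<close>, and
  \<open>a ^ (2 * t)\<close> and \<open>a ^ (3 * t)\<close> are at most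
  \<open>exp (3 * t * ln a)\<close>; this is the origin of the summand
  \<open>3 * ln a\<close>.\<close>

lemma rate_const_bound:
  fixes p a q :: real
  assumes p: "0 \<le> p" and a: "1 \<le> a" and q: "1 \<le> q"
    and C: "C = 2 + 24 * p * real m * q + 40 * p * real m ^ 3 * q ^ 3 + 3 * ln a"
  shows "24 * p * real m * q * real t * a ^ (2 * t) + 40 * p * real m ^ 3 * (a ^ t * q) ^ 3 \<le> C * exp (C * real t)"
proof -
  define E where "E = exp (real t * (1 + 3 * ln a))"
  have la: "0 \<le> ln a" using a by (rule ln_ge_zero)
  have pow: "a ^ n = exp (real n * ln a)" for n using a by (simp add: exp_of_nat_mult)
  have "real t * a ^ (2 * t) \<le> exp (real t) * exp (real (2 * t) * ln a)"
    unfolding pow using exp_ge_add_one_self[of "real t"] by (intro mult_right_mono) (linarith, simp)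
  also have "... \<le> E" unfolding E_def exp_add[symmetric] using la by (simp add: algebra_simps mult_nonneg_nonneg)
  finally have e1: "real t * a ^ (2 * t) \<le> E" .
  have "a ^ (3 * t) \<le> E" unfolding pow E_def using la by (simp add: algebra_simps)
  then have e2: "(a ^ t) ^ 3 \<le> E" by (simp add: power_mult[symmetric] mult.commute)
  have D: "0 \<le> 24 * p * real m * q" "0 \<le> 40 * p * real m ^ 3 * q ^ 3" using p q by simp_all
  have "24 * p * real m * q * real t * a ^ (2 * t) + 40 * p * real m ^ 3 * (a ^ t * q) ^ 3 =
      24 * p * real m * q * (real t * a ^ (2 * t)) + 40 * p * real m ^ 3 * q ^ 3 * (a ^ t) ^ 3"
    by (simp add: power_mult_distrib mult_ac)
  also have "... \<le> 24 * p * real m * q * E + 40 * p * real m ^ 3 * q ^ 3 * E"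
    by (intro add_mono mult_left_mono e1 e2 D)
  also have "... = (24 * p * real m * q + 40 * p * real m ^ 3 * q ^ 3) * E" by (simp add: distrib_right)
  also have "... \<le> C * exp (C * real t)"
  proof (rule mult_mono)
    show "24 * p * real m * q + 40 * p * real m ^ 3 * q ^ 3 \<le> C" "0 \<le> C" using D la unfolding C by linarith+
    have "1 + 3 * ln a \<le> C" using D unfolding C by linarith
    then have "real t * (1 + 3 * ln a) \<le> real t * C" by (rule mult_left_mono) simp
    then show "E \<le> exp (C * real t)" unfolding E_def by (simp only: exp_le_cancel_iff mult.commute)
  qed (simp add: E_def)
  finally show ?thesis .
qed

theorem theorem1p7:
  shows "\<exists>\<Delta>0 :: real \<Rightarrow> real \<Rightarrow> real \<Rightarrow> real.
    (\<forall>h \<kappa> K. Ck_torus2 3 h \<longrightarrow> \<kappa> > 0 \<longrightarrow> K > 0 \<longrightarrow>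
       \<Delta>0 (Ck_norm_torus2 3 h) \<kappa> K > 0 \<and>
       property_E (Ck_norm_torus2 3 h) \<kappa> K (\<Delta>0 (Ck_norm_torus2 3 h) \<kappa> K)) \<and>
    (\<exists>C :: real \<Rightarrow> nat \<Rightarrow> real \<Rightarrow> real \<Rightarrow> real \<Rightarrow> real list \<Rightarrow> real.
       (\<forall>\<Delta> m p f b qs. C \<Delta> m p f b qs > 0) \<and>
       (\<forall>T m h \<kappa> K \<Delta> F \<rho> (P :: 'a measure) X (Q :: 'b measure) \<eta> \<phi> \<Psi> N t.
          Ck_torus2 3 h \<longrightarrow> \<kappa> > 0 \<longrightarrow> K > 0 \<longrightarrow>
          0 < \<Delta> \<longrightarrow> \<Delta> < \<Delta>0 (Ck_norm_torus2 3 h) \<kappa> K \<longrightarrow>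
          Ck_map 3 F \<longrightarrow> (\<exists>c>0. \<forall>x. c \<le> \<bar>map_deriv F x\<bar>) \<longrightarrow>
          mean_field_solution \<Delta> h F \<kappa> K T \<rho> \<longrightarrow>
          prob_space P \<longrightarrow> prob_space.indep_vars P (\<lambda>_. borel) X (UNIV :: nat set) \<longrightarrow>
          (\<forall>i. distr P borel (X i) = dens (\<rho> 0)) \<longrightarrow>
          prob_space Q \<longrightarrow> gaussian_field (\<rho> 0) Q (\<eta> 0) \<longrightarrow>
          fluctuation_solution \<Delta> h F T \<rho> Q \<eta> \<longrightarrow>
          (\<forall>i<m. Ck_torus 2 (\<phi> i)) \<longrightarrow> Cb_euclid m 3 \<Psi> \<longrightarrow>
          N \<ge> 1 \<longrightarrow> t \<le> T \<longrightarrow>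
          (let C0 = C \<Delta> m (Ck_norm_euclid m 3 \<Psi>) (Ck_norm_map 2 F) (Ck_norm_torus2 2 h)
                      (map (\<lambda>i. Ck_norm_torus 2 (\<phi> i)) [0..<m])
           in \<bar>(LINT \<omega>|P. \<Psi> (\<lambda>i. fluctuation N (particles \<Delta> h F N (\<lambda>j. X j \<omega>) t) (\<rho> t) (\<phi> i)))
               - (LINT \<omega>|Q. \<Psi> (\<lambda>i. dual_pair (\<phi> i) (\<eta> t \<omega>)))\<bar>
              \<le> C0 * exp (C0 * real t) / sqrt (real N))))"
proof (intro exI[of _ "\<lambda>H \<kappa> K. 1 / (64 * (1 + \<bar>H\<bar>))"] conjI allI impI, goal_cases)
  case (1 h \<kappa> K)
  show ?case by (simp add: add_pos_nonneg)
next
  case (2 h \<kappa> K)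
  then show ?case using property_E_holds by simp
next
  case 3
  show ?case
  proof (intro exI[of _ rate_const] conjI allI impI, goal_cases)
    case (1 \<Delta> m p f b qs)
    show ?case by (rule rate_const_pos)
  next
    case (2 T m h \<kappa> K \<Delta> F \<rho> P X Q \<eta> \<phi> \<Psi> N t)
    interpret interaction h F \<Delta> "Ck_norm_torus2 2 h" "Ck_norm_map 2 F" by standard (use 2 in auto)
    define p qs q where "p = Ck_norm_euclid m 3 \<Psi>" and "qs = map (\<lambda>i. Ck_norm_torus 2 (\<phi> i)) [0..<m]"
      and "q = 1 + (\<Sum>i<m. \<bar>qs ! i\<bar>)"
    have q1: "1 \<le> q" unfolding q_def by (simp add: sum_nonneg)
    have p0: "0 \<le> p" unfolding p_def using order_trans[OF abs_ge_zero Cb_euclid_bound[of m 3 \<Psi> "[]"]] 2 by simp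
    have \<phi>: "C11 q (\<phi> i) (torus_deriv (\<phi> i))" if i: "i < m" for i
    proof (rule C11_mono[OF Ck_torus_C11])
      show "Ck_torus 2 (\<phi> i)" using 2 i by blast
      have "\<bar>qs ! i\<bar> \<le> (\<Sum>i<m. \<bar>qs ! i\<bar>)" using i by (intro member_le_sum) auto
      then show "Ck_norm_torus 2 (\<phi> i) \<le> q" using i by (simp add: q_def qs_def)
    qed
    note sol = \<open>mean_field_solution \<Delta> h F \<kappa> K T \<rho>\<close>[unfolded mean_field_solution_def]
    have *: "\<bar>(LINT \<omega>|P. \<Psi> (\<lambda>i. fluctuation N (particles \<Delta> h F N (\<lambda>j. X j \<omega>) t) (\<rho> t) (\<phi> i)))
        - (LINT \<omega>|Q. \<Psi> (\<lambda>i. dual_pair (\<phi> i) (\<eta> t \<omega>)))\<bar>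
      \<le> (24 * p * real m * q * real t * A ^ (2 * t) + 40 * p * real m ^ 3 * (A ^ t * q) ^ 3) / sqrt (real N)"
      unfolding p_def by (rule fluctuation_bound[where T = T]) (use 2 sol \<phi> q1 in auto)
    define C where "C = rate_const \<Delta> m p (Ck_norm_map 2 F) (Ck_norm_torus2 2 h) qs"
    have "24 * p * real m * q * real t * A ^ (2 * t) + 40 * p * real m ^ 3 * (A ^ t * q) ^ 3 \<le> C * exp (C * real t)"
      by (rule rate_const_bound[OF p0 const_nonneg(5) q1])
         (use p0 const_nonneg(5) in \<open>simp add: C_def rate_const_def Let_def q_def max_absorb2\<close>)
    from order_trans[OF * divide_right_mono[OF this]]
    show ?case unfolding Let_def p_def[symmetric] qs_def[symmetric] C_def[symmetric] by simp
  qed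
qed

end
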